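(* Let $\Omega\subset\mathbb{R}^2$ be a polygon with Lipschitz boundary consisting of straight sides and with a finite set $\mathcal{C}$ of corners. Let $\underline{\gamma}=\{\gamma_c:c\in\mathcal{C}\}$ with $\min\underline{\gamma}>1$. Then for all $u\in\mathcal{J}^\varpi_{\underline{\gamma}}(\Omega;\mathcal{C},\emptyset)$ and every $0<\epsilon<1$ there exists a ReLU neural network $\Phi_{\epsilon,u}$ such that $\|u-\mathrm{R}(\Phi_{\epsilon,u})\|_{H^1(\Omega)}\le\epsilon$. In addition, as $\epsilon\to0$, $\mathrm{size}(\Phi_{\epsilon,u})=\mathcal{O}(|\log\epsilon|^5)$ and $\mathrm{depth}(\Phi_{\epsilon,u})=\mathcal{O}(|\log\epsilon|\log(|\log\epsilon|))$.
   Context: Weighted analytic class in a polygon: for $c\in\mathcal{C}$ let $r_c(x)=|x-c|$; fix $\hat\varepsilon>0$ so small that the sets $\Omega_c=\{x\in\Omega:r_c(x)<\hat\varepsilon\}$ are pairwise disjoint, and let $\Omega_0=\Omega\setminus\overline{\bigcup_c\Omega_c}$. $\mathcal{J}^\varpi_{\underline{\gamma}}(\Omega;\mathcal{C},\emptyset)$ is the set of $v\in L^2(\Omega)$ for which there exist $C,A>0$ with $\sum_{|\alpha|=k}\|\partial^\alpha v\|_{L^2(\Omega_0)}\le CA^kk!$ and $\sum_{|\alpha|=k}\|r_c^{(|\alpha|-\gamma_c)_+}\partial^\alpha v\|_{L^2(\Omega_c)}\le CA^kk!$ for all $c\in\mathcal{C}$ and all $k\in\mathbb{N}_0$, where $(x)_+=\max\{0,x\}$.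 Neural networks: $\Phi=((A_1,b_1),\dots,(A_L,b_L))$, $A_\ell\in\mathbb{R}^{N_\ell\times N_{\ell-1}}$, $b_\ell\in\mathbb{R}^{N_\ell}$; realization $x_0=x$, $x_\ell=\varrho(A_\ell x_{\ell-1}+b_\ell)$ ($\ell<L$), $\mathrm{R}(\Phi)(x)=A_Lx_{L-1}+b_L$, $\varrho(t)=\max\{0,t\}$ componentwise; $\mathrm{depth}(\Phi)=L$, $\mathrm{size}(\Phi)$ = number of nonzero entries of all $A_\ell,b_\ell$. *)

theory Defs
  imports "HOL-Analysis.Analysis" "HOL-Library.Landau_Symbols"
begin

definition rot :: "real \<Rightarrow> real \<times> real \<Rightarrow> real \<times> real" where
  "rot \<theta> p = (cos \<theta> * fst p - sin \<theta> * snd p, sin \<theta> * fst p + cos \<theta> * snd p)"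

definition lipschitz_boundary :: "(real \<times> real) set \<Rightarrow> bool" where
  "lipschitz_boundary \<Omega> \<longleftrightarrow>
     (\<forall>p \<in> frontier \<Omega>. \<exists>\<theta> r h L. r > 0 \<and> L-lipschitz_on UNIV h \<and>
        (\<forall>x \<in> ball p r. x \<in> \<Omega> \<longleftrightarrow>
            snd (rot \<theta> (x - p)) < h (fst (rot \<theta> (x - p)))))"

definition polygon :: "(real \<times> real) set \<Rightarrow> bool" where
  "polygon \<Omega> \<longleftrightarrow> open \<Omega> \<and> bounded \<Omega> \<and> connected \<Omega> \<and> \<Omega> \<noteq> {} \<and> lipschitz_boundary \<Omega> \<and>
     (\<exists>S. finite S \<and> frontier \<Omega> = (\<Union>(a,b)\<in>S. closed_segment a b))"

definition locally_straight :: "(real \<times> real) set \<Rightarrow> real \<times> real \<Rightarrow> bool" where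
  "locally_straight \<Omega> p \<longleftrightarrow>
     (\<exists>r>0. \<exists>v. v \<noteq> 0 \<and> frontier \<Omega> \<inter> ball p r = {p + t *\<^sub>R v | t. True} \<inter> ball p r)"

definition corners :: "(real \<times> real) set \<Rightarrow> (real \<times> real) set" where
  "corners \<Omega> = {p \<in> frontier \<Omega>. \<not> locally_straight \<Omega> p}"

fun pd :: "nat \<Rightarrow> nat \<Rightarrow> (real \<times> real \<Rightarrow> real) \<Rightarrow> real \<times> real \<Rightarrow> real" where
  "pd 0 0 f = f"
| "pd (Suc a) b f = (\<lambda>p. deriv (\<lambda>t. pd a b f (t, snd p)) (fst p))"
| "pd 0 (Suc b) f = (\<lambda>p. deriv (\<lambda>s. pd 0 b f (fst p, s)) (snd p))"

definition test_fun :: "(real \<times> real) set \<Rightarrow> (real \<times> real \<Rightarrow> real) \<Rightarrow> bool" where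
  "test_fun \<Omega> \<phi> \<longleftrightarrow> (\<forall>a b p. pd a b \<phi> differentiable (at p)) \<and>
     compact (closure {x. \<phi> x \<noteq> 0}) \<and> closure {x. \<phi> x \<noteq> 0} \<subseteq> \<Omega>"

definition loc_integrable :: "(real \<times> real) set \<Rightarrow> (real \<times> real \<Rightarrow> real) \<Rightarrow> bool" where
  "loc_integrable \<Omega> g \<longleftrightarrow> (\<forall>K. compact K \<and> K \<subseteq> \<Omega> \<longrightarrow> set_integrable lborel K g)"

definition weak_deriv :: "(real \<times> real) set \<Rightarrow> (real \<times> real \<Rightarrow> real) \<Rightarrow> nat \<Rightarrow> nat
    \<Rightarrow> (real \<times> real \<Rightarrow> real) \<Rightarrow> bool" where
  "weak_deriv \<Omega> v a b g \<longleftrightarrow> loc_integrable \<Omega> v \<and> loc_integrable \<Omega> g \<and>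
     (\<forall>\<phi>. test_fun \<Omega> \<phi> \<longrightarrow>
        (LINT x:\<Omega>|lborel. v x * pd a b \<phi> x) = (-1) ^ (a + b) * (LINT x:\<Omega>|lborel. g x * \<phi> x))"

definition L2_on :: "(real \<times> real) set \<Rightarrow> (real \<times> real \<Rightarrow> real) \<Rightarrow> bool" where
  "L2_on S f \<longleftrightarrow> set_borel_measurable lborel S f \<and> set_integrable lborel S (\<lambda>x. (f x)\<^sup>2)"

definition L2norm :: "(real \<times> real) set \<Rightarrow> (real \<times> real \<Rightarrow> real) \<Rightarrow> real" where
  "L2norm S f = sqrt (LINT x:S|lborel. (f x)\<^sup>2)"

definition H1norm_le :: "(real \<times> real) set \<Rightarrow> (real \<times> real \<Rightarrow> real) \<Rightarrow> real \<Rightarrow> bool" where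
  "H1norm_le \<Omega> f e \<longleftrightarrow> (\<exists>g1 g2. L2_on \<Omega> f \<and> weak_deriv \<Omega> f 1 0 g1 \<and> weak_deriv \<Omega> f 0 1 g2 \<and>
      L2_on \<Omega> g1 \<and> L2_on \<Omega> g2 \<and>
      sqrt ((L2norm \<Omega> f)\<^sup>2 + (L2norm \<Omega> g1)\<^sup>2 + (L2norm \<Omega> g2)\<^sup>2) \<le> e)"

definition Omega_c :: "(real \<times> real) set \<Rightarrow> real \<Rightarrow> real \<times> real \<Rightarrow> (real \<times> real) set" where
  "Omega_c \<Omega> \<epsilon>h c = {x \<in> \<Omega>. dist x c < \<epsilon>h}"

definition Omega_0 :: "(real \<times> real) set \<Rightarrow> (real \<times> real) set \<Rightarrow> real \<Rightarrow> (real \<times> real) set" where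
  "Omega_0 \<Omega> Cs \<epsilon>h = \<Omega> - closure (\<Union>c\<in>Cs. Omega_c \<Omega> \<epsilon>h c)"

text \<open>Multi-indices with |alpha| = k are (a, k - a), a = 0..k; D a b is the weak derivative
  d^(a,b) v.\<close>
definition J_class :: "(real \<times> real) set \<Rightarrow> (real \<times> real) set \<Rightarrow> (real \<times> real \<Rightarrow> real) \<Rightarrow> real
    \<Rightarrow> (real \<times> real \<Rightarrow> real) set" where
  "J_class \<Omega> Cs \<gamma> \<epsilon>h = {v. L2_on \<Omega> v \<and>
     (\<exists>D. (\<forall>a b. weak_deriv \<Omega> v a b (D a b)) \<and>
       (\<exists>C A. C > 0 \<and> A > 0 \<and>
         (\<forall>k::nat.
            (\<forall>a\<le>k. L2_on (Omega_0 \<Omega> Cs \<epsilon>h) (D a (k - a))) \<and>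
            (\<Sum>a\<le>k. L2norm (Omega_0 \<Omega> Cs \<epsilon>h) (D a (k - a))) \<le> C * A ^ k * fact k \<and>
            (\<forall>c\<in>Cs.
               (\<forall>a\<le>k. L2_on (Omega_c \<Omega> \<epsilon>h c)
                   (\<lambda>x. dist x c powr (max 0 (real k - \<gamma> c)) * D a (k - a) x)) \<and>
               (\<Sum>a\<le>k. L2norm (Omega_c \<Omega> \<epsilon>h c)
                   (\<lambda>x. dist x c powr (max 0 (real k - \<gamma> c)) * D a (k - a) x))
                 \<le> C * A ^ k * fact k))))}"

text \<open>A layer (A,b): A as list of rows.\<close>
type_synonym layer = "real list list \<times> real list"

definition affine :: "layer \<Rightarrow> real list \<Rightarrow> real list" where
  "affine l x = map2 (+) (map (\<lambda>row. sum_list (map2 (*) row x)) (fst l)) (snd l)"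

fun eval_layers :: "layer list \<Rightarrow> real list \<Rightarrow> real list" where
  "eval_layers [] x = x"
| "eval_layers [l] x = affine l x"
| "eval_layers (l # l' # ls) x = eval_layers (l' # ls) (map (max 0) (affine l x))"

fun wf_layers :: "nat \<Rightarrow> layer list \<Rightarrow> bool" where
  "wf_layers n [] = (n = 1)"
| "wf_layers n (l # ls) = (length (fst l) = length (snd l) \<and> (\<forall>row\<in>set (fst l). length row = n)
      \<and> wf_layers (length (fst l)) ls)"

definition nn_valid :: "layer list \<Rightarrow> bool" where
  "nn_valid \<Phi> \<longleftrightarrow> \<Phi> \<noteq> [] \<and> wf_layers 2 \<Phi>"

definition realization :: "layer list \<Rightarrow> real \<times> real \<Rightarrow> real" where
  "realization \<Phi> p = hd (eval_layers \<Phi> [fst p, snd p])"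

definition nn_depth :: "layer list \<Rightarrow> nat" where
  "nn_depth \<Phi> = length \<Phi>"

definition nn_size :: "layer list \<Rightarrow> nat" where
  "nn_size \<Phi> = (\<Sum>l\<leftarrow>\<Phi>. length (filter (\<lambda>x. x \<noteq> 0) (concat (fst l)))
                         + length (filter (\<lambda>x. x \<noteq> 0) (snd l)))"

end

theory Submission
  imports Defs "HOL-Computational_Algebra.Polynomial"
begin

text \<open>Near a point with distance \<delta> to the corners, the weighted bounds make u approximable by a Taylor
  polynomial of degree p at scale \<delta> with an error exponentially small in p. Dyadic layers around the
  corners, cut at level p, and hat functions inside each layer give O(p) cells; in the innermost cells a
  constant suffices, since \<gamma> > 1 yields a Hardy-type decay of the H1-seminorm on small balls. All estimates
  average a weak Taylor formula over segments inside an interior cone, so neither continuity of u nor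
  extension is needed. Glued by the partition of unity, the O(p^3) terms cutoff times monomial are products
  of O(p) one-layer ReLU functions; a binary tree of approximate ReLU multiplications realizes each with depth
  O(p log p), size O(p^2) and an error, also in Lipschitz norm, that beats the coefficient growth. Finally p is
  of the order of |log \<epsilon>|.\<close>

text \<open>All derivatives of u are weak, hence given only up to null sets: neither a point value
  nor a restriction to one segment means anything by itself. This fixes the quantifiers. For each
  fixed increment h the Taylor identity holds for almost every x; estimates integrate over pairs (x,
  y) with y in a ball Y inside the cone; a centre y is then picked by a Chebyshev argument that
  controls finitely many quantities at once. The weight enters through the same geometry: the point
  at parameter s of a segment from Y to the patch carries a ball of radius 2 r (1 - s) inside
  \<Omega>, so it is at least that far from the corners. The resulting singular factor in 1 - s is
  integrable because \<gamma> > 1. Cells at level p make coefficients and slopes as large as 2^p;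
  products accurate to about 16^-p pay for both and still leave 4^-p. Losses polynomial in p, such
  as the squared number of cells, are accepted everywhere, since geometric decay absorbs them. Most
  bounds live in \<open>ennreal\<close>, so that no integrability has to be shown before an
  estimate.\<close>

abbreviation sq_int :: "(real \<times> real) set \<Rightarrow> (real \<times> real \<Rightarrow> real) \<Rightarrow> ennreal" where
  "sq_int X f \<equiv> \<integral>\<^sup>+x\<in>X. ennreal ((f x)\<^sup>2) \<partial>lborel"

section \<open>Networks computing several functions\<close>

text \<open>\<open>wf_layers\<close> fixes one output. Intermediate networks have several, and
  appending a layer at the end needs the output dimension as a parameter.\<close>

fun wfl :: "nat \<Rightarrow> layer list \<Rightarrow> nat \<Rightarrow> bool" where
  "wfl n [] m = (n = m)"
| "wfl n (l # ls) m = (length (fst l) = length (snd l) \<and> (\<forall>row\<in>set (fst l). length row = n)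
      \<and> wfl (length (fst l)) ls m)"

lemma wf_layers_eq_wfl: "wf_layers n ls = wfl n ls 1"
  by (induction ls arbitrary: n) auto

definition lsize :: "layer \<Rightarrow> nat" where
  "lsize l = length (filter (\<lambda>x. x \<noteq> 0) (concat (fst l))) + length (filter (\<lambda>x. x \<noteq> 0) (snd l))"

lemma nn_size_sum: "nn_size \<Phi> = sum_list (map lsize \<Phi>)"
  by (simp add: nn_size_def lsize_def[abs_def])

lemma wfl_append: "wfl n (ls @ [l]) m' \<longleftrightarrow> (\<exists>m. wfl n ls m \<and> length (fst l) = length (snd l) \<and>
    (\<forall>row\<in>set (fst l). length row = m) \<and> length (fst l) = m')"
  by (induction ls arbitrary: n) auto

text \<open>\<open>eval_layers\<close> applies no ReLU after its last layer, so appending a layer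
  turns the former output into a hidden layer and only then rectifies it. This is why every later
  construction sees \<open>max 0 (f x)\<close> in place of \<open>f x\<close>.\<close>

lemma eval_append: "ls \<noteq> [] \<Longrightarrow> eval_layers (ls @ [l]) x = affine l (map (max 0) (eval_layers ls x))"
proof (induction ls arbitrary: x)
  case Nil then show ?case by simp
next
  case (Cons a ls)
  then show ?case by (cases ls) auto
qed

lemma length_affine: "length (fst l) = length (snd l) \<Longrightarrow> length (affine l x) = length (fst l)"
  by (simp add: affine_def)

lemma length_eval:
  "ls \<noteq> [] \<Longrightarrow> wfl n ls m \<Longrightarrow> length (eval_layers ls x) = m"
proof (induction ls rule: rev_induct)
  case Nil then show ?case by simp
next
  case (snoc l ls)
  then show ?case by (cases "ls = []") (auto simp: wfl_append eval_append length_affine)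
qed

text \<open>Depth is exact because parallel composition needs equal depths; size is only an upper
  bound, which makes weakening free. The outputs \<open>fs\<close> are taken before any
  rectification and the layer list stays hidden, so that constructions are carried out on functions
  alone.\<close>

definition NNs :: "nat \<Rightarrow> nat \<Rightarrow> (real \<times> real \<Rightarrow> real) list \<Rightarrow> bool" where
  "NNs L s fs \<longleftrightarrow> (\<exists>\<Phi>. \<Phi> \<noteq> [] \<and> length \<Phi> = L \<and> nn_size \<Phi> \<le> s \<and> wfl 2 \<Phi> (length fs) \<and>
     (\<forall>x. eval_layers \<Phi> [fst x, snd x] = map (\<lambda>f. f x) fs))"

lemma NNs_mono: "NNs L s fs \<Longrightarrow> s \<le> s' \<Longrightarrow> NNs L s' fs"
  unfolding NNs_def by (blast intro: order_trans)

lemma NNs_realization: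
  assumes "NNs L s [f]"
  shows "\<exists>\<Phi>. nn_valid \<Phi> \<and> nn_depth \<Phi> = L \<and> nn_size \<Phi> \<le> s \<and> realization \<Phi> = f"
  using assms unfolding NNs_def nn_valid_def nn_depth_def realization_def wf_layers_eq_wfl
  by (auto simp: fun_eq_iff)

lemma length_filter_concat_le:
  "(\<forall>row\<in>set A. length row = m) \<Longrightarrow> length (filter P (concat A)) \<le> length A * m"
proof (induction A)
  case Nil then show ?case by simp
next
  case (Cons a A)
  then show ?case using length_filter_le[of P a] by auto
qed

lemma lsize_le:
  assumes "\<forall>row\<in>set (fst l). length row = m" "length (fst l) = length (snd l)"
  shows "lsize l \<le> length (fst l) * (m + 1)"
  using length_filter_concat_le[OF assms(1)] length_filter_le[of _ "snd l"] assms(2)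
  unfolding lsize_def by (smt (verit, best) add_mono_thms_linordered_semiring(1) distrib_left mult.right_neutral)

lemma rows_exist:
  assumes "\<forall>g\<in>set gs. \<exists>row b. length row = m \<and> (\<forall>x. g x = sum_list (map2 (*) row (V x)) + b)"
  shows "\<exists>l. length (fst l) = length (snd l) \<and> length (fst l) = length gs \<and>
     (\<forall>row\<in>set (fst l). length row = m) \<and> (\<forall>x. affine l (V x) = map (\<lambda>g. g x) gs)"
  using assms
proof (induction gs)
  case Nil
  show ?case by (rule exI[of _ "([],[])"]) (simp add: affine_def)
next
  case (Cons g gs)
  then obtain l where l: "length (fst l) = length (snd l)" "length (fst l) = length gs"
     "\<forall>row\<in>set (fst l). length row = m" "\<forall>x. affine l (V x) = map (\<lambda>g. g x) gs" by auto
  obtain row b where "length row = m" "\<forall>x. g x = sum_list (map2 (*) row (V x)) + b"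
    using Cons.prems by auto
  then show ?case using l
    by (intro exI[of _ "(row # fst l, b # snd l)"]) (auto simp: affine_def)
qed

definition layer_row :: "(real \<times> real \<Rightarrow> real) list \<Rightarrow> (real \<times> real \<Rightarrow> real) \<Rightarrow> bool" where
  "layer_row fs g \<longleftrightarrow> (\<exists>row b. length row = length fs \<and>
     (\<forall>x. g x = sum_list (map2 (*) row (map (\<lambda>f. max 0 (f x)) fs)) + b))"

lemma layer_rowI:
  "length rw = length fs \<Longrightarrow> (\<And>x. g x = sum_list (map2 (*) rw (map (\<lambda>f. max 0 (f x)) fs)) + b)
    \<Longrightarrow> layer_row fs g"
  unfolding layer_row_def by blast

text \<open>The size added is that of a full matrix with its bias. Every use has boundedly many
  entries or a single output row, so nothing is lost in the order of magnitude.\<close>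

lemma NNs_layer:
  assumes "NNs L s fs" and "list_all (layer_row fs) gs"
    and "L' = L + 1" and "s + length gs * (length fs + 1) \<le> s'"
  shows "NNs L' s' gs"
proof -
  obtain \<Phi> where \<Phi>: "\<Phi> \<noteq> []" "length \<Phi> = L" "nn_size \<Phi> \<le> s" "wfl 2 \<Phi> (length fs)"
     "\<forall>x. eval_layers \<Phi> [fst x, snd x] = map (\<lambda>f. f x) fs" using assms(1) unfolding NNs_def by auto
  obtain l where l: "length (fst l) = length (snd l)" "length (fst l) = length gs"
     "\<forall>row\<in>set (fst l). length row = length fs"
     "\<forall>x. affine l (map (\<lambda>f. max 0 (f x)) fs) = map (\<lambda>g. g x) gs"
    using rows_exist[of gs "length fs" "\<lambda>x. map (\<lambda>f. max 0 (f x)) fs"] assms(2)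
    unfolding list_all_iff layer_row_def by auto
  show ?thesis unfolding NNs_def
    using \<Phi> l lsize_le[OF l(3,1)] assms(3,4)
    by (intro exI[of _ "\<Phi> @ [l]"]) (auto simp: eval_append wfl_append nn_size_sum o_def)
qed

lemma NNs_input:
  assumes "\<forall>g\<in>set gs. \<exists>a b c. \<forall>x. g x = a * fst x + b * snd x + c"
  shows "NNs 1 (length gs * 3) gs"
proof -
  have "\<forall>g\<in>set gs. \<exists>row b. length row = 2 \<and>
      (\<forall>x. g x = sum_list (map2 (*) row [fst x, snd x]) + b)"
  proof
    fix g assume "g \<in> set gs"
    then obtain a b c where "\<forall>x. g x = a * fst x + b * snd x + c" using assms by blast
    then show "\<exists>row b. length row = 2 \<and> (\<forall>x. g x = sum_list (map2 (*) row [fst x, snd x]) + b)"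
      by (intro exI[of _ "[a,b]"] exI[of _ c]) auto
  qed
  from rows_exist[OF this] obtain l where l: "length (fst l) = length (snd l)" "length (fst l) = length gs"
     "\<forall>row\<in>set (fst l). length row = 2"
     "\<forall>x. affine l [fst x, snd x] = map (\<lambda>g. g x) gs" by auto
  show ?thesis unfolding NNs_def using l lsize_le[OF l(3,1)]
    by (intro exI[of _ "[l]"]) (auto simp: nn_size_sum)
qed

text \<open>Block diagonal stacking. The padding zeros are not counted by \<open>nn_size\<close>, so
  sizes add up instead of multiplying.\<close>

definition par_layer :: "nat \<Rightarrow> nat \<Rightarrow> layer \<Rightarrow> layer \<Rightarrow> layer" where
  "par_layer n n' l l' = (map (\<lambda>r. r @ replicate n' 0) (fst l) @ map (\<lambda>r. replicate n 0 @ r) (fst l'),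
                          snd l @ snd l')"

lemma sum_map2_replicate0: "sum_list (map2 (*) (replicate n (0::real)) x) = 0"
  by (induction n arbitrary: x) (auto simp: zip_Cons1 split: list.split)

lemma affine_par:
  assumes "length (fst l) = length (snd l)" "\<forall>row\<in>set (fst l). length row = length x"
    "length (fst l') = length (snd l')" "\<forall>row\<in>set (fst l'). length row = length y"
  shows "affine (par_layer (length x) (length y) l l') (x @ y) = affine l x @ affine l' y"
proof -
  have 1: "map (\<lambda>row. sum_list (map2 (*) row (x @ y))) (map (\<lambda>r. r @ replicate (length y) 0) (fst l))
      = map (\<lambda>row. sum_list (map2 (*) row x)) (fst l)"
    using assms(2) by (auto simp: sum_map2_replicate0)
  have 2: "map (\<lambda>row. sum_list (map2 (*) row (x @ y))) (map (\<lambda>r. replicate (length x) 0 @ r) (fst l'))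
      = map (\<lambda>row. sum_list (map2 (*) row y)) (fst l')"
    using assms(4) by (auto simp: sum_map2_replicate0)
  show ?thesis
    unfolding affine_def par_layer_def fst_conv snd_conv map_append 1[unfolded map_append] 2
    using assms by simp
qed

lemma filter_concat_pad:
  "length (filter (\<lambda>x. x \<noteq> (0::real)) (concat (map (\<lambda>r. r @ replicate n 0) A))) = length (filter (\<lambda>x. x \<noteq> 0) (concat A))"
  "length (filter (\<lambda>x. x \<noteq> (0::real)) (concat (map (\<lambda>r. replicate n 0 @ r) A))) = length (filter (\<lambda>x. x \<noteq> 0) (concat A))"
  by (induction A) auto

lemma lsize_par: "lsize (par_layer n n' l l') = lsize l + lsize l'"
  unfolding lsize_def par_layer_def by (simp add: filter_concat_pad)

fun par_layers :: "nat \<Rightarrow> nat \<Rightarrow> layer list \<Rightarrow> layer list \<Rightarrow> layer list" where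
  "par_layers n n' (l # ls) (l' # ls') = par_layer n n' l l' # par_layers (length (fst l)) (length (fst l')) ls ls'"
| "par_layers n n' _ _ = []"

lemma par_layers_props:
  assumes "length ls = length ls'" "wfl n ls m" "wfl n' ls' m'"
  shows "wfl (n + n') (par_layers n n' ls ls') (m + m') \<and> length (par_layers n n' ls ls') = length ls \<and>
     nn_size (par_layers n n' ls ls') = nn_size ls + nn_size ls' \<and>
     (ls \<noteq> [] \<longrightarrow> (\<forall>x y. length x = n \<longrightarrow> length y = n' \<longrightarrow>
        eval_layers (par_layers n n' ls ls') (x @ y) = eval_layers ls x @ eval_layers ls' y))"
  using assms
proof (induction ls ls' arbitrary: n n' rule: list_induct2)
  case Nil
  then show ?case by (simp add: nn_size_sum)
next
  case (Cons l ls l' ls')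
  let ?m = "length (fst l)" let ?m' = "length (fst l')"
  have IH: "wfl (?m + ?m') (par_layers ?m ?m' ls ls') (m + m')"
     "length (par_layers ?m ?m' ls ls') = length ls"
     "nn_size (par_layers ?m ?m' ls ls') = nn_size ls + nn_size ls'"
     "ls \<noteq> [] \<longrightarrow> (\<forall>x y. length x = ?m \<longrightarrow> length y = ?m' \<longrightarrow>
        eval_layers (par_layers ?m ?m' ls ls') (x @ y) = eval_layers ls x @ eval_layers ls' y)"
    using Cons.IH[of ?m ?m'] Cons.prems by auto
  have ev: "eval_layers (par_layers n n' (l # ls) (l' # ls')) (x @ y)
      = eval_layers (l # ls) x @ eval_layers (l' # ls') y" if "length x = n" "length y = n'" for x y
  proof -
    have a: "affine (par_layer n n' l l') (x @ y) = affine l x @ affine l' y"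
      using affine_par[of l x l' y] Cons.prems that by auto
    show ?thesis
    proof (cases ls)
      case Nil
      with Cons.hyps have "ls' = []" by simp
      with Nil a show ?thesis by simp
    next
      case (Cons k ks)
      with Cons.hyps obtain k' ks' where k': "ls' = k' # ks'" by (cases ls') auto
      have "eval_layers (par_layers ?m ?m' ls ls') (map (max 0) (affine l x) @ map (max 0) (affine l' y))
          = eval_layers ls (map (max 0) (affine l x)) @ eval_layers ls' (map (max 0) (affine l' y))"
        using IH(4) Cons Cons.prems by (auto simp: length_affine)
      then show ?thesis using Cons k' a by simp
    qed
  qed
  have "wfl (n + n') (par_layers n n' (l # ls) (l' # ls')) (m + m')"
    using IH(1) Cons.prems by (auto simp: par_layer_def)
  moreover have "nn_size (par_layers n n' (l # ls) (l' # ls')) = nn_size (l # ls) + nn_size (l' # ls')"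
    using IH(3) by (simp add: nn_size_sum lsize_par)
  ultimately show ?case using IH(2) ev by auto
qed

lemma NNs_par:
  assumes "NNs L s fs" "NNs L s' gs"
  shows "NNs L (s + s') (fs @ gs)"
proof -
  obtain \<Phi> where \<Phi>: "\<Phi> \<noteq> []" "length \<Phi> = L" "nn_size \<Phi> \<le> s" "wfl 2 \<Phi> (length fs)"
     "\<forall>x. eval_layers \<Phi> [fst x, snd x] = map (\<lambda>f. f x) fs" using assms(1) unfolding NNs_def by auto
  obtain \<Psi> where \<Psi>: "\<Psi> \<noteq> []" "length \<Psi> = L" "nn_size \<Psi> \<le> s'" "wfl 2 \<Psi> (length gs)"
     "\<forall>x. eval_layers \<Psi> [fst x, snd x] = map (\<lambda>f. f x) gs" using assms(2) unfolding NNs_def by auto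
  obtain l ls where ls: "\<Phi> = l # ls" using \<Phi>(1) by (cases \<Phi>) auto
  obtain l' ls' where ls': "\<Psi> = l' # ls'" using \<Psi>(1) by (cases \<Psi>) auto
  let ?m = "length (fst l)" let ?m' = "length (fst l')"
  \<comment> \<open>Both networks read the same two inputs, so their first layers are stacked on top
    of each other; the block diagonal form is used only from the second layer on.\<close>
  define k where "k = (fst l @ fst l', snd l @ snd l')"
  have len: "length ls = length ls'" using \<Phi>(2) \<Psi>(2) ls ls' by simp
  have P: "wfl (?m + ?m') (par_layers ?m ?m' ls ls') (length fs + length gs)"
     "length (par_layers ?m ?m' ls ls') = length ls"
     "nn_size (par_layers ?m ?m' ls ls') = nn_size ls + nn_size ls'"
     "ls \<noteq> [] \<longrightarrow> (\<forall>x y. length x = ?m \<longrightarrow> length y = ?m' \<longrightarrow>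
        eval_layers (par_layers ?m ?m' ls ls') (x @ y) = eval_layers ls x @ eval_layers ls' y)"
    using par_layers_props[OF len, of ?m "length fs" ?m' "length gs"] \<Phi>(4) \<Psi>(4) ls ls' by auto
  have ak: "affine k x = affine l x @ affine l' x" for x
    unfolding k_def affine_def using \<Phi>(4) ls by simp
  have ev: "eval_layers (k # par_layers ?m ?m' ls ls') v = eval_layers \<Phi> v @ eval_layers \<Psi> v" for v
  proof (cases ls)
    case Nil
    with len have "ls' = []" by simp
    with Nil ls ls' ak show ?thesis by simp
  next
    case (Cons a as)
    with len obtain a' as' where a': "ls' = a' # as'" by (cases ls') auto
    have "eval_layers (par_layers ?m ?m' ls ls') (map (max 0) (affine l v) @ map (max 0) (affine l' v))
        = eval_layers ls (map (max 0) (affine l v)) @ eval_layers ls' (map (max 0) (affine l' v))"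
      using P(4) Cons \<Phi>(4) \<Psi>(4) ls ls' by (auto simp: length_affine)
    then show ?thesis using Cons a' ak ls ls' by simp
  qed
  have "wfl 2 (k # par_layers ?m ?m' ls ls') (length (fs @ gs))"
    using P(1) \<Phi>(4) \<Psi>(4) ls ls' by (auto simp: k_def)
  moreover have "nn_size (k # par_layers ?m ?m' ls ls') \<le> s + s'"
    using P(3) \<Phi>(3) \<Psi>(3) ls ls' by (simp add: nn_size_sum lsize_def k_def)
  ultimately show ?thesis unfolding NNs_def
    using ev \<Phi>(2,5) \<Psi>(5) P(2) ls by (intro exI[of _ "k # par_layers ?m ?m' ls ls'"]) auto
qed

text \<open>Only the last bias vector changes, at no cost in depth. With c = 2 and outputs of
  modulus at most 2 the shifted outputs are nonnegative, so the ReLU of the next layer acts on them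
  as the identity; this is cheaper than carrying each value together with its negative.\<close>

lemma NNs_shift:
  assumes "NNs L s fs"
  shows "NNs L (s + length fs) (map (\<lambda>f x. f x + c) fs)"
proof -
  obtain \<Phi> where \<Phi>: "\<Phi> \<noteq> []" "length \<Phi> = L" "nn_size \<Phi> \<le> s" "wfl 2 \<Phi> (length fs)"
     "\<forall>x. eval_layers \<Phi> [fst x, snd x] = map (\<lambda>f. f x) fs" using assms(1) unfolding NNs_def by auto
  obtain ls l where ls: "\<Phi> = ls @ [l]" using \<Phi>(1) by (metis rev_exhaust)
  define l' where "l' = (fst l, map (\<lambda>b. b + c) (snd l))"
  have wl: "length (fst l) = length (snd l)" "length (snd l) = length fs"
    using \<Phi>(4) unfolding ls wfl_append by auto
  have al: "affine l' v = map (\<lambda>b. b + c) (affine l v)" for v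
    using wl unfolding l'_def affine_def by (auto simp: list_eq_iff_nth_eq)
  have "eval_layers (ls @ [l']) v = map (\<lambda>b. b + c) (eval_layers (ls @ [l]) v)" for v
    using al by (cases "ls = []") (auto simp: eval_append)
  moreover have "lsize l' \<le> lsize l + length fs"
    using length_filter_le[of "\<lambda>x. x \<noteq> 0" "map (\<lambda>b. b + c) (snd l)"] wl unfolding lsize_def l'_def by simp
  moreover have "wfl 2 (ls @ [l']) (length fs)" using \<Phi>(4) unfolding ls wfl_append l'_def by auto
  ultimately show ?thesis unfolding NNs_def
    using \<Phi> unfolding ls by (intro exI[of _ "ls @ [l']"]) (auto simp: nn_size_sum)
qed

lemma NNs_listI:
  assumes "fs \<noteq> []" "\<And>f. f \<in> set fs \<Longrightarrow> NNs L s [f]"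
  shows "NNs L (length fs * s) fs"
  using assms
proof (induction fs rule: list_nonempty_induct)
  case (single f) then show ?case by simp
next
  case (cons f fs)
  then show ?case using NNs_par[of L s "[f]" "length fs * s" fs] by auto
qed

text \<open>One extra linear layer over the outputs shifted by 2; the bias
  \<open>- 2 * sum_list cs\<close> undoes the shift. The bound 2 on the summands is what the product
  networks provide.\<close>

lemma NNs_sum:
  assumes "fs \<noteq> []" "\<And>f. f \<in> set fs \<Longrightarrow> NNs L s [f]" "\<And>f x. f \<in> set fs \<Longrightarrow> \<bar>f x\<bar> \<le> (2::real)"
    and "length cs = length fs"
  shows "NNs (L + 1) (length fs * (s + 3)) [\<lambda>x. sum_list (map2 (*) cs (map (\<lambda>f. f x) fs))]"
proof -
  let ?gs = "map (\<lambda>f x. f x + 2) fs"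
  have 1: "NNs L (length fs * s + length fs) ?gs"
    by (rule NNs_shift[OF NNs_listI[OF assms(1,2)]])
  have mx: "map (\<lambda>f. max 0 (f x)) ?gs = map (\<lambda>f. f x + 2) fs" for x
    using assms(3)[of _ x] by (auto simp: max_def abs_le_iff) (smt (verit) assms(3))+
  have sm: "length cs = length fs \<Longrightarrow> sum_list (map2 (*) cs (map (\<lambda>f. f x + 2) fs))
     = sum_list (map2 (*) cs (map (\<lambda>f. f x) fs)) + 2 * sum_list cs" for x
    by (induction cs fs rule: list_induct2) (auto simp: algebra_simps)
  show ?thesis
  proof (rule NNs_layer[OF 1])
    show "list_all (layer_row ?gs) [\<lambda>x. sum_list (map2 (*) cs (map (\<lambda>f. f x) fs))]"
      unfolding list.pred_inject using assms(4) sm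
      by (intro conjI layer_rowI[of cs _ _ "- 2 * sum_list cs"]) (simp_all del: map_map add: mx)
    show "length fs * s + length fs + length [\<lambda>x. sum_list (map2 (*) cs (map (\<lambda>f. f x) fs))] * (length ?gs + 1)
       \<le> length fs * (s + 3)"
      using assms(1) by (cases fs) (simp_all add: algebra_simps)
  qed simp
qed

section \<open>Approximate products\<close>

text \<open>In contrast to \<open>lipschitz_on\<close>, no sign of K is required and the domain is
  the whole space; global estimates suit functions that are built from ReLUs.\<close>

definition lip :: "real \<Rightarrow> ('a::real_normed_vector \<Rightarrow> real) \<Rightarrow> bool" where
  "lip K f \<longleftrightarrow> (\<forall>x y. \<bar>f x - f y\<bar> \<le> K * norm (x - y))"

lemma lipD: "lip K f \<Longrightarrow> \<bar>f x - f y\<bar> \<le> K * norm (x - y)"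
  by (simp add: lip_def)

lemma lip_mono: "lip K f \<Longrightarrow> K \<le> K' \<Longrightarrow> lip K' f"
  unfolding lip_def by (meson mult_right_mono norm_ge_zero order_trans)

lemma lip_add: "lip K f \<Longrightarrow> lip K' g \<Longrightarrow> lip (K + K') (\<lambda>x. f x + g x)"
  unfolding lip_def by (smt (verit) distrib_right)

lemma lip_cmul:
  assumes "lip K f" shows "lip (\<bar>c\<bar> * K) (\<lambda>x. c * f x)"
  unfolding lip_def
proof (intro allI)
  fix x y
  have "\<bar>c * f x - c * f y\<bar> = \<bar>c\<bar> * \<bar>f x - f y\<bar>" by (metis abs_mult right_diff_distrib)
  also have "\<dots> \<le> \<bar>c\<bar> * (K * norm (x - y))" using lipD[OF assms] by (intro mult_left_mono) auto
  finally show "\<bar>c * f x - c * f y\<bar> \<le> \<bar>c\<bar> * K * norm (x - y)" by (simp add: mult.assoc)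
qed

lemma lip_const: "0 \<le> K \<Longrightarrow> lip K (\<lambda>x. c)"
  unfolding lip_def by auto

lemma lip_relu: "lip K f \<Longrightarrow> lip K (\<lambda>x. max 0 (f x))"
  unfolding lip_def by (smt (verit))

lemma lip_min: "lip K f \<Longrightarrow> lip K g \<Longrightarrow> lip K (\<lambda>x. min (f x) (g x))"
  unfolding lip_def by (smt (verit))

lemma lip_mult:
  assumes "lip K f" "lip K' g" "\<And>x. \<bar>f x\<bar> \<le> B" "\<And>x. \<bar>g x\<bar> \<le> B'" "0 \<le> K" "0 \<le> K'"
  shows "lip (K * B' + B * K') (\<lambda>x. f x * g x)"
  unfolding lip_def
proof (intro allI)
  fix x y
  have "\<bar>f x * g x - f y * g y\<bar> = \<bar>(f x - f y) * g x + f y * (g x - g y)\<bar>" by (simp add: algebra_simps)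
  also have "\<dots> \<le> \<bar>f x - f y\<bar> * \<bar>g x\<bar> + \<bar>f y\<bar> * \<bar>g x - g y\<bar>"
    by (metis abs_mult abs_triangle_ineq)
  also have "\<dots> \<le> (K * norm (x - y)) * B' + B * (K' * norm (x - y))"
    using assms lipD[OF assms(1)] lipD[OF assms(2)] order_trans[OF abs_ge_zero assms(3)]
    by (intro add_mono mult_mono) auto
  finally show "\<bar>f x * g x - f y * g y\<bar> \<le> (K * B' + B * K') * norm (x - y)" by (simp add: algebra_simps)
qed

definition tent :: "real \<Rightarrow> real" where "tent t = 2 * max 0 t - 4 * max 0 (t - 1/2)"

text \<open>On the unit interval this is the piecewise linear interpolant of t^2 on the dyadic grid
  of width 2^-m: each refinement subtracts a scaled sawtooth, and the sawtooth of level m is the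
  m-fold iterate of \<open>tent\<close>.\<close>

fun sawacc :: "nat \<Rightarrow> real \<Rightarrow> real" where
  "sawacc 0 t = t"
| "sawacc (Suc m) t = sawacc m t - (tent ^^ Suc m) t / 4 ^ Suc m"

lemma tent_range: "t \<in> {0..1} \<Longrightarrow> tent t \<in> {0..1}"
  unfolding tent_def by (auto simp: max_def)

lemma tentpow_range: "t \<in> {0..1} \<Longrightarrow> (tent ^^ m) t \<in> {0..1}"
  by (induction m) (auto simp del: atLeastAtMost_iff intro: tent_range)

text \<open>One refinement is the identity v - v^2 = tent v / 4 + (tent v - (tent v)^2) / 4, applied
  to the m-fold iterate v. The error is thereby known exactly, which serves both its size and its
  slope.\<close>

lemma sawacc_eq:
  assumes "t \<in> {0..1}"
  shows "sawacc m t = t\<^sup>2 + ((tent ^^ m) t - ((tent ^^ m) t)\<^sup>2) / 4 ^ m"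
proof (induction m)
  case 0 show ?case by simp
next
  case (Suc m)
  define v where "v = (tent ^^ m) t"
  have v: "v \<in> {0..1}" unfolding v_def by (rule tentpow_range[OF assms])
  have "v - v\<^sup>2 = tent v / 4 + (tent v - (tent v)\<^sup>2) / 4"
    using v unfolding tent_def by (cases "v \<le> 1/2") (auto simp: power2_eq_square field_simps)
  then have "(v - v\<^sup>2) / 4 ^ m = tent v / 4 ^ Suc m + (tent v - (tent v)\<^sup>2) / 4 ^ Suc m"
    by (metis (no_types, lifting) add_divide_distrib divide_divide_eq_left power_Suc)
  then show ?case using Suc v_def by simp
qed

lemma sawacc_err:
  assumes "t \<in> {0..1}"
  shows "0 \<le> sawacc m t - t\<^sup>2" "sawacc m t - t\<^sup>2 \<le> 1 / 4 / 4 ^ m" "0 \<le> sawacc m t"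
proof -
  define v where "v = (tent ^^ m) t"
  have v: "v \<in> {0..1}" unfolding v_def by (rule tentpow_range[OF assms])
  have e: "sawacc m t - t\<^sup>2 = (v - v\<^sup>2) / 4 ^ m" using sawacc_eq[OF assms] v_def by simp
  have "0 \<le> v * (1 - v)" using v by auto
  then have 0: "0 \<le> v - v\<^sup>2" by (simp add: power2_eq_square algebra_simps)
  have "0 \<le> (v - 1/2)\<^sup>2" by simp
  then have 1: "v - v\<^sup>2 \<le> 1/4" by (simp add: power2_eq_square algebra_simps)
  show "0 \<le> sawacc m t - t\<^sup>2" using e 0 by simp
  then show "0 \<le> sawacc m t" by (smt (verit) zero_le_power2)
  show "sawacc m t - t\<^sup>2 \<le> 1 / 4 / 4 ^ m" unfolding e using 1 by (intro divide_right_mono) auto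
qed

text \<open>The error is (v - v^2) / 4^m with v = (tent ^^ m) t. The map v - v^2 has slope at most 1
  on the unit interval and v has slope 2^m, hence the rate 2^-m, which is only the square root of
  the rate 4^-m of the sup bound.\<close>

lemma sawacc_lip:
  assumes "t \<in> {0..1}" "t' \<in> {0..1}"
  shows "\<bar>(sawacc m t - t\<^sup>2) - (sawacc m t' - t'\<^sup>2)\<bar> \<le> \<bar>t - t'\<bar> / 2 ^ m"
proof -
  have t2: "\<bar>tent a - tent b\<bar> \<le> 2 * \<bar>a - b\<bar>" for a b unfolding tent_def by (auto simp: max_def abs_if)
  have tm: "\<bar>(tent ^^ m) t - (tent ^^ m) t'\<bar> \<le> 2 ^ m * \<bar>t - t'\<bar>"
  proof (induction m)
    case (Suc m) then show ?case using t2[of "(tent ^^ m) t" "(tent ^^ m) t'"] by simp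
  qed simp
  define v where "v = (tent ^^ m) t"
  define v' where "v' = (tent ^^ m) t'"
  have v: "v \<in> {0..1}" "v' \<in> {0..1}" unfolding v_def v'_def using tentpow_range assms by blast+
  have "\<bar>(v - v\<^sup>2) - (v' - v'\<^sup>2)\<bar> = \<bar>v - v'\<bar> * \<bar>1 - (v + v')\<bar>"
    unfolding abs_mult[symmetric] by (simp add: power2_eq_square algebra_simps)
  also have "\<dots> \<le> \<bar>v - v'\<bar> * 1" using v by (intro mult_left_mono) auto
  finally have "\<bar>(v - v\<^sup>2) - (v' - v'\<^sup>2)\<bar> \<le> 2 ^ m * \<bar>t - t'\<bar>" using tm v_def v'_def by simp
  then have "\<bar>(v - v\<^sup>2) - (v' - v'\<^sup>2)\<bar> / 4 ^ m \<le> 2 ^ m * \<bar>t - t'\<bar> / 4 ^ m" by (intro divide_right_mono) auto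
  also have "\<dots> = \<bar>t - t'\<bar> / 2 ^ m"
    by (simp add: field_simps power_mult_distrib[symmetric])
  finally have "\<bar>((v - v\<^sup>2) - (v' - v'\<^sup>2)) / 4 ^ m\<bar> \<le> \<bar>t - t'\<bar> / 2 ^ m" by (simp add: abs_divide)
  then show ?thesis using sawacc_eq[OF assms(1), of m] sawacc_eq[OF assms(2), of m] v_def v'_def
    by (simp add: diff_divide_distrib)
qed

text \<open>The state of each square consists of the current sawtooth, the same minus 1/2 (the two
  arguments rectified in \<open>tent\<close>) and the accumulator. The accumulator is nonnegative,
  so rectification leaves it unchanged. Two squares run side by side: six values with 6 * 7 = 42
  entries per layer.\<close>

lemma NNs_squares:
  assumes "NNs L s [t1, \<lambda>x. t1 x - 1/2, t1, t2, \<lambda>x. t2 x - 1/2, t2]"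
    and "\<And>x. t1 x \<in> {0..1}" "\<And>x. t2 x \<in> {0..1}"
  shows "NNs (L + m) (s + 42 * m)
    [\<lambda>x. (tent ^^ m) (t1 x), \<lambda>x. (tent ^^ m) (t1 x) - 1/2, \<lambda>x. sawacc m (t1 x),
     \<lambda>x. (tent ^^ m) (t2 x), \<lambda>x. (tent ^^ m) (t2 x) - 1/2, \<lambda>x. sawacc m (t2 x)]"
proof (induction m)
  case 0 show ?case using assms(1) by simp
next
  case (Suc m)
  have p: "max 0 (sawacc m (t1 x)) = sawacc m (t1 x)" "max 0 (sawacc m (t2 x)) = sawacc m (t2 x)" for x
    using sawacc_err(3)[OF assms(2)] sawacc_err(3)[OF assms(3)] by auto
  let ?q = "1 / 4 ^ Suc m :: real"
  let ?gs = "[\<lambda>x. (tent ^^ Suc m) (t1 x), \<lambda>x. (tent ^^ Suc m) (t1 x) - 1/2, \<lambda>x. sawacc (Suc m) (t1 x),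
     \<lambda>x. (tent ^^ Suc m) (t2 x), \<lambda>x. (tent ^^ Suc m) (t2 x) - 1/2, \<lambda>x. sawacc (Suc m) (t2 x)]"
  have "NNs (L + m + 1) (s + 42 * m + length ?gs * (6 + 1)) ?gs"
    apply (rule NNs_layer[OF Suc.IH])
      apply (unfold list.pred_inject, intro conjI)
    subgoal by (rule layer_rowI[of "[2,-4,0,0,0,0]" _ _ 0]) (simp_all add: p tent_def[of "(tent ^^ m) _"])
    subgoal by (rule layer_rowI[of "[2,-4,0,0,0,0]" _ _ "-1/2"]) (simp_all add: p tent_def[of "(tent ^^ m) _"])
    subgoal by (rule layer_rowI[of "[-2*?q,4*?q,1,0,0,0]" _ _ 0]) (simp_all add: p tent_def[of "(tent ^^ m) _"] field_simps)
    subgoal by (rule layer_rowI[of "[0,0,0,2,-4,0]" _ _ 0]) (simp_all add: p tent_def[of "(tent ^^ m) _"])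
    subgoal by (rule layer_rowI[of "[0,0,0,2,-4,0]" _ _ "-1/2"]) (simp_all add: p tent_def[of "(tent ^^ m) _"])
    subgoal by (rule layer_rowI[of "[0,0,0,-2*?q,4*?q,1]" _ _ 0]) (simp_all add: p tent_def[of "(tent ^^ m) _"] field_simps)
    by simp_all
  then show ?case by (simp add: algebra_simps)
qed

text \<open>Polarisation: f g = 4 ((|f + g| / 4)^2 - (|f - g| / 4)^2). The bounds by 2 put both
  squared arguments into the unit interval. The three layers besides the m squaring layers form sums
  and differences, their moduli, and the final difference; 51 = 2 + 12 + 30 + 7 counts the entries
  they cost together with the initial shift.\<close>

lemma NNs_mult:
  assumes f: "NNs L s [f]" and g: "NNs L s' [g]"
    and fb: "\<And>x. \<bar>f x\<bar> \<le> 2" and gb: "\<And>x. \<bar>g x\<bar> \<le> 2"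
    and lf: "lip K f" and lg: "lip K' g" and K: "0 \<le> K" "0 \<le> K'"
  shows "\<exists>N. NNs (L + (m + 3)) (s + s' + 51 + 42 * m) [N] \<and> (\<forall>x. \<bar>N x - f x * g x\<bar> \<le> 1 / 4 ^ m) \<and>
     lip (2 / 2 ^ m * (K + K')) (\<lambda>x. N x - f x * g x)"
proof -
  define t1 where "t1 x = \<bar>f x + g x\<bar> / 4" for x
  define t2 where "t2 x = \<bar>f x - g x\<bar> / 4" for x
  have r1: "t1 x \<in> {0..1}" and r2: "t2 x \<in> {0..1}" for x
    using fb[of x] gb[of x] unfolding t1_def t2_def by auto
  have n1: "NNs L (s + s' + 2) [\<lambda>x. f x + 2, \<lambda>x. g x + 2]"
    using NNs_shift[OF NNs_par[OF f g], of 2] by simp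
  let ?g2 = "[\<lambda>x. f x + g x, \<lambda>x. - (f x + g x), \<lambda>x. f x - g x, \<lambda>x. - (f x - g x)]"
  have mf: "max 0 (f x + 2) = f x + 2" "max 0 (g x + 2) = g x + 2" for x using fb[of x] gb[of x] by auto
  have n2: "NNs (L + 1) (s + s' + 2 + 12) ?g2"
    apply (rule NNs_layer[OF n1])
      apply (unfold list.pred_inject, intro conjI)
    subgoal by (rule layer_rowI[of "[1,1]" _ _ "-4"]) (simp_all add: mf)
    subgoal by (rule layer_rowI[of "[-1,-1]" _ _ 4]) (simp_all add: mf)
    subgoal by (rule layer_rowI[of "[1,-1]" _ _ 0]) (simp_all add: mf)
    subgoal by (rule layer_rowI[of "[-1,1]" _ _ 0]) (simp_all add: mf)
    by simp_all
  let ?g3 = "[t1, \<lambda>x. t1 x - 1/2, t1, t2, \<lambda>x. t2 x - 1/2, t2]"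
  have ab: "\<bar>y\<bar> = max 0 y + max 0 (- y)" for y :: real by auto
  have n3: "NNs (L + 2) (s + s' + 2 + 12 + 30) ?g3"
    apply (rule NNs_layer[OF n2])
      apply (unfold list.pred_inject, intro conjI)
    subgoal by (rule layer_rowI[of "[1/4,1/4,0,0]" _ _ "0"]) (simp_all add: t1_def t2_def ab)
    subgoal by (rule layer_rowI[of "[1/4,1/4,0,0]" _ _ "-1/2"]) (simp_all add: t1_def t2_def ab)
    subgoal by (rule layer_rowI[of "[1/4,1/4,0,0]" _ _ "0"]) (simp_all add: t1_def t2_def ab)
    subgoal by (rule layer_rowI[of "[0,0,1/4,1/4]" _ _ "0"]) (simp_all add: t1_def t2_def ab)
    subgoal by (rule layer_rowI[of "[0,0,1/4,1/4]" _ _ "-1/2"]) (simp_all add: t1_def t2_def ab)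
    subgoal by (rule layer_rowI[of "[0,0,1/4,1/4]" _ _ "0"]) (simp_all add: t1_def t2_def ab)
    by simp_all
  define N where "N x = 4 * (sawacc m (t1 x) - sawacc m (t2 x))" for x
  have p: "max 0 (sawacc m (t1 x)) = sawacc m (t1 x)" "max 0 (sawacc m (t2 x)) = sawacc m (t2 x)" for x
    using sawacc_err(3)[OF r1] sawacc_err(3)[OF r2] by auto
  have n4: "NNs (L + (m + 3)) (s + s' + 51 + 42 * m) [N]"
    apply (rule NNs_layer[OF NNs_squares[OF n3 r1 r2, where m=m]])
      apply (unfold list.pred_inject, intro conjI)
    subgoal by (rule layer_rowI[of "[0,0,4,0,0,-4]" _ _ "0"]) (simp_all add: N_def p)
    by simp_all
  have fg: "f x * g x = 4 * ((t1 x)\<^sup>2 - (t2 x)\<^sup>2)" for x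
    unfolding t1_def t2_def power_divide power2_abs by (simp add: power2_eq_square field_simps)
  define e where "e t = sawacc m t - t\<^sup>2" for t
  have Ne: "N x - f x * g x = 4 * (e (t1 x) - e (t2 x))" for x
    unfolding N_def fg e_def by simp
  \<comment> \<open>Both squaring errors are nonnegative, so their difference is bounded by the
    larger one and no factor 2 arises.\<close>
  have "\<bar>N x - f x * g x\<bar> \<le> 1 / 4 ^ m" for x
    unfolding Ne e_def using sawacc_err(1,2)[OF r1, of m x] sawacc_err(1,2)[OF r2, of m x] by auto
  moreover have "lip (2 / 2 ^ m * (K + K')) (\<lambda>x. N x - f x * g x)"
    unfolding lip_def Ne
  proof (intro allI)
    fix x y
    have 1: "\<bar>e (t1 x) - e (t1 y)\<bar> \<le> \<bar>t1 x - t1 y\<bar> / 2 ^ m" unfolding e_def by (rule sawacc_lip[OF r1 r1])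
    have 2: "\<bar>e (t2 x) - e (t2 y)\<bar> \<le> \<bar>t2 x - t2 y\<bar> / 2 ^ m" unfolding e_def by (rule sawacc_lip[OF r2 r2])
    have 3: "\<bar>t1 x - t1 y\<bar> \<le> (K + K') * norm (x - y) / 4" "\<bar>t2 x - t2 y\<bar> \<le> (K + K') * norm (x - y) / 4"
    proof -
      have A: "\<bar>\<bar>a\<bar> / 4 - \<bar>b\<bar> / 4\<bar> \<le> \<bar>a - b\<bar> / 4" for a b :: real
        by (simp add: abs_triangle_ineq3 diff_divide_distrib[symmetric])
      have B: "\<bar>f x + g x - (f y + g y)\<bar> \<le> (K + K') * norm (x - y)" "\<bar>f x - g x - (f y - g y)\<bar> \<le> (K + K') * norm (x - y)"
        unfolding distrib_right using lipD[OF lf, of x y] lipD[OF lg, of x y] by linarith+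
      show "\<bar>t1 x - t1 y\<bar> \<le> (K + K') * norm (x - y) / 4" "\<bar>t2 x - t2 y\<bar> \<le> (K + K') * norm (x - y) / 4"
        unfolding t1_def t2_def
        using order_trans[OF A divide_right_mono[OF B(1), of 4]] order_trans[OF A divide_right_mono[OF B(2), of 4]] by auto
    qed
    have "\<bar>4 * (e (t1 x) - e (t2 x)) - 4 * (e (t1 y) - e (t2 y))\<bar>
        \<le> 4 * (\<bar>t1 x - t1 y\<bar> / 2 ^ m + \<bar>t2 x - t2 y\<bar> / 2 ^ m)"
    proof -
      have "\<bar>a - b\<bar> \<le> p \<Longrightarrow> \<bar>c - d\<bar> \<le> r \<Longrightarrow> \<bar>4 * (a - c) - 4 * (b - d)\<bar> \<le> 4 * (p + r)" for a b c d p r :: real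
        by (auto simp: abs_le_iff)
      from this[OF 1 2] show ?thesis .
    qed
    also have "\<dots> \<le> 4 * ((K + K') * norm (x - y) / 4 / 2 ^ m + (K + K') * norm (x - y) / 4 / 2 ^ m)"
      using 3 by (intro mult_left_mono add_mono divide_right_mono) auto
    also have "\<dots> = 2 / 2 ^ m * (K + K') * norm (x - y)" by (simp add: field_simps)
    finally show "\<bar>4 * (e (t1 x) - e (t2 x)) - 4 * (e (t1 y) - e (t2 y))\<bar> \<le> 2 / 2 ^ m * (K + K') * norm (x - y)" .
  qed
  moreover have "NNs (L + (m + 3)) (s + s' + 51 + 42 * m) [N]" by (rule n4)
  ultimately show ?thesis by blast
qed

lemma prod_list_bound_lip:
  assumes "\<And>f. f \<in> set fs \<Longrightarrow> lip \<Lambda> f" "\<And>f x. f \<in> set fs \<Longrightarrow> \<bar>f x\<bar> \<le> 1" "0 \<le> \<Lambda>"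
  shows "(\<forall>x. \<bar>prod_list (map (\<lambda>f. f x) fs)\<bar> \<le> 1) \<and> lip (real (length fs) * \<Lambda>) (\<lambda>x. prod_list (map (\<lambda>f. f x) fs))"
  using assms
proof (induction fs)
  case Nil then show ?case by (auto intro: lip_const)
next
  case (Cons f fs)
  have IH: "\<And>x. \<bar>prod_list (map (\<lambda>f. f x) fs)\<bar> \<le> 1" "lip (real (length fs) * \<Lambda>) (\<lambda>x. prod_list (map (\<lambda>f. f x) fs))"
    using Cons by auto
  have "\<bar>f x * prod_list (map (\<lambda>f. f x) fs)\<bar> \<le> 1" for x
    using IH(1)[of x] Cons.prems(2)[of f x] by (simp add: abs_mult mult_le_one)
  moreover have "lip (\<Lambda> * 1 + 1 * (real (length fs) * \<Lambda>)) (\<lambda>x. f x * prod_list (map (\<lambda>f. f x) fs))"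
    using IH Cons.prems by (intro lip_mult) auto
  ultimately show ?case by (simp add: algebra_simps)
qed

text \<open>A balanced tree keeps the depth proportional to q instead of 2^q. Per level the sup
  error grows by a factor of at most 4 and the Lipschitz error by at most 16. The hypothesis
  \<open>q \<le> m\<close> keeps 4^q / 4^m at most 1, so that all intermediate outputs stay within
  [-2, 2] as \<open>NNs_mult\<close> requires.\<close>

lemma NNs_prod_tree:
  assumes "length fs = 2 ^ q" "q \<le> m" "2 \<le> m" "0 \<le> \<Lambda>"
    and "\<And>f. f \<in> set fs \<Longrightarrow> NNs L s [f]" "\<And>f. f \<in> set fs \<Longrightarrow> lip \<Lambda> f" "\<And>f x. f \<in> set fs \<Longrightarrow> \<bar>f x\<bar> \<le> 1"
  shows "\<exists>N. NNs (L + q * (m + 3)) (2 ^ q * (s + 51 + 42 * m)) [N] \<and>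
     (\<forall>x. \<bar>N x - prod_list (map (\<lambda>f. f x) fs)\<bar> \<le> 4 ^ q / 4 ^ m) \<and>
     lip (16 ^ q * \<Lambda> / 2 ^ m) (\<lambda>x. N x - prod_list (map (\<lambda>f. f x) fs))"
proof -
  \<comment> \<open>The size bound is strengthened by the cost of one node: a tree with 2^q leaves
    has only 2^q - 1 inner nodes, and doubling this form and adding one node reproduces it.\<close>
  have "\<exists>N. NNs (L + q * (m + 3)) (2 ^ q * (s + 51 + 42 * m) - (51 + 42 * m)) [N] \<and>
     (\<forall>x. \<bar>N x - prod_list (map (\<lambda>f. f x) fs)\<bar> \<le> 4 ^ q / 4 ^ m) \<and>
     lip (16 ^ q * \<Lambda> / 2 ^ m) (\<lambda>x. N x - prod_list (map (\<lambda>f. f x) fs))"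
    using assms
  proof (induction q arbitrary: fs)
    case 0
    then obtain f where f: "fs = [f]" by (cases fs) auto
    then show ?case using 0 by (intro exI[of _ f]) (auto intro!: lip_const)
  next
    case (Suc q)
    define fs1 where "fs1 = take (2 ^ q) fs"
    define fs2 where "fs2 = drop (2 ^ q) fs"
    have fs: "fs = fs1 @ fs2" unfolding fs1_def fs2_def by simp
    have l: "length fs1 = 2 ^ q" "length fs2 = 2 ^ q" using Suc.prems(1) unfolding fs1_def fs2_def by auto
    define F where "F x = prod_list (map (\<lambda>f. f x) fs1)" for x
    define G where "G x = prod_list (map (\<lambda>f. f x) fs2)" for x
    let ?S = "2 ^ q * (s + 51 + 42 * m) - (51 + 42 * m)"
    obtain N1 where N1: "NNs (L + q * (m + 3)) ?S [N1]" "\<And>x. \<bar>N1 x - F x\<bar> \<le> 4 ^ q / 4 ^ m"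
       "lip (16 ^ q * \<Lambda> / 2 ^ m) (\<lambda>x. N1 x - F x)"
      using Suc.IH[OF l(1)] Suc.prems unfolding F_def fs by auto
    obtain N2 where N2: "NNs (L + q * (m + 3)) ?S [N2]" "\<And>x. \<bar>N2 x - G x\<bar> \<le> 4 ^ q / 4 ^ m"
       "lip (16 ^ q * \<Lambda> / 2 ^ m) (\<lambda>x. N2 x - G x)"
      using Suc.IH[OF l(2)] Suc.prems unfolding G_def fs by auto
    have F: "\<And>x. \<bar>F x\<bar> \<le> 1" "lip (2 ^ q * \<Lambda>) F"
      using prod_list_bound_lip[of fs1 \<Lambda>] Suc.prems l unfolding F_def fs by auto
    have G: "\<And>x. \<bar>G x\<bar> \<le> 1" "lip (2 ^ q * \<Lambda>) G"
      using prod_list_bound_lip[of fs2 \<Lambda>] Suc.prems l unfolding G_def fs by auto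
    define ep where "ep = (4 ^ q / 4 ^ m :: real)"
    define la where "la = 16 ^ q * \<Lambda> / 2 ^ m"
    have la0: "0 \<le> la" unfolding la_def using Suc.prems by simp
    have ep1: "ep \<le> 1" "0 \<le> ep" unfolding ep_def using Suc.prems(2) by (auto simp: power_increasing)
    have b1: "\<bar>N1 x\<bar> \<le> 2" and b2: "\<bar>N2 x\<bar> \<le> 2" for x
      using N1(2)[of x] N2(2)[of x] F(1)[of x] G(1)[of x] ep1 unfolding ep_def by linarith+
    have lN1: "lip (2 ^ q * \<Lambda> + la) N1" using lip_add[OF F(2) N1(3)] unfolding la_def by simp
    have lN2: "lip (2 ^ q * \<Lambda> + la) N2" using lip_add[OF G(2) N2(3)] unfolding la_def by simp
    have q0: "0 \<le> 2 ^ q * \<Lambda>" using Suc.prems(4) by simp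
    obtain N where N: "NNs (L + q * (m + 3) + (m + 3)) (?S + ?S + 51 + 42 * m) [N]"
       "\<And>x. \<bar>N x - N1 x * N2 x\<bar> \<le> 1 / 4 ^ m"
       "lip (2 / 2 ^ m * ((2 ^ q * \<Lambda> + la) + (2 ^ q * \<Lambda> + la))) (\<lambda>x. N x - N1 x * N2 x)"
      using NNs_mult[OF N1(1) N2(1) b1 b2 lN1 lN2, of m] q0 la0 by auto
    have dec: "N x - F x * G x = ((N1 x - F x) * N2 x + F x * (N2 x - G x)) + (N x - N1 x * N2 x)" for x
      by (simp add: algebra_simps)
    have PL: "prod_list (map (\<lambda>f. f x) fs) = F x * G x" for x unfolding F_def G_def fs by simp
    have sup: "\<bar>N x - F x * G x\<bar> \<le> 4 ^ Suc q / 4 ^ m" for x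
    proof -
      have "\<bar>(N1 x - F x) * N2 x\<bar> \<le> ep * 2" unfolding abs_mult using N1(2)[of x] b2[of x] ep1 unfolding ep_def
        by (intro mult_mono) auto
      moreover have "\<bar>F x * (N2 x - G x)\<bar> \<le> 1 * ep" unfolding abs_mult using N2(2)[of x] F(1)[of x] ep1 unfolding ep_def
        by (intro mult_mono) auto
      moreover have "1 / 4 ^ m \<le> ep" unfolding ep_def by (simp add: divide_right_mono)
      ultimately have "\<bar>N x - F x * G x\<bar> \<le> 4 * ep" unfolding dec[of x] using N(2)[of x] by linarith
      then show ?thesis unfolding ep_def by simp
    qed
    have l1: "lip (la * 2 + ep * (2 ^ q * \<Lambda> + la)) (\<lambda>x. (N1 x - F x) * N2 x)"
      using N1(2,3) b2 lN2 la0 q0 unfolding la_def[symmetric] ep_def[symmetric] by (intro lip_mult) auto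
    have l2: "lip (2 ^ q * \<Lambda> * ep + 1 * la) (\<lambda>x. F x * (N2 x - G x))"
      using N2(2,3) F la0 q0 unfolding la_def[symmetric] ep_def[symmetric] by (intro lip_mult) auto
    have "lip (la * 2 + ep * (2 ^ q * \<Lambda> + la) + (2 ^ q * \<Lambda> * ep + 1 * la)
       + 2 / 2 ^ m * ((2 ^ q * \<Lambda> + la) + (2 ^ q * \<Lambda> + la))) (\<lambda>x. N x - F x * G x)"
      unfolding dec by (intro lip_add l1 l2 N(3))
    \<comment> \<open>Every contribution is at most a small multiple of \<open>la\<close>, eleven
      times \<open>la\<close> in total; the growth factor 16 per level is what makes room for
      this.\<close>
    moreover have "la * 2 + ep * (2 ^ q * \<Lambda> + la) + (2 ^ q * \<Lambda> * ep + 1 * la)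
       + 2 / 2 ^ m * ((2 ^ q * \<Lambda> + la) + (2 ^ q * \<Lambda> + la)) \<le> 16 ^ Suc q * \<Lambda> / 2 ^ m"
    proof -
      have e4: "(4::real) ^ m = 2 ^ m * 2 ^ m" by (simp add: power_mult_distrib[symmetric])
      have "(2::real) ^ 2 \<le> 2 ^ m" using Suc.prems(3) by (intro power_increasing) auto
      then have m4: "4 / 2 ^ m \<le> (1::real)" by simp
      have A: "ep * la \<le> la" using ep1 la0 by (simp add: mult_left_le_one_le)
      have B: "4 / 2 ^ m * la \<le> la" using mult_right_mono[OF m4 la0] by simp
      have C: "ep * (2 ^ q * \<Lambda>) \<le> la"
      proof -
        have "ep * (2 ^ q * \<Lambda>) = (8 ^ q * \<Lambda> / 2 ^ m) / 2 ^ m"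
          unfolding ep_def e4 by (simp add: power_mult_distrib[symmetric] field_simps)
        also have "\<dots> \<le> 8 ^ q * \<Lambda> / 2 ^ m" using Suc.prems(4)
          mult_left_mono[of 1 "2 ^ m" "8 ^ q * \<Lambda> / 2 ^ m"] by (simp add: divide_le_eq)
        also have "\<dots> \<le> la" unfolding la_def using Suc.prems(4)
          by (intro divide_right_mono mult_right_mono power_mono) auto
        finally show ?thesis .
      qed
      have D: "4 / 2 ^ m * (2 ^ q * \<Lambda>) \<le> 4 * la"
      proof -
        have "(2 ^ q * \<Lambda>) \<le> 16 ^ q * \<Lambda>" using Suc.prems(4) by (intro mult_right_mono power_mono) auto
        then show ?thesis unfolding la_def by (simp add: field_simps)
      qed
      have E: "16 ^ Suc q * \<Lambda> / 2 ^ m = 16 * la" unfolding la_def by simp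
      show ?thesis unfolding E using A B C D la0 by (simp add: algebra_simps)
    qed
    ultimately have lp: "lip (16 ^ Suc q * \<Lambda> / 2 ^ m) (\<lambda>x. N x - F x * G x)" by (rule lip_mono)
    have "NNs (L + Suc q * (m + 3)) (2 ^ Suc q * (s + 51 + 42 * m) - (51 + 42 * m)) [N]"
    proof -
      have "1 * (51 + 42 * m) \<le> 2 ^ q * (s + 51 + 42 * m)" by (intro mult_le_mono) auto
      then have "?S + ?S + 51 + 42 * m \<le> 2 ^ Suc q * (s + 51 + 42 * m) - (51 + 42 * m)" by simp
      moreover have "L + q * (m + 3) + (m + 3) = L + Suc q * (m + 3)" by simp
      ultimately show ?thesis using NNs_mono[OF N(1)] by metis
    qed
    then show ?case using sup lp unfolding PL by blast
  qed
  then obtain N where "NNs (L + q * (m + 3)) (2 ^ q * (s + 51 + 42 * m) - (51 + 42 * m)) [N]"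
    "(\<forall>x. \<bar>N x - prod_list (map (\<lambda>f. f x) fs)\<bar> \<le> 4 ^ q / 4 ^ m)"
    "lip (16 ^ q * \<Lambda> / 2 ^ m) (\<lambda>x. N x - prod_list (map (\<lambda>f. f x) fs))" by blast
  then show ?thesis using NNs_mono[of _ _ _ "2 ^ q * (s + 51 + 42 * m)"] by (meson diff_le_self)
qed

text \<open>Three rectified affine functions of one scalar suffice for a hat function, two for
  clipping and four for a dyadic layer. One shape for all of them gives all factors of a product the
  same depth and size.\<close>

lemma NNs_relu4:
  assumes "NNs L s [f, \<lambda>x. - f x]"
  shows "NNs (L + 2) (s + 17) [\<lambda>x. c1 * max 0 (a1 * f x + b1) + c2 * max 0 (a2 * f x + b2)
     + c3 * max 0 (a3 * f x + b3) + c4 * max 0 (a4 * f x + b4) + c0]"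
proof -
  let ?g1 = "[\<lambda>x. a1 * f x + b1, \<lambda>x. a2 * f x + b2, \<lambda>x. a3 * f x + b3, \<lambda>x. a4 * f x + b4]"
  have mf: "f x = max 0 (f x) - max 0 (- f x)" for x by auto
  have mf': "a * f x + b = a * max 0 (f x) - a * max 0 (- f x) + b" for a b x
    by (subst mf) (simp add: algebra_simps)
  have n1: "NNs (L + 1) (s + 12) ?g1"
    apply (rule NNs_layer[OF assms])
      apply (unfold list.pred_inject, intro conjI)
    subgoal by (rule layer_rowI[of "[a1,-a1]" _ _ b1]) (simp_all add: mf')
    subgoal by (rule layer_rowI[of "[a2,-a2]" _ _ b2]) (simp_all add: mf')
    subgoal by (rule layer_rowI[of "[a3,-a3]" _ _ b3]) (simp_all add: mf')
    subgoal by (rule layer_rowI[of "[a4,-a4]" _ _ b4]) (simp_all add: mf')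
    by simp_all
  let ?g = "\<lambda>x. c1 * max 0 (a1 * f x + b1) + c2 * max 0 (a2 * f x + b2)
     + c3 * max 0 (a3 * f x + b3) + c4 * max 0 (a4 * f x + b4) + c0"
  have "NNs (L + 1 + 1) (s + 12 + 5) [?g]"
    apply (rule NNs_layer[OF n1])
      apply (unfold list.pred_inject, intro conjI)
    subgoal by (rule layer_rowI[of "[c1,c2,c3,c4]" _ _ c0]) simp_all
    by simp_all
  then show ?thesis by (simp add: algebra_simps)
qed

text \<open>Since f = max 0 f - max 0 (- f), a pair of opposite outputs passes unchanged through any
  number of layers. This equalises the depths of networks that are to be composed in
  parallel.\<close>

lemma NNs_deepen:
  assumes "NNs L s [f, \<lambda>x. - f x]"
  shows "NNs (L + k) (s + 6 * k) [f, \<lambda>x. - f x]"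
proof (induction k)
  case 0 then show ?case using assms by simp
next
  case (Suc k)
  have mf: "f x = max 0 (f x) - max 0 (- f x)" for x by auto
  show ?case
    apply (rule NNs_layer[OF Suc.IH])
      apply (unfold list.pred_inject, intro conjI)
    subgoal by (rule layer_rowI[of "[1,-1]" _ _ 0]) (simp_all add: max_def)
    subgoal by (rule layer_rowI[of "[-1,1]" _ _ 0]) (simp_all add: max_def)
    by simp_all
qed

section \<open>Difference quotients\<close>

text \<open>One-sided difference quotients along e: for ReLU networks and products of them they converge
  everywhere, so no exceptional null set is needed.\<close>

definition dqn :: "'a::real_normed_vector \<Rightarrow> ('a \<Rightarrow> real) \<Rightarrow> 'a \<Rightarrow> nat \<Rightarrow> real" where
  "dqn e f x n = (f (x + (1 / real (Suc n)) *\<^sub>R e) - f x) * real (Suc n)"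

definition dq :: "'a::real_normed_vector \<Rightarrow> ('a \<Rightarrow> real) \<Rightarrow> 'a \<Rightarrow> real" where
  "dq e f x = lim (dqn e f x)"

text \<open>The Lipschitz half supplies the majorant for limits under the integral, the other half
  holds at every point. Both survive rectification, which two-sided differentiability does
  not.\<close>

definition good :: "'a::real_normed_vector \<Rightarrow> ('a \<Rightarrow> real) \<Rightarrow> bool" where
  "good e f \<longleftrightarrow> (\<exists>K\<ge>0. lip K f) \<and> (\<forall>x. convergent (dqn e f x))"

lemma dq_lim: "good e f \<Longrightarrow> dqn e f x \<longlonglongrightarrow> dq e f x"
  unfolding good_def dq_def by (simp add: convergent_LIMSEQ_iff)

lemma dq_eqI: "dqn e f x \<longlonglongrightarrow> l \<Longrightarrow> dq e f x = l"
  unfolding dq_def by (rule limI)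

lemma lip_continuous_on:
  assumes "lip K f" shows "continuous_on S f"
proof -
  have "\<bar>K\<bar>-lipschitz_on S f"
    unfolding lipschitz_on_def
    using lipD[OF assms] by (auto simp: dist_norm intro!: order_trans[OF lipD[OF assms]] mult_right_mono)
  then show ?thesis by (rule lipschitz_on_continuous_on)
qed

lemma good_continuous: "good e f \<Longrightarrow> continuous_on S f"
  unfolding good_def using lip_continuous_on by blast

lemma shift_lim: "(\<lambda>n. x + (1 / real (Suc n)) *\<^sub>R e) \<longlonglongrightarrow> (x::'a::real_normed_vector)"
proof -
  have "(\<lambda>n. x + (1 / real (Suc n)) *\<^sub>R e) \<longlonglongrightarrow> x + 0 *\<^sub>R e"
    using LIMSEQ_inverse_real_of_nat by (intro tendsto_intros) (simp add: inverse_eq_divide)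
  then show ?thesis by simp
qed

lemma cont_shift_lim:
  fixes f :: "'a::real_normed_vector \<Rightarrow> real"
  assumes "isCont f x"
  shows "(\<lambda>n. f (x + (1 / real (Suc n)) *\<^sub>R e)) \<longlonglongrightarrow> f x"
  using isCont_tendsto_compose[OF assms shift_lim] .

lemma good_isCont: "good e f \<Longrightarrow> isCont f x"
  using good_continuous[of e f UNIV] by (simp add: continuous_on_eq_continuous_at)

lemma dqn_add_lim: "good e f \<Longrightarrow> good e g \<Longrightarrow> dqn e (\<lambda>x. f x + g x) x \<longlonglongrightarrow> dq e f x + dq e g x"
  using tendsto_add[OF dq_lim[of e f x] dq_lim[of e g x]] by (simp add: dqn_def[abs_def] algebra_simps)

lemma dqn_cmul_lim: "good e f \<Longrightarrow> dqn e (\<lambda>x. c * f x) x \<longlonglongrightarrow> c * dq e f x"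
  using tendsto_mult_left[OF dq_lim[of e f x], of c] by (simp add: dqn_def[abs_def] algebra_simps)

lemma goodI:
  assumes "lip K f" "0 \<le> K" "\<And>x. dqn e f x \<longlonglongrightarrow> d x"
  shows "good e f"
  unfolding good_def using assms convergentI by blast

lemma good_lipE:
  assumes "good e f" obtains K where "0 \<le> K" "lip K f"
  using assms unfolding good_def by blast

lemma good_add:
  assumes "good e f" "good e g" shows "good e (\<lambda>x. f x + g x)"
proof -
  obtain K K' where K: "0 \<le> K" "lip K f" "0 \<le> K'" "lip K' g" using assms good_lipE by metis
  show ?thesis by (rule goodI[OF lip_add[OF K(2,4)] _ dqn_add_lim[OF assms]]) (use K in auto)
qed

lemma good_cmul:
  assumes "good e f" shows "good e (\<lambda>x. c * f x)"
proof -
  obtain K where K: "0 \<le> K" "lip K f" using assms good_lipE by metis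
  show ?thesis by (rule goodI[OF lip_cmul[OF K(2)] _ dqn_cmul_lim[OF assms]]) (use K in auto)
qed

lemma good_const: "good e (\<lambda>x. c)"
  unfolding good_def dqn_def[abs_def] by (auto intro!: exI[of _ 0] lip_const convergent_const)

lemma good_sum: "(\<And>i. i \<in> I \<Longrightarrow> good e (f i)) \<Longrightarrow> good e (\<lambda>x. \<Sum>i\<in>I. f i x)"
  by (induction I rule: infinite_finite_induct) (auto intro: good_const good_add)

lemma dq_add: "good e f \<Longrightarrow> good e g \<Longrightarrow> dq e (\<lambda>x. f x + g x) x = dq e f x + dq e g x"
  by (rule dq_eqI[OF dqn_add_lim])

lemma dq_const: "dq e (\<lambda>x. c) x = 0"
  by (rule dq_eqI) (simp add: dqn_def[abs_def])

lemma dq_sum: "(\<And>i. i \<in> I \<Longrightarrow> good e (f i)) \<Longrightarrow> dq e (\<lambda>x. \<Sum>i\<in>I. f i x) x = (\<Sum>i\<in>I. dq e (f i) x)"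
  by (induction I rule: infinite_finite_induct) (auto simp: dq_const dq_add good_sum)

lemma dqn_mult_lim:
  assumes "dqn e f x \<longlonglongrightarrow> a" "dqn e g x \<longlonglongrightarrow> b" "isCont g x"
  shows "dqn e (\<lambda>x. f x * g x) x \<longlonglongrightarrow> a * g x + f x * b"
proof -
  have "(\<lambda>n. dqn e f x n * g (x + (1 / real (Suc n)) *\<^sub>R e) + f x * dqn e g x n) \<longlonglongrightarrow> a * g x + f x * b"
    by (intro tendsto_intros assms cont_shift_lim)
  then show ?thesis by (simp add: dqn_def[abs_def] algebra_simps)
qed

lemma good_mult:
  assumes "good e f" "good e g" "\<And>x. \<bar>f x\<bar> \<le> B" "\<And>x. \<bar>g x\<bar> \<le> B'"
  shows "good e (\<lambda>x. f x * g x)"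
proof -
  obtain K K' where K: "0 \<le> K" "lip K f" "0 \<le> K'" "lip K' g" using assms(1,2) unfolding good_def by auto
  have "lip (K * B' + B * K') (\<lambda>x. f x * g x)" by (rule lip_mult[OF K(2,4) assms(3,4) K(1,3)])
  moreover have "0 \<le> K * B' + B * K'"
    using K order_trans[OF abs_ge_zero assms(3)] order_trans[OF abs_ge_zero assms(4)] by simp
  moreover have "convergent (dqn e (\<lambda>x. f x * g x) x)" for x
    using dqn_mult_lim[OF dq_lim[OF assms(1)] dq_lim[OF assms(2)] good_isCont[OF assms(2)]] convergentI by blast
  ultimately show ?thesis unfolding good_def by auto
qed

lemma good_relu:
  assumes "good e f" shows "good e (\<lambda>x. max 0 (f x))"
proof -
  have "convergent (dqn e (\<lambda>x. max 0 (f x)) x)" for x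
  proof -
    have c: "(\<lambda>n. f (x + (1 / real (Suc n)) *\<^sub>R e)) \<longlonglongrightarrow> f x" by (rule cont_shift_lim[OF good_isCont[OF assms]])
    consider "f x > 0" | "f x < 0" | "f x = 0" by linarith
    then show ?thesis
    proof cases
      case 1
      have "\<forall>\<^sub>F n in sequentially. dqn e f x n = dqn e (\<lambda>x. max 0 (f x)) x n"
        using order_tendstoD(1)[OF c 1] by eventually_elim (use 1 in \<open>simp add: dqn_def\<close>)
      then show ?thesis using dq_lim[OF assms, of x] by (intro convergentI) (rule Lim_transform_eventually)
    next
      case 2
      have "\<forall>\<^sub>F n in sequentially. 0 = dqn e (\<lambda>x. max 0 (f x)) x n"
        using order_tendstoD(2)[OF c 2] by eventually_elim (use 2 in \<open>simp add: dqn_def\<close>)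
      then show ?thesis by (intro convergentI) (rule Lim_transform_eventually[OF tendsto_const])
    next
      case 3
      \<comment> \<open>At a zero of f the quotients are positive multiples of the values of f, and
        \<open>max 0\<close> commutes with positive factors. This is where the one-sided quotient is
        essential.\<close>
      have "dqn e (\<lambda>x. max 0 (f x)) x = (\<lambda>n. max 0 (dqn e f x n))"
        using 3 by (intro ext) (auto simp: dqn_def max_def mult_le_0_iff zero_le_mult_iff)
      moreover have "(\<lambda>n. max 0 (dqn e f x n)) \<longlonglongrightarrow> max 0 (dq e f x)"
        by (intro tendsto_intros dq_lim assms)
      ultimately show ?thesis by (simp add: convergentI)
    qed
  qed
  moreover obtain K where "K \<ge> 0" "lip K f" using assms unfolding good_def by auto
  ultimately show ?thesis unfolding good_def using lip_relu by blast
qed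

lemma good_linear:
  assumes "bounded_linear f" shows "good e f"
proof -
  interpret bounded_linear f by fact
  obtain K where K: "K > 0" "\<And>x. norm (f x) \<le> norm x * K" using pos_bounded by auto
  have "dqn e f x = (\<lambda>n. f e)" for x
    by (rule ext) (simp add: dqn_def add scaleR)
  moreover have "lip K f" unfolding lip_def using K by (metis diff mult.commute real_norm_def)
  ultimately show ?thesis unfolding good_def using K by (auto intro!: exI[of _ K] convergent_const)
qed

lemma dqn_lip: "lip K f \<Longrightarrow> \<bar>dqn e f x n\<bar> \<le> K * norm e"
proof -
  assume l: "lip K f"
  have "\<bar>dqn e f x n\<bar> = \<bar>f (x + (1 / real (Suc n)) *\<^sub>R e) - f x\<bar> * real (Suc n)"
    unfolding dqn_def abs_mult by simp
  also have "\<dots> \<le> (K * norm ((1 / real (Suc n)) *\<^sub>R e)) * real (Suc n)"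
    using lipD[OF l, of "x + (1 / real (Suc n)) *\<^sub>R e" x] by (intro mult_right_mono) auto
  also have "\<dots> = K * norm e" by (simp del: of_nat_Suc)
  finally show ?thesis .
qed

lemma dq_bound:
  assumes "good e f" "lip K f" shows "\<bar>dq e f x\<bar> \<le> K * norm e"
  by (rule tendsto_upperbound[OF tendsto_rabs[OF dq_lim[OF assms(1)]]])
     (auto intro!: always_eventually dqn_lip[OF assms(2)])

lemma dq_measurable:
  fixes f :: "'a::euclidean_space \<Rightarrow> real"
  assumes "good e f" shows "dq e f \<in> borel_measurable borel"
proof -
  have [measurable]: "f \<in> borel_measurable borel"
    using good_continuous[OF assms, of UNIV] by (rule borel_measurable_continuous_onI)
  have "(\<lambda>x. dqn e f x n) \<in> borel_measurable borel" for n unfolding dqn_def by measurable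
  then have "(\<lambda>x. lim (\<lambda>n. dqn e f x n)) \<in> borel_measurable borel" by measurable
  then show ?thesis by (simp add: dq_def[abs_def])
qed

lemma dq_local:
  assumes "open S" "x \<in> S" "\<And>y. y \<in> S \<Longrightarrow> f y = g y"
  shows "dq e f x = dq e g x"
proof -
  have "\<forall>\<^sub>F n in sequentially. x + (1 / real (Suc n)) *\<^sub>R e \<in> S"
    using topological_tendstoD[OF shift_lim assms(1,2)] .
  then have ev: "\<forall>\<^sub>F n in sequentially. dqn e f x n = dqn e g x n"
    by eventually_elim (simp add: dqn_def assms)
  have "(\<lambda>l. dqn e f x \<longlonglongrightarrow> l) = (\<lambda>l. dqn e g x \<longlonglongrightarrow> l)"
    by (rule ext) (rule tendsto_cong[OF ev])
  then show ?thesis unfolding dq_def lim_def by simp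
qed

lemma dqn_has_derivative:
  assumes "(Q has_derivative Q') (at x)"
  shows "dqn e Q x \<longlonglongrightarrow> Q' e"
proof (cases "e = 0")
  case True
  interpret bounded_linear Q' using assms by (rule has_derivative_bounded_linear)
  show ?thesis using True zero by (simp add: dqn_def[abs_def])
next
  case False
  have "((\<lambda>t. x + t *\<^sub>R e) has_derivative (\<lambda>t. t *\<^sub>R e)) (at 0)"
    by (auto intro!: derivative_eq_intros)
  then have "((\<lambda>t. Q (x + t *\<^sub>R e)) has_derivative (\<lambda>t. Q' (t *\<^sub>R e))) (at 0)"
    using has_derivative_compose[of "\<lambda>t. x + t *\<^sub>R e" "\<lambda>t. t *\<^sub>R e" 0 UNIV Q Q'] assms by simp
  moreover have "Q' (t *\<^sub>R e) = t * Q' e" for t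
    using linear_cmul[OF bounded_linear.linear[OF has_derivative_bounded_linear[OF assms]]] by simp
  ultimately have "((\<lambda>t. Q (x + t *\<^sub>R e)) has_field_derivative Q' e) (at 0)"
    by (simp add: has_field_derivative_def mult.commute[of _ "Q' e"] )
  then have "(\<lambda>h. (Q (x + h *\<^sub>R e) - Q x) / h) \<midarrow>0\<rightarrow> Q' e"
    by (simp add: DERIV_def)
  moreover have "filterlim (\<lambda>n. 1 / real (Suc n)) (at 0) sequentially"
    using LIMSEQ_inverse_real_of_nat by (intro filterlim_atI) (auto simp: inverse_eq_divide)
  ultimately have "(\<lambda>n. (Q (x + (1 / real (Suc n)) *\<^sub>R e) - Q x) / (1 / real (Suc n))) \<longlonglongrightarrow> Q' e"
    by (rule filterlim_compose)
  then show ?thesis by (simp add: dqn_def[abs_def])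
qed

text \<open>Coordinates are linear, and \<open>good\<close> is preserved by linear combinations,
  constants and rectification. The induction removes the last layer, because
  \<open>eval_append\<close> exposes the rectified outputs of the preceding ones.\<close>

lemma NNs_good:
  assumes "NNs L s fs" "f \<in> set fs" shows "good e f"
proof -
  obtain \<Phi> where \<Phi>: "\<Phi> \<noteq> []" "wfl 2 \<Phi> (length fs)"
     "\<forall>x. eval_layers \<Phi> [fst x, snd x] = map (\<lambda>f. f x) fs" using assms(1) unfolding NNs_def by auto
  have sl: "good e (\<lambda>x. sum_list (map2 (*) rw (map (\<lambda>h. h x) hs)))"
    if "\<And>h. h \<in> set hs \<Longrightarrow> good e h" for rw :: "real list" and hs :: "(real \<times> real \<Rightarrow> real) list"
    using that
  proof (induction rw arbitrary: hs)
    case Nil then show ?case by (simp add: good_const)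
  next
    case (Cons r rw)
    show ?case
    proof (cases hs)
      case Nil then show ?thesis by (simp add: good_const)
    next
      case (Cons h hs')
      then have "good e (\<lambda>x. sum_list (map2 (*) rw (map (\<lambda>h. h x) hs')))"
        using Cons.prems Cons.IH[of hs'] by auto
      moreover have "good e (\<lambda>x. r * h x)" using Cons.prems Cons by (auto intro: good_cmul)
      ultimately show ?thesis using Cons by (simp add: good_add)
    qed
  qed
  have "i < length (eval_layers \<Phi> v0) \<Longrightarrow> good e (\<lambda>x. eval_layers \<Phi> [fst x, snd x] ! i)"
    if "wfl 2 \<Phi> m" "\<Phi> \<noteq> []" for i m \<Phi> v0
    using that
  proof (induction \<Phi> arbitrary: i m v0 rule: rev_induct)
    case Nil then show ?case by simp
  next
    case (snoc l ls)
    obtain k where k: "wfl 2 ls k" "length (fst l) = length (snd l)" "length (fst l) = m"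
      using snoc.prems unfolding wfl_append by auto
    have im: "i < m" using snoc.prems length_eval[OF snoc.prems(3,2)] by simp
    obtain hs where hs: "\<And>h. h \<in> set hs \<Longrightarrow> good e h"
      "\<And>x. eval_layers (ls @ [l]) [fst x, snd x] = affine l (map (\<lambda>h. h x) hs)"
    proof (cases "ls = []")
      case True
      have "good e fst" "good e snd"
        by (rule good_linear, rule bounded_linear_fst, rule good_linear, rule bounded_linear_snd)
      then show ?thesis using True by (intro that[of "[fst, snd]"]) (simp_all, blast)
    next
      case False
      define hs where "hs = map (\<lambda>i x. max 0 (eval_layers ls [fst x, snd x] ! i)) [0..<k]"
      have "map (\<lambda>h. h x) hs = map (max 0) (eval_layers ls [fst x, snd x])" for x
        unfolding hs_def using length_eval[OF False k(1)] by (intro nth_equalityI) auto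
      then show ?thesis using False snoc.IH[OF _ k(1) False] length_eval[OF False k(1)]
        by (intro that[of hs]) (auto simp: eval_append hs_def intro!: good_relu)
    qed
    have "good e (\<lambda>x. sum_list (map2 (*) (fst l ! i) (map (\<lambda>h. h x) hs)) + snd l ! i)"
      by (intro good_add sl hs good_const)
    then show ?case unfolding hs(2) affine_def using im k by simp
  qed
  note g = this[OF \<Phi>(2,1)]
  obtain i where "i < length fs" "f = fs ! i" using assms(2) by (metis in_set_conv_nth)
  then show ?thesis using g[of i "[0,0]"] \<Phi>(3) length_eval[OF \<Phi>(1,2)] by simp
qed

section \<open>Weak derivatives of Lipschitz functions\<close>

lemma integral_lborel_shift:
  fixes F :: "'a::euclidean_space \<Rightarrow> real"
  assumes "F \<in> borel_measurable borel"
  shows "(\<integral>x. F (x + v) \<partial>lborel) = (\<integral>x. F x \<partial>lborel)"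
proof -
  have "(\<integral>x. F x \<partial>lborel) = (\<integral>x. F x \<partial>(distr lborel borel ((+) v)))" by (simp add: lborel_distr_plus)
  also have "\<dots> = (\<integral>x. F (v + x) \<partial>lborel)" using assms by (intro integral_distr) auto
  finally show ?thesis by (simp add: add.commute)
qed

lemma integrable_lborel_shift:
  fixes F :: "'a::euclidean_space \<Rightarrow> real"
  assumes "integrable lborel F"
  shows "integrable lborel (\<lambda>x. F (x + v))"
proof -
  have "integrable (distr lborel borel ((+) v)) F" using assms by (simp add: lborel_distr_plus)
  then have "integrable lborel (\<lambda>x. F (v + x))" using assms by (subst (asm) integrable_distr_eq) (auto dest: borel_measurable_integrable)
  then show ?thesis by (simp add: add.commute)
qed

lemma integrable_bounded_cball:
  fixes g :: "'a::euclidean_space \<Rightarrow> real"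
  assumes "g \<in> borel_measurable borel" "\<And>x. \<bar>g x\<bar> \<le> B" "\<And>x. x \<notin> cball 0 R \<Longrightarrow> g x = 0"
  shows "integrable lborel g"
proof (rule integrableI_bounded_set[where A="cball 0 R" and B=B])
  show "emeasure lborel (cball (0::'a) R) < \<infinity>" by (rule emeasure_bounded_finite) simp
qed (use assms in \<open>auto intro!: always_eventually\<close>)

lemma bounded_cballE:
  fixes S :: "'a::real_normed_vector set"
  assumes "bounded S" obtains R where "0 \<le> R" "S \<subseteq> cball 0 R"
proof -
  obtain a where "\<forall>x\<in>S. norm x \<le> a" using assms unfolding bounded_iff by blast
  then show ?thesis by (intro that[of "max 0 a"]) (auto simp: le_max_iff_disj)
qed

text \<open>Translation invariance makes the integral of every difference quotient of f \<phi>
  vanish. The product rule identifies the pointwise limit as dq f * \<phi> + f * \<psi>, and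
  dominated convergence shows that its integral vanishes too.\<close>

lemma good_integration_by_parts:
  fixes f \<phi> \<psi> :: "'a::euclidean_space \<Rightarrow> real"
  assumes g: "good e f" and c: "continuous_on UNIV \<phi>" "continuous_on UNIV \<psi>"
    and d: "\<And>x t. ((\<lambda>t. \<phi> (x + t *\<^sub>R e)) has_real_derivative \<psi> (x + t *\<^sub>R e)) (at t)"
    and z: "\<And>x. x \<notin> cball 0 R \<Longrightarrow> \<phi> x = 0" "\<And>x. x \<notin> cball 0 R \<Longrightarrow> \<psi> x = 0" and "0 \<le> R"
  shows "(\<integral>x. f x * \<psi> x \<partial>lborel) = - (\<integral>x. dq e f x * \<phi> x \<partial>lborel)"
proof -
  obtain K where K: "0 \<le> K" "lip K f" using g good_lipE by metis
  let ?C = "cball (0::'a) (R + norm e)"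
  have bd: "\<exists>B\<ge>0. \<forall>x\<in>?C. \<bar>h x\<bar> \<le> B" if "continuous_on UNIV h" for h :: "'a \<Rightarrow> real"
  proof -
    have "bounded (h ` ?C)" using that
      by (intro compact_imp_bounded compact_continuous_image) (auto intro: continuous_on_subset)
    then show ?thesis unfolding bounded_iff by (metis abs_ge_zero imageI order_trans real_norm_def)
  qed
  obtain Bf where Bf: "Bf \<ge> 0" "\<And>x. x \<in> ?C \<Longrightarrow> \<bar>f x\<bar> \<le> Bf" using bd[OF good_continuous[OF g]] by auto
  obtain B0 where B0: "B0 \<ge> 0" "\<And>x. x \<in> ?C \<Longrightarrow> \<bar>\<phi> x\<bar> \<le> B0" using bd[OF c(1)] by auto
  obtain B1 where B1: "B1 \<ge> 0" "\<And>x. x \<in> ?C \<Longrightarrow> \<bar>\<psi> x\<bar> \<le> B1" using bd[OF c(2)] by auto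
  have sub: "cball 0 R \<subseteq> ?C" by (rule subset_cball) simp
  have B0': "\<bar>\<phi> x\<bar> \<le> B0" and B1': "\<bar>\<psi> x\<bar> \<le> B1" for x
    using B0 B1 z[of x] subsetD[OF sub, of x] by (cases "x \<in> cball 0 R", simp_all)+
  have fm: "f \<in> borel_measurable borel" and pm: "\<phi> \<in> borel_measurable borel" and sm: "\<psi> \<in> borel_measurable borel"
    using good_continuous[OF g] c by (auto intro: borel_measurable_continuous_onI)
  note [measurable] = fm pm sm dq_measurable[OF g]
  define F where "F x = f x * \<phi> x" for x
  have Fm[measurable]: "F \<in> borel_measurable borel" unfolding F_def by measurable
  have dphi: "\<bar>dqn e \<phi> x n\<bar> \<le> B1" for x n
  proof -
    obtain t where t: "\<phi> (x + (1 / real (Suc n)) *\<^sub>R e) - \<phi> (x + 0 *\<^sub>R e) = (1 / real (Suc n) - 0) * \<psi> (x + t *\<^sub>R e)"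
      using MVT2[of 0 "1 / real (Suc n)" "\<lambda>t. \<phi> (x + t *\<^sub>R e)" "\<lambda>t. \<psi> (x + t *\<^sub>R e)"] d by auto
    have "dqn e \<phi> x n = \<psi> (x + t *\<^sub>R e)" unfolding dqn_def using t by (simp del: of_nat_Suc)
    then show ?thesis using B1' by simp
  qed
  have FB: "\<bar>F x\<bar> \<le> Bf * B0" for x
  proof (cases "x \<in> cball 0 R")
    case True
    then show ?thesis unfolding F_def abs_mult using Bf B0 sub by (intro mult_mono) auto
  qed (use Bf B0 in \<open>simp add: F_def z\<close>)
  have Fi: "integrable lborel F"
    using FB by (rule integrable_bounded_cball[OF Fm, where R=R]) (simp add: F_def z)
  have lim: "dqn e F x \<longlonglongrightarrow> dq e f x * \<phi> x + f x * \<psi> x" for x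
  proof -
    have "((\<lambda>t. \<phi> (x + t *\<^sub>R e)) has_real_derivative \<psi> x) (at 0)" using d[of x 0] by simp
    then have "(\<lambda>h. (\<phi> (x + h *\<^sub>R e) - \<phi> x) / h) \<midarrow>0\<rightarrow> \<psi> x" by (simp add: DERIV_def)
    moreover have "filterlim (\<lambda>n. 1 / real (Suc n)) (at 0) sequentially"
      using LIMSEQ_inverse_real_of_nat by (intro filterlim_atI) (auto simp: inverse_eq_divide)
    ultimately have "(\<lambda>n. (\<phi> (x + (1 / real (Suc n)) *\<^sub>R e) - \<phi> x) / (1 / real (Suc n))) \<longlonglongrightarrow> \<psi> x"
      by (rule filterlim_compose)
    then have "dqn e \<phi> x \<longlonglongrightarrow> \<psi> x" by (simp add: dqn_def[abs_def])
    then show ?thesis unfolding F_def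
      using c(1) by (intro dqn_mult_lim dq_lim g) (auto simp: continuous_on_eq_continuous_at)
  qed
  \<comment> \<open>All shifts are at most \<open>norm e\<close>, so the quotients of f \<phi> live
    on the ball enlarged by that amount; there the product rule for differences gives a constant
    majorant.\<close>
  have bound: "\<bar>dqn e F x n\<bar> \<le> (K * norm e * B0 + Bf * B1) * indicator ?C x" for x n
  proof (cases "x \<in> ?C")
    case True
    have "dqn e F x n = dqn e f x n * \<phi> (x + (1 / real (Suc n)) *\<^sub>R e) + f x * dqn e \<phi> x n"
      unfolding dqn_def F_def by (simp add: algebra_simps)
    also have "\<bar>\<dots>\<bar> \<le> \<bar>dqn e f x n\<bar> * \<bar>\<phi> (x + (1 / real (Suc n)) *\<^sub>R e)\<bar> + \<bar>f x\<bar> * \<bar>dqn e \<phi> x n\<bar>"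
      by (metis abs_mult abs_triangle_ineq)
    also have "\<dots> \<le> K * norm e * B0 + Bf * B1"
      using dqn_lip[OF K(2)] B0' dphi Bf True K B0 B1 by (intro add_mono mult_mono) auto
    finally show ?thesis using True by simp
  next
    case False
    have "norm ((1 / real (Suc n)) *\<^sub>R e) \<le> norm e"
      by (simp add: divide_le_eq mult_le_cancel_left1)
    then have "x + (1 / real (Suc n)) *\<^sub>R e \<notin> cball 0 R" "x \<notin> cball 0 R"
      using False norm_triangle_ineq4[of "x + (1 / real (Suc n)) *\<^sub>R e" "(1 / real (Suc n)) *\<^sub>R e"] norm_ge_zero[of e]
      unfolding mem_cball_0 add_diff_cancel_right' by linarith+
    then have "dqn e F x n = 0" unfolding dqn_def F_def by (simp add: z)
    then show ?thesis using False by simp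
  qed
  have "(\<lambda>n. \<integral>x. dqn e F x n \<partial>lborel) \<longlonglongrightarrow> (\<integral>x. (dq e f x * \<phi> x + f x * \<psi> x) \<partial>lborel)"
  proof (rule integral_dominated_convergence[where w="\<lambda>x. (K * norm e * B0 + Bf * B1) * indicator ?C x"])
    show "integrable lborel (\<lambda>x. (K * norm e * B0 + Bf * B1) * indicator ?C x)"
      using emeasure_bounded_finite[OF bounded_cball, of "0::'a" "R + norm e"]
      by (intro integrable_mult_right integrable_real_indicator) auto
    show "(\<lambda>x. dqn e F x n) \<in> borel_measurable lborel" for n unfolding dqn_def by measurable
  qed (use lim bound in \<open>auto intro!: always_eventually\<close>)
  moreover have "(\<integral>x. dqn e F x n \<partial>lborel) = 0" for n
    unfolding dqn_def
    using integrable_lborel_shift[OF Fi, of "(1 / real (Suc n)) *\<^sub>R e"] Fi integral_lborel_shift[OF Fm]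
    by (simp del: of_nat_Suc)
  ultimately have 0: "(\<integral>x. (dq e f x * \<phi> x + f x * \<psi> x) \<partial>lborel) = 0"
    by (simp add: LIMSEQ_const_iff)
  have i1: "integrable lborel (\<lambda>x. dq e f x * \<phi> x)"
  proof (rule integrable_bounded_cball[where R=R and B="K * norm e * B0"])
    show "\<bar>dq e f x * \<phi> x\<bar> \<le> K * norm e * B0" for x
      unfolding abs_mult using dq_bound[OF g K(2)] B0' K B0 by (intro mult_mono) auto
  qed (simp_all add: z)
  have i2: "integrable lborel (\<lambda>x. f x * \<psi> x)"
  proof (rule integrable_bounded_cball[where R=R and B="Bf * B1"])
    show "\<bar>f x * \<psi> x\<bar> \<le> Bf * B1" for x
    proof (cases "x \<in> cball 0 R")
      case True
      then show ?thesis unfolding abs_mult using Bf B1 sub by (intro mult_mono) auto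
    qed (use Bf B1 in \<open>simp add: z\<close>)
  qed (simp_all add: z)
  show ?thesis using 0 i1 i2 by simp
qed

text \<open>\<open>pd\<close> is built from \<open>deriv\<close>, which is meaningful only where a
  derivative exists; \<open>test_fun\<close> demands differentiability of every
  \<open>pd a b \<phi>\<close>, which turns them into true and continuous partial derivatives. Off
  the closed support \<phi> vanishes near the point, hence so do the derivatives.\<close>

lemma test_fun_pd:
  assumes "test_fun \<Omega> \<phi>"
  shows "continuous_on UNIV \<phi>" "continuous_on UNIV (pd 1 0 \<phi>)" "continuous_on UNIV (pd 0 1 \<phi>)"
    "((\<lambda>t. \<phi> (x + t *\<^sub>R (1,0))) has_real_derivative pd 1 0 \<phi> (x + t *\<^sub>R (1,0))) (at t)"
    "((\<lambda>t. \<phi> (x + t *\<^sub>R (0,1))) has_real_derivative pd 0 1 \<phi> (x + t *\<^sub>R (0,1))) (at t)"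
    "x \<notin> closure {x. \<phi> x \<noteq> 0} \<Longrightarrow> \<phi> x = 0"
    "x \<notin> closure {x. \<phi> x \<noteq> 0} \<Longrightarrow> pd 1 0 \<phi> x = 0"
    "x \<notin> closure {x. \<phi> x \<noteq> 0} \<Longrightarrow> pd 0 1 \<phi> x = 0"
proof -
  have df: "pd a b \<phi> differentiable (at p)" for a b p using assms unfolding test_fun_def by blast
  have cn: "continuous_on UNIV (pd a b \<phi>)" for a b
    by (intro differentiable_imp_continuous_on differentiable_at_imp_differentiable_on) (use df in auto)
  from cn[of 0 0] show "continuous_on UNIV \<phi>" by simp
  show "continuous_on UNIV (pd 1 0 \<phi>)" "continuous_on UNIV (pd 0 1 \<phi>)" using cn by blast+
  have d1: "((\<lambda>t. \<phi> (t, b)) has_real_derivative pd 1 0 \<phi> (a, b)) (at a)" for a b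
  proof -
    have "(\<lambda>t. \<phi> (t, b)) differentiable (at a)"
      using differentiable_chain_at[of "\<lambda>t. (t, b)" a \<phi>] df[of 0 0 "(a,b)"]
      by (simp add: o_def differentiable_Pair)
    then show ?thesis by (simp add: DERIV_deriv_iff_real_differentiable)
  qed
  have d2: "((\<lambda>t. \<phi> (a, t)) has_real_derivative pd 0 1 \<phi> (a, b)) (at b)" for a b
  proof -
    have "(\<lambda>t. \<phi> (a, t)) differentiable (at b)"
      using differentiable_chain_at[of "\<lambda>t. (a, t)" b \<phi>] df[of 0 0 "(a,b)"]
      by (simp add: o_def differentiable_Pair)
    then show ?thesis by (simp add: DERIV_deriv_iff_real_differentiable)
  qed
  show "((\<lambda>t. \<phi> (x + t *\<^sub>R (1,0))) has_real_derivative pd 1 0 \<phi> (x + t *\<^sub>R (1,0))) (at t)"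
  proof (cases x)
    case (Pair a b)
    have "((\<lambda>s. \<phi> (a + s, b)) has_real_derivative pd 1 0 \<phi> (a + t, b) * 1) (at t)"
      by (rule DERIV_chain'[where f="\<lambda>s. a + s" and g="\<lambda>s. \<phi> (s, b)", OF _ d1]) (auto intro!: derivative_eq_intros)
    then show ?thesis unfolding Pair by simp
  qed
  show "((\<lambda>t. \<phi> (x + t *\<^sub>R (0,1))) has_real_derivative pd 0 1 \<phi> (x + t *\<^sub>R (0,1))) (at t)"
  proof (cases x)
    case (Pair a b)
    have "((\<lambda>s. \<phi> (a, b + s)) has_real_derivative pd 0 1 \<phi> (a, b + t) * 1) (at t)"
      by (rule DERIV_chain'[where f="\<lambda>s. b + s" and g="\<lambda>s. \<phi> (a, s)", OF _ d2]) (auto intro!: derivative_eq_intros)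
    then show ?thesis unfolding Pair by simp
  qed
  assume x: "x \<notin> closure {x. \<phi> x \<noteq> 0}"
  show "\<phi> x = 0" using closure_subset[of "{x. \<phi> x \<noteq> 0}"] x by blast
  obtain a b where ab: "x = (a, b)" by (cases x)
  have ev: "\<forall>\<^sub>F y in nhds x. \<phi> y = 0"
  proof -
    have "\<forall>\<^sub>F y in nhds x. y \<in> - closure {x. \<phi> x \<noteq> 0}"
      by (rule eventually_nhds_in_open) (use x in auto)
    then show ?thesis
      by (rule eventually_mono) (use closure_subset[of "{x. \<phi> x \<noteq> 0}"] in blast)
  qed
  have "\<forall>\<^sub>F t in nhds a. \<phi> (t, b) = 0"
    using ev unfolding ab by (rule eventually_compose_filterlim) (intro tendsto_intros filterlim_ident)
  then have "deriv (\<lambda>t. \<phi> (t, b)) a = deriv (\<lambda>t. 0) a" by (intro deriv_cong_ev) auto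
  then show "pd 1 0 \<phi> x = 0" by (simp add: ab)
  have "\<forall>\<^sub>F t in nhds b. \<phi> (a, t) = 0"
    using ev unfolding ab by (rule eventually_compose_filterlim) (intro tendsto_intros filterlim_ident)
  then have "deriv (\<lambda>t. \<phi> (a, t)) b = deriv (\<lambda>t. 0) b" by (intro deriv_cong_ev) auto
  then show "pd 0 1 \<phi> x = 0" by (simp add: ab)
qed

lemma set_integral_restrict:
  fixes h :: "real \<times> real \<Rightarrow> real"
  assumes "\<And>x. x \<notin> \<Omega> \<Longrightarrow> h x = 0"
  shows "(LINT x:\<Omega>|lborel. h x) = (\<integral>x. h x \<partial>lborel)"
  unfolding set_lebesgue_integral_def
  by (rule Bochner_Integration.integral_cong) (use assms in \<open>auto simp: indicator_def\<close>)

lemma loc_integrable_bounded: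
  fixes g :: "real \<times> real \<Rightarrow> real"
  assumes "g \<in> borel_measurable borel" "\<And>K. compact K \<Longrightarrow> \<exists>B. \<forall>x\<in>K. \<bar>g x\<bar> \<le> B"
  shows "loc_integrable \<Omega> g"
  unfolding loc_integrable_def set_integrable_def
proof (intro allI impI)
  fix K :: "(real \<times> real) set" assume K: "compact K \<and> K \<subseteq> \<Omega>"
  then obtain B where B: "\<forall>x\<in>K. \<bar>g x\<bar> \<le> B" using assms(2) by blast
  have [measurable]: "K \<in> sets borel" using K by (auto intro: borel_compact)
  obtain R where R: "K \<subseteq> cball 0 R" using K compact_imp_bounded bounded_cballE by metis
  show "integrable lborel (\<lambda>x. indicat_real K x *\<^sub>R g x)"
  proof (rule integrable_bounded_cball[where R=R and B="\<bar>B\<bar>"])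
    show "\<bar>indicat_real K x *\<^sub>R g x\<bar> \<le> \<bar>B\<bar>" for x using B by (cases "x \<in> K") auto
    show "x \<notin> cball 0 R \<Longrightarrow> indicat_real K x *\<^sub>R g x = 0" for x using R by (auto simp: indicator_def)
    show "(\<lambda>x. indicat_real K x *\<^sub>R g x) \<in> borel_measurable borel" using assms(1) by measurable
  qed
qed

lemma good_weak_deriv:
  assumes "good (1,0) f" "good (0,1) f"
  shows "weak_deriv \<Omega> f 1 0 (dq (1,0) f)" "weak_deriv \<Omega> f 0 1 (dq (0,1) f)"
proof -
  have fc: "continuous_on UNIV f" by (rule good_continuous[OF assms(1)])
  have lf: "loc_integrable \<Omega> f"
  proof (rule loc_integrable_bounded)
    show "f \<in> borel_measurable borel" using fc by (rule borel_measurable_continuous_onI)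
    show "\<exists>B. \<forall>x\<in>K. \<bar>f x\<bar> \<le> B" if "compact K" for K
      using compact_imp_bounded[OF compact_continuous_image[OF continuous_on_subset[OF fc] that]]
      unfolding bounded_iff by auto
  qed
  have ld: "loc_integrable \<Omega> (dq e f)" if g: "good e f" for e
  proof (rule loc_integrable_bounded[OF dq_measurable[OF g]])
    obtain K where "0 \<le> K" "lip K f" using g good_lipE by metis
    then show "\<exists>B. \<forall>x\<in>S. \<bar>dq e f x\<bar> \<le> B" for S using dq_bound[OF g] by blast
  qed
  have R: "\<exists>R\<ge>0. closure {x. \<phi> x \<noteq> 0} \<subseteq> cball 0 R" if "test_fun \<Omega> \<phi>" for \<phi>
  proof -
    have "bounded (closure {x. \<phi> x \<noteq> 0})" using that unfolding test_fun_def by (auto intro: compact_imp_bounded)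
    then show ?thesis using bounded_cballE by metis
  qed
  have sub: "x \<notin> closure {x. \<phi> x \<noteq> 0}" if "test_fun \<Omega> \<phi>" "x \<notin> \<Omega>" for \<phi> x
    using that unfolding test_fun_def by blast
  show "weak_deriv \<Omega> f 1 0 (dq (1,0) f)"
    unfolding weak_deriv_def
  proof (intro conjI allI impI lf ld assms)
    fix \<phi> assume t: "test_fun \<Omega> \<phi>"
    obtain R where R: "R \<ge> 0" "closure {x. \<phi> x \<noteq> 0} \<subseteq> cball 0 R" using R[OF t] by blast
    have "(\<integral>x. f x * pd 1 0 \<phi> x \<partial>lborel) = - (\<integral>x. dq (1,0) f x * \<phi> x \<partial>lborel)"
      by (rule good_integration_by_parts[OF assms(1) test_fun_pd(1,2,4)[OF t] test_fun_pd(6,7)[OF t], where R=R])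
         (use R in blast)+
    then show "(LINT x:\<Omega>|lborel. f x * pd 1 0 \<phi> x) = (-1) ^ (1 + 0) * (LINT x:\<Omega>|lborel. dq (1,0) f x * \<phi> x)"
      using set_integral_restrict[of \<Omega> "\<lambda>x. f x * pd 1 0 \<phi> x"] set_integral_restrict[of \<Omega> "\<lambda>x. dq (1,0) f x * \<phi> x"]
        test_fun_pd(6,7)[OF t sub[OF t]] by simp
  qed
  show "weak_deriv \<Omega> f 0 1 (dq (0,1) f)"
    unfolding weak_deriv_def
  proof (intro conjI allI impI lf ld assms)
    fix \<phi> assume t: "test_fun \<Omega> \<phi>"
    obtain R where R: "R \<ge> 0" "closure {x. \<phi> x \<noteq> 0} \<subseteq> cball 0 R" using R[OF t] by blast
    have "(\<integral>x. f x * pd 0 1 \<phi> x \<partial>lborel) = - (\<integral>x. dq (0,1) f x * \<phi> x \<partial>lborel)"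
      by (rule good_integration_by_parts[OF assms(2) test_fun_pd(1,3,5)[OF t] test_fun_pd(6,8)[OF t], where R=R])
         (use R in blast)+
    then show "(LINT x:\<Omega>|lborel. f x * pd 0 1 \<phi> x) = (-1) ^ (0 + 1) * (LINT x:\<Omega>|lborel. dq (0,1) f x * \<phi> x)"
      using set_integral_restrict[of \<Omega> "\<lambda>x. f x * pd 0 1 \<phi> x"] set_integral_restrict[of \<Omega> "\<lambda>x. dq (0,1) f x * \<phi> x"]
        test_fun_pd(6,8)[OF t sub[OF t]] by simp
  qed
qed

lemma loc_integrable_times_test:
  assumes "loc_integrable \<Omega> v" "test_fun \<Omega> \<phi>" "continuous_on UNIV \<psi>" 
    and "\<And>x. x \<notin> closure {x. \<phi> x \<noteq> 0} \<Longrightarrow> \<psi> x = 0"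
  shows "set_integrable lborel \<Omega> (\<lambda>x. v x * \<psi> x)"
proof -
  let ?K = "closure {x. \<phi> x \<noteq> 0}"
  have K: "compact ?K" "?K \<subseteq> \<Omega>" using assms(2) unfolding test_fun_def by auto
  have i: "integrable lborel (\<lambda>x. indicat_real ?K x *\<^sub>R v x)"
    using assms(1) K unfolding loc_integrable_def set_integrable_def by blast
  have [measurable]: "\<psi> \<in> borel_measurable borel" using assms(3) by (rule borel_measurable_continuous_onI)
  obtain B where B: "\<And>x. x \<in> ?K \<Longrightarrow> \<bar>\<psi> x\<bar> \<le> B"
    using compact_imp_bounded[OF compact_continuous_image[OF continuous_on_subset[OF assms(3)] K(1)]]
    unfolding bounded_iff by auto
  have "integrable lborel (\<lambda>x. (indicat_real ?K x *\<^sub>R v x) * \<psi> x)"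
  proof (rule Bochner_Integration.integrable_bound[OF integrable_mult_right[OF i, of "\<bar>B\<bar>"]])
    show "(\<lambda>x. (indicat_real ?K x *\<^sub>R v x) * \<psi> x) \<in> borel_measurable lborel"
      using borel_measurable_integrable[OF i] by measurable
    have "norm (indicat_real ?K x *\<^sub>R v x * \<psi> x) \<le> norm (\<bar>B\<bar> * (indicat_real ?K x *\<^sub>R v x))" for x
    proof (cases "x \<in> ?K")
      case True
      have "\<bar>v x\<bar> * \<bar>\<psi> x\<bar> \<le> \<bar>v x\<bar> * \<bar>B\<bar>" using B[OF True] by (intro mult_left_mono) auto
      then show ?thesis using True by (simp add: abs_mult mult.commute)
    qed simp
    then show "AE x in lborel. norm (indicat_real ?K x *\<^sub>R v x * \<psi> x) \<le> norm (\<bar>B\<bar> * (indicat_real ?K x *\<^sub>R v x))"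
      by simp
  qed
  moreover have "(\<lambda>x. (indicat_real ?K x *\<^sub>R v x) * \<psi> x) = (\<lambda>x. indicat_real \<Omega> x *\<^sub>R (v x * \<psi> x))"
    using K(2) assms(4) by (auto simp: fun_eq_iff indicator_def)
  ultimately show ?thesis unfolding set_integrable_def by simp
qed

lemma loc_integrable_diff:
  assumes "loc_integrable \<Omega> v" "loc_integrable \<Omega> v'" shows "loc_integrable \<Omega> (\<lambda>x. v x - v' x)"
  unfolding loc_integrable_def
proof (intro allI impI)
  fix K assume "compact K \<and> K \<subseteq> \<Omega>"
  then show "set_integrable lborel K (\<lambda>x. v x - v' x)"
    using assms unfolding loc_integrable_def by (intro set_integral_diff(1)) simp_all
qed

lemma weak_deriv_diff:
  assumes "weak_deriv \<Omega> v a b g" "weak_deriv \<Omega> v' a b g'" "(a,b) = (1,0) \<or> (a,b) = (0,1)"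
  shows "weak_deriv \<Omega> (\<lambda>x. v x - v' x) a b (\<lambda>x. g x - g' x)"
  unfolding weak_deriv_def
proof (intro conjI allI impI)
  have l: "loc_integrable \<Omega> v" "loc_integrable \<Omega> v'" "loc_integrable \<Omega> g" "loc_integrable \<Omega> g'"
    using assms(1,2) unfolding weak_deriv_def by simp_all
  show "loc_integrable \<Omega> (\<lambda>x. v x - v' x)" using l(1,2) by (rule loc_integrable_diff)
  show "loc_integrable \<Omega> (\<lambda>x. g x - g' x)" using l(3,4) by (rule loc_integrable_diff)
  fix \<phi> assume t: "test_fun \<Omega> \<phi>"
  have "continuous_on UNIV (pd a b \<phi>)" and "\<And>x. x \<notin> closure {x. \<phi> x \<noteq> 0} \<Longrightarrow> pd a b \<phi> x = 0"
    using test_fun_pd(2,3)[OF t] test_fun_pd(7,8)[OF t] assms(3) by (metis Pair_inject)+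
  note i = loc_integrable_times_test[OF _ t this] loc_integrable_times_test[OF _ t test_fun_pd(1,6)[OF t]]
  have "(LINT x:\<Omega>|lborel. v x * pd a b \<phi> x) = (-1) ^ (a + b) * (LINT x:\<Omega>|lborel. g x * \<phi> x)"
    "(LINT x:\<Omega>|lborel. v' x * pd a b \<phi> x) = (-1) ^ (a + b) * (LINT x:\<Omega>|lborel. g' x * \<phi> x)"
    using assms(1,2) t unfolding weak_deriv_def by simp_all
  then show "(LINT x:\<Omega>|lborel. (v x - v' x) * pd a b \<phi> x) = (-1) ^ (a + b) * (LINT x:\<Omega>|lborel. (g x - g' x) * \<phi> x)"
    unfolding left_diff_distrib
    by (simp add: set_integral_diff i l right_diff_distrib)
qed

section \<open>A weak Taylor formula\<close>

text \<open>Pascal's rule as a summation identity: it is the induction step both of the Leibniz rule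
  and of the binomial formula for directional derivatives.\<close>

lemma pascal_sum:
  fixes A :: "nat \<Rightarrow> nat \<Rightarrow> real"
  shows "(\<Sum>k\<le>n. (n choose k) * (A (Suc k) (n - k) + A k (Suc (n - k)))) = (\<Sum>k\<le>Suc n. (Suc n choose k) * A k (Suc n - k))"
proof -
  have 1: "(\<Sum>k\<le>n. (n choose k) * A k (Suc (n - k))) = A 0 (Suc n) + (\<Sum>k<n. (n choose Suc k) * A (Suc k) (n - k))"
    by (subst sum.atMost_shift) (auto intro!: sum.cong simp: Suc_diff_Suc)
  have 2: "(\<Sum>k\<le>n. (n choose Suc k) * A (Suc k) (n - k)) = (\<Sum>k<n. (n choose Suc k) * A (Suc k) (n - k))"
    by (rule sum.mono_neutral_right) (auto simp: not_less)
  have "(\<Sum>k\<le>Suc n. (Suc n choose k) * A k (Suc n - k)) = A 0 (Suc n) + (\<Sum>k\<le>n. (Suc n choose Suc k) * A (Suc k) (n - k))"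
    by (subst sum.atMost_Suc_shift) simp
  also have "\<dots> = A 0 (Suc n) + (\<Sum>k\<le>n. (n choose k) * A (Suc k) (n - k)) + (\<Sum>k\<le>n. (n choose Suc k) * A (Suc k) (n - k))"
    by (simp add: distrib_right sum.distrib)
  finally show ?thesis using 1 2 by (simp add: distrib_left sum.distrib)
qed

section \<open>Smooth compactly supported functions built from exp (- 1 / t)\<close>

definition expinv :: "real poly \<Rightarrow> real \<Rightarrow> real" where
  "expinv P t = (if t \<le> 0 then 0 else poly P (1 / t) * exp (- (1 / t)))"

lemma poly_exp_lim: "((\<lambda>u. u ^ k * poly P u * exp (- u)) \<longlongrightarrow> (0::real)) at_top"
proof (induction P arbitrary: k)
  case 0 show ?case by simp
next
  case (pCons a P)
  have "((\<lambda>u. a * (u ^ k / exp u) + u ^ Suc k * poly P u * exp (- u)) \<longlongrightarrow> a * 0 + (0::real)) at_top"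
    by (intro tendsto_intros pCons.IH tendsto_power_div_exp_0)
  then show ?case by (simp add: algebra_simps exp_minus inverse_eq_divide)
qed

text \<open>The functions P (1/t) exp (- 1/t) are closed under differentiation, P becoming X^2 (P -
  P'). Carrying the polynomial along yields derivatives of all orders, with the critical point 0
  treated once and for all.\<close>

lemma expinv_deriv:
  "(expinv P has_real_derivative expinv (monom 1 2 * (P - pderiv P)) t) (at t)"
proof -
  consider "t < 0" | "t > 0" | "t = 0" by linarith
  then show ?thesis
  proof cases
    case 1
    have "(expinv P has_real_derivative 0) (at t) \<longleftrightarrow> ((\<lambda>x. 0::real) has_real_derivative 0) (at t)"
      using 1 eventually_nhds_in_open[of "{..<0}" t]
      by (intro DERIV_cong_ev) (auto elim!: eventually_mono simp: expinv_def)
    then show ?thesis using 1 by (simp add: expinv_def)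
  next
    case 2
    have "((\<lambda>t. poly P (1 / t) * exp (- (1 / t))) has_real_derivative
        poly (monom 1 2 * (P - pderiv P)) (1 / t) * exp (- (1 / t))) (at t)"
      using 2 by (auto intro!: derivative_eq_intros simp: poly_monom field_simps power2_eq_square)
    moreover have "(expinv P has_real_derivative poly (monom 1 2 * (P - pderiv P)) (1 / t) * exp (- (1 / t))) (at t)
       \<longleftrightarrow> ((\<lambda>t. poly P (1 / t) * exp (- (1 / t))) has_real_derivative
        poly (monom 1 2 * (P - pderiv P)) (1 / t) * exp (- (1 / t))) (at t)"
      using 2 eventually_nhds_in_open[of "{0<..}" t]
      by (intro DERIV_cong_ev) (auto elim!: eventually_mono simp: expinv_def)
    ultimately show ?thesis using 2 by (simp add: expinv_def)
  next
    case 3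
    \<comment> \<open>With u = 1/h the right-hand quotient is u P(u) exp (- u), which tends to 0 for
      every polynomial P.\<close>
    have r: "((\<lambda>h. expinv P h / h) \<longlongrightarrow> 0) (at_right 0)"
    proof (rule Lim_transform_eventually)
      show "((\<lambda>h. inverse h ^ 1 * poly P (inverse h) * exp (- inverse h)) \<longlongrightarrow> (0::real)) (at_right 0)"
        using poly_exp_lim filterlim_inverse_at_top_right by (rule filterlim_compose)
      show "\<forall>\<^sub>F h in at_right 0. inverse h ^ 1 * poly P (inverse h) * exp (- inverse h) = expinv P h / h"
        by (auto simp: eventually_at_right_field expinv_def inverse_eq_divide intro!: exI[of _ 1])
    qed
    have l: "((\<lambda>h. expinv P h / h) \<longlongrightarrow> 0) (at_left 0)"
      by (rule Lim_transform_eventually[OF tendsto_const])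
         (auto simp: eventually_at_left_field expinv_def intro!: exI[of _ "-1"])
    have "((\<lambda>h. expinv P h / h) \<longlongrightarrow> 0) (at 0)" using l r by (simp add: filterlim_at_split)
    then show ?thesis using 3 by (simp add: DERIV_def expinv_def[of _ 0])
  qed
qed

text \<open>Successive derivatives are given as an explicit sequence; with iterated
  \<open>deriv\<close> every order would call for its own differentiability proof.\<close>

definition dseq :: "(nat \<Rightarrow> real \<Rightarrow> real) \<Rightarrow> bool" where
  "dseq F \<longleftrightarrow> (\<forall>n t. (F n has_real_derivative F (Suc n) t) (at t))"

lemma dseq_expinv: "\<exists>F. dseq F \<and> F 0 = expinv P"
  by (rule exI[of _ "\<lambda>n. expinv (((\<lambda>P. monom 1 2 * (P - pderiv P)) ^^ n) P)"])
     (use expinv_deriv in \<open>auto simp: dseq_def\<close>)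

lemma dseq_affine:
  assumes "dseq F" shows "dseq (\<lambda>n t. c ^ n * F n (c * t + d))"
  unfolding dseq_def
proof (intro allI)
  fix n t
  have "((\<lambda>t. F n (c * t + d)) has_real_derivative F (Suc n) (c * t + d) * c) (at t)"
    by (rule DERIV_chain'[where g="F n" and f="\<lambda>t. c * t + d"])
       (use assms in \<open>auto simp: dseq_def intro!: derivative_eq_intros\<close>)
  then show "((\<lambda>t. c ^ n * F n (c * t + d)) has_real_derivative c ^ Suc n * F (Suc n) (c * t + d)) (at t)"
    by (auto intro!: derivative_eq_intros)
qed

lemma dseq_mult:
  fixes F G :: "nat \<Rightarrow> real \<Rightarrow> real"
  assumes "dseq F" "dseq G"
  shows "dseq (\<lambda>n t. \<Sum>k\<le>n. (n choose k) * (F k t * G (n - k) t))"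
  unfolding dseq_def
proof (intro allI)
  fix n t
  have "((\<lambda>t. \<Sum>k\<le>n. (n choose k) * (F k t * G (n - k) t)) has_real_derivative
     (\<Sum>k\<le>n. (n choose k) * (F (Suc k) t * G (n - k) t + F k t * G (Suc (n - k)) t))) (at t)"
    using assms unfolding dseq_def
    by (intro DERIV_sum) (auto intro!: derivative_eq_intros simp: algebra_simps)
  then show "((\<lambda>t. \<Sum>k\<le>n. (n choose k) * (F k t * G (n - k) t)) has_real_derivative
     (\<Sum>k\<le>Suc n. (Suc n choose k) * (F k t * G (Suc n - k) t))) (at t)"
    unfolding pascal_sum[of n "\<lambda>i j. F i t * G j t"] .
qed

text \<open>As N grows, exp (- 1 / (N s)) tends to 1 for s > 0, so these functions tend to the
  indicator of the interval while staying bounded by 1. They carry statements about test functions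
  over to indicators of boxes.\<close>

definition bump :: "real \<Rightarrow> real \<Rightarrow> nat \<Rightarrow> real \<Rightarrow> real" where
  "bump a b N t = expinv 1 (real N * (t - a)) * expinv 1 (real N * (b - t))"

lemma dseq_bump: "\<exists>F. dseq F \<and> F 0 = bump a b N"
proof -
  obtain F where F: "dseq F" "F 0 = expinv 1" using dseq_expinv by blast
  have 1: "dseq (\<lambda>n t. real N ^ n * F n (real N * t + (- real N * a)))" by (rule dseq_affine[OF F(1)])
  have 2: "dseq (\<lambda>n t. (- real N) ^ n * F n ((- real N) * t + real N * b))" by (rule dseq_affine[OF F(1)])
  show ?thesis
    by (rule exI, rule conjI[OF dseq_mult[OF 1 2]]) (auto simp: fun_eq_iff bump_def F(2) algebra_simps)
qed

lemma bump_bounds: "0 \<le> bump a b N t" "bump a b N t \<le> 1" "t \<notin> {a<..<b} \<Longrightarrow> bump a b N t = 0"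
proof -
  have e: "0 \<le> expinv 1 s" "expinv 1 s \<le> 1" for s by (auto simp: expinv_def)
  then show "0 \<le> bump a b N t" "bump a b N t \<le> 1" unfolding bump_def by (auto intro: mult_le_one)
  assume "t \<notin> {a<..<b}"
  then have "real N * (t - a) \<le> 0 \<or> real N * (b - t) \<le> 0" by (auto simp: mult_le_0_iff)
  then show "bump a b N t = 0" unfolding bump_def by (auto simp: expinv_def)
qed

lemma bump_lim: "(\<lambda>N. bump a b N t) \<longlonglongrightarrow> indicator {a<..<b} t"
proof (cases "t \<in> {a<..<b}")
  case True
  have e: "(\<lambda>N. expinv 1 (real N * s)) \<longlonglongrightarrow> 1" if "s > 0" for s
  proof -
    have "(\<lambda>N. exp (- (1 / (real N * s)))) \<longlonglongrightarrow> exp (- 0)"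
    proof (intro tendsto_intros)
      have "filterlim (\<lambda>N. real N * s) at_top sequentially"
        using filterlim_tendsto_pos_mult_at_top[OF tendsto_const that filterlim_real_sequentially]
        by (simp add: mult.commute)
      then show "(\<lambda>N. 1 / (real N * s)) \<longlonglongrightarrow> 0"
        by (intro tendsto_divide_0[OF tendsto_const] filterlim_at_top_imp_at_infinity)
    qed
    moreover have "\<forall>\<^sub>F N in sequentially. exp (- (1 / (real N * s))) = expinv 1 (real N * s)"
      using eventually_gt_at_top[of 0]
      by eventually_elim (use that in \<open>auto simp: expinv_def mult_le_0_iff\<close>)
    ultimately show ?thesis by (simp add: Lim_transform_eventually)
  qed
  show ?thesis using tendsto_mult[OF e[of "t - a"] e[of "b - t"]] True by (simp add: bump_def)
qed (simp add: bump_bounds(3))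

section \<open>Directional derivatives and the classical Taylor formula\<close>

definition dirW :: "(nat \<Rightarrow> nat \<Rightarrow> real \<times> real \<Rightarrow> real) \<Rightarrow> nat \<Rightarrow> real \<times> real \<Rightarrow> real \<times> real \<Rightarrow> real" where
  "dirW V k h z = (\<Sum>i\<le>k. real (k choose i) * (fst h ^ i * snd h ^ (k - i) * V i (k - i) z))"

definition dfam :: "(nat \<Rightarrow> nat \<Rightarrow> real \<times> real \<Rightarrow> real) \<Rightarrow> bool" where
  "dfam V \<longleftrightarrow> (\<forall>i j x. (V i j has_derivative (\<lambda>h. fst h * V (Suc i) j x + snd h * V i (Suc j) x)) (at x))"

lemma dfam_continuous: "dfam V \<Longrightarrow> continuous_on S (V i j)"
  unfolding dfam_def by (meson has_derivative_continuous continuous_at_imp_continuous_on)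

text \<open>\<open>dirW V k h\<close> is the k-th derivative in direction h written through mixed
  partials, as in the expansion of (h1 d1 + h2 d2)^k. As V is an arbitrary array, the same
  expression can later be formed with weak derivatives, for which no chain rule is at hand.\<close>

lemma dirW_deriv:
  assumes "dfam V"
  shows "((\<lambda>s. dirW V k h (y + s *\<^sub>R h)) has_real_derivative dirW V (Suc k) h (y + s *\<^sub>R h)) (at s)"
proof -
  have V: "((\<lambda>s. V i j (y + s *\<^sub>R h)) has_real_derivative
      fst h * V (Suc i) j (y + s *\<^sub>R h) + snd h * V i (Suc j) (y + s *\<^sub>R h)) (at s)" for i j
  proof -
    have "((\<lambda>s. y + s *\<^sub>R h) has_derivative (\<lambda>s. s *\<^sub>R h)) (at s)" by (auto intro!: derivative_eq_intros)
    from has_derivative_compose[OF this, of "V i j"] assms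
    have "((\<lambda>s. V i j (y + s *\<^sub>R h)) has_derivative (\<lambda>t. fst (t *\<^sub>R h) * V (Suc i) j (y + s *\<^sub>R h) + snd (t *\<^sub>R h) * V i (Suc j) (y + s *\<^sub>R h))) (at s)"
      unfolding dfam_def by blast
    then show ?thesis unfolding has_field_derivative_def
      by (rule has_derivative_eq_rhs) (auto simp: fun_eq_iff algebra_simps)
  qed
  have "((\<lambda>s. dirW V k h (y + s *\<^sub>R h)) has_real_derivative
     (\<Sum>i\<le>k. real (k choose i) * (fst h ^ Suc i * snd h ^ (k - i) * V (Suc i) (k - i) (y + s *\<^sub>R h)
        + fst h ^ i * snd h ^ Suc (k - i) * V i (Suc (k - i)) (y + s *\<^sub>R h)))) (at s)"
    unfolding dirW_def
    by (intro DERIV_sum) (auto intro!: derivative_eq_intros V simp: algebra_simps)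
  then show ?thesis
    unfolding dirW_def pascal_sum[of k "\<lambda>i j. fst h ^ i * snd h ^ j * V i j (y + s *\<^sub>R h)"] .
qed

lemma dirW_continuous: "dfam V \<Longrightarrow> continuous_on S (dirW V k h)"
  unfolding dirW_def by (intro continuous_intros dfam_continuous)

lemma taylor_segment:
  assumes "dfam V" "n > 0"
  shows "V 0 0 (y + h) = (\<Sum>k<n. dirW V k h y / fact k)
     + (LINT s:{0..1}|lborel. (1 - s) ^ (n - 1) / fact (n - 1) * dirW V n h (y + s *\<^sub>R h))"
proof -
  have "V 0 0 (y + 1 *\<^sub>R h) = (\<Sum>i<n. ((1 - 0) ^ i / fact i) *\<^sub>R dirW V i h (y + 0 *\<^sub>R h))
     + integral {0..1} (\<lambda>s. ((1 - s) ^ (n - 1) / fact (n - 1)) *\<^sub>R dirW V n h (y + s *\<^sub>R h))"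
  proof (rule Taylor_integral[where f="\<lambda>s. V 0 0 (y + s *\<^sub>R h)" and Df="\<lambda>m s. dirW V m h (y + s *\<^sub>R h)" and p=n])
    show "(\<lambda>s. dirW V 0 h (y + s *\<^sub>R h)) = (\<lambda>s. V 0 0 (y + s *\<^sub>R h))" by (simp add: dirW_def)
    show "((\<lambda>s. dirW V m h (y + s *\<^sub>R h)) has_vector_derivative dirW V (Suc m) h (y + t *\<^sub>R h)) (at t within {0..1})" for m t
      using dirW_deriv[OF assms(1), of m h y t]
      by (metis has_field_derivative_at_within has_real_derivative_iff_has_vector_derivative)
  qed (use assms in auto)
  moreover have "set_integrable lborel {0..1} (\<lambda>s. (1 - s) ^ (n - 1) / fact (n - 1) * dirW V n h (y + s *\<^sub>R h))"
    by (intro borel_integrable_atLeastAtMost' continuous_intros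
        continuous_on_compose2[OF dirW_continuous[OF assms(1), of UNIV]]) auto
  then have "(LINT s:{0..1}|lborel. (1 - s) ^ (n - 1) / fact (n - 1) * dirW V n h (y + s *\<^sub>R h))
      = integral {0..1} (\<lambda>s. (1 - s) ^ (n - 1) / fact (n - 1) * dirW V n h (y + s *\<^sub>R h))"
    by (rule set_borel_integral_eq_integral)
  ultimately show ?thesis by simp
qed

lemma dirW_minus: "dirW V k (- h) z = (-1) ^ k * dirW V k h z"
proof -
  have "(- a) ^ i * (- b) ^ (k - i) = (-1) ^ k * (a ^ i * b ^ (k - i))" if "i \<le> k" for i and a b :: real
  proof -
    have "(- a) ^ i * (- b) ^ (k - i) = ((-1) ^ i * (-1) ^ (k - i)) * (a ^ i * b ^ (k - i))"
      by (simp add: power_minus[of a] power_minus[of b])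
    also have "(-1) ^ i * (-1::real) ^ (k - i) = (-1) ^ k" using that by (simp flip: power_add)
    finally show ?thesis .
  qed
  then show ?thesis unfolding dirW_def sum_distrib_left by (intro sum.cong) (auto simp: mult_ac)
qed

text \<open>Products of functions of one variable are sufficient as test functions, because only
  indicators of boxes have to be approximated.\<close>

definition tensor :: "(nat \<Rightarrow> real \<Rightarrow> real) \<Rightarrow> (nat \<Rightarrow> real \<Rightarrow> real) \<Rightarrow> nat \<Rightarrow> nat \<Rightarrow> real \<times> real \<Rightarrow> real" where
  "tensor F G i j x = F i (fst x) * G j (snd x)"

lemma dfam_tensor:
  assumes "dseq F" "dseq G" shows "dfam (tensor F G)"
  unfolding dfam_def
proof (intro allI)
  fix i j and x :: "real \<times> real"
  have 1: "((\<lambda>x. F i (fst x)) has_derivative (\<lambda>h. fst h * F (Suc i) (fst x))) (at x)"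
    using has_derivative_compose[of fst fst x UNIV "F i" "(*) (F (Suc i) (fst x))"] assms(1)
    unfolding dseq_def has_field_derivative_def by (simp add: has_derivative_fst mult.commute)
  have 2: "((\<lambda>x. G j (snd x)) has_derivative (\<lambda>h. snd h * G (Suc j) (snd x))) (at x)"
    using has_derivative_compose[of snd snd x UNIV "G j" "(*) (G (Suc j) (snd x))"] assms(2)
    unfolding dseq_def has_field_derivative_def by (simp add: has_derivative_snd mult.commute)
  show "(tensor F G i j has_derivative (\<lambda>h. fst h * tensor F G (Suc i) j x + snd h * tensor F G i (Suc j) x)) (at x)"
    unfolding tensor_def using has_derivative_mult[OF 1 2]
    by (rule has_derivative_eq_rhs) (auto simp: fun_eq_iff algebra_simps)
qed

lemma pd_tensor:
  assumes "dseq F" "dseq G" shows "pd i j (tensor F G 0 0) = tensor F G i j"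
proof -
  have c1: "deriv (\<lambda>t. F i t * c) a = F (Suc i) a * c" for i c a
    using assms unfolding dseq_def by (intro DERIV_imp_deriv) (auto intro!: derivative_eq_intros)
  have c2: "deriv (\<lambda>t. c * G j t) a = c * G (Suc j) a" for j c a
    using assms unfolding dseq_def by (intro DERIV_imp_deriv) (auto intro!: derivative_eq_intros)
  have "pd 0 j (tensor F G 0 0) = tensor F G 0 j" for j
    by (induction j) (auto simp: tensor_def fun_eq_iff c2)
  then show ?thesis
    by (induction i) (auto simp: tensor_def fun_eq_iff c1)
qed

lemma test_fun_tensor:
  assumes "dseq F" "dseq G" "compact K" "K \<subseteq> \<Omega>" "\<And>x. x \<notin> K \<Longrightarrow> tensor F G 0 0 x = 0"
  shows "test_fun \<Omega> (tensor F G 0 0)"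
proof -
  have "closure {x. tensor F G 0 0 x \<noteq> 0} \<subseteq> K"
    using assms(3,5) by (intro closure_minimal compact_imp_closed) blast+
  then have "compact (closure {x. tensor F G 0 0 x \<noteq> 0})"
    using assms(3) by (metis closed_closure compact_Int_closed inf.absorb2)
  moreover have "tensor F G a b differentiable at p" for a b p
    using dfam_tensor[OF assms(1,2)] unfolding dfam_def differentiable_def by blast
  ultimately show ?thesis
    unfolding test_fun_def pd_tensor[OF assms(1,2)]
    using \<open>closure {x. tensor F G 0 0 x \<noteq> 0} \<subseteq> K\<close> assms(4) by blast
qed

text \<open>Boxes generate the Borel sets and are stable under intersection, so vanishing integrals
  extend to all Borel sets by a Dynkin argument. The plane itself is no box; that g lives on one box
  supplies the integral over the plane, which the complement step needs.\<close>

lemma AE_zero_on_boxes: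
  fixes g :: "real \<times> real \<Rightarrow> real"
  assumes g: "integrable lborel g" and l: "\<And>x. x \<notin> box l r \<Longrightarrow> g x = 0"
    and b: "\<And>a b. (LINT x:box a b|lborel. g x) = 0"
  shows "AE x in lborel. g x = 0"
proof (rule sigma_finite_measure.density_zero[OF lborel.sigma_finite_measure_axioms g])
  fix A :: "(real \<times> real) set" assume A: "A \<in> sets lborel"
  have si: "set_integrable lborel S g" if "S \<in> sets borel" for S
    unfolding set_integrable_def using integrable_mult_indicator[of S lborel g] g that by simp
  have U: "(LINT x:UNIV|lborel. g x) = 0"
  proof -
    have "(LINT x:UNIV|lborel. g x) = (LINT x:box l r|lborel. g x)"
      unfolding set_lebesgue_integral_def
      by (rule Bochner_Integration.integral_cong) (simp, metis indicator_simps(2) indicator_UNIV indicator_simps(1) l scaleR_zero_left scaleR_zero_right)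
    then show ?thesis using b by simp
  qed
  let ?G = "range (\<lambda>(a, b). box a b) :: (real \<times> real) set set"
  have Ae: "A \<in> sigma_sets UNIV ?G"
    using A by (simp add: borel_eq_box)
  have st: "Int_stable ?G"
  proof (rule Int_stableI)
    fix X Y assume "X \<in> ?G" "Y \<in> ?G"
    then obtain a b c d where "X = box a b" "Y = box c d" by auto
    moreover obtain p q where "box a b \<inter> box c d = box p q" by (rule that[OF box_Int_box])
    ultimately have "X \<inter> Y = (\<lambda>(a, b). box a b) (p, q)" by simp
    then show "X \<inter> Y \<in> ?G" by (rule range_eqI)
  qed
  have bs: "S \<in> sets borel" if "S \<in> sigma_sets UNIV ?G" for S
    using that by (simp add: borel_eq_box)
  have G: "?G \<subseteq> Pow UNIV" by simp
  from st G Ae show "(LINT x:A|lborel. g x) = 0"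
  proof (induct rule: sigma_sets_induct_disjoint)
    case (basic A) then show ?case using b by auto
  next
    case empty show ?case by (simp add: set_lebesgue_integral_def)
  next
    case (compl A)
    have "(LINT x:UNIV|lborel. g x) = (LINT x:A|lborel. g x) + (LINT x:(UNIV - A)|lborel. g x)"
      using set_integral_Un[of A "UNIV - A" lborel g] si bs[OF compl(1)] by (simp add: Un_Diff_cancel)
    then show ?case using U compl(2) by simp
  next
    case (union A)
    have "range A \<subseteq> sets borel" using union(2) bs by blast
    moreover have "(LINT x:(\<Union>(range A))|lborel. g x) = (\<Sum>i. LINT x:(A i)|lborel. g x)"
    proof (rule lebesgue_integral_countable_add)
      show "set_integrable lborel (\<Union> (range A)) g" using \<open>range A \<subseteq> sets borel\<close> by (intro si) blast
      show "A i \<in> sets lborel" for i using \<open>range A \<subseteq> sets borel\<close> by auto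
      show "i \<noteq> j \<Longrightarrow> A i \<inter> A j = {}" for i j using union(1) by (simp add: disjoint_family_on_def)
    qed
    ultimately show ?case using union(3) by simp
  qed
qed

text \<open>The bound B on the L1 norms, uniform in s, makes the function integrable on the product
  of the unit interval with the plane; both claims are then Fubini's theorem.\<close>

lemma fubini_unit:
  fixes G :: "real \<Rightarrow> real \<times> real \<Rightarrow> real"
  assumes m: "(\<lambda>(s, x). G s x) \<in> borel_measurable (borel \<Otimes>\<^sub>M borel)"
    and i: "\<And>s. s \<in> {0..1} \<Longrightarrow> integrable lborel (G s)"
    and b: "\<And>s. s \<in> {0..1} \<Longrightarrow> (\<integral>x. \<bar>G s x\<bar> \<partial>lborel) \<le> B"
  shows "integrable lborel (\<lambda>x. LINT s:{0..1}|lborel. G s x)"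
    "(\<integral>x. (LINT s:{0..1}|lborel. G s x) \<partial>lborel) = (LINT s:{0..1}|lborel. (\<integral>x. G s x \<partial>lborel))"
proof -
  define H where "H s x = indicator {0..1} s * G s x" for s x
  have [measurable]: "(\<lambda>(s, x). G s x) \<in> borel_measurable (lborel \<Otimes>\<^sub>M lborel)"
    using m by (simp cong: measurable_cong_sets add: sets_pair_measure_cong[OF sets_lborel sets_lborel])
  have Hm: "(\<lambda>(s, x). H s x) \<in> borel_measurable (lborel \<Otimes>\<^sub>M lborel)"
    unfolding H_def by (simp add: case_prod_beta) measurable
  have Hi: "integrable lborel (H s)" for s
    using i[of s] unfolding H_def by (cases "s \<in> {0..1}") auto
  have "integrable (lborel \<Otimes>\<^sub>M lborel) (\<lambda>(s, x). H s x)"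
  proof (rule lborel_pair.Fubini_integrable[OF Hm])
    show "AE s in lborel. integrable lborel (\<lambda>x. case (s, x) of (s, x) \<Rightarrow> H s x)" using Hi by simp
    have mm: "(\<lambda>s. \<integral>x. norm (H s x) \<partial>lborel) \<in> borel_measurable lborel"
      using Hm by measurable
    have "integrable lborel (\<lambda>s. \<integral>x. norm (H s x) \<partial>lborel)"
    proof (rule integrableI_bounded_set[where A="{0..1}" and B="B"])
      show "AE s in lborel. s \<in> {0..1} \<longrightarrow> norm (\<integral>x. norm (H s x) \<partial>lborel) \<le> B"
        using b by (intro always_eventually) (auto simp: H_def)
      show "AE s in lborel. s \<notin> {0..1} \<longrightarrow> (\<integral>x. norm (H s x) \<partial>lborel) = 0"
        by (intro always_eventually) (auto simp: H_def)
    qed (use mm in auto)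
    then show "integrable lborel (\<lambda>s. \<integral>x. norm (case (s, x) of (s, x) \<Rightarrow> H s x) \<partial>lborel)" by simp
  qed
  note P = this
  have e: "(LINT s:{0..1}|lborel. G s x) = (\<integral>s. H s x \<partial>lborel)" for x
    unfolding set_lebesgue_integral_def H_def by simp
  show "integrable lborel (\<lambda>x. LINT s:{0..1}|lborel. G s x)"
    unfolding e using lborel_pair.integrable_snd[OF P] .
  have "(\<integral>x. (\<integral>s. H s x \<partial>lborel) \<partial>lborel) = (\<integral>s. (\<integral>x. H s x \<partial>lborel) \<partial>lborel)"
    using lborel_pair.Fubini_integral[OF P] .
  also have "\<dots> = (LINT s:{0..1}|lborel. (\<integral>x. G s x \<partial>lborel))"
    unfolding set_lebesgue_integral_def H_def by simp
  finally show "(\<integral>x. (LINT s:{0..1}|lborel. G s x) \<partial>lborel) = (LINT s:{0..1}|lborel. (\<integral>x. G s x \<partial>lborel))"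
    unfolding e .
qed

section \<open>The Taylor formula for weak derivatives\<close>

lemma dseq_shift: "dseq F \<Longrightarrow> dseq (\<lambda>n t. F n (t + d))"
  using dseq_affine[of F 1 d] by simp

lemma dseq_zero_open:
  assumes "dseq F" "open S" "\<And>t. t \<in> S \<Longrightarrow> F 0 t = 0" "t \<in> S" shows "F n t = 0"
  using assms(4)
proof (induction n arbitrary: t)
  case 0 then show ?case using assms(3) by simp
next
  case (Suc n)
  have "(F n has_real_derivative F (Suc n) t) (at t)" using assms(1) unfolding dseq_def by blast
  moreover have "((\<lambda>_. 0::real) has_real_derivative 0) (at t)" by simp
  then have "(F n has_real_derivative 0) (at t)"
    by (rule has_field_derivative_transform_within_open[OF _ assms(2) Suc.prems]) (use Suc.IH in simp)
  ultimately show ?case by (rule DERIV_unique)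
qed

lemma cbox_pair_iff: "x \<in> cbox l r \<longleftrightarrow> fst l \<le> fst x \<and> fst x \<le> fst r \<and> snd l \<le> snd x \<and> snd x \<le> (snd r::real)"
  for x l r :: "real \<times> real"
  by (cases x; cases l; cases r) (auto simp: cbox_Pair_eq)

lemma box_pair_iff: "x \<in> box l r \<longleftrightarrow> fst l < fst x \<and> fst x < fst r \<and> snd l < snd x \<and> snd x < (snd r::real)"
  for x l r :: "real \<times> real"
  by (cases x; cases l; cases r) (auto simp: box_def Basis_prod_def inner_Pair_0)

lemma integrable_times_bounded:
  fixes f g :: "'a::euclidean_space \<Rightarrow> real"
  assumes "integrable lborel f" "g \<in> borel_measurable borel" "\<And>x. \<bar>g x\<bar> \<le> B"
  shows "integrable lborel (\<lambda>x. g x * f x)" "(\<integral>x. \<bar>g x * f x\<bar> \<partial>lborel) \<le> B * (\<integral>x. \<bar>f x\<bar> \<partial>lborel)"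
proof -
  have fm: "f \<in> borel_measurable borel" using borel_measurable_integrable[OF assms(1)] by simp
  have le: "\<bar>g x * f x\<bar> \<le> B * \<bar>f x\<bar>" for x
    unfolding abs_mult using assms(3) by (intro mult_right_mono) auto
  have B0: "0 \<le> B" using order_trans[OF abs_ge_zero assms(3)] .
  have i: "integrable lborel (\<lambda>x. B * \<bar>f x\<bar>)" using assms(1) by simp
  show 1: "integrable lborel (\<lambda>x. g x * f x)"
    using fm assms(2) le B0
    by (intro Bochner_Integration.integrable_bound[OF i]) (auto simp: abs_mult intro!: always_eventually)
  have "(\<integral>x. \<bar>g x * f x\<bar> \<partial>lborel) \<le> (\<integral>x. B * \<bar>f x\<bar> \<partial>lborel)"
    using 1 i le by (intro integral_mono) auto
  then show "(\<integral>x. \<bar>g x * f x\<bar> \<partial>lborel) \<le> B * (\<integral>x. \<bar>f x\<bar> \<partial>lborel)" by simp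
qed

lemma continuous_zero_outside_bounded:
  fixes f :: "'a::euclidean_space \<Rightarrow> real"
  assumes "continuous_on UNIV f" "compact K" "\<And>x. x \<notin> K \<Longrightarrow> f x = 0"
  obtains B where "0 \<le> B" "\<And>x. \<bar>f x\<bar> \<le> B"
proof -
  obtain B where B: "\<And>x. x \<in> K \<Longrightarrow> \<bar>f x\<bar> \<le> B"
    using compact_imp_bounded[OF compact_continuous_image[OF continuous_on_subset[OF assms(1)] assms(2)]]
    unfolding bounded_iff by auto
  show thesis
  proof (rule that[of "max 0 B"])
    show "\<bar>f x\<bar> \<le> max 0 B" for x using B[of x] assms(3)[of x] by (cases "x \<in> K") auto
  qed simp
qed

text \<open>The \<open>E a b\<close> are Borel functions on the whole plane, so that joint
  measurability in several variables is available without restriction to \<Omega>. Integrability is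
  only local, and the weak derivative identity is an integral over the plane because test functions
  vanish off \<Omega>.\<close>

locale weak_family =
  fixes \<Omega> :: "(real \<times> real) set" and E :: "nat \<Rightarrow> nat \<Rightarrow> real \<times> real \<Rightarrow> real"
  assumes op: "open \<Omega>"
    and Em[measurable]: "\<And>a b. E a b \<in> borel_measurable borel"
    and Ei: "\<And>a b K. compact K \<Longrightarrow> K \<subseteq> \<Omega> \<Longrightarrow> integrable lborel (\<lambda>x. indicat_real K x * E a b x)"
    and wd: "\<And>a b \<phi>. test_fun \<Omega> \<phi> \<Longrightarrow>
        (\<integral>x. E 0 0 x * pd a b \<phi> x \<partial>lborel) = (-1) ^ (a + b) * (\<integral>x. E a b x * \<phi> x \<partial>lborel)"
begin

text \<open>Here x is the end point and x - h the centre of the expansion. The offsets i0, j0 select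
  the derivative that is expanded, so the gradient is treated by the same formula as the
  function.\<close>

definition remainder :: "nat \<Rightarrow> nat \<Rightarrow> nat \<Rightarrow> real \<times> real \<Rightarrow> real \<times> real \<Rightarrow> real" where
  "remainder i0 j0 n h x = (LINT s:{0..1}|lborel. (1 - s) ^ (n - 1) / fact (n - 1) *
     dirW (\<lambda>i j. E (i0 + i) (j0 + j)) n h (x - h + s *\<^sub>R h))"

definition taylor :: "nat \<Rightarrow> nat \<Rightarrow> nat \<Rightarrow> real \<times> real \<Rightarrow> real \<times> real \<Rightarrow> real" where
  "taylor i0 j0 n h y = (\<Sum>k<n. dirW (\<lambda>i j. E (i0 + i) (j0 + j)) k h y / fact k)"

text \<open>Duality: after testing with smooth products, every term is translated and all
  derivatives are moved to the test function. What remains is the classical Taylor formula for the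
  test function in direction - h, which holds exactly. As h is fixed throughout, the exceptional
  null set depends on h.\<close>

lemma taylor_AE_box:
  assumes n: "n > 0" and sub: "\<And>x s. x \<in> cbox l r \<Longrightarrow> s \<in> {0..1} \<Longrightarrow> x - s *\<^sub>R h \<in> \<Omega>"
  shows "AE x in lborel. x \<in> box l r \<longrightarrow> E i0 j0 x = taylor i0 j0 n h (x - h) + remainder i0 j0 n h x"
proof -
  \<comment> \<open>The compact set swept by all segments. Multiplying by its indicator makes the
    derivatives integrable over the plane, so that translations can be applied freely.\<close>
  define K where "K = (\<lambda>z. fst z - snd z *\<^sub>R h) ` (cbox l r \<times> {0..1::real})"
  have cK: "compact K" unfolding K_def
    by (intro compact_continuous_image compact_Times compact_cbox) (auto intro!: continuous_intros)
  have KO: "K \<subseteq> \<Omega>" unfolding K_def by (rule image_subsetI) (use sub in \<open>simp add: mem_Times_iff\<close>)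
  have inK: "x - s *\<^sub>R h \<in> K" if "x \<in> cbox l r" "s \<in> {0..1}" for x s
    unfolding K_def using that by (intro image_eqI[of _ _ "(x, s)"]) auto
  have Kb[measurable]: "K \<in> sets borel" using cK by (rule borel_compact)
  define EK where "EK a b x = indicat_real K x * E a b x" for a b x
  have EKm[measurable]: "EK a b \<in> borel_measurable borel" for a b unfolding EK_def by measurable
  have EKi: "integrable lborel (EK a b)" for a b unfolding EK_def by (rule Ei[OF cK KO])
  have EKe: "EK a b (x - s *\<^sub>R h) = E a b (x - s *\<^sub>R h)" if "x \<in> cbox l r" "s \<in> {0..1}" for a b x s
    unfolding EK_def using inK[OF that] by simp
  let ?E = "\<lambda>i j. EK (i0 + i) (j0 + j)"
  have Wm[measurable]: "dirW ?E k h \<in> borel_measurable borel" for k unfolding dirW_def by measurable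
  have Wi: "integrable lborel (dirW ?E k h)" for k
    unfolding dirW_def by (intro Bochner_Integration.integrable_sum integrable_mult_right EKi)
  have Wi': "integrable lborel (\<lambda>x. dirW ?E k h (x + v))" for k v by (rule integrable_lborel_shift[OF Wi])
  define c where "c s = (1 - s) ^ (n - 1) / fact (n - 1)" for s :: real
  have cm[measurable]: "c \<in> borel_measurable borel" unfolding c_def by measurable
  have cb: "\<bar>c s\<bar> \<le> 1" if "s \<in> {0..1}" for s
  proof -
    have "\<bar>(1 - s) ^ (n - 1)\<bar> \<le> 1" using that by (simp add: power_le_one)
    moreover have "(1::real) \<le> fact (n - 1)" by simp
    ultimately have "\<bar>(1 - s) ^ (n - 1)\<bar> \<le> fact (n - 1)" by linarith
    then show ?thesis unfolding c_def abs_divide by (simp add: divide_le_eq)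
  qed
  define g where "g x = EK i0 j0 x - (\<Sum>k<n. dirW ?E k h (x - h) / fact k)
     - (LINT s:{0..1}|lborel. c s * dirW ?E n h (x - h + s *\<^sub>R h))" for x
  have absW: "(\<integral>x. \<bar>dirW ?E n h (x + v)\<bar> \<partial>lborel) = (\<integral>x. \<bar>dirW ?E n h x\<bar> \<partial>lborel)" for v
    using integral_lborel_shift[of "\<lambda>x. \<bar>dirW ?E n h x\<bar>"] by simp
  have "integrable lborel (\<lambda>x. LINT s:{0..1}|lborel. c s * dirW ?E n h (x - h + s *\<^sub>R h))"
  proof (rule fubini_unit(1)[where B="\<integral>x. \<bar>dirW ?E n h x\<bar> \<partial>lborel"])
    show "(\<lambda>(s, x). c s * dirW ?E n h (x - h + s *\<^sub>R h)) \<in> borel_measurable (borel \<Otimes>\<^sub>M borel)" by measurable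
    fix s :: real assume s: "s \<in> {0..1}"
    have eq: "x - h + s *\<^sub>R h = x + (s *\<^sub>R h - h)" for x by simp
    show "integrable lborel (\<lambda>x. c s * dirW ?E n h (x - h + s *\<^sub>R h))"
      unfolding eq by (intro integrable_mult_right Wi')
    have "(\<integral>x. \<bar>c s * dirW ?E n h (x - h + s *\<^sub>R h)\<bar> \<partial>lborel) \<le> 1 * (\<integral>x. \<bar>dirW ?E n h (x + (s *\<^sub>R h - h))\<bar> \<partial>lborel)"
      unfolding eq using cb[OF s] by (intro integrable_times_bounded(2)[OF Wi']) auto
    then show "(\<integral>x. \<bar>c s * dirW ?E n h (x - h + s *\<^sub>R h)\<bar> \<partial>lborel) \<le> (\<integral>x. \<bar>dirW ?E n h x\<bar> \<partial>lborel)"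
      unfolding absW by simp
  qed
  note Ri = this
  have Wi'': "integrable lborel (\<lambda>x. dirW ?E k h (x - h))" for k
    using Wi'[of k "- h"] by simp
  have gi: "integrable lborel g" unfolding g_def
    by (intro Bochner_Integration.integrable_diff Bochner_Integration.integrable_sum integrable_divide EKi Wi'' Ri)
  have ge: "g x = E i0 j0 x - taylor i0 j0 n h (x - h) - remainder i0 j0 n h x" if x: "x \<in> cbox l r" for x
  proof -
    have W: "dirW ?E k h (x - s *\<^sub>R h) = dirW (\<lambda>i j. E (i0 + i) (j0 + j)) k h (x - s *\<^sub>R h)" if "s \<in> {0..1}" for k s
      unfolding dirW_def using EKe[OF x that] by simp
    have W1: "dirW ?E k h (x - h) = dirW (\<lambda>i j. E (i0 + i) (j0 + j)) k h (x - h)" for k using W[of 1 k] by simp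
    have W2: "dirW ?E k h (x - h + s *\<^sub>R h) = dirW (\<lambda>i j. E (i0 + i) (j0 + j)) k h (x - h + s *\<^sub>R h)" if "s \<in> {0..1}" for k s
      using W[of "1 - s" k] that by (simp add: algebra_simps)
    have "(LINT s:{0..1}|lborel. c s * dirW ?E n h (x - h + s *\<^sub>R h)) = remainder i0 j0 n h x"
      unfolding remainder_def c_def by (rule set_lebesgue_integral_cong) (auto simp: W2)
    moreover have "EK i0 j0 x = E i0 j0 x" using EKe[OF x, of 0] by simp
    ultimately show ?thesis unfolding g_def taylor_def W1 by simp
  qed
  have main: "(\<integral>x. tensor F G 0 0 x * g x \<partial>lborel) = 0"
    if F: "dseq F" and G: "dseq G" and z: "\<And>x. x \<notin> box l r \<Longrightarrow> tensor F G 0 0 x = 0"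
      and zF: "\<And>i t. t \<notin> {fst l..fst r} \<Longrightarrow> F i t = 0" and zG: "\<And>i t. t \<notin> {snd l..snd r} \<Longrightarrow> G i t = 0"
    for F G
  proof -
    let ?V = "tensor F G"
    have V0: "?V i j x = 0" if "x \<notin> cbox l r" for i j x
      using that zF[of "fst x" i] zG[of "snd x" j] unfolding tensor_def cbox_pair_iff by (auto simp: not_le)
    have dV: "dfam ?V" by (rule dfam_tensor[OF F G])
    have Vc: "continuous_on UNIV (?V i j)" for i j by (rule dfam_continuous[OF dV])
    have Vm[measurable]: "?V i j \<in> borel_measurable borel" for i j using Vc by (rule borel_measurable_continuous_onI)
    obtain B where B: "0 \<le> B" "\<And>x. \<bar>?V 0 0 x\<bar> \<le> B"
      using continuous_zero_outside_bounded[OF Vc compact_cbox V0] by metis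
    \<comment> \<open>A translation by s h moves the shift from E to the test function. The shifted
      test function still vanishes off K, hence has its support inside \<Omega>, and the weak
      derivative identity applies.\<close>
    have J: "(\<integral>x. ?V 0 0 x * EK a b (x - s *\<^sub>R h) \<partial>lborel) = (-1) ^ (a + b) * (\<integral>x. EK 0 0 x * ?V a b (x + s *\<^sub>R h) \<partial>lborel)"
      if s: "s \<in> {0..1}" for a b s
    proof -
      let ?F = "\<lambda>n t. F n (t + s * fst h)" and ?G = "\<lambda>n t. G n (t + s * snd h)"
      have te: "tensor ?F ?G i j x = ?V i j (x + s *\<^sub>R h)" for i j x by (simp add: tensor_def)
      have out: "?V i j (x + s *\<^sub>R h) = 0" if "x \<notin> K" for i j x
        using inK[OF _ s, of "x + s *\<^sub>R h"] that by (intro V0) auto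
      have tf: "test_fun \<Omega> (tensor ?F ?G 0 0)"
        by (rule test_fun_tensor[OF dseq_shift[OF F] dseq_shift[OF G] cK KO]) (simp add: te out)
      have "(\<integral>x. ?V 0 0 x * EK a b (x - s *\<^sub>R h) \<partial>lborel) = (\<integral>x. ?V 0 0 (x + s *\<^sub>R h) * EK a b x \<partial>lborel)"
        using integral_lborel_shift[of "\<lambda>x. ?V 0 0 x * EK a b (x - s *\<^sub>R h)" "s *\<^sub>R h"] by simp
      also have "\<dots> = (\<integral>x. E a b x * tensor ?F ?G 0 0 x \<partial>lborel)"
        by (rule Bochner_Integration.integral_cong) (simp_all add: te EK_def indicator_def, metis out)
      also have "\<dots> = (-1) ^ (a + b) * (\<integral>x. E 0 0 x * pd a b (tensor ?F ?G 0 0) x \<partial>lborel)"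
        unfolding wd[OF tf] by (simp add: mult.assoc[symmetric] power_add[symmetric])
      also have "(\<integral>x. E 0 0 x * pd a b (tensor ?F ?G 0 0) x \<partial>lborel) = (\<integral>x. EK 0 0 x * ?V a b (x + s *\<^sub>R h) \<partial>lborel)"
        unfolding pd_tensor[OF dseq_shift[OF F] dseq_shift[OF G]]
        by (rule Bochner_Integration.integral_cong) (simp_all add: te EK_def indicator_def, metis out)
      finally show ?thesis .
    qed
    let ?V' = "\<lambda>i j. ?V (i0 + i) (j0 + j)"
    have dV': "dfam ?V'" using dV unfolding dfam_def by simp
    have Wc: "continuous_on UNIV (dirW ?V' k v)" for k v by (rule dirW_continuous[OF dV'])
    have WVm[measurable]: "dirW ?V' k v \<in> borel_measurable borel" for k v using Wc by (rule borel_measurable_continuous_onI)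
    have W0: "dirW ?V' k v x = 0" if "x \<notin> cbox l r" for k v x unfolding dirW_def using V0[OF that] by simp
    have VE: "integrable lborel (\<lambda>x. ?V 0 0 x * EK a b (x + v))" for a b v
      using B by (intro integrable_times_bounded(1)[OF integrable_lborel_shift[OF EKi]]) auto
    have EVi: "integrable lborel (\<lambda>x. EK 0 0 x * ?V a b (x + v))" for a b v
    proof -
      obtain B' where B': "\<And>x. \<bar>?V a b x\<bar> \<le> B'"
        using continuous_zero_outside_bounded[OF Vc compact_cbox V0] by metis
      have "integrable lborel (\<lambda>x. ?V a b (x + v) * EK 0 0 x)"
        using B' by (intro integrable_times_bounded(1)[OF EKi, of _ B']) auto
      then show ?thesis by (simp add: mult.commute)
    qed
    \<comment> \<open>The sign (-1)^k from k integrations by parts is absorbed by replacing h by -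
      h; the sign from i0 and j0 is common to all terms.\<close>
    have JW: "(\<integral>x. ?V 0 0 x * dirW ?E k h (x - s *\<^sub>R h) \<partial>lborel) =
        (-1) ^ (i0 + j0) * (\<integral>x. EK 0 0 x * dirW ?V' k (- h) (x + s *\<^sub>R h) \<partial>lborel)" if s: "s \<in> {0..1}" for k s
    proof -
      have VEm: "integrable lborel (\<lambda>x. ?V 0 0 x * EK a b (x - s *\<^sub>R h))" for a b using VE[of a b "- (s *\<^sub>R h)"] by simp
      have "(\<integral>x. ?V 0 0 x * dirW ?E k h (x - s *\<^sub>R h) \<partial>lborel)
          = (\<integral>x. (\<Sum>i\<le>k. (real (k choose i) * (fst h ^ i * snd h ^ (k - i))) * (?V 0 0 x * ?E i (k - i) (x - s *\<^sub>R h))) \<partial>lborel)"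
        unfolding dirW_def by (simp add: sum_distrib_left mult_ac)
      also have "\<dots> = (\<Sum>i\<le>k. (real (k choose i) * (fst h ^ i * snd h ^ (k - i))) * (\<integral>x. ?V 0 0 x * ?E i (k - i) (x - s *\<^sub>R h) \<partial>lborel))"
        by (subst Bochner_Integration.integral_sum) (auto intro!: integrable_mult_right VEm)
      also have "\<dots> = (\<Sum>i\<le>k. (real (k choose i) * (fst h ^ i * snd h ^ (k - i))) *
          ((-1) ^ (i0 + j0) * (-1) ^ k * (\<integral>x. EK 0 0 x * ?V' i (k - i) (x + s *\<^sub>R h) \<partial>lborel)))"
      proof (rule sum.cong[OF refl])
        fix i assume "i \<in> {..k}"
        then have ex: "i0 + i + (j0 + (k - i)) = (i0 + j0) + k" by auto
        show "(real (k choose i) * (fst h ^ i * snd h ^ (k - i))) * (\<integral>x. ?V 0 0 x * ?E i (k - i) (x - s *\<^sub>R h) \<partial>lborel)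
          = (real (k choose i) * (fst h ^ i * snd h ^ (k - i))) *
          ((-1) ^ (i0 + j0) * (-1) ^ k * (\<integral>x. EK 0 0 x * ?V' i (k - i) (x + s *\<^sub>R h) \<partial>lborel))"
          unfolding J[OF s] ex by (simp only: power_add mult.assoc)
      qed
      also have "\<dots> = (-1) ^ (i0 + j0) * ((-1) ^ k * (\<Sum>i\<le>k. (real (k choose i) * (fst h ^ i * snd h ^ (k - i))) *
          (\<integral>x. EK 0 0 x * ?V' i (k - i) (x + s *\<^sub>R h) \<partial>lborel)))"
        by (simp add: sum_distrib_left mult_ac)
      also have "(\<Sum>i\<le>k. (real (k choose i) * (fst h ^ i * snd h ^ (k - i))) *
          (\<integral>x. EK 0 0 x * ?V' i (k - i) (x + s *\<^sub>R h) \<partial>lborel))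
        = (\<integral>x. (\<Sum>i\<le>k. (real (k choose i) * (fst h ^ i * snd h ^ (k - i))) * (EK 0 0 x * ?V' i (k - i) (x + s *\<^sub>R h))) \<partial>lborel)"
        by (subst Bochner_Integration.integral_sum) (auto intro!: integrable_mult_right EVi)
      also have "(-1) ^ k * \<dots> = (\<integral>x. EK 0 0 x * dirW ?V' k (- h) (x + s *\<^sub>R h) \<partial>lborel)"
        unfolding dirW_minus unfolding dirW_def
        by (subst integral_mult_right_zero[symmetric]) (simp add: sum_distrib_left mult_ac)
      finally show ?thesis .
    qed
    have EW: "integrable lborel (\<lambda>x. EK 0 0 x * dirW ?V' k v (x + w))" for k v w
    proof -
      obtain B' where B': "\<And>x. \<bar>dirW ?V' k v x\<bar> \<le> B'"
        using continuous_zero_outside_bounded[OF Wc compact_cbox W0] by metis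
      have "integrable lborel (\<lambda>x. dirW ?V' k v (x + w) * EK 0 0 x)"
        using B' by (intro integrable_times_bounded(1)[OF EKi, of _ B']) auto
      then show ?thesis by (simp add: mult.commute)
    qed
    have VW: "integrable lborel (\<lambda>x. ?V 0 0 x * dirW ?E k h (x + v))" for k v
      using B by (intro integrable_times_bounded(1)[OF Wi']) auto
    let ?sg = "(-1) ^ (i0 + j0) :: real"
    have T1: "(\<integral>x. ?V 0 0 x * EK i0 j0 x \<partial>lborel) = ?sg * (\<integral>x. EK 0 0 x * ?V' 0 0 x \<partial>lborel)"
      using J[of 0 i0 j0] by simp
    have T2: "(\<integral>x. ?V 0 0 x * dirW ?E k h (x - h) \<partial>lborel) = ?sg * (\<integral>x. EK 0 0 x * dirW ?V' k (- h) (x + h) \<partial>lborel)" for k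
      using JW[of 1 k] by simp
    have T3: "(\<integral>x. ?V 0 0 x * (LINT s:{0..1}|lborel. c s * dirW ?E n h (x - h + s *\<^sub>R h)) \<partial>lborel)
       = ?sg * (\<integral>x. EK 0 0 x * (LINT s:{0..1}|lborel. c s * dirW ?V' n (- h) (x + h + s *\<^sub>R (- h))) \<partial>lborel)"
    proof -
      have eq: "x - h + s *\<^sub>R h = x + (s *\<^sub>R h - h)" "x - h + s *\<^sub>R h = x - (1 - s) *\<^sub>R h" 
          "x + h + s *\<^sub>R (- h) = x + (1 - s) *\<^sub>R h" for x s by (simp_all add: algebra_simps)
      have "(\<integral>x. ?V 0 0 x * (LINT s:{0..1}|lborel. c s * dirW ?E n h (x - h + s *\<^sub>R h)) \<partial>lborel)
        = (\<integral>x. (LINT s:{0..1}|lborel. ?V 0 0 x * (c s * dirW ?E n h (x - h + s *\<^sub>R h))) \<partial>lborel)"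
        by simp
      also have "\<dots> = (LINT s:{0..1}|lborel. (\<integral>x. ?V 0 0 x * (c s * dirW ?E n h (x - h + s *\<^sub>R h)) \<partial>lborel))"
      proof (rule fubini_unit(2)[where B="B * (\<integral>x. \<bar>dirW ?E n h x\<bar> \<partial>lborel)"])
        show "(\<lambda>(s, x). ?V 0 0 x * (c s * dirW ?E n h (x - h + s *\<^sub>R h))) \<in> borel_measurable (borel \<Otimes>\<^sub>M borel)" by measurable
        fix s :: real assume s: "s \<in> {0..1}"
        have "integrable lborel (\<lambda>x. c s * (?V 0 0 x * dirW ?E n h (x + (s *\<^sub>R h - h))))"
          by (intro integrable_mult_right VW)
        then show "integrable lborel (\<lambda>x. ?V 0 0 x * (c s * dirW ?E n h (x - h + s *\<^sub>R h)))" unfolding eq(1) by (simp only: mult_ac)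
        have "(\<integral>x. \<bar>(?V 0 0 x * c s) * dirW ?E n h (x + (s *\<^sub>R h - h))\<bar> \<partial>lborel) \<le> B * (\<integral>x. \<bar>dirW ?E n h (x + (s *\<^sub>R h - h))\<bar> \<partial>lborel)"
        proof (intro integrable_times_bounded(2)[OF Wi'])
          show "\<bar>?V 0 0 x * c s\<bar> \<le> B" for x
            unfolding abs_mult using mult_mono[OF B(2)[of x] cb[OF s]] B(1) by simp
        qed measurable
        then show "(\<integral>x. \<bar>?V 0 0 x * (c s * dirW ?E n h (x - h + s *\<^sub>R h))\<bar> \<partial>lborel) \<le> B * (\<integral>x. \<bar>dirW ?E n h x\<bar> \<partial>lborel)"
          unfolding eq(1) absW by (simp only: mult_ac)
      qed
      also have "\<dots> = (LINT s:{0..1}|lborel. ?sg * (\<integral>x. EK 0 0 x * (c s * dirW ?V' n (- h) (x + h + s *\<^sub>R (- h))) \<partial>lborel))"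
      proof (rule set_lebesgue_integral_cong)
        show "\<forall>s. s \<in> {0..1} \<longrightarrow> (\<integral>x. ?V 0 0 x * (c s * dirW ?E n h (x - h + s *\<^sub>R h)) \<partial>lborel) =
            ?sg * (\<integral>x. EK 0 0 x * (c s * dirW ?V' n (- h) (x + h + s *\<^sub>R (- h))) \<partial>lborel)"
        proof (intro allI impI)
          fix s :: real assume s: "s \<in> {0..1}"
          then have s': "1 - s \<in> {0..1}" by auto
          have "(\<integral>x. ?V 0 0 x * (c s * dirW ?E n h (x - h + s *\<^sub>R h)) \<partial>lborel)
            = c s * (\<integral>x. ?V 0 0 x * dirW ?E n h (x - (1 - s) *\<^sub>R h) \<partial>lborel)"
            unfolding eq(2) by (subst integral_mult_right_zero[symmetric]) (simp only: mult_ac)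
          also have "\<dots> = ?sg * (c s * (\<integral>x. EK 0 0 x * dirW ?V' n (- h) (x + (1 - s) *\<^sub>R h) \<partial>lborel))"
            unfolding JW[OF s'] by (simp only: mult_ac)
          also have "c s * (\<integral>x. EK 0 0 x * dirW ?V' n (- h) (x + (1 - s) *\<^sub>R h) \<partial>lborel)
             = (\<integral>x. EK 0 0 x * (c s * dirW ?V' n (- h) (x + h + s *\<^sub>R (- h))) \<partial>lborel)"
            unfolding eq(3) by (subst integral_mult_right_zero[symmetric]) (simp only: mult_ac)
          finally show "(\<integral>x. ?V 0 0 x * (c s * dirW ?E n h (x - h + s *\<^sub>R h)) \<partial>lborel) =
            ?sg * (\<integral>x. EK 0 0 x * (c s * dirW ?V' n (- h) (x + h + s *\<^sub>R (- h))) \<partial>lborel)" .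
        qed
      qed simp
      also have "\<dots> = ?sg * (LINT s:{0..1}|lborel. (\<integral>x. EK 0 0 x * (c s * dirW ?V' n (- h) (x + h + s *\<^sub>R (- h))) \<partial>lborel))"
        by simp
      also have "(LINT s:{0..1}|lborel. (\<integral>x. EK 0 0 x * (c s * dirW ?V' n (- h) (x + h + s *\<^sub>R (- h))) \<partial>lborel))
        = (\<integral>x. (LINT s:{0..1}|lborel. EK 0 0 x * (c s * dirW ?V' n (- h) (x + h + s *\<^sub>R (- h)))) \<partial>lborel)"
      proof -
        obtain B' where B': "\<And>x. \<bar>dirW ?V' n (- h) x\<bar> \<le> B'"
          using continuous_zero_outside_bounded[OF Wc compact_cbox W0] by metis
        have B0: "0 \<le> B'" using order_trans[OF abs_ge_zero B'] .
        show ?thesis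
        proof (rule fubini_unit(2)[symmetric, where B="B' * (\<integral>x. \<bar>EK 0 0 x\<bar> \<partial>lborel)"])
          show "(\<lambda>(s, x). EK 0 0 x * (c s * dirW ?V' n (- h) (x + h + s *\<^sub>R (- h)))) \<in> borel_measurable (borel \<Otimes>\<^sub>M borel)"
            by measurable
          fix s :: real assume s: "s \<in> {0..1}"
          have bb: "\<bar>c s * dirW ?V' n (- h) (x + h + s *\<^sub>R (- h))\<bar> \<le> B'" for x
            unfolding abs_mult using mult_mono[OF cb[OF s] B'] B0 by simp
          have mm: "(\<lambda>x. c s * dirW ?V' n (- h) (x + h + s *\<^sub>R (- h))) \<in> borel_measurable borel" by measurable
          show "integrable lborel (\<lambda>x. EK 0 0 x * (c s * dirW ?V' n (- h) (x + h + s *\<^sub>R (- h))))"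
            using integrable_times_bounded(1)[OF EKi[of 0 0] mm bb] by (simp only: mult.commute)
          show "(\<integral>x. \<bar>EK 0 0 x * (c s * dirW ?V' n (- h) (x + h + s *\<^sub>R (- h)))\<bar> \<partial>lborel) \<le> B' * (\<integral>x. \<bar>EK 0 0 x\<bar> \<partial>lborel)"
            using integrable_times_bounded(2)[OF EKi[of 0 0] mm bb] by (simp only: mult.commute)
        qed
      qed
      also have "\<dots> = (\<integral>x. EK 0 0 x * (LINT s:{0..1}|lborel. c s * dirW ?V' n (- h) (x + h + s *\<^sub>R (- h))) \<partial>lborel)"
        by simp
      finally show ?thesis .
    qed
    \<comment> \<open>The smooth function is expanded at x + h with increment - h, which ends at x.
      With this the three transformed parts of g cancel.\<close>
    have tay: "(LINT s:{0..1}|lborel. c s * dirW ?V' n (- h) (x + h + s *\<^sub>R (- h)))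
       = ?V' 0 0 x - (\<Sum>k<n. dirW ?V' k (- h) (x + h) / fact k)" for x
      using taylor_segment[OF dV' n, of "x + h" "- h"] unfolding c_def by simp
    have VR: "integrable lborel (\<lambda>x. ?V 0 0 x * (LINT s:{0..1}|lborel. c s * dirW ?E n h (x - h + s *\<^sub>R h)))"
      using B by (intro integrable_times_bounded(1)[OF Ri]) auto
    have VE0: "integrable lborel (\<lambda>x. ?V 0 0 x * EK i0 j0 x)" using VE[of i0 j0 0] by simp
    have VW0: "integrable lborel (\<lambda>x. ?V 0 0 x * dirW ?E k h (x - h))" for k using VW[of k "- h"] by simp
    have EV0: "integrable lborel (\<lambda>x. EK 0 0 x * ?V' 0 0 x)" using EVi[of i0 j0 0] by simp
    have "(\<integral>x. ?V 0 0 x * g x \<partial>lborel) = (\<integral>x. ?V 0 0 x * EK i0 j0 x - (\<Sum>k<n. ?V 0 0 x * dirW ?E k h (x - h) / fact k)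
       - ?V 0 0 x * (LINT s:{0..1}|lborel. c s * dirW ?E n h (x - h + s *\<^sub>R h)) \<partial>lborel)"
      unfolding g_def by (simp only: right_diff_distrib sum_distrib_left times_divide_eq_right)
    also have "\<dots> = (\<integral>x. ?V 0 0 x * EK i0 j0 x \<partial>lborel) - (\<Sum>k<n. (\<integral>x. ?V 0 0 x * dirW ?E k h (x - h) \<partial>lborel) / fact k)
       - (\<integral>x. ?V 0 0 x * (LINT s:{0..1}|lborel. c s * dirW ?E n h (x - h + s *\<^sub>R h)) \<partial>lborel)"
      by (simp add: VE0 VW0 VR)
    also have "\<dots> = ?sg * ((\<integral>x. EK 0 0 x * ?V' 0 0 x \<partial>lborel) - (\<Sum>k<n. (\<integral>x. EK 0 0 x * dirW ?V' k (- h) (x + h) \<partial>lborel) / fact k)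
       - (\<integral>x. EK 0 0 x * (?V' 0 0 x - (\<Sum>k<n. dirW ?V' k (- h) (x + h) / fact k)) \<partial>lborel))"
      unfolding T1 T2 T3 tay by (simp only: right_diff_distrib sum_distrib_left times_divide_eq_right)
    also have "(\<integral>x. EK 0 0 x * (?V' 0 0 x - (\<Sum>k<n. dirW ?V' k (- h) (x + h) / fact k)) \<partial>lborel)
      = (\<integral>x. EK 0 0 x * ?V' 0 0 x - (\<Sum>k<n. EK 0 0 x * dirW ?V' k (- h) (x + h) / fact k) \<partial>lborel)"
      by (simp only: right_diff_distrib sum_distrib_left times_divide_eq_right)
    also have "\<dots> = (\<integral>x. EK 0 0 x * ?V' 0 0 x \<partial>lborel) - (\<Sum>k<n. (\<integral>x. EK 0 0 x * dirW ?V' k (- h) (x + h) \<partial>lborel) / fact k)"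
      by (simp add: EW EV0[simplified])
    finally show ?thesis by simp
  qed
  have gm[measurable]: "g \<in> borel_measurable borel" using borel_measurable_integrable[OF gi] by simp
  \<comment> \<open>Products of bumps converge to the indicator of the subbox with |g| as majorant,
    so vanishing tests become vanishing integrals over boxes.\<close>
  have sub_box: "(LINT x:box a b|lborel. g x) = 0" if ab: "box a b \<subseteq> box l r" for a b
  proof (cases "box a b = {}")
    case True then show ?thesis by (simp add: set_lebesgue_integral_def)
  next
    case False
    define \<phi> where "\<phi> N x = bump (fst a) (fst b) N (fst x) * bump (snd a) (snd b) N (snd x)" for N x
    have in1: "{fst a<..<fst b} \<times> {snd a<..<snd b} = box a b" unfolding set_eq_iff box_pair_iff by auto
    have ne: "fst a < fst b" "snd a < snd b" using False unfolding in1[symmetric] by auto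
    have "cbox a b \<subseteq> cbox l r" using closure_mono[OF ab] closure_box[OF False] box_subset_cbox[of l r]
      by (metis False closure_box subset_empty ab)
    then have le: "fst l \<le> fst a" "fst b \<le> fst r" "snd l \<le> snd a" "snd b \<le> snd r"
      using ne subsetD[of "cbox a b" "cbox l r" a] subsetD[of "cbox a b" "cbox l r" b]
      by (auto simp: cbox_pair_iff)
    have 0: "(\<integral>x. \<phi> N x * g x \<partial>lborel) = 0" for N
    proof -
      obtain F where F: "dseq F" "F 0 = bump (fst a) (fst b) N" using dseq_bump by blast
      obtain G where G: "dseq G" "G 0 = bump (snd a) (snd b) N" using dseq_bump by blast
      have te: "tensor F G 0 0 = \<phi> N" unfolding tensor_def \<phi>_def F G by simp
      have "(\<integral>x. tensor F G 0 0 x * g x \<partial>lborel) = 0"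
      proof (rule main[OF F(1) G(1)])
        show "tensor F G 0 0 x = 0" if "x \<notin> box l r" for x
        proof -
          have "x \<notin> box a b" using that ab by blast
          then have "fst x \<notin> {fst a<..<fst b} \<or> snd x \<notin> {snd a<..<snd b}" unfolding box_pair_iff by simp
          then show ?thesis unfolding te \<phi>_def
            using bump_bounds(3)[of "fst x" "fst a" "fst b" N] bump_bounds(3)[of "snd x" "snd a" "snd b" N] by auto
        qed
        show "F i t = 0" if "t \<notin> {fst l..fst r}" for i t
        proof (rule dseq_zero_open[OF F(1), of "- {fst l..fst r}"])
          fix t' assume "t' \<in> - {fst l..fst r}"
          then have "t' \<notin> {fst a<..<fst b}" using le by auto
          then show "F 0 t' = 0" unfolding F(2) by (rule bump_bounds(3))
        qed (use that in auto)
        show "G i t = 0" if "t \<notin> {snd l..snd r}" for i t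
        proof (rule dseq_zero_open[OF G(1), of "- {snd l..snd r}"])
          fix t' assume "t' \<in> - {snd l..snd r}"
          then have "t' \<notin> {snd a<..<snd b}" using le by auto
          then show "G 0 t' = 0" unfolding G(2) by (rule bump_bounds(3))
        qed (use that in auto)
      qed
      then show ?thesis unfolding te .
    qed
    have bm: "bump p q N \<in> borel_measurable borel" for p q N
    proof -
      obtain F where F: "dseq F" "F 0 = bump p q N" using dseq_bump by blast
      then have "continuous_on UNIV (bump p q N)" unfolding dseq_def
        by (metis DERIV_continuous_on UNIV_I has_field_derivative_at_within)
      then show ?thesis by (rule borel_measurable_continuous_onI)
    qed
    have fs: "fst \<in> borel_measurable (borel :: (real \<times> real) measure)" "snd \<in> borel_measurable (borel :: (real \<times> real) measure)"
      by (rule borel_measurable_continuous_onI, intro continuous_intros)+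
    have pm[measurable]: "\<phi> N \<in> borel_measurable borel" for N
      unfolding \<phi>_def
      by (intro borel_measurable_times measurable_compose[OF fs(1) bm] measurable_compose[OF fs(2) bm])
    have "(\<lambda>N. \<integral>x. \<phi> N x * g x \<partial>lborel) \<longlonglongrightarrow> (\<integral>x. indicator (box a b) x *\<^sub>R g x \<partial>lborel)"
    proof (rule integral_dominated_convergence[where w="\<lambda>x. \<bar>g x\<bar>"])
      show "AE x in lborel. (\<lambda>N. \<phi> N x * g x) \<longlonglongrightarrow> indicat_real (box a b) x *\<^sub>R g x"
      proof (intro always_eventually allI)
        fix x
        have "(\<lambda>N. \<phi> N x * g x) \<longlonglongrightarrow> (indicator {fst a<..<fst b} (fst x) * indicator {snd a<..<snd b} (snd x)) * g x"
          unfolding \<phi>_def by (intro tendsto_intros bump_lim)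
        also have "indicator {fst a<..<fst b} (fst x) * indicator {snd a<..<snd b} (snd x) = indicat_real (box a b) x"
          unfolding in1[symmetric] by (cases x) (simp add: indicator_times)
        finally show "(\<lambda>N. \<phi> N x * g x) \<longlonglongrightarrow> indicat_real (box a b) x *\<^sub>R g x" by simp
      qed
      show "AE x in lborel. norm (\<phi> N x * g x) \<le> \<bar>g x\<bar>" for N
      proof (intro always_eventually allI)
        fix x
        have "\<bar>\<phi> N x\<bar> \<le> 1" unfolding \<phi>_def abs_mult
          using bump_bounds(1,2) by (simp add: mult_le_one)
        then show "norm (\<phi> N x * g x) \<le> \<bar>g x\<bar>" by (simp add: abs_mult mult_left_le_one_le)
      qed
      show "(\<lambda>x. \<phi> N x * g x) \<in> borel_measurable lborel" for N
        using borel_measurable_times[OF pm gm] by simp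
    qed (use gi in auto)
    then show ?thesis unfolding set_lebesgue_integral_def 0 by (simp add: LIMSEQ_const_iff)
  qed
  have "AE x in lborel. indicator (box l r) x * g x = 0"
  proof (rule AE_zero_on_boxes[where l=l and r=r])
    show "integrable lborel (\<lambda>x. indicat_real (box l r) x * g x)"
      using integrable_mult_indicator[OF _ gi, of "box l r"] by simp
    fix a b :: "real \<times> real"
    obtain p q where pq: "box a b \<inter> box l r = box p q" by (rule that[OF box_Int_box])
    have "(LINT x:box a b|lborel. indicat_real (box l r) x * g x) = (LINT x:box p q|lborel. g x)"
      unfolding set_lebesgue_integral_def pq[symmetric] indicator_inter_arith by (simp add: mult.assoc)
    then show "(LINT x:box a b|lborel. indicat_real (box l r) x * g x) = 0" using sub_box[of p q] pq by auto
  qed simp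
  then show ?thesis
  proof (eventually_elim)
    fix x assume "indicat_real (box l r) x * g x = 0"
    then show "x \<in> box l r \<longrightarrow> E i0 j0 x = taylor i0 j0 n h (x - h) + remainder i0 j0 n h x"
      using ge[of x] box_subset_cbox[of l r] by auto
  qed
qed

text \<open>The admissible points form an open set, as their complement is the sum of a closed and a
  compact set. By the Lindelof property countably many boxes cover it, and the null sets of the
  boxes can be united.\<close>

lemma taylor_AE:
  assumes n: "n > 0"
  shows "AE x in lborel. (\<forall>s\<in>{0..1}. x - s *\<^sub>R h \<in> \<Omega>) \<longrightarrow> E i0 j0 x = taylor i0 j0 n h (x - h) + remainder i0 j0 n h x"
proof -
  define S where "S = {x. \<forall>s\<in>{0..1}. x - s *\<^sub>R h \<in> \<Omega>}"
  have "open S"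
  proof -
    have "compact ((\<lambda>s. s *\<^sub>R h) ` {0..1})" by (intro compact_continuous_image continuous_intros) auto
    then have "closed (\<Union>x\<in>- \<Omega>. \<Union>y\<in>(\<lambda>s. s *\<^sub>R h) ` {0..1}. {x + y})"
      using op by (intro closed_compact_sums) auto
    moreover have "(\<Union>x\<in>- \<Omega>. \<Union>y\<in>(\<lambda>s. s *\<^sub>R h) ` {0..1}. {x + y}) = - S"
    proof (rule set_eqI)
      fix z
      have "z \<in> - S \<longleftrightarrow> (\<exists>s\<in>{0..1}. z - s *\<^sub>R h \<notin> \<Omega>)" unfolding S_def by blast
      also have "\<dots> \<longleftrightarrow> (\<exists>x\<in>-\<Omega>. \<exists>s\<in>{0..1}. z = x + s *\<^sub>R h)"
        by (metis ComplI ComplD add_diff_cancel_right' diff_add_cancel)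
      finally show "z \<in> (\<Union>x\<in>- \<Omega>. \<Union>y\<in>(\<lambda>s. s *\<^sub>R h) ` {0..1}. {x + y}) \<longleftrightarrow> z \<in> - S" by blast
    qed
    ultimately have "closed (- S)" by simp
    then show ?thesis by (simp add: closed_def)
  qed
  define \<F> where "\<F> = {box l r | l r. cbox l r \<subseteq> S}"
  have "open B" if "B \<in> \<F>" for B using that unfolding \<F>_def by (auto intro: open_box)
  then obtain \<F>' where F: "\<F>' \<subseteq> \<F>" "countable \<F>'" "\<Union>\<F>' = \<Union>\<F>"
    using Lindelof[of \<F>] by blast
  have cov: "S \<subseteq> \<Union>\<F>"
  proof
    fix x assume "x \<in> S"
    then obtain a b where "cbox a b \<subseteq> S" "x \<in> box a b"
      using open_contains_cbox[OF \<open>open S\<close>] by metis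
    then show "x \<in> \<Union>\<F>" unfolding \<F>_def by blast
  qed
  have "AE x in lborel. \<forall>B\<in>\<F>'. x \<in> B \<longrightarrow> E i0 j0 x = taylor i0 j0 n h (x - h) + remainder i0 j0 n h x"
  proof (subst AE_ball_countable[OF F(2)], intro ballI)
    fix B assume "B \<in> \<F>'"
    then obtain l r where B: "B = box l r" "cbox l r \<subseteq> S" using F(1) unfolding \<F>_def by blast
    show "AE x in lborel. x \<in> B \<longrightarrow> E i0 j0 x = taylor i0 j0 n h (x - h) + remainder i0 j0 n h x"
      unfolding B(1) by (rule taylor_AE_box[OF n]) (use B(2) S_def in blast)
  qed
  then show ?thesis
    by eventually_elim (use cov F(3) S_def in blast)
qed

end

section \<open>L2 bounds for remainders averaged over segments\<close>

lemma borel_measurable_fst_snd: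
  "fst \<in> borel_measurable (borel :: (real \<times> real) measure)" "snd \<in> borel_measurable (borel :: (real \<times> real) measure)"
  by (rule borel_measurable_continuous_onI, intro continuous_intros)+

lemma dirW_measurable:
  assumes "f \<in> borel_measurable M" "g \<in> borel_measurable M" "\<And>i j. V i j \<in> borel_measurable borel"
  shows "(\<lambda>p. dirW V k (g p) (f p)) \<in> borel_measurable M"
  unfolding dirW_def
  by (intro borel_measurable_sum borel_measurable_times borel_measurable_power borel_measurable_const
      measurable_compose[OF assms(2) borel_measurable_fst_snd(1)] measurable_compose[OF assms(2) borel_measurable_fst_snd(2)]
      measurable_compose[OF assms(1,3)])

lemma nn_integral_lborel_affine:
  fixes F :: "real \<times> real \<Rightarrow> ennreal"
  assumes [measurable]: "F \<in> borel_measurable borel" and c: "c \<noteq> 0"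
  shows "(\<integral>\<^sup>+x. F (t + c *\<^sub>R x) \<partial>lborel) = ennreal (1 / c\<^sup>2) * (\<integral>\<^sup>+z. F z \<partial>lborel)"
proof -
  have "(\<integral>\<^sup>+z. F z \<partial>lborel) = (\<integral>\<^sup>+z. F z \<partial>density (distr lborel borel (\<lambda>x. t + c *\<^sub>R x)) (\<lambda>_. ennreal (\<bar>c\<bar> ^ DIM(real \<times> real))))"
    using lborel_affine[OF c, of t] by simp
  also have "\<dots> = (\<integral>\<^sup>+x. ennreal (c\<^sup>2) * F (t + c *\<^sub>R x) \<partial>lborel)"
    by (simp add: nn_integral_density nn_integral_distr power2_eq_square)
  also have "\<dots> = ennreal (c\<^sup>2) * (\<integral>\<^sup>+x. F (t + c *\<^sub>R x) \<partial>lborel)" by (simp add: nn_integral_cmult)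
  finally have "ennreal (1 / c\<^sup>2) * (\<integral>\<^sup>+z. F z \<partial>lborel) = (ennreal (1 / c\<^sup>2) * ennreal (c\<^sup>2)) * (\<integral>\<^sup>+x. F (t + c *\<^sub>R x) \<partial>lborel)"
    by (simp add: mult.assoc)
  also have "ennreal (1 / c\<^sup>2) * ennreal (c\<^sup>2) = 1" using c by (simp flip: ennreal_mult)
  finally show ?thesis by simp
qed

text \<open>For fixed s the point z = y + s (x - y) is substituted either for x, with Jacobian
  factor 1 / s^2, or for y, with factor 1 / (1 - s)^2. For each s in (0, 1) one of the factors is at
  most 4, so the singularities at both ends can be avoided; the second form also profits from a
  small set X.\<close>

lemma segment_nn_integral_le:
  fixes F :: "real \<times> real \<Rightarrow> ennreal"
  assumes F[measurable]: "F \<in> borel_measurable borel"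
    and [measurable]: "X \<in> sets borel" "Y \<in> sets borel" "U \<in> sets borel"
    and seg: "\<And>x y. x \<in> X \<Longrightarrow> y \<in> Y \<Longrightarrow> y + s *\<^sub>R (x - y) \<in> U"
  shows "s > 0 \<Longrightarrow> (\<integral>\<^sup>+x\<in>X. (\<integral>\<^sup>+y\<in>Y. F (y + s *\<^sub>R (x - y)) \<partial>lborel) \<partial>lborel)
      \<le> emeasure lborel Y * ennreal (1 / s\<^sup>2) * (\<integral>\<^sup>+z\<in>U. F z \<partial>lborel)"
    and "s < 1 \<Longrightarrow> (\<integral>\<^sup>+x\<in>X. (\<integral>\<^sup>+y\<in>Y. F (y + s *\<^sub>R (x - y)) \<partial>lborel) \<partial>lborel)
      \<le> emeasure lborel X * ennreal (1 / (1 - s)\<^sup>2) * (\<integral>\<^sup>+z\<in>U. F z \<partial>lborel)"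
proof -
  define G where "G z = F z * indicator U z" for z
  have G[measurable]: "G \<in> borel_measurable borel" unfolding G_def by measurable
  let ?T = "\<integral>\<^sup>+x\<in>X. (\<integral>\<^sup>+y\<in>Y. F (y + s *\<^sub>R (x - y)) \<partial>lborel) \<partial>lborel"
  have T: "?T = (\<integral>\<^sup>+x. (\<integral>\<^sup>+y. F (y + s *\<^sub>R (x - y)) * indicator Y y * indicator X x \<partial>lborel) \<partial>lborel)"
    by (intro nn_integral_cong) (simp add: nn_integral_multc)
  have eq1: "y + s *\<^sub>R (x - y) = (1 - s) *\<^sub>R y + s *\<^sub>R x" and eq2: "y + s *\<^sub>R (x - y) = s *\<^sub>R x + (1 - s) *\<^sub>R y"
    for x y :: "real \<times> real" by (simp_all add: algebra_simps)
  {
    assume s: "s > 0"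
    have "?T \<le> (\<integral>\<^sup>+x. (\<integral>\<^sup>+y. G (y + s *\<^sub>R (x - y)) * indicator Y y \<partial>lborel) \<partial>lborel)"
      unfolding T G_def by (intro nn_integral_mono) (simp add: indicator_def, metis seg)
    also have "\<dots> = (\<integral>\<^sup>+y. (\<integral>\<^sup>+x. G (y + s *\<^sub>R (x - y)) * indicator Y y \<partial>lborel) \<partial>lborel)"
      by (rule lborel_pair.Fubini') measurable
    also have "\<dots> = (\<integral>\<^sup>+y. (\<integral>\<^sup>+x. G ((1 - s) *\<^sub>R y + s *\<^sub>R x) \<partial>lborel) * indicator Y y \<partial>lborel)"
      unfolding eq1 by (intro nn_integral_cong nn_integral_multc) measurable
    also have "\<dots> = (\<integral>\<^sup>+y. (ennreal (1 / s\<^sup>2) * (\<integral>\<^sup>+z. G z \<partial>lborel)) * indicator Y y \<partial>lborel)"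
      by (subst nn_integral_lborel_affine) (use s in auto)
    also have "\<dots> = emeasure lborel Y * ennreal (1 / s\<^sup>2) * (\<integral>\<^sup>+z\<in>U. F z \<partial>lborel)"
      by (subst nn_integral_cmult_indicator) (simp_all add: G_def[abs_def] mult_ac)
    finally show "?T \<le> emeasure lborel Y * ennreal (1 / s\<^sup>2) * (\<integral>\<^sup>+z\<in>U. F z \<partial>lborel)" .
  }
  {
    assume s: "s < 1"
    have "?T \<le> (\<integral>\<^sup>+x. (\<integral>\<^sup>+y. G (y + s *\<^sub>R (x - y)) * indicator X x \<partial>lborel) \<partial>lborel)"
      unfolding T G_def by (intro nn_integral_mono) (simp add: indicator_def, metis seg)
    also have "\<dots> = (\<integral>\<^sup>+x. (\<integral>\<^sup>+y. G (s *\<^sub>R x + (1 - s) *\<^sub>R y) \<partial>lborel) * indicator X x \<partial>lborel)"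
      unfolding eq2 by (intro nn_integral_cong nn_integral_multc) measurable
    also have "\<dots> = (\<integral>\<^sup>+x. (ennreal (1 / (1 - s)\<^sup>2) * (\<integral>\<^sup>+z. G z \<partial>lborel)) * indicator X x \<partial>lborel)"
      by (subst nn_integral_lborel_affine) (use s in auto)
    also have "\<dots> = emeasure lborel X * ennreal (1 / (1 - s)\<^sup>2) * (\<integral>\<^sup>+z\<in>U. F z \<partial>lborel)"
      by (subst nn_integral_cmult_indicator) (simp_all add: G_def[abs_def] mult_ac)
    finally show "?T \<le> emeasure lborel X * ennreal (1 / (1 - s)\<^sup>2) * (\<integral>\<^sup>+z\<in>U. F z \<partial>lborel)" .
  }
qed

text \<open>If f is not integrable on S, the Bochner integral is 0 by convention, so the estimate
  holds without any integrability.\<close>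

lemma ennreal_abs_set_integral_le:
  fixes f :: "real \<Rightarrow> real"
  shows "ennreal \<bar>LINT s:S|lborel. f s\<bar> \<le> (\<integral>\<^sup>+s\<in>S. ennreal \<bar>f s\<bar> \<partial>lborel)"
proof (cases "integrable lborel (\<lambda>s. indicat_real S s *\<^sub>R f s)")
  case True
  have "ennreal \<bar>LINT s:S|lborel. f s\<bar> \<le> (\<integral>\<^sup>+s. ennreal (norm (indicat_real S s *\<^sub>R f s)) \<partial>lborel)"
    unfolding set_lebesgue_integral_def using integral_norm_bound_ennreal[OF True] by simp
  also have "\<dots> = (\<integral>\<^sup>+s\<in>S. ennreal \<bar>f s\<bar> \<partial>lborel)"
    by (intro nn_integral_cong) (simp add: indicator_def)
  finally show ?thesis .
next
  case False
  then have "(LINT s:S|lborel. f s) = 0" unfolding set_lebesgue_integral_def by (rule not_integrable_integral_eq)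
  then show ?thesis by simp
qed

definition sqsum :: "(nat \<Rightarrow> nat \<Rightarrow> real \<times> real \<Rightarrow> real) \<Rightarrow> nat \<Rightarrow> real \<times> real \<Rightarrow> real" where
  "sqsum V n z = (\<Sum>i\<le>n. (V i (n - i) z)\<^sup>2)"

lemma sqsum_nonneg: "0 \<le> sqsum V n z"
  unfolding sqsum_def by (intro sum_nonneg) auto

text \<open>Cauchy-Schwarz against the binomial coefficients. The sum of their squares is at most
  the square of their sum, and summing (n choose i) H^n over i gives (2 H)^n.\<close>

lemma dirW_bound:
  assumes "\<bar>fst h\<bar> \<le> H" "\<bar>snd h\<bar> \<le> H"
  shows "\<bar>dirW V n h z\<bar> \<le> (2 * H) ^ n * sqrt (sqsum V n z)"
proof -
  have H: "0 \<le> H" using assms by linarith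
  define a where "a i = real (n choose i) * (fst h ^ i * snd h ^ (n - i))" for i
  have a: "\<bar>a i\<bar> \<le> real (n choose i) * H ^ n" if "i \<le> n" for i
  proof -
    have "\<bar>fst h ^ i * snd h ^ (n - i)\<bar> \<le> H ^ i * H ^ (n - i)"
      unfolding abs_mult power_abs using assms H by (intro mult_mono power_mono) auto
    also have "\<dots> = H ^ n" using that by (simp flip: power_add)
    finally show ?thesis unfolding a_def abs_mult by (simp add: mult_left_mono)
  qed
  have "(dirW V n h z)\<^sup>2 = (\<Sum>i\<le>n. a i * V i (n - i) z)\<^sup>2" unfolding dirW_def a_def by (simp add: mult.assoc)
  also have "\<dots> \<le> (\<Sum>i\<le>n. (a i)\<^sup>2) * sqsum V n z" unfolding sqsum_def by (rule Cauchy_Schwarz_ineq_sum)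
  finally have 1: "(dirW V n h z)\<^sup>2 \<le> (\<Sum>i\<le>n. (a i)\<^sup>2) * sqsum V n z" .
  have "(\<Sum>i\<le>n. (a i)\<^sup>2) \<le> (\<Sum>i\<le>n. \<bar>a i\<bar>)\<^sup>2"
  proof -
    have "(\<Sum>i\<le>n. (a i)\<^sup>2) = (\<Sum>i\<le>n. \<bar>a i\<bar> * \<bar>a i\<bar>)" by (simp add: power2_eq_square)
    also have "\<dots> \<le> (\<Sum>i\<le>n. \<bar>a i\<bar> * (\<Sum>j\<le>n. \<bar>a j\<bar>))"
      by (intro sum_mono mult_left_mono member_le_sum) auto
    finally show ?thesis by (simp add: sum_distrib_right power2_eq_square)
  qed
  also have "(\<Sum>i\<le>n. \<bar>a i\<bar>)\<^sup>2 \<le> ((2 * H) ^ n)\<^sup>2"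
  proof (rule power_mono)
    have "(\<Sum>i\<le>n. \<bar>a i\<bar>) \<le> (\<Sum>i\<le>n. real (n choose i) * H ^ n)" by (intro sum_mono a) auto
    also have "\<dots> = real (\<Sum>i\<le>n. n choose i) * H ^ n" by (simp add: sum_distrib_right)
    finally show "(\<Sum>i\<le>n. \<bar>a i\<bar>) \<le> (2 * H) ^ n" by (simp only: choose_row_sum power_mult_distrib) simp
  qed (simp add: sum_nonneg)
  finally have "(\<Sum>i\<le>n. (a i)\<^sup>2) \<le> ((2 * H) ^ n)\<^sup>2" .
  from order_trans[OF 1 mult_right_mono[OF this sqsum_nonneg]]
  have "(dirW V n h z)\<^sup>2 \<le> ((2 * H) ^ n)\<^sup>2 * sqsum V n z" .
  then have "sqrt ((dirW V n h z)\<^sup>2) \<le> sqrt (((2 * H) ^ n)\<^sup>2 * sqsum V n z)" by (rule real_sqrt_le_mono)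
  then show ?thesis using H by (simp add: real_sqrt_mult)
qed

context weak_family
begin

text \<open>Cauchy-Schwarz in s after inserting sqrt w * sqrt (1 / w). The weight is left free: w =
  1 serves where the derivatives are bounded uniformly along the segment, while w = (1 - s)^(2 -
  \<gamma>) will balance a singularity at the end s = 1.\<close>

lemma remainder_bound:
  assumes H: "\<bar>fst h\<bar> \<le> H" "\<bar>snd h\<bar> \<le> H" and w[measurable]: "w \<in> borel_measurable borel"
    and wp: "\<And>s. s \<in> {0<..<1} \<Longrightarrow> w s > 0"
  shows "ennreal ((remainder i0 j0 n h x)\<^sup>2) \<le> ennreal (((2 * H) ^ n / fact (n - 1))\<^sup>2) *
     (\<integral>\<^sup>+s\<in>{0<..<1}. ennreal (1 / w s) \<partial>lborel) *
     (\<integral>\<^sup>+s\<in>{0<..<1}. ennreal (w s) * ennreal (sqsum (\<lambda>i j. E (i0 + i) (j0 + j)) n (x - h + s *\<^sub>R h)) \<partial>lborel)"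
proof -
  let ?V = "\<lambda>i j. E (i0 + i) (j0 + j)"
  define F where "F s = sqsum ?V n (x - h + s *\<^sub>R h)" for s
  have Fm[measurable]: "F \<in> borel_measurable borel"
    unfolding F_def sqsum_def by measurable
  have F0: "0 \<le> F s" for s unfolding F_def by (rule sqsum_nonneg)
  have H0: "0 \<le> H" using H by linarith
  let ?c = "(2 * H) ^ n / fact (n - 1)"
  have c0: "0 \<le> ?c" using H0 by simp
  have pt: "\<bar>(1 - s) ^ (n - 1) / fact (n - 1) * dirW ?V n h (x - h + s *\<^sub>R h)\<bar> \<le> ?c * sqrt (F s)" if "s \<in> {0<..<1}" for s
  proof -
    have 1: "\<bar>(1 - s) ^ (n - 1) / fact (n - 1)\<bar> \<le> 1 / fact (n - 1)"
      using that by (simp add: divide_right_mono power_le_one)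
    have 2: "\<bar>dirW ?V n h (x - h + s *\<^sub>R h)\<bar> \<le> (2 * H) ^ n * sqrt (F s)"
      unfolding F_def by (rule dirW_bound[OF H])
    show ?thesis unfolding abs_mult using mult_mono[OF 1 2] by simp
  qed
  have ms: "(\<lambda>s. ennreal (sqrt (F s * w s) * indicator {0<..<1} s)) \<in> borel_measurable lborel"
    "(\<lambda>s. ennreal (sqrt (1 / w s) * indicator {0<..<1} s)) \<in> borel_measurable lborel" by measurable
  \<comment> \<open>The weight is known to be positive only in the open interval, so the end points
    are discarded as a null set.\<close>
  have ae: "AE s in lborel. s \<noteq> 0 \<and> s \<noteq> (1::real)"
    using AE_lborel_singleton[of "0::real"] AE_lborel_singleton[of "1::real"] by eventually_elim auto
  have "ennreal \<bar>remainder i0 j0 n h x\<bar> \<le> (\<integral>\<^sup>+s\<in>{0..1}. ennreal \<bar>(1 - s) ^ (n - 1) / fact (n - 1) * dirW ?V n h (x - h + s *\<^sub>R h)\<bar> \<partial>lborel)"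
    unfolding remainder_def by (rule ennreal_abs_set_integral_le)
  also have "\<dots> \<le> (\<integral>\<^sup>+s. (ennreal ?c * (ennreal (sqrt (F s * w s) * indicator {0<..<1} s) * ennreal (sqrt (1 / w s) * indicator {0<..<1} s))) \<partial>lborel)"
  proof (rule nn_integral_mono_AE, use ae in eventually_elim)
    fix s :: real assume s: "s \<noteq> 0 \<and> s \<noteq> 1"
    show "ennreal \<bar>(1 - s) ^ (n - 1) / fact (n - 1) * dirW ?V n h (x - h + s *\<^sub>R h)\<bar> * indicator {0..1} s
      \<le> ennreal ?c * (ennreal (sqrt (F s * w s) * indicator {0<..<1} s) * ennreal (sqrt (1 / w s) * indicator {0<..<1} s))"
    proof (cases "s \<in> {0<..<1}")
      case True
      have "sqrt (F s * w s) * sqrt (1 / w s) = sqrt (F s)"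
        using wp[OF True] by (simp flip: real_sqrt_mult)
      then have "ennreal (sqrt (F s * w s)) * ennreal (sqrt (1 / w s)) = ennreal (sqrt (F s))"
        using wp[OF True] F0 by (simp flip: ennreal_mult)
      moreover have "ennreal (?c * sqrt (F s)) = ennreal ?c * ennreal (sqrt (F s))"
        by (rule ennreal_mult) (use c0 F0[of s] in auto)
      ultimately show ?thesis using True ennreal_leI[OF pt[OF True]] by (simp only: indicator_simps mult_1_right greaterThanLessThan_iff atLeastAtMost_iff less_imp_le simp_thms)
    next
      case False
      then have "s \<notin> {0..1}" using s by auto
      then show ?thesis by simp
    qed
  qed
  also have "\<dots> = ennreal ?c * (\<integral>\<^sup>+s. ennreal (sqrt (F s * w s) * indicator {0<..<1} s) * ennreal (sqrt (1 / w s) * indicator {0<..<1} s) \<partial>lborel)"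
    by (rule nn_integral_cmult) measurable
  finally have "(ennreal \<bar>remainder i0 j0 n h x\<bar>)\<^sup>2 \<le> (ennreal ?c)\<^sup>2 *
     (\<integral>\<^sup>+s. ennreal (sqrt (F s * w s) * indicator {0<..<1} s) * ennreal (sqrt (1 / w s) * indicator {0<..<1} s) \<partial>lborel)\<^sup>2"
    unfolding power_mult_distrib[symmetric] by (rule power_mono) simp
  also have "\<dots> \<le> (ennreal ?c)\<^sup>2 * ((\<integral>\<^sup>+s. (ennreal (sqrt (F s * w s) * indicator {0<..<1} s))\<^sup>2 \<partial>lborel) *
      (\<integral>\<^sup>+s. (ennreal (sqrt (1 / w s) * indicator {0<..<1} s))\<^sup>2 \<partial>lborel))"
    by (intro mult_left_mono Cauchy_Schwarz_nn_integral ms) simp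
  also have "(\<integral>\<^sup>+s. (ennreal (sqrt (F s * w s) * indicator {0<..<1} s))\<^sup>2 \<partial>lborel) = (\<integral>\<^sup>+s\<in>{0<..<1}. ennreal (w s) * ennreal (F s) \<partial>lborel)"
  proof (intro nn_integral_cong)
    fix s show "(ennreal (sqrt (F s * w s) * indicator {0<..<1} s))\<^sup>2 = ennreal (w s) * ennreal (F s) * indicator {0<..<1} s"
      using wp[of s] F0[of s] by (cases "s \<in> {0<..<1}") (simp_all add: ennreal_power mult.commute flip: ennreal_mult)
  qed
  also have "(\<integral>\<^sup>+s. (ennreal (sqrt (1 / w s) * indicator {0<..<1} s))\<^sup>2 \<partial>lborel) = (\<integral>\<^sup>+s\<in>{0<..<1}. ennreal (1 / w s) \<partial>lborel)"
  proof (intro nn_integral_cong)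
    fix s show "(ennreal (sqrt (1 / w s) * indicator {0<..<1} s))\<^sup>2 = ennreal (1 / w s) * indicator {0<..<1} s"
      using wp[of s] by (cases "s \<in> {0<..<1}") (simp_all add: ennreal_power)
  qed
  finally show ?thesis unfolding F_def using c0
    by (simp add: ennreal_power mult_ac)
qed

text \<open>The Taylor identity is available for almost every x with h fixed, not for prescribed
  pairs (x, y). Substituting y = x - h and integrating over x first makes it applicable; Tonelli's
  theorem then restores the variables x and y and moves s to the outside.\<close>

lemma taylor_L2:
  assumes n: "n > 0" and [measurable]: "X \<in> sets borel" "Y \<in> sets borel"
    and seg: "\<And>x y s. x \<in> X \<Longrightarrow> y \<in> Y \<Longrightarrow> s \<in> {0..1} \<Longrightarrow> y + s *\<^sub>R (x - y) \<in> \<Omega>"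
    and H: "\<And>x y. x \<in> X \<Longrightarrow> y \<in> Y \<Longrightarrow> \<bar>fst (x - y)\<bar> \<le> H \<and> \<bar>snd (x - y)\<bar> \<le> H"
    and w[measurable]: "w \<in> borel_measurable borel" and wp: "\<And>s. s \<in> {0<..<1} \<Longrightarrow> w s > 0"
  shows "(\<integral>\<^sup>+x\<in>X. (\<integral>\<^sup>+y\<in>Y. ennreal ((E i0 j0 x - taylor i0 j0 n (x - y) y)\<^sup>2) \<partial>lborel) \<partial>lborel)
    \<le> ennreal (((2 * H) ^ n / fact (n - 1))\<^sup>2) * (\<integral>\<^sup>+s\<in>{0<..<1}. ennreal (1 / w s) \<partial>lborel) *
      (\<integral>\<^sup>+s\<in>{0<..<1}. ennreal (w s) * (\<integral>\<^sup>+x\<in>X. (\<integral>\<^sup>+y\<in>Y.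
          ennreal (sqsum (\<lambda>i j. E (i0 + i) (j0 + j)) n (y + s *\<^sub>R (x - y))) \<partial>lborel) \<partial>lborel) \<partial>lborel)"
proof -
  let ?V = "\<lambda>i j. E (i0 + i) (j0 + j)"
  let ?cA = "ennreal (((2 * H) ^ n / fact (n - 1))\<^sup>2) * (\<integral>\<^sup>+s\<in>{0<..<1}. ennreal (1 / w s) \<partial>lborel)"
  have Tm[measurable]: "(\<lambda>p. taylor i0 j0 n (g p) (f p)) \<in> borel_measurable M"
    if "f \<in> borel_measurable M" "g \<in> borel_measurable M" for f g and M :: "'m measure"
    unfolding taylor_def by (intro borel_measurable_sum borel_measurable_divide borel_measurable_const dirW_measurable that Em)
  have Sm[measurable]: "sqsum ?V n \<in> borel_measurable borel" unfolding sqsum_def by measurable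
  have flip: "(\<integral>\<^sup>+y. G x y \<partial>lborel) = (\<integral>\<^sup>+h. G x (x - h) \<partial>lborel)"
    if "G x \<in> borel_measurable borel" for G :: "real \<times> real \<Rightarrow> real \<times> real \<Rightarrow> ennreal" and x
    using nn_integral_lborel_affine[of "G x" "-1" x] that by simp
  define P where "P x y = ennreal ((E i0 j0 x - taylor i0 j0 n (x - y) y)\<^sup>2) * indicator Y y * indicator X x" for x y
  have Pm[measurable]: "(\<lambda>(x, y). P x y) \<in> borel_measurable (borel \<Otimes>\<^sub>M borel)" unfolding P_def by measurable
  have Pm': "(\<lambda>(x, h). P x (x - h)) \<in> borel_measurable (lborel \<Otimes>\<^sub>M lborel)" unfolding P_def by measurable
  define S where "S s x y = ennreal (w s) * ennreal (sqsum ?V n (y + s *\<^sub>R (x - y))) * indicator {0<..<1} s * indicator Y y * indicator X x" for s x y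
  have Sm1[measurable]: "(\<lambda>(s, x, y). S s x y) \<in> borel_measurable (borel \<Otimes>\<^sub>M borel \<Otimes>\<^sub>M borel)" unfolding S_def by measurable
  have m1: "(\<lambda>x. \<integral>\<^sup>+s. S s x (x - h) \<partial>lborel) \<in> borel_measurable lborel" for h unfolding S_def by measurable
  have m2: "(\<lambda>h. \<integral>\<^sup>+x. (\<integral>\<^sup>+s. S s x (x - h) \<partial>lborel) \<partial>lborel) \<in> borel_measurable lborel" unfolding S_def by measurable
  have cm: "(\<integral>\<^sup>+h. (\<integral>\<^sup>+x. c * (\<integral>\<^sup>+s. S s x (x - h) \<partial>lborel) \<partial>lborel) \<partial>lborel)
      = c * (\<integral>\<^sup>+h. (\<integral>\<^sup>+x. (\<integral>\<^sup>+s. S s x (x - h) \<partial>lborel) \<partial>lborel) \<partial>lborel)" for c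
    unfolding nn_integral_cmult[OF m2, symmetric] by (intro nn_integral_cong nn_integral_cmult m1)
  have "(\<integral>\<^sup>+x\<in>X. (\<integral>\<^sup>+y\<in>Y. ennreal ((E i0 j0 x - taylor i0 j0 n (x - y) y)\<^sup>2) \<partial>lborel) \<partial>lborel)
     = (\<integral>\<^sup>+x. (\<integral>\<^sup>+y. P x y \<partial>lborel) \<partial>lborel)"
    unfolding P_def by (intro nn_integral_cong) (simp add: nn_integral_multc)
  also have "\<dots> = (\<integral>\<^sup>+x. (\<integral>\<^sup>+h. P x (x - h) \<partial>lborel) \<partial>lborel)"
    by (intro nn_integral_cong flip) (unfold P_def, measurable)
  also have "\<dots> = (\<integral>\<^sup>+h. (\<integral>\<^sup>+x. P x (x - h) \<partial>lborel) \<partial>lborel)"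
    by (rule lborel_pair.Fubini'[symmetric]) (use Pm' in \<open>simp add: P_def, measurable\<close>)
  also have "\<dots> \<le> (\<integral>\<^sup>+h. (\<integral>\<^sup>+x. ?cA * (\<integral>\<^sup>+s. S s x (x - h) \<partial>lborel) \<partial>lborel) \<partial>lborel)"
  proof (rule nn_integral_mono)
    fix h :: "real \<times> real"
    show "(\<integral>\<^sup>+x. P x (x - h) \<partial>lborel) \<le> (\<integral>\<^sup>+x. ?cA * (\<integral>\<^sup>+s. S s x (x - h) \<partial>lborel) \<partial>lborel)"
    proof (rule nn_integral_mono_AE, use taylor_AE[OF n, of h i0 j0] in eventually_elim)
      fix x assume ae: "(\<forall>s\<in>{0..1}. x - s *\<^sub>R h \<in> \<Omega>) \<longrightarrow> E i0 j0 x = taylor i0 j0 n h (x - h) + remainder i0 j0 n h x"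
      show "P x (x - h) \<le> ?cA * (\<integral>\<^sup>+s. S s x (x - h) \<partial>lborel)"
      proof (cases "x \<in> X \<and> x - h \<in> Y")
        case True
        have "x - s *\<^sub>R h \<in> \<Omega>" if "s \<in> {0..1}" for s
          using seg[of x "x - h" "1 - s"] True that by (simp add: algebra_simps)
        then have eq: "E i0 j0 x - taylor i0 j0 n h (x - h) = remainder i0 j0 n h x" using ae by simp
        have "P x (x - h) = ennreal ((remainder i0 j0 n h x)\<^sup>2)" unfolding P_def using True eq by simp
        also have "\<dots> \<le> ?cA * (\<integral>\<^sup>+s\<in>{0<..<1}. ennreal (w s) * ennreal (sqsum ?V n (x - h + s *\<^sub>R h)) \<partial>lborel)"
          using H[of x "x - h"] True by (intro remainder_bound w wp) auto
        also have "(\<integral>\<^sup>+s\<in>{0<..<1}. ennreal (w s) * ennreal (sqsum ?V n (x - h + s *\<^sub>R h)) \<partial>lborel) = (\<integral>\<^sup>+s. S s x (x - h) \<partial>lborel)"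
          unfolding S_def using True by simp
        finally show ?thesis .
      next
        case False then show ?thesis unfolding P_def by auto
      qed
    qed
  qed
  also have "\<dots> = ?cA * (\<integral>\<^sup>+h. (\<integral>\<^sup>+x. (\<integral>\<^sup>+s. S s x (x - h) \<partial>lborel) \<partial>lborel) \<partial>lborel)"
    by (rule cm)
  also have "(\<integral>\<^sup>+h. (\<integral>\<^sup>+x. (\<integral>\<^sup>+s. S s x (x - h) \<partial>lborel) \<partial>lborel) \<partial>lborel) = (\<integral>\<^sup>+x. (\<integral>\<^sup>+h. (\<integral>\<^sup>+s. S s x (x - h) \<partial>lborel) \<partial>lborel) \<partial>lborel)"
    by (rule lborel_pair.Fubini') (simp add: S_def, measurable)
  also have "\<dots> = (\<integral>\<^sup>+x. (\<integral>\<^sup>+s. (\<integral>\<^sup>+h. S s x (x - h) \<partial>lborel) \<partial>lborel) \<partial>lborel)"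
    by (intro nn_integral_cong lborel_pair.Fubini') (simp add: S_def, measurable)
  also have "\<dots> = (\<integral>\<^sup>+s. (\<integral>\<^sup>+x. (\<integral>\<^sup>+h. S s x (x - h) \<partial>lborel) \<partial>lborel) \<partial>lborel)"
    by (rule lborel_pair.Fubini') (simp add: S_def, measurable)
  also have "\<dots> = (\<integral>\<^sup>+s. (\<integral>\<^sup>+x. (\<integral>\<^sup>+y. S s x y \<partial>lborel) \<partial>lborel) \<partial>lborel)"
    by (intro nn_integral_cong flip[symmetric]) (unfold S_def, measurable)
  also have "\<dots> = (\<integral>\<^sup>+s\<in>{0<..<1}. ennreal (w s) * (\<integral>\<^sup>+x\<in>X. (\<integral>\<^sup>+y\<in>Y.
          ennreal (sqsum (\<lambda>i j. E (i0 + i) (j0 + j)) n (y + s *\<^sub>R (x - y))) \<partial>lborel) \<partial>lborel) \<partial>lborel)"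
  proof (rule nn_integral_cong)
    fix s
    have "(\<integral>\<^sup>+x. (\<integral>\<^sup>+y. S s x y \<partial>lborel) \<partial>lborel) = (\<integral>\<^sup>+x. (ennreal (w s) * indicator {0<..<1} s) *
       ((\<integral>\<^sup>+y\<in>Y. ennreal (sqsum ?V n (y + s *\<^sub>R (x - y))) \<partial>lborel) * indicator X x) \<partial>lborel)"
    proof (rule nn_integral_cong)
      fix x
      have "(\<integral>\<^sup>+y. S s x y \<partial>lborel) = (\<integral>\<^sup>+y. (ennreal (w s) * indicator {0<..<1} s * indicator X x) * (ennreal (sqsum ?V n (y + s *\<^sub>R (x - y))) * indicator Y y) \<partial>lborel)"
        unfolding S_def by (intro nn_integral_cong) (simp only: mult_ac)
      also have "\<dots> = (ennreal (w s) * indicator {0<..<1} s * indicator X x) * (\<integral>\<^sup>+y\<in>Y. ennreal (sqsum ?V n (y + s *\<^sub>R (x - y))) \<partial>lborel)"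
        by (rule nn_integral_cmult) measurable
      finally show "(\<integral>\<^sup>+y. S s x y \<partial>lborel) = (ennreal (w s) * indicator {0<..<1} s) *
       ((\<integral>\<^sup>+y\<in>Y. ennreal (sqsum ?V n (y + s *\<^sub>R (x - y))) \<partial>lborel) * indicator X x)" by (simp only: mult_ac)
    qed
    also have "\<dots> = (ennreal (w s) * indicator {0<..<1} s) * (\<integral>\<^sup>+x\<in>X. (\<integral>\<^sup>+y\<in>Y. ennreal (sqsum ?V n (y + s *\<^sub>R (x - y))) \<partial>lborel) \<partial>lborel)"
      by (rule nn_integral_cmult) measurable
    finally show "(\<integral>\<^sup>+x. (\<integral>\<^sup>+y. S s x y \<partial>lborel) \<partial>lborel) = ennreal (w s) * (\<integral>\<^sup>+x\<in>X. (\<integral>\<^sup>+y\<in>Y. ennreal (sqsum ?V n (y + s *\<^sub>R (x - y))) \<partial>lborel) \<partial>lborel) * indicator {0<..<1} s"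
      by (simp only: mult_ac)
  qed
  finally show ?thesis .
qed

end

section \<open>Interior cones\<close>

lemma rot_diff: "rot \<theta> (x - y) = rot \<theta> x - rot \<theta> y"
  by (simp add: rot_def algebra_simps)

lemma rot_add_scale: "rot \<theta> (x + t *\<^sub>R v) = rot \<theta> x + t *\<^sub>R rot \<theta> v"
  by (simp add: rot_def algebra_simps)

lemma norm_rot: "norm (rot \<theta> x) = norm x"
proof -
  have "(c * a - s * b)\<^sup>2 + (s * a + c * b)\<^sup>2 = (c\<^sup>2 + s\<^sup>2) * (a\<^sup>2 + b\<^sup>2)" for a b c s :: real
    by (simp add: power2_eq_square algebra_simps)
  from this[of "cos \<theta>" "fst x" "sin \<theta>" "snd x"] show ?thesis by (simp add: norm_prod_def rot_def)
qed

text \<open>Directions pointing below the graph, in the rotated frame, form an interior cone at all nearby points.\<close>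
lemma local_cone:
  assumes "open \<Omega>" "lipschitz_boundary \<Omega>" "p \<in> closure \<Omega>"
  shows "\<exists>d \<kappa> \<rho>. norm d = 1 \<and> 0 < \<kappa> \<and> \<kappa> \<le> 1 \<and> 0 < \<rho> \<and>
    (\<forall>x v t. x \<in> \<Omega> \<longrightarrow> dist x p < 2 * \<rho> \<longrightarrow> norm (v - d) \<le> \<kappa> \<longrightarrow> 0 \<le> t \<longrightarrow> t \<le> \<rho> \<longrightarrow> x + t *\<^sub>R v \<in> \<Omega>)"
proof -
  have small: "norm (t *\<^sub>R v) \<le> 2 * \<rho>" if "norm (v - d) \<le> \<kappa>" "\<kappa> \<le> 1" "norm d = 1" "0 \<le> t" "t \<le> \<rho>"
    for v d :: "real \<times> real" and t \<rho> \<kappa> :: real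
  proof -
    have "norm v \<le> norm (v - d) + norm d" by (metis diff_add_cancel norm_triangle_ineq)
    then have "t * norm v \<le> \<rho> * 2" using that by (intro mult_mono) auto
    then show ?thesis using that by simp
  qed
  show ?thesis
  proof (cases "p \<in> \<Omega>")
    case True
    then obtain r where r: "r > 0" "ball p r \<subseteq> \<Omega>" using assms(1) open_contains_ball by blast
    have "x + t *\<^sub>R v \<in> \<Omega>" if "dist x p < 2 * (r / 4)" "norm (v - (1,0)) \<le> 1" "0 \<le> t" "t \<le> r / 4" for x v t
    proof -
      have "norm (t *\<^sub>R v) \<le> 2 * (r / 4)" by (rule small[where d="(1,0)" and \<kappa>=1]) (use that in \<open>auto simp: norm_prod_def\<close>)
      moreover have "dist (x + t *\<^sub>R v) p \<le> dist x p + norm (t *\<^sub>R v)"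
        by (metis add.commute add_diff_eq dist_norm norm_triangle_ineq)
      ultimately have "dist (x + t *\<^sub>R v) p < r" using that by linarith
      then show ?thesis using r(2) by (auto simp: dist_commute)
    qed
    then show ?thesis using r(1)
      by (intro exI[of _ "(1,0)"] exI[of _ 1] exI[of _ "r / 4"]) (simp add: norm_prod_def)
  next
    case False
    then have "p \<in> frontier \<Omega>" using assms(1,3) by (simp add: frontier_def interior_open)
    then obtain \<theta> r h L where r: "r > 0" and L: "L-lipschitz_on UNIV h"
      and gr: "\<forall>x \<in> ball p r. x \<in> \<Omega> \<longleftrightarrow> snd (rot \<theta> (x - p)) < h (fst (rot \<theta> (x - p)))"
      using assms(2) unfolding lipschitz_boundary_def by blast
    have L0: "L \<ge> 0" using L by (rule lipschitz_on_nonneg)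
    \<comment> \<open>Per unit of t, a direction v with norm (v - d) \<le> \<kappa> descends by at
      least 1 - \<kappa> while the graph falls by at most L \<kappa>; for \<kappa> = 1 / (L + 1) the
      two agree.\<close>
    define \<kappa> where "\<kappa> = 1 / (L + 1)"
    have k: "0 < \<kappa>" "\<kappa> \<le> 1" "\<kappa> * (L + 1) = 1" using L0 unfolding \<kappa>_def by auto
    define d where "d = (- sin \<theta>, - cos \<theta>)"
    have rd: "rot \<theta> d = (0, -1)"
      unfolding d_def rot_def using sin_cos_squared_add[of \<theta>] by (simp add: power2_eq_square)
    have nd: "norm d = 1" using norm_rot[of \<theta> d] unfolding rd by (simp add: norm_prod_def)
    have "x + t *\<^sub>R v \<in> \<Omega>" if x: "x \<in> \<Omega>" "dist x p < 2 * (r / 4)" and v: "norm (v - d) \<le> \<kappa>" and t: "0 \<le> t" "t \<le> r / 4" for x v t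
    proof -
      have "norm (t *\<^sub>R v) \<le> 2 * (r / 4)" by (rule small[OF v k(2) nd t])
      moreover have "dist (x + t *\<^sub>R v) p \<le> dist x p + norm (t *\<^sub>R v)"
        by (metis add.commute add_diff_eq dist_norm norm_triangle_ineq)
      ultimately have in_ball: "x + t *\<^sub>R v \<in> ball p r" "x \<in> ball p r" using x r by (auto simp: dist_commute)
      let ?X = "rot \<theta> (x - p)" and ?V = "rot \<theta> v"
      have nV: "norm (?V - (0, -1)) \<le> \<kappa>" using v norm_rot[of \<theta> "v - d"] by (simp add: rot_diff rd)
      have V1: "\<bar>fst ?V\<bar> \<le> \<kappa>" using order_trans[OF norm_fst_le[of "fst (?V - (0,-1))" "snd (?V - (0,-1))", unfolded prod.collapse] nV] by simp
      have V2: "\<bar>snd ?V + 1\<bar> \<le> \<kappa>" using order_trans[OF norm_snd_le[of "snd (?V - (0,-1))" "fst (?V - (0,-1))", unfolded prod.collapse] nV] by simp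
      have e: "rot \<theta> (x + t *\<^sub>R v - p) = ?X + t *\<^sub>R ?V" using rot_add_scale[of \<theta> "x - p" t v] by (simp add: algebra_simps)
      have X: "snd ?X < h (fst ?X)" using gr in_ball(2) x(1) by blast
      have "\<bar>h (fst ?X) - h (fst ?X + t * fst ?V)\<bar> \<le> L * \<bar>fst ?X - (fst ?X + t * fst ?V)\<bar>"
        using lipschitz_onD[OF L, of "fst ?X" "fst ?X + t * fst ?V"] by (simp add: dist_real_def)
      also have "\<dots> \<le> L * (t * \<kappa>)" using V1 L0 t by (intro mult_left_mono) (auto simp: abs_mult mult_left_mono)
      finally have hh: "h (fst ?X) \<le> h (fst ?X + t * fst ?V) + L * (t * \<kappa>)" by linarith
      have "snd ?V \<le> - 1 + \<kappa>" using V2 by linarith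
      then have "t * snd ?V \<le> t * (- 1 + \<kappa>)" using t by (intro mult_left_mono) auto
      moreover have "t * (- 1 + \<kappa>) + L * (t * \<kappa>) = t * (\<kappa> * (L + 1) - 1)" by (simp add: algebra_simps)
      ultimately have "snd ?X + t * snd ?V < h (fst ?X + t * fst ?V)" using X hh k(3) by simp
      then show ?thesis using gr in_ball(1) e by auto
    qed
    then show ?thesis using nd k(1,2) r
      by (intro exI[of _ d] exI[of _ \<kappa>] exI[of _ "r / 4"]) simp
  qed
qed

text \<open>Compactness of the closure. The factor 2 in \<open>local_cone\<close> is the reserve for
  it: a point within the common radius of x0 is within twice the local radius of the centre whose
  ball contains x0.\<close>

lemma uniform_cone:
  assumes "open \<Omega>" "bounded \<Omega>" "\<Omega> \<noteq> {}" "lipschitz_boundary \<Omega>"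
  obtains \<kappa> \<rho> where "0 < \<kappa>" "\<kappa> \<le> 1" "0 < \<rho>"
    "\<And>x0. x0 \<in> closure \<Omega> \<Longrightarrow> \<exists>d. norm d = 1 \<and> (\<forall>x v t. x \<in> \<Omega> \<longrightarrow> dist x x0 < \<rho> \<longrightarrow> norm (v - d) \<le> \<kappa> \<longrightarrow>
        0 \<le> t \<longrightarrow> t \<le> \<rho> \<longrightarrow> x + t *\<^sub>R v \<in> \<Omega>)"
proof -
  define P where "P p d \<kappa> \<rho> \<longleftrightarrow> norm d = 1 \<and> 0 < \<kappa> \<and> \<kappa> \<le> 1 \<and> 0 < \<rho> \<and>
    (\<forall>x v t. x \<in> \<Omega> \<longrightarrow> dist x p < 2 * \<rho> \<longrightarrow> norm (v - d) \<le> \<kappa> \<longrightarrow> 0 \<le> t \<longrightarrow> t \<le> \<rho> \<longrightarrow> x + t *\<^sub>R v \<in> \<Omega>)"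
    for p d :: "real \<times> real" and \<kappa> \<rho> :: real
  have "\<forall>p\<in>closure \<Omega>. \<exists>d \<kappa> \<rho>. P p d \<kappa> \<rho>" unfolding P_def using local_cone[OF assms(1,4)] by blast
  then obtain d \<kappa> \<rho> where P: "\<And>p. p \<in> closure \<Omega> \<Longrightarrow> P p (d p) (\<kappa> p) (\<rho> p)" by metis
  have cc: "compact (closure \<Omega>)" using assms(2) by (simp add: compact_closure)
  have cov: "closure \<Omega> \<subseteq> (\<Union>p\<in>closure \<Omega>. ball p (\<rho> p))"
  proof
    fix p assume "p \<in> closure \<Omega>"
    moreover from this have "\<rho> p > 0" using P unfolding P_def by blast
    ultimately show "p \<in> (\<Union>p\<in>closure \<Omega>. ball p (\<rho> p))" using centre_in_ball by blast
  qed
  obtain D where D: "D \<subseteq> closure \<Omega>" "finite D" "closure \<Omega> \<subseteq> (\<Union>p\<in>D. ball p (\<rho> p))"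
    using compactE_image[OF cc _ cov] by auto
  have Dne: "D \<noteq> {}" using D(3) assms(3) closure_subset by blast
  define K where "K = Min (\<kappa> ` D)"
  define R where "R = Min (\<rho> ` D)"
  have K: "K \<le> \<kappa> p" "R \<le> \<rho> p" if "p \<in> D" for p using D(2) that unfolding K_def R_def by auto
  have PD: "P p (d p) (\<kappa> p) (\<rho> p)" if "p \<in> D" for p using P D(1) that by blast
  have K0: "0 < K" "0 < R" unfolding K_def R_def using D(2) Dne PD unfolding P_def by auto
  have K1: "K \<le> 1" using K(1) PD Dne unfolding P_def by (metis all_not_in_conv order_trans)
  show thesis
  proof (rule that[OF K0(1) K1 K0(2)])
    fix x0 assume "x0 \<in> closure \<Omega>"
    then obtain p where p: "p \<in> D" "dist p x0 < \<rho> p" using D(3) by auto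
    have "x + t *\<^sub>R v \<in> \<Omega>" if "x \<in> \<Omega>" "dist x x0 < R" "norm (v - d p) \<le> K" "0 \<le> t" "t \<le> R" for x v t
    proof -
      have "dist x p < 2 * \<rho> p" using dist_triangle[of x p x0] that(2) p(2) K(2)[OF p(1)] by (simp add: dist_commute)
      then show ?thesis using PD[OF p(1)] that K[OF p(1)] unfolding P_def by (meson order_trans)
    qed
    then show "\<exists>d. norm d = 1 \<and> (\<forall>x v t. x \<in> \<Omega> \<longrightarrow> dist x x0 < R \<longrightarrow> norm (v - d) \<le> K \<longrightarrow>
        0 \<le> t \<longrightarrow> t \<le> R \<longrightarrow> x + t *\<^sub>R v \<in> \<Omega>)"
      using PD[OF p(1)] unfolding P_def by (intro exI[of _ "d p"]) blast
  qed
qed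

text \<open>Chebyshev: if every y violated one of the bounds, the sum of all f j / b j would be at
  least 2 card J / V on Y and have an integral of at least 2 card J, while this integral is at most
  card J. Thus finitely many averaged estimates become estimates at one common centre.\<close>

lemma choose_point:
  fixes f :: "'j \<Rightarrow> real \<times> real \<Rightarrow> ennreal"
  assumes J: "finite J" "J \<noteq> {}" and [measurable]: "\<And>j. j \<in> J \<Longrightarrow> f j \<in> borel_measurable borel" and Y[measurable]: "Y \<in> sets borel"
    and b: "\<And>j. j \<in> J \<Longrightarrow> b j > 0" "\<And>j. j \<in> J \<Longrightarrow> (\<integral>\<^sup>+y\<in>Y. f j y \<partial>lborel) \<le> ennreal (b j)"
    and V: "emeasure lborel Y = ennreal V" "V > 0"
  shows "\<exists>y\<in>Y. \<forall>j\<in>J. f j y \<le> ennreal (2 * real (card J) * b j / V)"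
proof (rule ccontr)
  assume "\<not> ?thesis"
  then have H: "\<And>y. y \<in> Y \<Longrightarrow> \<exists>j\<in>J. ennreal (2 * real (card J) * b j / V) < f j y" by (auto simp: not_le)
  define N where "N = real (card J)"
  have N: "N \<ge> 1" unfolding N_def using J by (simp add: Suc_le_eq card_gt_0_iff)
  define g where "g y = (\<Sum>j\<in>J. ennreal (1 / b j) * f j y)" for y
  have g: "ennreal (2 * N / V) \<le> g y" if yY: "y \<in> Y" for y
  proof -
    obtain j where j: "j \<in> J" "ennreal (2 * N * b j / V) < f j y" using H[OF yY] unfolding N_def by blast
    have "ennreal (2 * N / V) = ennreal (1 / b j) * ennreal (2 * N * b j / V)"
      using b(1)[OF j(1)] N V(2) by (simp flip: ennreal_mult)
    also have "\<dots> \<le> ennreal (1 / b j) * f j y" using j(2) by (intro mult_left_mono) auto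
    also have "\<dots> \<le> g y" unfolding g_def using J(1) j(1)
      by (intro member_le_sum[of j J "\<lambda>j. ennreal (1 / b j) * f j y"]) auto
    finally show ?thesis .
  qed
  have "ennreal (2 * N) = ennreal (2 * N / V) * emeasure lborel Y"
    unfolding V(1) using V(2) N by (simp flip: ennreal_mult)
  also have "\<dots> = (\<integral>\<^sup>+y\<in>Y. ennreal (2 * N / V) \<partial>lborel)" by (simp add: nn_integral_cmult_indicator)
  also have "\<dots> \<le> (\<integral>\<^sup>+y\<in>Y. g y \<partial>lborel)" using g by (intro nn_integral_mono) (simp add: indicator_def)
  also have "\<dots> = (\<integral>\<^sup>+y. (\<Sum>j\<in>J. ennreal (1 / b j) * (f j y * indicator Y y)) \<partial>lborel)"
    unfolding g_def by (simp add: sum_distrib_right mult.assoc)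
  also have "\<dots> = (\<Sum>j\<in>J. ennreal (1 / b j) * (\<integral>\<^sup>+y\<in>Y. f j y \<partial>lborel))"
    by (subst nn_integral_sum) (auto intro!: sum.cong nn_integral_cmult)
  also have "\<dots> \<le> (\<Sum>j\<in>J. 1)"
  proof (rule sum_mono)
    fix j assume j: "j \<in> J"
    have "ennreal (1 / b j) * (\<integral>\<^sup>+y\<in>Y. f j y \<partial>lborel) \<le> ennreal (1 / b j) * ennreal (b j)"
      by (intro mult_left_mono b j) simp
    also have "\<dots> = 1" using b(1)[OF j] by (simp flip: ennreal_mult)
    finally show "ennreal (1 / b j) * (\<integral>\<^sup>+y\<in>Y. f j y \<partial>lborel) \<le> 1" .
  qed
  also have "\<dots> = ennreal N" unfolding N_def by (simp add: ennreal_of_nat_eq_real_of_nat)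
  finally have "2 * N \<le> N" using N by (subst (asm) ennreal_le_iff) auto
  then show False using N by simp
qed

lemma powr_nn_integral:
  assumes "0 \<le> a" "a < 1"
  shows "(\<integral>\<^sup>+s\<in>{0<..<1}. ennreal ((1 - s) powr (- a)) \<partial>lborel) \<le> ennreal (1 / (1 - a))"
proof -
  have "((\<lambda>x. x powr (- a)) has_integral (1 powr (- a + 1) / (- a + 1))) {0..1::real}"
    by (rule has_integral_powr_from_0) (use assms in auto)
  then have "((\<lambda>x. x powr (- a)) has_integral (1 / (1 - a))) {0..1::real}" by simp
  then have "((\<lambda>x. if x \<in> {0..1} then x powr (- a) else 0) has_integral (1 / (1 - a))) UNIV"
    by (simp only: has_integral_restrict_UNIV)
  then have "(\<integral>\<^sup>+x. ennreal (if x \<in> {0..1} then x powr (- a) else 0) \<partial>lborel) = ennreal (1 / (1 - a))"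
    by (intro nn_integral_has_integral_lborel) auto
  then have "(\<integral>\<^sup>+x. ennreal (indicator {0..1} x * x powr (- a)) \<partial>lborel) = ennreal (1 / (1 - a))"
    by (subst nn_integral_cong[where v="\<lambda>x. ennreal (if x \<in> {0..1} then x powr (- a) else 0)"]) (simp_all add: indicator_def)
  moreover have "(\<integral>\<^sup>+x. ennreal (indicator {0..1} x * x powr (- a)) \<partial>lborel)
     = (\<integral>\<^sup>+s. ennreal (indicator {0..1} (1 - s) * (1 - s) powr (- a)) \<partial>lborel)"
    using nn_integral_real_affine[of "\<lambda>x. ennreal (indicator {0..1} x * x powr (- a))" "-1" 1] by simp
  moreover have "(\<integral>\<^sup>+s\<in>{0<..<1}. ennreal ((1 - s) powr (- a)) \<partial>lborel) \<le> (\<integral>\<^sup>+s. ennreal (indicator {0..1} (1 - s) * (1 - s) powr (- a)) \<partial>lborel)"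
    by (intro nn_integral_mono) (auto simp: indicator_def)
  ultimately show ?thesis by simp
qed

lemma sqsum_shift_le: "sqsum (\<lambda>i j. E (i0 + i) (j0 + j)) n z \<le> sqsum E (n + i0 + j0) z"
proof -
  have "sqsum (\<lambda>i j. E (i0 + i) (j0 + j)) n z = (\<Sum>i\<in>(+) i0 ` {..n}. (E i (n + i0 + j0 - i) z)\<^sup>2)"
    unfolding sqsum_def by (subst sum.reindex) (auto intro!: sum.cong simp: algebra_simps)
  also have "\<dots> \<le> sqsum E (n + i0 + j0) z"
    unfolding sqsum_def by (rule sum_mono2) auto
  finally show ?thesis .
qed

text \<open>Differentiating the homogeneous part of degree k + 1 in h produces the parts of degree k
  that belong to the two first derivatives; the absorption identities for binomial coefficients
  supply the factor that turns one factorial into the other.\<close>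

lemma dirW_has_derivative_h:
  "((\<lambda>h. dirW V (Suc k) h y / fact (Suc k)) has_derivative
     (\<lambda>e. fst e * (dirW (\<lambda>i j. V (Suc i) j) k h y / fact k) + snd e * (dirW (\<lambda>i j. V i (Suc j)) k h y / fact k))) (at h)"
proof -
  let ?n = "Suc k"
  have d: "((\<lambda>h. fst h ^ i * snd h ^ j) has_derivative
      (\<lambda>e. fst e * (real i * fst h ^ (i - 1) * snd h ^ j) + snd e * (fst h ^ i * (real j * snd h ^ (j - 1))))) (at h)" for i j and h :: "real \<times> real"
    by (auto intro!: derivative_eq_intros simp: fun_eq_iff algebra_simps)
  have D: "((\<lambda>h. dirW V ?n h y) has_derivative
     (\<lambda>e. \<Sum>i\<le>?n. real (?n choose i) * ((fst e * (real i * fst h ^ (i - 1) * snd h ^ (?n - i)) +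
        snd e * (fst h ^ i * (real (?n - i) * snd h ^ (?n - i - 1)))) * V i (?n - i) y))) (at h)"
    unfolding dirW_def
    by (intro has_derivative_sum has_derivative_mult_right has_derivative_mult_left d)
  have 1: "(\<Sum>i\<le>?n. real (?n choose i) * (real i * fst h ^ (i - 1) * snd h ^ (?n - i)) * V i (?n - i) y)
      = real ?n * dirW (\<lambda>i j. V (Suc i) j) k h y"
  proof -
    have "(\<Sum>i\<le>?n. real (?n choose i) * (real i * fst h ^ (i - 1) * snd h ^ (?n - i)) * V i (?n - i) y)
       = (\<Sum>i\<le>k. real (?n choose Suc i) * (real (Suc i) * fst h ^ i * snd h ^ (k - i)) * V (Suc i) (k - i) y)"
      by (subst sum.atMost_Suc_shift) simp
    also have "\<dots> = (\<Sum>i\<le>k. real ?n * (real (k choose i) * (fst h ^ i * snd h ^ (k - i) * V (Suc i) (k - i) y)))"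
    proof (rule sum.cong[OF refl])
      fix i
      have "real (?n choose Suc i) * real (Suc i) = real ?n * real (k choose i)"
        by (metis Suc_times_binomial_eq of_nat_mult)
      then show "real (?n choose Suc i) * (real (Suc i) * fst h ^ i * snd h ^ (k - i)) * V (Suc i) (k - i) y
        = real ?n * (real (k choose i) * (fst h ^ i * snd h ^ (k - i) * V (Suc i) (k - i) y))"
        by (simp only: mult.assoc[symmetric])
    qed
    finally show ?thesis unfolding dirW_def by (simp only: sum_distrib_left)
  qed
  have 2: "(\<Sum>i\<le>?n. real (?n choose i) * (fst h ^ i * (real (?n - i) * snd h ^ (?n - i - 1))) * V i (?n - i) y)
      = real ?n * dirW (\<lambda>i j. V i (Suc j)) k h y"
  proof -
    have "(\<Sum>i\<le>?n. real (?n choose i) * (fst h ^ i * (real (?n - i) * snd h ^ (?n - i - 1))) * V i (?n - i) y)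
       = (\<Sum>i\<le>k. real (?n choose i) * (fst h ^ i * (real (?n - i) * snd h ^ (?n - i - 1))) * V i (?n - i) y)"
      by simp
    also have "\<dots> = (\<Sum>i\<le>k. real ?n * (real (k choose i) * (fst h ^ i * snd h ^ (k - i) * V i (Suc (k - i)) y)))"
    proof (rule sum.cong[OF refl])
      fix i assume i: "i \<in> {..k}"
      have e: "real (?n - i) * real (?n choose i) = real ?n * real (k choose i)"
        using binomial_absorb_comp[of ?n i] by (metis diff_Suc_1 of_nat_mult)
      have s: "?n - i = Suc (k - i)" "?n - i - 1 = k - i" using i by auto
      have "real (?n choose i) * (fst h ^ i * (real (?n - i) * snd h ^ (?n - i - 1))) * V i (?n - i) y
        = (real (?n - i) * real (?n choose i)) * (fst h ^ i * snd h ^ (k - i) * V i (Suc (k - i)) y)"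
        unfolding s(2) s(1)[symmetric] by (simp only: mult_ac)
      then show "real (?n choose i) * (fst h ^ i * (real (?n - i) * snd h ^ (?n - i - 1))) * V i (?n - i) y
        = real ?n * (real (k choose i) * (fst h ^ i * snd h ^ (k - i) * V i (Suc (k - i)) y))"
        unfolding e by (simp only: mult.assoc)
    qed
    finally show ?thesis unfolding dirW_def by (simp only: sum_distrib_left)
  qed
  have S: "(\<Sum>i\<le>?n. real (?n choose i) * ((fst e * (real i * fst h ^ (i - 1) * snd h ^ (?n - i)) +
        snd e * (fst h ^ i * (real (?n - i) * snd h ^ (?n - i - 1)))) * V i (?n - i) y))
      = fst e * (real ?n * dirW (\<lambda>i j. V (Suc i) j) k h y) + snd e * (real ?n * dirW (\<lambda>i j. V i (Suc j)) k h y)" for e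
    unfolding 1[symmetric] 2[symmetric] sum_distrib_left sum.distrib[symmetric]
    by (rule sum.cong) (simp_all add: algebra_simps)
  have f: "real ?n * c / fact ?n = c / fact k" for c by (simp del: of_nat_Suc)
  show ?thesis
    using bounded_linear.has_derivative[OF bounded_linear_divide[of "fact ?n"] D] unfolding S
    by (rule has_derivative_eq_rhs) (simp add: fun_eq_iff add_divide_distrib f[symmetric] del: of_nat_Suc fact_Suc)
qed

context weak_family
begin

text \<open>The gradient of the Taylor polynomial is the Taylor polynomial of the gradient with one
  order less. Gradient errors are therefore Taylor errors again, and no inverse estimate for
  polynomials enters.\<close>

lemma taylor_has_derivative:
  "((\<lambda>x. taylor 0 0 (Suc p) (x - y) y) has_derivative
     (\<lambda>e. fst e * taylor 1 0 p (x - y) y + snd e * taylor 0 1 p (x - y) y)) (at x)"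
proof -
  have sh: "((\<lambda>x. x - y) has_derivative (\<lambda>e. e)) (at x)" by (auto intro!: derivative_eq_intros)
  have eq: "taylor 0 0 (Suc p) h y = E 0 0 y + (\<Sum>k<p. dirW E (Suc k) h y / fact (Suc k))" for h
    unfolding taylor_def by (subst sum.lessThan_Suc_shift) (simp add: dirW_def)
  have "((\<lambda>x. E 0 0 y + (\<Sum>k<p. dirW E (Suc k) (x - y) y / fact (Suc k))) has_derivative
     (\<lambda>e. 0 + (\<Sum>k<p. fst e * (dirW (\<lambda>i j. E (Suc i) j) k (x - y) y / fact k) + snd e * (dirW (\<lambda>i j. E i (Suc j)) k (x - y) y / fact k)))) (at x)"
    by (intro has_derivative_add has_derivative_const has_derivative_sum
        has_derivative_compose[OF sh dirW_has_derivative_h])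
  then show ?thesis unfolding eq
    by (rule has_derivative_eq_rhs) (simp add: fun_eq_iff taylor_def sum.distrib sum_distrib_left)
qed

end

section \<open>Local polynomial approximation\<close>

lemma emeasure_ball_plane: "0 \<le> r \<Longrightarrow> emeasure lborel (ball (x :: real \<times> real) r) = ennreal (pi * r\<^sup>2)"
  by (simp add: emeasure_ball unit_ball_vol_2 power2_eq_square)

lemma ennreal_mult_le_divide:
  assumes "ennreal V * I \<le> ennreal K" "V > 0" "0 \<le> K" shows "I \<le> ennreal (K / V)"
proof -
  have "I = ennreal (1 / V) * (ennreal V * I)"
    using assms(2) by (simp add: mult.assoc[symmetric] flip: ennreal_mult)
  also have "\<dots> \<le> ennreal (1 / V) * ennreal K" using assms(1) by (intro mult_left_mono) auto
  also have "\<dots> = ennreal (K / V)" using assms(2,3) by (simp flip: ennreal_mult)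
  finally show ?thesis .
qed

text \<open>Averaging (g x)^2 \<le> 2 (g x - g y)^2 + 2 (g y)^2 over y transfers a bound from the
  set Y to the set X.\<close>

lemma nn_integral_L2_split:
  fixes g :: "real \<times> real \<Rightarrow> real"
  assumes [measurable]: "g \<in> borel_measurable borel" "X \<in> sets borel" "Y \<in> sets borel"
  shows "emeasure lborel Y * (sq_int X g)
    \<le> 2 * (\<integral>\<^sup>+x\<in>X. (\<integral>\<^sup>+y\<in>Y. ennreal ((g x - g y)\<^sup>2) \<partial>lborel) \<partial>lborel)
      + 2 * emeasure lborel X * (\<integral>\<^sup>+y\<in>Y. ennreal ((g y)\<^sup>2) \<partial>lborel)"
proof -
  have 2: "(2::ennreal) * ennreal a = ennreal (2 * a)" if "0 \<le> a" for a
    using that by (simp add: ennreal_mult)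
  have p: "ennreal ((g x)\<^sup>2) \<le> 2 * ennreal ((g x - g y)\<^sup>2) + 2 * ennreal ((g y)\<^sup>2)" for x y
  proof -
    have "0 \<le> (g x - 2 * g y)\<^sup>2" by simp
    then have "(g x)\<^sup>2 \<le> 2 * (g x - g y)\<^sup>2 + 2 * (g y)\<^sup>2" by (simp add: power2_eq_square algebra_simps)
    then show ?thesis by (simp add: 2 flip: ennreal_plus)
  qed
  have "emeasure lborel Y * (sq_int X g)
     = (\<integral>\<^sup>+x\<in>X. (emeasure lborel Y * ennreal ((g x)\<^sup>2)) \<partial>lborel)"
    by (subst nn_integral_cmult[symmetric]) (auto simp: mult.assoc)
  also have "\<dots> = (\<integral>\<^sup>+x\<in>X. (\<integral>\<^sup>+y\<in>Y. ennreal ((g x)\<^sup>2) \<partial>lborel) \<partial>lborel)"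
    by (intro nn_integral_cong) (subst nn_integral_cmult_indicator, simp_all add: mult_ac)
  also have "\<dots> \<le> (\<integral>\<^sup>+x\<in>X. (2 * (\<integral>\<^sup>+y\<in>Y. ennreal ((g x - g y)\<^sup>2) \<partial>lborel) + 2 * (\<integral>\<^sup>+y\<in>Y. ennreal ((g y)\<^sup>2) \<partial>lborel)) \<partial>lborel)"
  proof (intro nn_integral_mono mult_right_mono)
    fix x
    have "(\<integral>\<^sup>+y\<in>Y. ennreal ((g x)\<^sup>2) \<partial>lborel) \<le> (\<integral>\<^sup>+y. 2 * (ennreal ((g x - g y)\<^sup>2) * indicator Y y) + 2 * (ennreal ((g y)\<^sup>2) * indicator Y y) \<partial>lborel)"
      using p[of x] by (intro nn_integral_mono) (simp add: indicator_def)
    also have "\<dots> = 2 * (\<integral>\<^sup>+y\<in>Y. ennreal ((g x - g y)\<^sup>2) \<partial>lborel) + 2 * (\<integral>\<^sup>+y\<in>Y. ennreal ((g y)\<^sup>2) \<partial>lborel)"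
      by (simp add: nn_integral_add nn_integral_cmult)
    finally show "(\<integral>\<^sup>+y\<in>Y. ennreal ((g x)\<^sup>2) \<partial>lborel) \<le> 2 * (\<integral>\<^sup>+y\<in>Y. ennreal ((g x - g y)\<^sup>2) \<partial>lborel) + 2 * (\<integral>\<^sup>+y\<in>Y. ennreal ((g y)\<^sup>2) \<partial>lborel)" .
  qed simp
  also have "\<dots> = (\<integral>\<^sup>+x. 2 * ((\<integral>\<^sup>+y\<in>Y. ennreal ((g x - g y)\<^sup>2) \<partial>lborel) * indicator X x) + (2 * (\<integral>\<^sup>+y\<in>Y. ennreal ((g y)\<^sup>2) \<partial>lborel)) * indicator X x \<partial>lborel)"
    by (intro nn_integral_cong) (simp add: distrib_right mult.assoc)
  also have "\<dots> = 2 * (\<integral>\<^sup>+x\<in>X. (\<integral>\<^sup>+y\<in>Y. ennreal ((g x - g y)\<^sup>2) \<partial>lborel) \<partial>lborel) + (2 * (\<integral>\<^sup>+y\<in>Y. ennreal ((g y)\<^sup>2) \<partial>lborel)) * emeasure lborel X"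
    by (subst nn_integral_add) (simp_all add: nn_integral_cmult nn_integral_cmult_indicator)
  finally show ?thesis by (simp add: mult_ac)
qed

text \<open>The weight \<delta> stands for the distance to the corners cut at 1, and
  \<open>delta_ball\<close> expresses that corners lie outside \<Omega>. One exponent \<gamma>
  between 1 and 2 replaces the exponents of the corners: the weight is then absent for orders 0 and
  1 and has exponent 2 - \<gamma> in (0, 1) for order 2.\<close>

locale cone_family = weak_family +
  fixes \<kappa> \<rho> \<gamma> C A :: real and \<delta> :: "real \<times> real \<Rightarrow> real"
  assumes kappa: "0 < \<kappa>" "\<kappa> \<le> 1" and rho: "0 < \<rho>"
    and cone: "\<And>x0. x0 \<in> closure \<Omega> \<Longrightarrow> \<exists>d. norm d = 1 \<and> (\<forall>x v t. x \<in> \<Omega> \<longrightarrow> dist x x0 < \<rho> \<longrightarrow> norm (v - d) \<le> \<kappa> \<longrightarrow>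
        0 \<le> t \<longrightarrow> t \<le> \<rho> \<longrightarrow> x + t *\<^sub>R v \<in> \<Omega>)"
    and delta_le: "\<And>x. \<delta> x \<le> 1" and delta_ball: "\<And>x r. ball x r \<subseteq> \<Omega> \<Longrightarrow> 0 \<le> r \<Longrightarrow> r \<le> 1 \<Longrightarrow> r \<le> \<delta> x"
    and gam: "1 < \<gamma>" "\<gamma> < 2" and CA: "0 < C" "0 < A"
    and delta_m[measurable]: "\<delta> \<in> borel_measurable borel"
    and weighted: "\<And>k. (\<integral>\<^sup>+x\<in>\<Omega>. ennreal (\<delta> x powr (2 * max 0 (real k - \<gamma>)) * sqsum E k x) \<partial>lborel) \<le> ennreal ((C * A ^ k * fact k)\<^sup>2)"
begin

text \<open>A deviation of up to 4 r must fit into the cone of opening \<kappa> at distance M r: 2 r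
  come from the positions of x and y in their balls, 2 r from the ball around the segment
  point.\<close>

definition "M = 4 / \<kappa>"

lemma M4: "M \<ge> 4" "M * \<kappa> = 4"
  using kappa unfolding M_def by (auto simp: le_divide_eq)

lemma Om_sets[measurable]: "\<Omega> \<in> sets borel" using op by simp

lemma sqsum_m[measurable]: "sqsum (\<lambda>i j. E (i0 + i) (j0 + j)) k \<in> borel_measurable borel" "sqsum E k \<in> borel_measurable borel"
  unfolding sqsum_def by measurable

text \<open>The second ball has radius r and lies at distance M r in the cone direction. At
  parameter s the segment has left x by (1 - s) (y - x), and there the cone has room for a ball of
  radius 2 r (1 - s): the distance to the boundary grows linearly away from x, even if x is
  arbitrarily close to a corner.\<close>

lemma patch_geom:
  assumes x0: "x0 \<in> closure \<Omega>" and r: "0 < r" "M * r \<le> \<rho>"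
  obtains d where "norm d = 1"
    "\<And>x y. x \<in> ball x0 r \<Longrightarrow> y \<in> ball (x0 + (M * r) *\<^sub>R d) r \<Longrightarrow> norm (x - y) \<le> (M + 2) * r"
    "\<And>x y s. x \<in> \<Omega> \<inter> ball x0 r \<Longrightarrow> y \<in> ball (x0 + (M * r) *\<^sub>R d) r \<Longrightarrow> s \<in> {0..1} \<Longrightarrow>
       y + s *\<^sub>R (x - y) \<in> \<Omega> \<inter> ball x0 ((M + 1) * r) \<and> ball (y + s *\<^sub>R (x - y)) ((1 - s) * (2 * r)) \<subseteq> \<Omega>"
proof -
  obtain d where d: "norm d = 1" "\<And>x v t. x \<in> \<Omega> \<Longrightarrow> dist x x0 < \<rho> \<Longrightarrow> norm (v - d) \<le> \<kappa> \<Longrightarrow>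
        0 \<le> t \<Longrightarrow> t \<le> \<rho> \<Longrightarrow> x + t *\<^sub>R v \<in> \<Omega>" using cone[OF x0] by blast
  have "1 * r \<le> M * r" using r M4(1) by (intro mult_right_mono) auto
  then have rr: "r \<le> \<rho>" using r(2) by linarith
  have yx: "norm (y - x - (M * r) *\<^sub>R d) \<le> 2 * r" if "x \<in> ball x0 r" "y \<in> ball (x0 + (M * r) *\<^sub>R d) r" for x y
  proof -
    have e: "y - x - (M * r) *\<^sub>R d = (y - (x0 + (M * r) *\<^sub>R d)) + (x0 - x)" by simp
    have "norm (y - x - (M * r) *\<^sub>R d) \<le> norm (y - (x0 + (M * r) *\<^sub>R d)) + norm (x0 - x)"
      unfolding e by (rule norm_triangle_ineq)
    then show ?thesis using that by (simp add: dist_norm norm_minus_commute)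
  qed
  have nM: "norm ((M * r) *\<^sub>R d) = M * r" using d(1) M4 r by simp
  show thesis
  proof (rule that[OF d(1)])
    fix x y assume xy: "x \<in> ball x0 r" "y \<in> ball (x0 + (M * r) *\<^sub>R d) r"
    have "norm (x - y) = norm ((y - x - (M * r) *\<^sub>R d) + (M * r) *\<^sub>R d)" by (simp add: norm_minus_commute)
    also have "\<dots> \<le> norm (y - x - (M * r) *\<^sub>R d) + norm ((M * r) *\<^sub>R d)" by (rule norm_triangle_ineq)
    also have "\<dots> \<le> (M + 2) * r" using yx[OF xy] unfolding nM by (simp add: algebra_simps)
    finally show "norm (x - y) \<le> (M + 2) * r" .
  next
    fix x y s assume xy: "x \<in> \<Omega> \<inter> ball x0 r" "y \<in> ball (x0 + (M * r) *\<^sub>R d) r" and s: "s \<in> {0..1::real}"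
    let ?z = "y + s *\<^sub>R (x - y)"
    have ballO: "ball ?z ((1 - s) * (2 * r)) \<subseteq> \<Omega>"
    proof
      fix z' assume z': "z' \<in> ball ?z ((1 - s) * (2 * r))"
      have "0 < (1 - s) * (2 * r)" using z' zero_le_dist[of ?z z'] unfolding mem_ball by linarith
      then have s1: "s < 1" using r(1) by (simp add: zero_less_mult_iff)
      define \<tau> where "\<tau> = (1 - s) * (M * r)"
      have t0: "\<tau> > 0" unfolding \<tau>_def using s1 r M4 by simp
      have t1: "\<tau> \<le> \<rho>"
      proof -
        have "\<tau> \<le> 1 * (M * r)" unfolding \<tau>_def using s r M4 by (intro mult_right_mono) auto
        then show ?thesis using r by simp
      qed
      have "z' - x - \<tau> *\<^sub>R d = (z' - ?z) + (1 - s) *\<^sub>R (y - x - (M * r) *\<^sub>R d)"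
        unfolding \<tau>_def by (simp add: algebra_simps)
      then have "norm (z' - x - \<tau> *\<^sub>R d) \<le> norm (z' - ?z) + norm ((1 - s) *\<^sub>R (y - x - (M * r) *\<^sub>R d))"
        by (metis norm_triangle_ineq)
      also have "\<dots> \<le> (1 - s) * (2 * r) + (1 - s) * (2 * r)"
        using z' yx[of x y] xy s1 by (intro add_mono) (auto simp: dist_norm norm_minus_commute intro!: mult_left_mono)
      also have "\<dots> = (1 - s) * r * (M * \<kappa>)" unfolding M4(2) by (simp add: algebra_simps)
      also have "\<dots> = \<tau> * \<kappa>" unfolding \<tau>_def by (simp only: mult_ac)
      finally have n: "norm (z' - x - \<tau> *\<^sub>R d) \<le> \<tau> * \<kappa>" .
      have "(1 / \<tau>) *\<^sub>R (z' - x) - d = (1 / \<tau>) *\<^sub>R (z' - x - \<tau> *\<^sub>R d)" using t0 by (simp add: scaleR_right_diff_distrib)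
      then have "norm ((1 / \<tau>) *\<^sub>R (z' - x) - d) = norm (z' - x - \<tau> *\<^sub>R d) / \<tau>" using t0 by simp
      also have "\<dots> \<le> \<kappa>" using n t0 by (simp add: divide_le_eq mult.commute)
      finally have "x + \<tau> *\<^sub>R ((1 / \<tau>) *\<^sub>R (z' - x)) \<in> \<Omega>"
        using xy t0 t1 rr by (intro d(2)) (auto simp: dist_commute)
      then show "z' \<in> \<Omega>" using t0 by simp
    qed
    have zO: "?z \<in> \<Omega>"
    proof (cases "s = 1")
      case True then show ?thesis using xy by simp
    next
      case False
      then have "0 < (1 - s) * (2 * r)" using s r(1) by simp
      then have "?z \<in> ball ?z ((1 - s) * (2 * r))" by simp
      then show ?thesis using ballO by blast
    qed
    have "?z \<in> ball x0 ((M + 1) * r)"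
    proof -
      have "dist x0 y \<le> dist x0 (x0 + (M * r) *\<^sub>R d) + dist (x0 + (M * r) *\<^sub>R d) y" by (rule dist_triangle)
      also have "\<dots> < M * r + r" using xy(2) nM by (simp add: dist_norm)
      finally have y: "y \<in> ball x0 ((M + 1) * r)" by (simp add: algebra_simps)
      have "r \<le> (M + 1) * r" using M4 r by (simp add: mult_le_cancel_right1)
      then have x: "x \<in> ball x0 ((M + 1) * r)" using xy(1) by auto
      have "?z = (1 - s) *\<^sub>R y + s *\<^sub>R x" by (simp add: algebra_simps)
      then show ?thesis using convexD_alt[OF convex_ball y x, of s] s by simp
    qed
    then show "?z \<in> \<Omega> \<inter> ball x0 ((M + 1) * r) \<and> ball ?z ((1 - s) * (2 * r)) \<subseteq> \<Omega>" using zO ballO by blast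
  qed
qed

lemma weighted_local:
  assumes U: "U \<in> sets borel" "U \<subseteq> \<Omega>" and d: "0 < d" "\<And>x. x \<in> U \<Longrightarrow> d \<le> \<delta> x"
  shows "(\<integral>\<^sup>+x\<in>U. ennreal (sqsum E k x) \<partial>lborel) \<le> ennreal (d powr (- 2 * max 0 (real k - \<gamma>)) * (C * A ^ k * fact k)\<^sup>2)"
proof -
  let ?m = "2 * max 0 (real k - \<gamma>)"
  have "(\<integral>\<^sup>+x\<in>U. ennreal (sqsum E k x) \<partial>lborel)
      \<le> (\<integral>\<^sup>+x. ennreal (d powr (- ?m)) * (ennreal (\<delta> x powr ?m * sqsum E k x) * indicator \<Omega> x) \<partial>lborel)"
  proof (rule nn_integral_mono)
    fix x
    show "ennreal (sqsum E k x) * indicator U x \<le> ennreal (d powr (- ?m)) * (ennreal (\<delta> x powr ?m * sqsum E k x) * indicator \<Omega> x)"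
    proof (cases "x \<in> U")
      case True
      have "d powr ?m \<le> \<delta> x powr ?m" using d(1) d(2)[OF True] by (intro powr_mono2) auto
      then have "1 \<le> d powr (- ?m) * \<delta> x powr ?m"
        using d(1) by (simp add: powr_minus field_simps)
      then have "1 * sqsum E k x \<le> (d powr (- ?m) * \<delta> x powr ?m) * sqsum E k x" using sqsum_nonneg by (rule mult_right_mono)
      then have "ennreal (sqsum E k x) \<le> ennreal (d powr (- ?m)) * ennreal (\<delta> x powr ?m * sqsum E k x)"
        using sqsum_nonneg[of E k x] by (subst ennreal_mult[symmetric]) (auto simp: mult.assoc intro!: ennreal_leI)
      then show ?thesis using True U(2) by (auto simp: indicator_def)
    qed simp
  qed
  also have "\<dots> = ennreal (d powr (- ?m)) * (\<integral>\<^sup>+x\<in>\<Omega>. ennreal (\<delta> x powr ?m * sqsum E k x) \<partial>lborel)"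
    by (rule nn_integral_cmult) measurable
  also have "\<dots> \<le> ennreal (d powr (- ?m)) * ennreal ((C * A ^ k * fact k)\<^sup>2)"
    by (intro mult_left_mono weighted) simp
  also have "\<dots> = ennreal (d powr (- ?m) * (C * A ^ k * fact k)\<^sup>2)" by (simp add: ennreal_mult)
  finally show ?thesis by simp
qed

text \<open>Since \<gamma> > 1 and d \<le> 1, the power of 1 / d is k - 1 instead of k. The
  truncated subtraction is right at k = 0 as well, where the weight is absent.\<close>

lemma weighted_local_k:
  assumes U: "U \<in> sets borel" "U \<subseteq> \<Omega>" and d: "0 < d" "d \<le> 1" "\<And>x. x \<in> U \<Longrightarrow> d \<le> \<delta> x"
  shows "(\<integral>\<^sup>+x\<in>U. ennreal (sqsum E k x) \<partial>lborel) \<le> ennreal ((C * A ^ k * fact k / d ^ (k - 1))\<^sup>2)"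
proof -
  have "max 0 (real k - \<gamma>) \<le> real (k - 1)" using gam by (cases k) auto
  then have "d powr (- 2 * max 0 (real k - \<gamma>)) \<le> d powr (- 2 * real (k - 1))"
    using d by (intro powr_mono') auto
  also have "\<dots> = 1 / (d ^ (k - 1))\<^sup>2"
  proof -
    have "d powr (- 2 * real (k - 1)) = 1 / d powr real (2 * (k - 1))"
      using d(1) by (simp flip: powr_minus_divide)
    also have "d powr real (2 * (k - 1)) = (d ^ (k - 1))\<^sup>2"
      unfolding powr_realpow[OF d(1)] by (simp only: power_mult[symmetric] mult.commute)
    finally show ?thesis .
  qed
  finally have "d powr (- 2 * max 0 (real k - \<gamma>)) * (C * A ^ k * fact k)\<^sup>2 \<le> 1 / (d ^ (k - 1))\<^sup>2 * (C * A ^ k * fact k)\<^sup>2"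
    by (rule mult_right_mono) simp
  also have "\<dots> = (C * A ^ k * fact k / d ^ (k - 1))\<^sup>2" by (simp add: power_divide)
  finally show ?thesis using weighted_local[OF U d(1,3), of k] by (meson ennreal_leI order_trans)
qed

lemma weighted_one:
  assumes "U \<in> sets borel" "U \<subseteq> \<Omega>" "k \<le> 1"
  shows "(\<integral>\<^sup>+x\<in>U. ennreal (sqsum E k x) \<partial>lborel) \<le> ennreal ((C * A ^ k * fact k)\<^sup>2)"
proof -
  have m: "max 0 (real k - \<gamma>) = 0" using assms(3) gam by auto
  \<comment> \<open>Positivity matters because \<open>0 powr 0\<close> is 0: at a zero of \<delta>
    the trivial weight would not be 1.\<close>
  have dp: "\<delta> x > 0" if x: "x \<in> \<Omega>" for x
  proof -
    obtain r where r: "r > 0" "ball x r \<subseteq> \<Omega>" using op x open_contains_ball by blast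
    have "ball x (min r 1) \<subseteq> \<Omega>" using r(2) by auto
    then have "min r 1 \<le> \<delta> x" using r(1) by (intro delta_ball) auto
    then show ?thesis using r(1) by auto
  qed
  have "(\<integral>\<^sup>+x\<in>U. ennreal (sqsum E k x) \<partial>lborel) \<le> (\<integral>\<^sup>+x\<in>\<Omega>. ennreal (\<delta> x powr (2 * max 0 (real k - \<gamma>)) * sqsum E k x) \<partial>lborel)"
  proof (rule nn_integral_mono)
    fix x show "ennreal (sqsum E k x) * indicator U x \<le> ennreal (\<delta> x powr (2 * max 0 (real k - \<gamma>)) * sqsum E k x) * indicator \<Omega> x"
      using assms(2) dp[of x] unfolding m by (cases "x \<in> U") (auto simp: indicator_def)
  qed
  then show ?thesis using weighted[of k] by (rule order_trans)
qed

text \<open>The remainder bound with weight 1. The substitution is made for x if s \<ge> 1/2 and for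
  y otherwise, which is the origin of the factor 4.\<close>

lemma taylor_L2_unit:
  assumes x0: "x0 \<in> closure \<Omega>" and r: "0 < r" and n: "n > 0" and H: "H = (M + 2) * r"
    and Y: "Y = ball y0 r"
    and g1: "\<And>x y. x \<in> ball x0 r \<Longrightarrow> y \<in> Y \<Longrightarrow> norm (x - y) \<le> (M + 2) * r"
    and g2: "\<And>x y s. x \<in> \<Omega> \<inter> ball x0 r \<Longrightarrow> y \<in> Y \<Longrightarrow> s \<in> {0..1} \<Longrightarrow> y + s *\<^sub>R (x - y) \<in> \<Omega> \<inter> ball x0 ((M + 1) * r)"
  shows "(\<integral>\<^sup>+x\<in>\<Omega> \<inter> ball x0 r. (\<integral>\<^sup>+y\<in>Y. ennreal ((E i0 j0 x - taylor i0 j0 n (x - y) y)\<^sup>2) \<partial>lborel) \<partial>lborel)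
    \<le> ennreal (((2 * H) ^ n / fact (n - 1))\<^sup>2 * (4 * (pi * r\<^sup>2))) *
       (\<integral>\<^sup>+z\<in>\<Omega> \<inter> ball x0 ((M + 1) * r). ennreal (sqsum E (n + i0 + j0) z) \<partial>lborel)"
proof -
  let ?X = "\<Omega> \<inter> ball x0 r" and ?U = "\<Omega> \<inter> ball x0 ((M + 1) * r)"
  let ?S = "\<lambda>z. ennreal (sqsum (\<lambda>i j. E (i0 + i) (j0 + j)) n z)"
  let ?T = "\<lambda>s. (\<integral>\<^sup>+x\<in>?X. (\<integral>\<^sup>+y\<in>Y. ?S (y + s *\<^sub>R (x - y)) \<partial>lborel) \<partial>lborel)"
  let ?I = "\<integral>\<^sup>+z\<in>?U. ennreal (sqsum E (n + i0 + j0) z) \<partial>lborel"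
  have [measurable]: "Y \<in> sets borel" unfolding Y by simp
  have V: "emeasure lborel Y = ennreal (pi * r\<^sup>2)" unfolding Y using r by (intro emeasure_ball_plane) simp
  have VX: "emeasure lborel ?X \<le> ennreal (pi * r\<^sup>2)"
    using emeasure_mono[of ?X "ball x0 r" lborel] emeasure_ball_plane[of r x0] r by simp
  have SI: "(\<integral>\<^sup>+z\<in>?U. ?S z \<partial>lborel) \<le> ?I"
    by (intro nn_integral_mono mult_right_mono ennreal_leI sqsum_shift_le) simp
  have T: "?T s \<le> ennreal (4 * (pi * r\<^sup>2)) * ?I" if s: "s \<in> {0<..<1}" for s
  proof -
    have seg: "x \<in> ?X \<Longrightarrow> y \<in> Y \<Longrightarrow> y + s *\<^sub>R (x - y) \<in> ?U" for x y using g2[of x y s] s by simp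
    note L = segment_nn_integral_le[of ?S ?X Y ?U s, OF _ _ _ _ seg]
    have "\<exists>c. c \<le> 4 \<and> 0 \<le> c \<and> ?T s \<le> ennreal (pi * r\<^sup>2) * ennreal c * (\<integral>\<^sup>+z\<in>?U. ?S z \<partial>lborel)"
    proof (cases "s \<ge> 1 / 2")
      case True
      have "(1/2)\<^sup>2 \<le> s\<^sup>2" using True by (intro power_mono) auto
      then have "1 / s\<^sup>2 \<le> 4" using True by (simp add: divide_le_eq power2_eq_square)
      then show ?thesis using L(1) s V by (intro exI[of _ "1 / s\<^sup>2"]) simp
    next
      case False
      have "(1/2)\<^sup>2 \<le> (1 - s)\<^sup>2" using False by (intro power_mono) auto
      then have "1 / (1 - s)\<^sup>2 \<le> 4" using s by (simp add: divide_le_eq power2_eq_square)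
      moreover have "?T s \<le> ennreal (pi * r\<^sup>2) * ennreal (1 / (1 - s)\<^sup>2) * (\<integral>\<^sup>+z\<in>?U. ?S z \<partial>lborel)"
        by (rule order_trans[OF L(2)]) (use s VX in \<open>auto intro!: mult_right_mono\<close>)
      ultimately show ?thesis by (intro exI[of _ "1 / (1 - s)\<^sup>2"]) simp
    qed
    then obtain c where c: "c \<le> 4" "0 \<le> c" "?T s \<le> ennreal (pi * r\<^sup>2) * ennreal c * (\<integral>\<^sup>+z\<in>?U. ?S z \<partial>lborel)" by blast
    note c(3)
    also have "ennreal (pi * r\<^sup>2) * ennreal c * (\<integral>\<^sup>+z\<in>?U. ?S z \<partial>lborel) \<le> ennreal (pi * r\<^sup>2) * ennreal 4 * ?I"
      using c SI by (intro mult_mono ennreal_leI) auto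
    also have "ennreal (pi * r\<^sup>2) * ennreal 4 = ennreal (4 * (pi * r\<^sup>2))" by (subst ennreal_mult[symmetric]) (auto simp: mult.commute)
    finally show ?thesis .
  qed
  have cmp: "\<bar>fst h\<bar> \<le> H \<and> \<bar>snd h\<bar> \<le> H" if "norm h \<le> (M + 2) * r" for h :: "real \<times> real"
    using that norm_fst_le[of "fst h" "snd h"] norm_snd_le[of "snd h" "fst h"] unfolding H by simp
  have D: "(\<integral>\<^sup>+x\<in>?X. (\<integral>\<^sup>+y\<in>Y. ennreal ((E i0 j0 x - taylor i0 j0 n (x - y) y)\<^sup>2) \<partial>lborel) \<partial>lborel)
    \<le> ennreal (((2 * H) ^ n / fact (n - 1))\<^sup>2) * (\<integral>\<^sup>+s\<in>{0<..<1::real}. ennreal (1 / 1) \<partial>lborel) * (\<integral>\<^sup>+s\<in>{0<..<1}. ennreal 1 * ?T s \<partial>lborel)"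
  proof (rule taylor_L2[OF n])
    fix x y assume xy: "x \<in> ?X" "y \<in> Y"
    then show "\<bar>fst (x - y)\<bar> \<le> H \<and> \<bar>snd (x - y)\<bar> \<le> H" using cmp[OF g1[of x y]] by simp
    show "y + s *\<^sub>R (x - y) \<in> \<Omega>" if "s \<in> {0..1}" for s using g2[OF xy that] by simp
  qed simp_all
  have 1: "(\<integral>\<^sup>+s\<in>{0<..<1::real}. ennreal (1 / 1) \<partial>lborel) = 1" by simp
  have "(\<integral>\<^sup>+s\<in>{0<..<1}. ennreal 1 * ?T s \<partial>lborel) \<le> (\<integral>\<^sup>+s\<in>{0<..<1::real}. ennreal (4 * (pi * r\<^sup>2)) * ?I \<partial>lborel)"
    using T by (intro nn_integral_mono) (simp add: indicator_def)
  also have "\<dots> = ennreal (4 * (pi * r\<^sup>2)) * ?I" by (simp add: nn_integral_cmult_indicator)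
  finally have 2: "(\<integral>\<^sup>+s\<in>{0<..<1}. ennreal 1 * ?T s \<partial>lborel) \<le> ennreal (4 * (pi * r\<^sup>2)) * ?I" .
  have "ennreal (((2 * H) ^ n / fact (n - 1))\<^sup>2 * (4 * (pi * r\<^sup>2))) * ?I = ennreal (((2 * H) ^ n / fact (n - 1))\<^sup>2) * (ennreal (4 * (pi * r\<^sup>2)) * ?I)"
    by (subst ennreal_mult) (auto simp: mult.assoc)
  then show ?thesis using order_trans[OF D[unfolded 1 mult_1_right] mult_left_mono[OF 2]] by simp
qed

lemma taylor_one: "taylor i0 j0 1 h y = E i0 j0 y"
  by (simp add: taylor_def dirW_def)

end

section \<open>Decay of the gradient on small balls\<close>

lemma ennreal_mult3:
  "0 \<le> x \<Longrightarrow> 0 \<le> y \<Longrightarrow> 0 \<le> z \<Longrightarrow> ennreal x * (ennreal y * ennreal z) = ennreal (x * (y * z))"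
  "0 \<le> x \<Longrightarrow> 0 \<le> y \<Longrightarrow> 0 \<le> z \<Longrightarrow> ennreal x * ennreal y * ennreal z = ennreal (x * y * z)"
  by (simp_all add: ennreal_mult)

context cone_family
begin

text \<open>The scale r1 stays fixed and only R shrinks. A first derivative is compared with its
  values on Y by a Taylor formula of order 1. With t = 1 - s, second derivatives are met only where
  \<delta> \<ge> 2 r1 t, which costs t^(- 2 \<beta>); the weight t^\<beta> reduces this to t^(-
  \<beta>). The factor (R / r1)^\<sigma> is bought by a further t^(- \<sigma>), and \<beta> +
  \<sigma> = (3 - \<gamma>) / 2 < 1 keeps the integral finite: \<sigma> is half of the available
  margin \<gamma> - 1.\<close>

lemma hardy_component:
  assumes x0: "x0 \<in> closure \<Omega>" and r1: "0 < r1" "M * r1 \<le> \<rho>" "r1 \<le> 1 / 2" and R: "0 < R" "R \<le> r1"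
    and ij: "i0 + j0 = 1" and \<beta>: "\<beta> = 2 - \<gamma>" and \<sigma>: "\<sigma> = (\<gamma> - 1) / 2"
    and K: "K = (2 * ((M + 2) * r1))\<^sup>2 * (1 / (1 - \<beta>)) * (4 * (pi * r1\<^sup>2) * ((2 * r1) powr (- 2 * \<beta>) * (C * A ^ 2 * fact 2)\<^sup>2)) * (1 / (1 - (\<beta> + \<sigma>)))"
  shows "sq_int (\<Omega> \<inter> ball x0 R) (E i0 j0) \<le> ennreal ((2 * K / (pi * r1\<^sup>2) + 2 * (C * A)\<^sup>2) * (R / r1) powr \<sigma>)"
proof -
  have b: "0 < \<beta>" "\<beta> < 1" "0 < \<sigma>" "\<sigma> \<le> 2" "\<beta> + \<sigma> < 1" using gam unfolding \<beta> \<sigma> by (auto simp: field_simps)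
  obtain d where d: "norm d = 1"
    "\<And>x y. x \<in> ball x0 r1 \<Longrightarrow> y \<in> ball (x0 + (M * r1) *\<^sub>R d) r1 \<Longrightarrow> norm (x - y) \<le> (M + 2) * r1"
    "\<And>x y s. x \<in> \<Omega> \<inter> ball x0 r1 \<Longrightarrow> y \<in> ball (x0 + (M * r1) *\<^sub>R d) r1 \<Longrightarrow> s \<in> {0..1} \<Longrightarrow>
       y + s *\<^sub>R (x - y) \<in> \<Omega> \<inter> ball x0 ((M + 1) * r1) \<and> ball (y + s *\<^sub>R (x - y)) ((1 - s) * (2 * r1)) \<subseteq> \<Omega>"
    using patch_geom[OF x0 r1(1,2)] by metis
  define Y where "Y = ball (x0 + (M * r1) *\<^sub>R d) r1"
  define X where "X = \<Omega> \<inter> ball x0 R"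
  have [measurable]: "X \<in> sets borel" "Y \<in> sets borel" unfolding X_def Y_def by simp_all
  have Xs: "X \<subseteq> \<Omega> \<inter> ball x0 r1" unfolding X_def using R by auto
  define V where "V = pi * r1\<^sup>2"
  have V0: "V > 0" unfolding V_def using r1 by simp
  have VY: "emeasure lborel Y = ennreal V" unfolding Y_def V_def using r1 by (intro emeasure_ball_plane) simp
  have VX: "emeasure lborel X \<le> ennreal (V * (R / r1)\<^sup>2)"
    using emeasure_mono[of X "ball x0 R" lborel] emeasure_ball_plane[of R x0] R r1 unfolding V_def X_def
    by (simp add: power_divide)
  let ?W = "(C * A ^ 2 * fact 2)\<^sup>2"
  let ?S = "\<lambda>z. ennreal (sqsum (\<lambda>i j. E (i0 + i) (j0 + j)) 1 z)"
  let ?T = "\<lambda>s. (\<integral>\<^sup>+x\<in>X. (\<integral>\<^sup>+y\<in>Y. ?S (y + s *\<^sub>R (x - y)) \<partial>lborel) \<partial>lborel)"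
  define K1 where "K1 = 4 * V * ((2 * r1) powr (- 2 * \<beta>) * ?W)"
  have K10: "0 \<le> K1" unfolding K1_def using V0 by simp
  define H where "H = (M + 2) * r1"
  have T: "ennreal ((1 - s) powr \<beta>) * ?T s \<le> ennreal (K1 * (R / r1) powr \<sigma>) * ennreal ((1 - s) powr (- (\<beta> + \<sigma>)))"
    if s: "s \<in> {0<..<1}" for s
  proof -
    define t where "t = 1 - s"
    have t: "0 < t" "t < 1" using s unfolding t_def by auto
    define U where "U = \<Omega> \<inter> {x. 2 * r1 * t \<le> \<delta> x}"
    have Um[measurable]: "U \<in> sets borel" unfolding U_def by measurable
    have seg: "y + s *\<^sub>R (x - y) \<in> U" if xy: "x \<in> X" "y \<in> Y" for x y
    proof -
      have "y + s *\<^sub>R (x - y) \<in> \<Omega>" "ball (y + s *\<^sub>R (x - y)) ((1 - s) * (2 * r1)) \<subseteq> \<Omega>"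
        using d(3)[OF subsetD[OF Xs xy(1)] xy(2)[unfolded Y_def], of s] s by simp_all
      moreover have "t * (2 * r1) \<le> 1 * 1" using t r1 by (intro mult_mono) auto
      ultimately have "t * (2 * r1) \<le> \<delta> (y + s *\<^sub>R (x - y))" using t r1 unfolding t_def by (intro delta_ball) auto
      then show ?thesis using \<open>y + s *\<^sub>R (x - y) \<in> \<Omega>\<close> unfolding U_def by (simp add: mult_ac)
    qed
    have I: "(\<integral>\<^sup>+z\<in>U. ?S z \<partial>lborel) \<le> ennreal ((2 * r1 * t) powr (- 2 * \<beta>) * ?W)"
    proof -
      have "(\<integral>\<^sup>+z\<in>U. ?S z \<partial>lborel) \<le> (\<integral>\<^sup>+z\<in>U. ennreal (sqsum E 2 z) \<partial>lborel)"
        using sqsum_shift_le[of E i0 j0 1] ij by (intro nn_integral_mono mult_right_mono ennreal_leI) (auto simp: numeral_2_eq_2)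
      also have "\<dots> \<le> ennreal ((2 * r1 * t) powr (- 2 * max 0 (real 2 - \<gamma>)) * ?W)"
        by (rule weighted_local) (use r1 t in \<open>auto simp: U_def\<close>)
      also have "max 0 (real 2 - \<gamma>) = \<beta>" using gam \<beta> by simp
      finally show ?thesis .
    qed
    define a where "a = R / (r1 * t)"
    have a0: "a > 0" unfolding a_def using R r1 t by simp
    \<comment> \<open>With a = R / (r1 t), substituting for y uses the small area of X and costs
      a^2, while substituting for x costs 1 / s^2. In each case one of the two is at most 4
      a^\<sigma>; this interpolation trades powers of R for powers of 1 / t.\<close>
    have "\<exists>c\<ge>0. c \<le> 4 * a powr \<sigma> \<and> ?T s \<le> ennreal (V * c) * (\<integral>\<^sup>+z\<in>U. ?S z \<partial>lborel)"
    proof -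
      note L = segment_nn_integral_le[of ?S X Y U s, OF _ _ _ _ seg]
      have LX: "?T s \<le> ennreal (V * a\<^sup>2) * (\<integral>\<^sup>+z\<in>U. ?S z \<partial>lborel)"
      proof -
        have "?T s \<le> emeasure lborel X * ennreal (1 / (1 - s)\<^sup>2) * (\<integral>\<^sup>+z\<in>U. ?S z \<partial>lborel)"
          by (rule L(2)) (use s in auto)
        also have "\<dots> \<le> ennreal (V * (R / r1)\<^sup>2) * ennreal (1 / t\<^sup>2) * (\<integral>\<^sup>+z\<in>U. ?S z \<partial>lborel)"
          unfolding t_def by (intro mult_right_mono VX) auto
        also have "ennreal (V * (R / r1)\<^sup>2) * ennreal (1 / t\<^sup>2) = ennreal (V * a\<^sup>2)"
          unfolding a_def using V0 by (subst ennreal_mult[symmetric]) (auto simp: power_divide power_mult_distrib)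
        finally show ?thesis .
      qed
      consider "a \<le> 1" | "a > 1" "s \<ge> 1/2" | "a > 1" "s < 1/2" by linarith
      then show ?thesis
      proof cases
        case 1
        have "a powr 2 \<le> a powr \<sigma>" using 1 a0 b by (intro powr_mono') auto
        then have "a\<^sup>2 \<le> a powr \<sigma>" using a0 by (simp add: powr_numeral)
        then have "a\<^sup>2 \<le> 4 * a powr \<sigma>" using powr_ge_zero[of a \<sigma>] by linarith
        then show ?thesis using LX by (intro exI[of _ "a\<^sup>2"]) auto
      next
        case 2
        have "(1/2)\<^sup>2 \<le> s\<^sup>2" using 2 by (intro power_mono) auto
        then have "1 / s\<^sup>2 \<le> 4" using s by (simp add: divide_le_eq power2_eq_square)
        also have "4 \<le> 4 * a powr \<sigma>" using 2 b by (simp add: ge_one_powr_ge_zero)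
        finally have "1 / s\<^sup>2 \<le> 4 * a powr \<sigma>" .
        moreover have "?T s \<le> ennreal (V * (1 / s\<^sup>2)) * (\<integral>\<^sup>+z\<in>U. ?S z \<partial>lborel)"
          using L(1) s V0 unfolding VY by (subst ennreal_mult) auto
        ultimately show ?thesis by (intro exI[of _ "1 / s\<^sup>2"]) auto
      next
        case 3
        have "r1 * 1 \<le> r1 * (2 * t)" using 3 r1(1) unfolding t_def by (intro mult_left_mono) auto
        then have "R \<le> r1 * (2 * t)" using R(2) by linarith
        then have "a \<le> 2" unfolding a_def using r1 t by (simp add: divide_le_eq mult_ac)
        then have "a\<^sup>2 \<le> 2\<^sup>2" using a0 by (intro power_mono) auto
        also have "2\<^sup>2 \<le> 4 * a powr \<sigma>" using 3 b by (simp add: ge_one_powr_ge_zero)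
        finally show ?thesis using LX by (intro exI[of _ "a\<^sup>2"]) auto
      qed
    qed
    then obtain c where c: "0 \<le> c" "c \<le> 4 * a powr \<sigma>" "?T s \<le> ennreal (V * c) * (\<integral>\<^sup>+z\<in>U. ?S z \<partial>lborel)" by blast
    have "?T s \<le> ennreal (V * (4 * a powr \<sigma>)) * ennreal ((2 * r1 * t) powr (- 2 * \<beta>) * ?W)"
      by (rule order_trans[OF c(3)]) (use c V0 I in \<open>intro mult_mono ennreal_leI mult_left_mono; simp\<close>)
    then have "ennreal (t powr \<beta>) * ?T s \<le> ennreal (t powr \<beta>) * (ennreal (V * (4 * a powr \<sigma>)) * ennreal ((2 * r1 * t) powr (- 2 * \<beta>) * ?W))"
      by (rule mult_left_mono) simp
    also have "\<dots> = ennreal (t powr \<beta> * (V * (4 * a powr \<sigma>) * ((2 * r1 * t) powr (- 2 * \<beta>) * ?W)))"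
      by (rule ennreal_mult3(1)) (use V0 in auto)
    also have "t powr \<beta> * (V * (4 * a powr \<sigma>) * ((2 * r1 * t) powr (- 2 * \<beta>) * ?W)) = K1 * (R / r1) powr \<sigma> * t powr (- (\<beta> + \<sigma>))"
    proof -
      have e1: "a powr \<sigma> = (R / r1) powr \<sigma> * t powr (- \<sigma>)"
      proof -
        have e: "a = (R / r1) / t" unfolding a_def by simp
        have "((R / r1) / t) powr \<sigma> = (R / r1) powr \<sigma> / t powr \<sigma>" by (rule powr_divide)
        then show ?thesis unfolding e powr_minus_divide by (simp only: times_divide_eq_right mult_1_right)
      qed
      have e2: "(2 * r1 * t) powr (- 2 * \<beta>) = (2 * r1) powr (- 2 * \<beta>) * t powr (- 2 * \<beta>)"
        by (rule powr_mult)
      have e3: "t powr \<beta> * t powr (- \<sigma>) * t powr (- 2 * \<beta>) = t powr (- (\<beta> + \<sigma>))"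
        by (simp flip: powr_add)
      show ?thesis unfolding K1_def e1 e2 e3[symmetric] by (simp only: mult_ac)
    qed
    also have "ennreal (K1 * (R / r1) powr \<sigma> * t powr (- (\<beta> + \<sigma>))) = ennreal (K1 * (R / r1) powr \<sigma>) * ennreal (t powr (- (\<beta> + \<sigma>)))"
      using K10 by (intro ennreal_mult) auto
    finally show ?thesis unfolding t_def .
  qed
  have wT: "(\<integral>\<^sup>+s\<in>{0<..<1}. ennreal ((1 - s) powr \<beta>) * ?T s \<partial>lborel) \<le> ennreal (K1 * (R / r1) powr \<sigma> * (1 / (1 - (\<beta> + \<sigma>))))"
  proof -
    have "(\<integral>\<^sup>+s\<in>{0<..<1}. ennreal ((1 - s) powr \<beta>) * ?T s \<partial>lborel)
      \<le> (\<integral>\<^sup>+s. ennreal (K1 * (R / r1) powr \<sigma>) * (ennreal ((1 - s) powr (- (\<beta> + \<sigma>))) * indicator {0<..<1} s) \<partial>lborel)"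
    proof (rule nn_integral_mono)
      fix s :: real
      show "ennreal ((1 - s) powr \<beta>) * ?T s * indicator {0<..<1} s \<le> ennreal (K1 * (R / r1) powr \<sigma>) * (ennreal ((1 - s) powr (- (\<beta> + \<sigma>))) * indicator {0<..<1} s)"
        using T[of s] by (cases "s \<in> {0<..<1}") simp_all
    qed
    also have "\<dots> = ennreal (K1 * (R / r1) powr \<sigma>) * (\<integral>\<^sup>+s\<in>{0<..<1}. ennreal ((1 - s) powr (- (\<beta> + \<sigma>))) \<partial>lborel)"
      by (rule nn_integral_cmult) measurable
    also have "\<dots> \<le> ennreal (K1 * (R / r1) powr \<sigma>) * ennreal (1 / (1 - (\<beta> + \<sigma>)))"
      using b by (intro mult_left_mono powr_nn_integral) auto
    also have "\<dots> = ennreal (K1 * (R / r1) powr \<sigma> * (1 / (1 - (\<beta> + \<sigma>))))"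
      using K10 b by (intro ennreal_mult[symmetric]) auto
    finally show ?thesis .
  qed
  have cmp: "\<bar>fst h\<bar> \<le> H \<and> \<bar>snd h\<bar> \<le> H" if "norm h \<le> (M + 2) * r1" for h :: "real \<times> real"
    using that norm_fst_le[of "fst h" "snd h"] norm_snd_le[of "snd h" "fst h"] unfolding H_def by simp
  let ?D = "\<integral>\<^sup>+x\<in>X. (\<integral>\<^sup>+y\<in>Y. ennreal ((E i0 j0 x - E i0 j0 y)\<^sup>2) \<partial>lborel) \<partial>lborel"
  have "?D = (\<integral>\<^sup>+x\<in>X. (\<integral>\<^sup>+y\<in>Y. ennreal ((E i0 j0 x - taylor i0 j0 1 (x - y) y)\<^sup>2) \<partial>lborel) \<partial>lborel)"
    unfolding taylor_one ..
  also have "\<dots> \<le> ennreal (((2 * H) ^ 1 / fact (1 - 1))\<^sup>2) * (\<integral>\<^sup>+s\<in>{0<..<1::real}. ennreal (1 / (1 - s) powr \<beta>) \<partial>lborel)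
      * (\<integral>\<^sup>+s\<in>{0<..<1}. ennreal ((1 - s) powr \<beta>) * ?T s \<partial>lborel)"
  proof (rule taylor_L2)
    fix x y assume xy: "x \<in> X" "y \<in> Y"
    then show "\<bar>fst (x - y)\<bar> \<le> H \<and> \<bar>snd (x - y)\<bar> \<le> H" using cmp[OF d(2)[of x y]] Xs unfolding Y_def by blast
    show "y + s *\<^sub>R (x - y) \<in> \<Omega>" if "s \<in> {0..1}" for s using d(3)[OF _ _ that, of x y] xy Xs unfolding Y_def by blast
  qed simp_all
  also have "\<dots> \<le> ennreal ((2 * H)\<^sup>2) * ennreal (1 / (1 - \<beta>)) * ennreal (K1 * (R / r1) powr \<sigma> * (1 / (1 - (\<beta> + \<sigma>))))"
    using powr_nn_integral[of \<beta>] b wT by (intro mult_mono) (simp_all add: powr_minus_divide)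
  also have "\<dots> = ennreal (K * (R / r1) powr \<sigma>)"
  proof (subst ennreal_mult3(2))
    show "ennreal ((2 * H)\<^sup>2 * (1 / (1 - \<beta>)) * (K1 * (R / r1) powr \<sigma> * (1 / (1 - (\<beta> + \<sigma>))))) = ennreal (K * (R / r1) powr \<sigma>)"
      unfolding K K1_def H_def V_def by (simp only: mult_ac)
  qed (use b K10 in auto)
  finally have D: "?D \<le> ennreal (K * (R / r1) powr \<sigma>)" .
  have K0: "0 \<le> K" unfolding K using b M4 r1 by (intro mult_nonneg_nonneg) auto
  have sq: "ennreal ((E i0 j0 z)\<^sup>2) \<le> ennreal (sqsum E 1 z)" for z
    using ij by (intro ennreal_leI) (cases i0, auto simp: sqsum_def)
  have YO: "Y \<subseteq> \<Omega>" if nX: "X \<noteq> {}"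
  proof
    fix y assume y: "y \<in> Y"
    obtain x where x: "x \<in> X" using nX by blast
    show "y \<in> \<Omega>" using d(3)[OF subsetD[OF Xs x] y[unfolded Y_def], of 0] by simp
  qed
  show ?thesis
  proof (cases "X = {}")
    case True then show ?thesis unfolding X_def by simp
  next
    case False
    \<comment> \<open>On Y the first derivatives obey an unweighted bound, because \<gamma> > 1.
      This term involves no smallness of its own; the power of R comes from the area of X.\<close>
    have gY: "(\<integral>\<^sup>+y\<in>Y. ennreal ((E i0 j0 y)\<^sup>2) \<partial>lborel) \<le> ennreal ((C * A)\<^sup>2)"
    proof -
      have "(\<integral>\<^sup>+y\<in>Y. ennreal ((E i0 j0 y)\<^sup>2) \<partial>lborel) \<le> (\<integral>\<^sup>+y\<in>Y. ennreal (sqsum E 1 y) \<partial>lborel)"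
        by (intro nn_integral_mono mult_right_mono sq) simp
      also have "\<dots> \<le> ennreal ((C * A ^ 1 * fact 1)\<^sup>2)" by (rule weighted_one) (use YO[OF False] in auto)
      finally show ?thesis by simp
    qed
    have Rq: "(R / r1)\<^sup>2 \<le> (R / r1) powr \<sigma>"
    proof -
      have "(R / r1) powr 2 \<le> (R / r1) powr \<sigma>" using R r1 b by (intro powr_mono') auto
      then show ?thesis using R r1 by (simp add: powr_numeral)
    qed
    have "ennreal V * (sq_int X (E i0 j0))
      \<le> 2 * ?D + 2 * emeasure lborel X * (\<integral>\<^sup>+y\<in>Y. ennreal ((E i0 j0 y)\<^sup>2) \<partial>lborel)"
      unfolding VY[symmetric] by (rule nn_integral_L2_split) measurable
    also have "\<dots> \<le> 2 * ennreal (K * (R / r1) powr \<sigma>) + 2 * ennreal (V * (R / r1) powr \<sigma>) * ennreal ((C * A)\<^sup>2)"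
      using Rq V0 by (intro add_mono mult_mono D gY order_trans[OF VX] ennreal_leI mult_left_mono) auto
    also have "\<dots> = ennreal (2 * (K * (R / r1) powr \<sigma>) + 2 * (V * (R / r1) powr \<sigma>) * (C * A)\<^sup>2)"
    proof -
      have two: "(2::ennreal) = ennreal 2" by simp
      show ?thesis unfolding two using K0 V0
        by (simp only: ennreal_mult[symmetric] ennreal_plus[symmetric] mult_nonneg_nonneg zero_le_numeral powr_ge_zero less_imp_le zero_le_power2)
    qed
    finally have "sq_int X (E i0 j0) \<le> ennreal ((2 * (K * (R / r1) powr \<sigma>) + 2 * (V * (R / r1) powr \<sigma>) * (C * A)\<^sup>2) / V)"
      using V0 K0 by (intro ennreal_mult_le_divide) auto
    also have "(2 * (K * (R / r1) powr \<sigma>) + 2 * (V * (R / r1) powr \<sigma>) * (C * A)\<^sup>2) / V = (2 * K / (pi * r1\<^sup>2) + 2 * (C * A)\<^sup>2) * (R / r1) powr \<sigma>"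
      unfolding V_def[symmetric] using V0 by (simp add: field_simps)
    finally show ?thesis unfolding X_def .
  qed
qed

lemma hardy:
  obtains K \<sigma> r1 where "0 < K" "0 < \<sigma>" "0 < r1" "\<And>x0 R. x0 \<in> closure \<Omega> \<Longrightarrow> 0 < R \<Longrightarrow> R \<le> r1 \<Longrightarrow>
     (\<integral>\<^sup>+x\<in>\<Omega> \<inter> ball x0 R. ennreal (sqsum E 1 x) \<partial>lborel) \<le> ennreal (K * R powr \<sigma>)"
proof -
  define \<sigma> where "\<sigma> = (\<gamma> - 1) / 2"
  \<comment> \<open>\<open>r1 \<le> 1/2\<close> keeps the inscribed radius 2 r1 (1 - s) at most 1,
    the range covered by \<open>delta_ball\<close>.\<close>
  define r1 where "r1 = min (\<rho> / M) (1 / 2)"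
  have r1: "0 < r1" "M * r1 \<le> \<rho>" "r1 \<le> 1/2"
    using rho M4 unfolding r1_def by (auto simp: min_def field_simps)
  define K where "K = (2 * ((M + 2) * r1))\<^sup>2 * (1 / (1 - (2 - \<gamma>))) * (4 * (pi * r1\<^sup>2) * ((2 * r1) powr (- 2 * (2 - \<gamma>)) * (C * A ^ 2 * fact 2)\<^sup>2)) * (1 / (1 - ((2 - \<gamma>) + \<sigma>)))"
  have K0: "0 \<le> K" unfolding K_def \<sigma>_def using gam M4 r1 by (intro mult_nonneg_nonneg) (auto simp: field_simps)
  define K' where "K' = 2 * K / (pi * r1\<^sup>2) + 2 * (C * A)\<^sup>2"
  have K': "K' > 0" unfolding K'_def using K0 CA r1 by (intro add_nonneg_pos) auto
  show thesis
  proof (rule that[of "2 * K' * r1 powr (- \<sigma>)" \<sigma> r1])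
    fix x0 R assume x: "x0 \<in> closure \<Omega>" and R: "0 < R" "R \<le> r1"
    have [measurable]: "\<Omega> \<inter> ball x0 R \<in> sets borel" by simp
    note h = hardy_component[OF x r1 R _ refl \<sigma>_def K_def, folded K'_def]
    have "(\<integral>\<^sup>+x\<in>\<Omega> \<inter> ball x0 R. ennreal (sqsum E 1 x) \<partial>lborel)
      = (\<integral>\<^sup>+x. ennreal ((E 0 1 x)\<^sup>2) * indicator (\<Omega> \<inter> ball x0 R) x + ennreal ((E 1 0 x)\<^sup>2) * indicator (\<Omega> \<inter> ball x0 R) x \<partial>lborel)"
      by (intro nn_integral_cong) (simp add: sqsum_def ennreal_plus distrib_right)
    also have "\<dots> = (sq_int (\<Omega> \<inter> ball x0 R) (E 0 1)) + (sq_int (\<Omega> \<inter> ball x0 R) (E 1 0))"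
      by (rule nn_integral_add) measurable
    also have "\<dots> \<le> ennreal (K' * (R / r1) powr \<sigma>) + ennreal (K' * (R / r1) powr \<sigma>)"
      by (intro add_mono h) auto
    also have "\<dots> = ennreal (2 * K' * r1 powr (- \<sigma>) * R powr \<sigma>)"
      using K' R r1 by (simp add: powr_divide powr_minus_divide flip: ennreal_plus)
    finally show "(\<integral>\<^sup>+x\<in>\<Omega> \<inter> ball x0 R. ennreal (sqsum E 1 x) \<partial>lborel) \<le> ennreal (2 * K' * r1 powr (- \<sigma>) * R powr \<sigma>)" .
  qed (use K' r1 gam in \<open>auto simp: \<sigma>_def\<close>)
qed

end

section \<open>Polynomial approximation on a single patch\<close>

lemma nn_integral_set_swap:
  fixes f :: "real \<times> real \<Rightarrow> real \<times> real \<Rightarrow> ennreal"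
  assumes [measurable]: "(\<lambda>(x, y). f x y) \<in> borel_measurable (borel \<Otimes>\<^sub>M borel)" "X \<in> sets borel" "Y \<in> sets borel"
  shows "(\<integral>\<^sup>+x\<in>X. (\<integral>\<^sup>+y\<in>Y. f x y \<partial>lborel) \<partial>lborel) = (\<integral>\<^sup>+y\<in>Y. (\<integral>\<^sup>+x\<in>X. f x y \<partial>lborel) \<partial>lborel)"
proof -
  have "(\<integral>\<^sup>+x\<in>X. (\<integral>\<^sup>+y\<in>Y. f x y \<partial>lborel) \<partial>lborel) = (\<integral>\<^sup>+x. (\<integral>\<^sup>+y. f x y * indicator Y y * indicator X x \<partial>lborel) \<partial>lborel)"
    by (intro nn_integral_cong nn_integral_multc[symmetric]) measurable
  also have "\<dots> = (\<integral>\<^sup>+y. (\<integral>\<^sup>+x. f x y * indicator Y y * indicator X x \<partial>lborel) \<partial>lborel)"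
    by (rule lborel_pair.Fubini') measurable
  also have "\<dots> = (\<integral>\<^sup>+y. (\<integral>\<^sup>+x. (f x y * indicator X x) * indicator Y y \<partial>lborel) \<partial>lborel)"
    by (intro nn_integral_cong) (simp only: mult_ac)
  also have "\<dots> = (\<integral>\<^sup>+y\<in>Y. (\<integral>\<^sup>+x\<in>X. f x y \<partial>lborel) \<partial>lborel)"
    by (intro nn_integral_cong nn_integral_multc) measurable
  finally show ?thesis .
qed

text \<open>The scale H will bound all coordinate distances between the patch and y. The scaled
  variables then lie in [-1, 1], where clipping is the identity and powers are bounded by 1.\<close>

definition ppoly :: "nat \<Rightarrow> real \<Rightarrow> (nat \<Rightarrow> nat \<Rightarrow> real) \<Rightarrow> real \<times> real \<Rightarrow> real \<times> real \<Rightarrow> real" where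
  "ppoly p H cf y x = (\<Sum>k\<le>p. \<Sum>i\<le>k. cf k i * ((fst (x - y) / H) ^ i * (snd (x - y) / H) ^ (k - i)))"

context cone_family
begin

text \<open>The errors are scaled as gluing needs them: the derivative of a cutoff multiplies the L2
  error by about 1 / r, so that error has to be e r when the gradient error is e. B bounds the
  coefficients and with them the accuracy demanded of the product networks.\<close>

definition patch :: "nat \<Rightarrow> real \<times> real \<Rightarrow> real \<Rightarrow> real \<Rightarrow> real \<Rightarrow> bool" where
  "patch p x0 r e B \<longleftrightarrow> (\<exists>y cf Q1 Q2.
     (\<forall>x. (ppoly p ((M + 2) * r) cf y has_derivative (\<lambda>e. fst e * Q1 x + snd e * Q2 x)) (at x)) \<and>
     (\<forall>k i. \<bar>cf k i\<bar> \<le> B) \<and> Q1 \<in> borel_measurable borel \<and> Q2 \<in> borel_measurable borel \<and>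
     (\<forall>x\<in>ball x0 r. \<bar>fst (x - y)\<bar> \<le> (M + 2) * r \<and> \<bar>snd (x - y)\<bar> \<le> (M + 2) * r) \<and>
     sq_int (\<Omega> \<inter> ball x0 r) (\<lambda>x. E 0 0 x - ppoly p ((M + 2) * r) cf y x) \<le> ennreal ((e * r)\<^sup>2) \<and>
     sq_int (\<Omega> \<inter> ball x0 r) (\<lambda>x. E 1 0 x - Q1 x) \<le> ennreal (e\<^sup>2) \<and>
     sq_int (\<Omega> \<inter> ball x0 r) (\<lambda>x. E 0 1 x - Q2 x) \<le> ennreal (e\<^sup>2))"

lemma taylor_measurable:
  assumes "f \<in> borel_measurable N" "g \<in> borel_measurable N"
  shows "(\<lambda>p. taylor i0 j0 n (g p) (f p)) \<in> borel_measurable N"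
  unfolding taylor_def by (intro borel_measurable_sum borel_measurable_divide borel_measurable_const dirW_measurable assms Em)

lemma sq_le_sqsum: "a \<le> k \<Longrightarrow> (E a (k - a) z)\<^sup>2 \<le> sqsum E k z"
  unfolding sqsum_def by (rule member_le_sum[of a "{..k}" "\<lambda>a. (E a (k - a) z)\<^sup>2"]) auto

lemma comp_le_norm: "norm h \<le> H \<Longrightarrow> \<bar>fst h\<bar> \<le> H \<and> \<bar>snd h\<bar> \<le> H" for h :: "real \<times> real"
  using norm_fst_le[of "fst h" "snd h"] norm_snd_le[of "snd h" "fst h"] by simp

text \<open>A Poincare inequality by segment averaging, with the constant E 0 0 y as approximation
  and the small gradient bound G as the only source of accuracy. The centre y is chosen so as to
  bound that constant too, since it becomes a coefficient of the network.\<close>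

lemma patch_inner:
  assumes x0: "x0 \<in> closure \<Omega>" and r: "0 < r" "M * r \<le> \<rho>" and ne: "\<Omega> \<inter> ball x0 r \<noteq> {}"
    and G: "0 < G" "(\<integral>\<^sup>+x\<in>\<Omega> \<inter> ball x0 ((M + 1) * r). ennreal (sqsum E 1 x) \<partial>lborel) \<le> ennreal (G\<^sup>2)"
  shows "patch p x0 r (8 * (M + 2) * G) (2 * C / r)"
proof -
  obtain d where d: "norm d = 1"
    "\<And>x y. x \<in> ball x0 r \<Longrightarrow> y \<in> ball (x0 + (M * r) *\<^sub>R d) r \<Longrightarrow> norm (x - y) \<le> (M + 2) * r"
    "\<And>x y s. x \<in> \<Omega> \<inter> ball x0 r \<Longrightarrow> y \<in> ball (x0 + (M * r) *\<^sub>R d) r \<Longrightarrow> s \<in> {0..1} \<Longrightarrow>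
       y + s *\<^sub>R (x - y) \<in> \<Omega> \<inter> ball x0 ((M + 1) * r) \<and> ball (y + s *\<^sub>R (x - y)) ((1 - s) * (2 * r)) \<subseteq> \<Omega>"
    using patch_geom[OF x0 r] by metis
  define Y where "Y = ball (x0 + (M * r) *\<^sub>R d) r"
  define H where "H = (M + 2) * r"
  define V where "V = pi * r\<^sup>2"
  let ?X = "\<Omega> \<inter> ball x0 r" and ?U = "\<Omega> \<inter> ball x0 ((M + 1) * r)"
  have H0: "H > 0" unfolding H_def using r M4 by simp
  have V0: "V > 0" unfolding V_def using r by simp
  have Vr: "r\<^sup>2 \<le> V" unfolding V_def using pi_gt3 mult_right_mono[of 1 pi "r\<^sup>2"] by simp
  have [measurable]: "Y \<in> sets borel" "?X \<in> sets borel" "?U \<in> sets borel" unfolding Y_def by simp_all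
  have YO: "Y \<subseteq> ?U"
  proof
    fix y assume y: "y \<in> Y"
    obtain x where x: "x \<in> ?X" using ne by blast
    show "y \<in> ?U" using d(3)[OF x y[unfolded Y_def], of 0] by simp
  qed
  have "(\<integral>\<^sup>+x\<in>?X. (\<integral>\<^sup>+y\<in>Y. ennreal ((E 0 0 x - taylor 0 0 1 (x - y) y)\<^sup>2) \<partial>lborel) \<partial>lborel) \<le>
     ennreal (((2 * H) ^ 1 / fact (1 - 1))\<^sup>2 * (4 * (pi * r\<^sup>2))) * (\<integral>\<^sup>+z\<in>?U. ennreal (sqsum E (1 + 0 + 0) z) \<partial>lborel)"
    by (rule taylor_L2_unit[OF x0 r(1) zero_less_one H_def Y_def]) (use d Y_def in blast)+
  also have "\<dots> \<le> ennreal (((2 * H) ^ 1 / fact (1 - 1))\<^sup>2 * (4 * (pi * r\<^sup>2))) * ennreal (G\<^sup>2)"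
    using G(2) by (intro mult_left_mono) auto
  also have "\<dots> = ennreal (V * (4 * H * G)\<^sup>2)"
    by (subst ennreal_mult[symmetric]) (auto simp: V_def power_mult_distrib)
  finally have D: "(\<integral>\<^sup>+y\<in>Y. (sq_int ?X (\<lambda>x. E 0 0 x - E 0 0 y)) \<partial>lborel) \<le> ennreal (V * (4 * H * G)\<^sup>2)"
    unfolding taylor_one by (subst nn_integral_set_swap[symmetric]) (simp_all add: case_prod_beta)
  have D2: "(\<integral>\<^sup>+y\<in>Y. ennreal ((E 0 0 y)\<^sup>2) \<partial>lborel) \<le> ennreal (C\<^sup>2)"
  proof -
    have "(\<integral>\<^sup>+y\<in>Y. ennreal ((E 0 0 y)\<^sup>2) \<partial>lborel) = (\<integral>\<^sup>+y\<in>Y. ennreal (sqsum E 0 y) \<partial>lborel)" by (simp add: sqsum_def)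
    also have "\<dots> \<le> ennreal ((C * A ^ 0 * fact 0)\<^sup>2)" by (rule weighted_one) (use YO in auto)
    finally show ?thesis by simp
  qed
  define f where "f j y = (if j = (0::nat) then (sq_int ?X (\<lambda>x. E 0 0 x - E 0 0 y)) else ennreal ((E 0 0 y)\<^sup>2))" for j y
  define b where "b j = (if j = (0::nat) then V * (4 * H * G)\<^sup>2 else C\<^sup>2)" for j
  have "\<exists>y\<in>Y. \<forall>j\<in>{0,1}. f j y \<le> ennreal (2 * real (card {0,1::nat}) * b j / V)"
  proof (rule choose_point)
    show "f j \<in> borel_measurable borel" for j
      unfolding f_def by (cases "j = 0"; simp; measurable)
    show "b j > 0" for j unfolding b_def using V0 H0 G(1) CA by auto
    show "(\<integral>\<^sup>+y\<in>Y. f j y \<partial>lborel) \<le> ennreal (b j)" for j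
      using D D2 unfolding f_def b_def by (cases "j = 0") simp_all
    show "emeasure lborel Y = ennreal V" unfolding Y_def V_def using r by (intro emeasure_ball_plane) simp
  qed (use V0 in auto)
  then obtain y where y: "y \<in> Y" "f 0 y \<le> ennreal (4 * b 0 / V)" "f 1 y \<le> ennreal (4 * b 1 / V)" by auto
  define cf where "cf k i = (if k = (0::nat) \<and> i = (0::nat) then E 0 0 y else 0)" for k i
  have pp: "ppoly p H cf y x = E 0 0 y" for x
  proof -
    have "ppoly p H cf y x = (\<Sum>k\<le>p. if k = 0 then E 0 0 y else 0)"
      unfolding ppoly_def cf_def by (intro sum.cong refl) (simp add: if_distrib[of "\<lambda>c. c * _"] cong: if_cong)
    then show ?thesis by simp
  qed
  have pe: "ppoly p H cf y = (\<lambda>x. E 0 0 y)" using pp by blast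
  have e1: "G \<le> 8 * (M + 2) * G" using G(1) M4 by (simp add: mult_le_cancel_right1)
  have gr: "sq_int ?X (\<lambda>x. E a (1 - a) x - 0) \<le> ennreal ((8 * (M + 2) * G)\<^sup>2)" if "a \<le> 1" for a
  proof -
    have "r \<le> (M + 1) * r" using M4 r by (simp add: mult_le_cancel_right1)
    then have "?X \<subseteq> ?U" by auto
    then have "sq_int ?X (\<lambda>x. E a (1 - a) x - 0) \<le> (\<integral>\<^sup>+x\<in>?U. ennreal (sqsum E 1 x) \<partial>lborel)"
      using sq_le_sqsum[OF that] by (intro nn_integral_mono mult_mono ennreal_leI) (auto simp: indicator_def)
    also have "\<dots> \<le> ennreal ((8 * (M + 2) * G)\<^sup>2)"
      using G e1 by (intro order_trans[OF G(2)] ennreal_leI power_mono) auto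
    finally show ?thesis .
  qed
  have E0: "\<bar>E 0 0 y\<bar> \<le> 2 * C / r"
  proof -
    have "(E 0 0 y)\<^sup>2 \<le> 4 * C\<^sup>2 / V" using y(3) V0 unfolding f_def b_def by (simp add: ennreal_le_iff)
    also have "\<dots> \<le> 4 * C\<^sup>2 / r\<^sup>2" using Vr r V0 by (intro divide_left_mono) auto
    also have "\<dots> = (2 * C / r)\<^sup>2" by (simp add: power_divide power_mult_distrib)
    finally have "\<bar>E 0 0 y\<bar>\<^sup>2 \<le> (2 * C / r)\<^sup>2" by (simp only: power2_abs)
    then show ?thesis by (rule power2_le_imp_le) (use CA r in simp)
  qed
  have er: "sq_int ?X (\<lambda>x. E 0 0 x - E 0 0 y) \<le> ennreal ((8 * (M + 2) * G * r)\<^sup>2)"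
  proof -
    have "4 * (V * (4 * H * G)\<^sup>2) / V = (2 * (4 * H * G))\<^sup>2" using V0 by (simp add: power_mult_distrib)
    also have "2 * (4 * H * G) = 8 * (M + 2) * G * r" unfolding H_def by (simp add: mult_ac)
    finally show ?thesis using y(2) unfolding f_def b_def by simp
  qed
  have B0: "0 \<le> 2 * C / r" using CA r by simp
  show ?thesis
    unfolding patch_def
  proof (rule exI[of _ y], rule exI[of _ cf], rule exI[of _ "\<lambda>_. 0"], rule exI[of _ "\<lambda>_. 0"], intro conjI)
    show "\<forall>x. (ppoly p ((M + 2) * r) cf y has_derivative (\<lambda>e. fst e * 0 + snd e * 0)) (at x)"
      unfolding H_def[symmetric] pe by simp
    show "\<forall>k i. \<bar>cf k i\<bar> \<le> 2 * C / r" unfolding cf_def using E0 B0 by simp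
    show "\<forall>x\<in>ball x0 r. \<bar>fst (x - y)\<bar> \<le> (M + 2) * r \<and> \<bar>snd (x - y)\<bar> \<le> (M + 2) * r"
      using d(2) y(1) comp_le_norm unfolding Y_def by blast
    show "sq_int ?X (\<lambda>x. E 0 0 x - ppoly p ((M + 2) * r) cf y x) \<le> ennreal ((8 * (M + 2) * G * r)\<^sup>2)"
      unfolding H_def[symmetric] pp by (rule er)
    show "sq_int ?X (\<lambda>x. E 1 0 x - 0) \<le> ennreal ((8 * (M + 2) * G)\<^sup>2)" using gr[of 1] by simp
    show "sq_int ?X (\<lambda>x. E 0 1 x - 0) \<le> ennreal ((8 * (M + 2) * G)\<^sup>2)" using gr[of 0] by simp
  qed simp_all
qed

text \<open>\<open>small\<close> makes 2 H A / d0 at most 1/4. The factorials of the derivative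
  bound and of the Taylor remainder cancel up to powers of p, so the error of order p + 1 is
  governed by (2 H A / d0)^(p + 1). The constant K compares d0 with r and yields the factor r in the
  L2 error.\<close>

lemma patch_regular:
  assumes x0: "x0 \<in> closure \<Omega>" and r: "0 < r" "M * r \<le> \<rho>" and ne: "\<Omega> \<inter> ball x0 r \<noteq> {}"
    and p: "1 \<le> p" and d0: "0 < d0" "d0 \<le> 1" "\<And>z. z \<in> \<Omega> \<inter> ball x0 ((M + 1) * r) \<Longrightarrow> d0 \<le> \<delta> z"
    and small: "8 * ((M + 2) * r) * A \<le> d0" and K: "d0 \<le> K * r"
  shows "patch p x0 r (C * K * real (p + 2) ^ 3 / 4 ^ p) (2 * real (p + 2) * C / r)"
proof -
  obtain d where d: "norm d = 1"
    "\<And>x y. x \<in> ball x0 r \<Longrightarrow> y \<in> ball (x0 + (M * r) *\<^sub>R d) r \<Longrightarrow> norm (x - y) \<le> (M + 2) * r"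
    "\<And>x y s. x \<in> \<Omega> \<inter> ball x0 r \<Longrightarrow> y \<in> ball (x0 + (M * r) *\<^sub>R d) r \<Longrightarrow> s \<in> {0..1} \<Longrightarrow>
       y + s *\<^sub>R (x - y) \<in> \<Omega> \<inter> ball x0 ((M + 1) * r) \<and> ball (y + s *\<^sub>R (x - y)) ((1 - s) * (2 * r)) \<subseteq> \<Omega>"
    using patch_geom[OF x0 r] by metis
  define Y where "Y = ball (x0 + (M * r) *\<^sub>R d) r"
  define H where "H = (M + 2) * r"
  define V where "V = pi * r\<^sup>2"
  let ?X = "\<Omega> \<inter> ball x0 r" and ?U = "\<Omega> \<inter> ball x0 ((M + 1) * r)"
  have "1 * r \<le> (M + 2) * r" using r M4 by (intro mult_right_mono) auto
  then have Hr: "r \<le> H" unfolding H_def by simp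
  then have H0: "H > 0" using r by simp
  have V0: "V > 0" unfolding V_def using r by simp
  have Vr: "r\<^sup>2 \<le> V" unfolding V_def using pi_gt3 mult_right_mono[of 1 pi "r\<^sup>2"] by simp
  have K0: "K > 0" using K d0 r by (meson order_less_le_trans zero_less_mult_pos2)
  have [measurable]: "Y \<in> sets borel" "?X \<in> sets borel" "?U \<in> sets borel" unfolding Y_def by simp_all
  have YO: "Y \<subseteq> ?U"
  proof
    fix y assume y: "y \<in> Y"
    obtain x where x: "x \<in> ?X" using ne by blast
    show "y \<in> ?U" using d(3)[OF x y[unfolded Y_def], of 0] by simp
  qed
  define q where "q = 2 * H * A / d0"
  have q: "0 \<le> q" "q \<le> 1/4" unfolding q_def using small H0 CA d0 unfolding H_def by (auto simp: divide_le_eq)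
  have qp: "q ^ k \<le> (1/4) ^ k" for k using q by (intro power_mono) auto
  define b0 where "b0 = 2 * C * real (p + 1) * K * r / 4 ^ (p + 1)"
  define b1 where "b1 = 2 * C * (real (p + 1))\<^sup>2 * K / 4 ^ (p + 1)"
  have bp: "b0 > 0" "b1 > 0" unfolding b0_def b1_def using CA K0 r by auto
  have fp: "fact p = (fact (p - 1) * real p :: real)" using p by (cases p) (auto simp: mult.commute)
  have n0: "2 * ((2 * H) ^ (p + 1) / fact p * (C * A ^ (p + 1) * fact (p + 1) / d0 ^ p)) \<le> b0"
  proof -
    have "2 * ((2 * H) ^ (p + 1) / fact p * (C * A ^ (p + 1) * fact (p + 1) / d0 ^ p)) = 2 * C * real (p + 1) * (q ^ (p + 1) * d0)"
      unfolding q_def using d0 by (simp add: power_divide power_mult_distrib field_simps)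
    also have "\<dots> \<le> 2 * C * real (p + 1) * ((1/4) ^ (p + 1) * (K * r))"
      by (intro mult_left_mono mult_mono[OF qp K]) (use q d0 CA in simp_all)
    also have "\<dots> = b0" unfolding b0_def by (simp add: power_divide)
    finally show ?thesis .
  qed
  have n1: "2 * ((2 * H) ^ p / fact (p - 1) * (C * A ^ (p + 1) * fact (p + 1) / d0 ^ p)) \<le> b1"
  proof -
    have "2 * ((2 * H) ^ p / fact (p - 1) * (C * A ^ (p + 1) * fact (p + 1) / d0 ^ p)) = 2 * C * (real (p + 1) * real p) * (q ^ (p + 1) * (d0 / (2 * H)))"
      unfolding q_def using d0 H0 fp by (simp add: power_divide power_mult_distrib field_simps)
    also have "\<dots> \<le> 2 * C * (real (p + 1) * real (p + 1)) * ((1/4) ^ (p + 1) * K)"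
    proof -
      have "K * r \<le> K * (2 * H)" using Hr K0 r by (intro mult_left_mono) auto
      then have "d0 \<le> K * (2 * H)" using K by linarith
      then have dk: "d0 / (2 * H) \<le> K" using H0 by (simp add: divide_le_eq)
      have m: "q ^ (p + 1) * (d0 / (2 * H)) \<le> (1/4) ^ (p + 1) * K"
        by (rule mult_mono[OF qp dk]) (use d0 H0 in simp_all)
      have l: "real (p + 1) * real p \<le> real (p + 1) * real (p + 1)" by (intro mult_left_mono) auto
      show ?thesis by (intro mult_mono[OF _ m] mult_left_mono l) (use q d0 CA H0 in simp_all)
    qed
    also have "\<dots> = b1" unfolding b1_def by (simp add: power_divide power2_eq_square)
    finally show ?thesis .
  qed
  have WU: "(\<integral>\<^sup>+z\<in>?U. ennreal (sqsum E (p + 1) z) \<partial>lborel) \<le> ennreal ((C * A ^ (p + 1) * fact (p + 1) / d0 ^ p)\<^sup>2)"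
    using weighted_local_k[of ?U d0 "p + 1"] d0 by simp
  define err where "err i j n y = (sq_int ?X (\<lambda>x. E i j x - taylor i j n (x - y) y))" for i j n y
  have tm: "(\<lambda>(x, y). ennreal ((E i j x - taylor i j n (x - y) y)\<^sup>2)) \<in> borel_measurable (borel \<Otimes>\<^sub>M borel)" for i j n
  proof -
    have [measurable]: "(\<lambda>z. taylor i j n (fst z - snd z) (snd z)) \<in> borel_measurable (borel \<Otimes>\<^sub>M borel)"
      by (rule taylor_measurable) measurable
    show ?thesis unfolding case_prod_beta by measurable
  qed
  have errm: "err i j n \<in> borel_measurable borel" for i j n
  proof -
    have [measurable]: "(\<lambda>z. taylor i j n (snd z - fst z) (fst z)) \<in> borel_measurable (borel \<Otimes>\<^sub>M lborel)"
      by (rule taylor_measurable) measurable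
    have "(\<lambda>(y, x). ennreal ((E i j x - taylor i j n (x - y) y)\<^sup>2) * indicator ?X x) \<in> borel_measurable (borel \<Otimes>\<^sub>M lborel)"
      unfolding case_prod_beta by measurable
    then show ?thesis unfolding err_def by measurable
  qed
  have D: "(\<integral>\<^sup>+y\<in>Y. err i j n y \<partial>lborel) \<le> ennreal (V * b\<^sup>2)"
    if n: "n > 0" "n + i + j = p + 1" and b: "2 * ((2 * H) ^ n / fact (n - 1) * (C * A ^ (p + 1) * fact (p + 1) / d0 ^ p)) \<le> b" for i j n b
  proof -
    have "(\<integral>\<^sup>+y\<in>Y. err i j n y \<partial>lborel) = (\<integral>\<^sup>+x\<in>?X. (\<integral>\<^sup>+y\<in>Y. ennreal ((E i j x - taylor i j n (x - y) y)\<^sup>2) \<partial>lborel) \<partial>lborel)"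
      unfolding err_def by (rule nn_integral_set_swap[symmetric, OF tm]) simp_all
    also have "\<dots> \<le> ennreal (((2 * H) ^ n / fact (n - 1))\<^sup>2 * (4 * (pi * r\<^sup>2))) * (\<integral>\<^sup>+z\<in>?U. ennreal (sqsum E (n + i + j) z) \<partial>lborel)"
      by (rule taylor_L2_unit[OF x0 r(1) n(1) H_def Y_def]) (use d Y_def in blast)+
    also have "\<dots> \<le> ennreal (((2 * H) ^ n / fact (n - 1))\<^sup>2 * (4 * (pi * r\<^sup>2))) * ennreal ((C * A ^ (p + 1) * fact (p + 1) / d0 ^ p)\<^sup>2)"
      unfolding n(2) by (intro mult_left_mono WU) simp
    also have "\<dots> = ennreal (V * (2 * ((2 * H) ^ n / fact (n - 1) * (C * A ^ (p + 1) * fact (p + 1) / d0 ^ p)))\<^sup>2)"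
      unfolding V_def by (subst ennreal_mult[symmetric], simp, simp) (simp only: power_mult_distrib power2_eq_square mult_ac, simp)
    also have "\<dots> \<le> ennreal (V * b\<^sup>2)"
      using V0 b H0 CA d0 by (intro ennreal_leI mult_left_mono power_mono) auto
    finally show ?thesis .
  qed
  \<comment> \<open>Pairs with k \<le> p control the derivatives at the centre, that is the
    coefficients; row p + 1 holds the three error integrals. One centre has to serve them all, at
    the price of a factor quadratic in p in the squared bounds.\<close>
  define J where "J = {..p} \<times> {..p} \<union> {p + 1} \<times> {0, 1, 2::nat}"
  define f where "f j y = (case j of (k, i) \<Rightarrow> if k = p + 1 then (if i = 0 then err 0 0 (p + 1) y else if i = 1 then err 1 0 p y else err 0 1 p y)
      else if i \<le> k then ennreal ((E i (k - i) y)\<^sup>2) else 0)" for j y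
  define b where "b j = (case j of (k, i) \<Rightarrow> if k = p + 1 then (if i = (0::nat) then V * b0\<^sup>2 else V * b1\<^sup>2) else (C * A ^ k * fact k / d0 ^ k)\<^sup>2)" for j
  define N where "N = real (card J)"
  have N: "N \<le> (real (p + 2))\<^sup>2"
  proof -
    have "card J \<le> card ({..p} \<times> {..p}) + card ({p + 1} \<times> {0, 1, 2::nat})" unfolding J_def by (rule card_Un_le)
    also have "\<dots> = (p + 1) * (p + 1) + 3" by (simp add: card_cartesian_product)
    also have "\<dots> \<le> (p + 2)\<^sup>2" by (simp add: power2_eq_square)
    finally show ?thesis unfolding N_def by (metis of_nat_le_iff of_nat_power)
  qed
  have "\<exists>y\<in>Y. \<forall>j\<in>J. f j y \<le> ennreal (2 * real (card J) * b j / V)"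
  proof (rule choose_point)
    show "finite J" "J \<noteq> {}" unfolding J_def by auto
    show "f j \<in> borel_measurable borel" for j
      unfolding f_def using errm by (cases j) (simp split: if_splits)
    show "b j > 0" for j unfolding b_def using V0 bp CA d0 by (cases j) auto
    show "(\<integral>\<^sup>+y\<in>Y. f j y \<partial>lborel) \<le> ennreal (b j)" if jJ: "j \<in> J" for j
    proof (cases j)
      case (Pair k i)
      show ?thesis
      proof (cases "k = p + 1")
        case True
        consider "i = 0" | "i = 1" | "i = 2" using jJ Pair True unfolding J_def by auto
        then show ?thesis
        proof cases
          case 1 then show ?thesis using D[of "p + 1" 0 0 b0] n0 Pair True by (simp add: f_def b_def)
        next
          case 2 then show ?thesis using D[of p 1 0 b1] n1 p Pair True by (simp add: f_def b_def)
        next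
          case 3 then show ?thesis using D[of p 0 1 b1] n1 p Pair True by (simp add: f_def b_def)
        qed
      next
        case False
        show ?thesis
        proof (cases "i \<le> k")
          case True
          have "(\<integral>\<^sup>+y\<in>Y. ennreal ((E i (k - i) y)\<^sup>2) \<partial>lborel) \<le> (\<integral>\<^sup>+y\<in>?U. ennreal (sqsum E k y) \<partial>lborel)"
            using sq_le_sqsum[OF True] YO by (intro nn_integral_mono mult_mono ennreal_leI) (auto simp: indicator_def)
          also have "\<dots> \<le> ennreal ((C * A ^ k * fact k / d0 ^ (k - 1))\<^sup>2)" by (rule weighted_local_k) (use d0 in auto)
          also have "\<dots> \<le> ennreal ((C * A ^ k * fact k / d0 ^ k)\<^sup>2)"
            using CA d0 by (intro ennreal_leI power_mono divide_left_mono power_decreasing) auto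
          finally show ?thesis using False True Pair by (simp add: f_def b_def)
        qed (use False Pair in \<open>simp add: f_def b_def\<close>)
      qed
    qed
    show "emeasure lborel Y = ennreal V" unfolding Y_def V_def using r by (intro emeasure_ball_plane) simp
  qed (use V0 in auto)
  then obtain y where y: "y \<in> Y" "\<And>j. j \<in> J \<Longrightarrow> f j y \<le> ennreal (2 * N * b j / V)" unfolding N_def by auto
  have N0: "0 \<le> N" unfolding N_def by simp
  have sqb: "2 * N * (V * x\<^sup>2) / V \<le> (2 * real (p + 2) * x)\<^sup>2" for x
  proof -
    have "2 * N * (V * x\<^sup>2) / V = 2 * N * x\<^sup>2" using V0 by simp
    also have "\<dots> \<le> 4 * (real (p + 2))\<^sup>2 * x\<^sup>2" using N N0 by (intro mult_right_mono) auto
    also have "\<dots> = (2 * real (p + 2) * x)\<^sup>2" by (simp only: power_mult_distrib) simp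
    finally show ?thesis .
  qed
  let ?e = "C * K * real (p + 2) ^ 3 / 4 ^ p"
  have c2: "real (p + 1) \<le> real (p + 2)" by simp
  have e0: "2 * real (p + 2) * b0 \<le> ?e * r"
  proof -
    have "2 * real (p + 2) * b0 = C * K * (real (p + 2) * real (p + 1)) / 4 ^ p * r"
    proof -
      have "2 * a * (2 * C * b * K * r / 4 ^ (p + 1)) = C * K * (a * b) / 4 ^ p * r" for a b :: real by simp
      then show ?thesis unfolding b0_def .
    qed
    also have "\<dots> \<le> C * K * (real (p + 2) * (real (p + 2))\<^sup>2) / 4 ^ p * r"
    proof (intro mult_right_mono divide_right_mono mult_left_mono)
      have "real (p + 1) * 1 \<le> real (p + 2) * real (p + 2)" by (intro mult_mono) auto
      then show "real (p + 1) \<le> (real (p + 2))\<^sup>2" by (simp add: power2_eq_square)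
    qed (use CA K0 r in auto)
    finally show ?thesis by (simp only: power3_eq_cube power2_eq_square mult.assoc)
  qed
  have e1: "2 * real (p + 2) * b1 \<le> ?e"
  proof -
    have "2 * real (p + 2) * b1 = C * K * (real (p + 2) * (real (p + 1))\<^sup>2) / 4 ^ p"
    proof -
      have "2 * a * (2 * C * b * K / 4 ^ (p + 1)) = C * K * (a * b) / 4 ^ p" for a b :: real by simp
      then show ?thesis unfolding b1_def .
    qed
    also have "\<dots> \<le> C * K * (real (p + 2) * (real (p + 2))\<^sup>2) / 4 ^ p"
      using CA K0 by (intro divide_right_mono mult_left_mono power_mono) auto
    finally show ?thesis by (simp only: power3_eq_cube power2_eq_square mult.assoc)
  qed
  have E0: "err 0 0 (p + 1) y \<le> ennreal ((?e * r)\<^sup>2)"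
  proof -
    have "err 0 0 (p + 1) y \<le> ennreal (2 * N * (V * b0\<^sup>2) / V)" using y(2)[of "(p + 1, 0)"] unfolding J_def f_def b_def by simp
    also have "\<dots> \<le> ennreal ((2 * real (p + 2) * b0)\<^sup>2)" by (intro ennreal_leI sqb)
    also have "\<dots> \<le> ennreal ((?e * r)\<^sup>2)" using e0 bp by (intro ennreal_leI power_mono) auto
    finally show ?thesis .
  qed
  have bb: "ennreal (2 * N * (V * b1\<^sup>2) / V) \<le> ennreal (?e\<^sup>2)"
    using e1 bp by (intro order_trans[OF ennreal_leI[OF sqb] ennreal_leI] power_mono) auto
  have E1: "err 1 0 p y \<le> ennreal (?e\<^sup>2)"
    using y(2)[of "(p + 1, 1)"] unfolding J_def f_def b_def by (intro order_trans[OF _ bb]) simp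
  have E2: "err 0 1 p y \<le> ennreal (?e\<^sup>2)"
    using y(2)[of "(p + 1, 2)"] unfolding J_def f_def b_def by (intro order_trans[OF _ bb]) simp
  \<comment> \<open>Set to zero outside the triangle i \<le> k \<le> p, so that the coefficient
    bound holds for all indices.\<close>
  define cf where "cf k i = (if i \<le> k \<and> k \<le> p then E i (k - i) y * H ^ k * real (k choose i) / fact k else 0)" for k i
  have pp: "ppoly p H cf y x = taylor 0 0 (Suc p) (x - y) y" for x
  proof -
    have "cf k i * ((fst (x - y) / H) ^ i * (snd (x - y) / H) ^ (k - i))
       = real (k choose i) * (fst (x - y) ^ i * snd (x - y) ^ (k - i) * E i (k - i) y) / fact k" if "k \<le> p" "i \<le> k" for k i
    proof -
      have "H ^ k = H ^ i * H ^ (k - i)" using that by (simp flip: power_add)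
      then show ?thesis using that H0 unfolding cf_def by (simp add: power_divide)
    qed
    then have "ppoly p H cf y x = (\<Sum>k\<le>p. dirW E k (x - y) y / fact k)"
      unfolding ppoly_def dirW_def sum_divide_distrib by (intro sum.cong refl) auto
    then show ?thesis unfolding taylor_def by (simp add: lessThan_Suc_atMost)
  qed
  have cfb: "\<bar>cf k i\<bar> \<le> 2 * real (p + 2) * C / r" for k i
  proof (cases "i \<le> k \<and> k \<le> p")
    case True
    let ?w = "C * A ^ k * fact k / d0 ^ k"
    have "(k, i) \<in> J" using True unfolding J_def by auto
    then have "ennreal ((E i (k - i) y)\<^sup>2) \<le> ennreal (2 * N * ?w\<^sup>2 / V)" using y(2)[of "(k, i)"] True unfolding f_def b_def by simp
    then have "(E i (k - i) y)\<^sup>2 \<le> 2 * N * ?w\<^sup>2 / V" using N0 V0 by (subst (asm) ennreal_le_iff) auto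
    also have "\<dots> \<le> 4 * (real (p + 2))\<^sup>2 * ?w\<^sup>2 / r\<^sup>2"
    proof (rule frac_le)
      show "2 * N * ?w\<^sup>2 \<le> 4 * (real (p + 2))\<^sup>2 * ?w\<^sup>2" using N N0 by (intro mult_right_mono) auto
    qed (use Vr r in auto)
    also have "\<dots> = (2 * real (p + 2) * ?w / r)\<^sup>2" by (simp only: power_divide power_mult_distrib) simp
    finally have "\<bar>E i (k - i) y\<bar>\<^sup>2 \<le> (2 * real (p + 2) * ?w / r)\<^sup>2" by (simp only: power2_abs)
    then have Ey: "\<bar>E i (k - i) y\<bar> \<le> 2 * real (p + 2) * ?w / r"
      by (rule power2_le_imp_le) (use CA d0 r in simp)
    have "\<bar>cf k i\<bar> = \<bar>E i (k - i) y\<bar> * (H ^ k * (real (k choose i) / fact k))"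
      unfolding cf_def using True H0 by (simp add: abs_mult)
    also have "\<dots> \<le> (2 * real (p + 2) * ?w / r) * (H ^ k * (2 ^ k / fact k))"
    proof (intro mult_mono Ey divide_right_mono)
      have "(k choose i) \<le> (\<Sum>i\<le>k. k choose i)" using True by (intro member_le_sum) auto
      then show "real (k choose i) \<le> 2 ^ k" unfolding choose_row_sum by (metis of_nat_le_iff of_nat_numeral of_nat_power)
    qed (use H0 CA d0 r in auto)
    also have "\<dots> = 2 * real (p + 2) * C / r * q ^ k"
    proof -
      have "(a * ?w / r) * (H ^ k * (2 ^ k / fact k)) = a * C / r * q ^ k" for a
        unfolding q_def by (simp add: power_divide power_mult_distrib mult_ac)
      then show ?thesis .
    qed
    also have "\<dots> \<le> 2 * real (p + 2) * C / r * 1" using q CA r by (intro mult_left_mono power_le_one) auto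
    finally show ?thesis by simp
  next
    case False
    then have "cf k i = 0" unfolding cf_def by auto
    then show ?thesis using CA r by simp
  qed
  have pe: "ppoly p H cf y = (\<lambda>x. taylor 0 0 (Suc p) (x - y) y)" using pp by blast
  have tmx: "(\<lambda>x. taylor i j n (x - y) y) \<in> borel_measurable borel" for i j n by (rule taylor_measurable) measurable
  show ?thesis
    unfolding patch_def H_def[symmetric]
  proof (rule exI[of _ y], rule exI[of _ cf], rule exI[of _ "\<lambda>x. taylor 1 0 p (x - y) y"], rule exI[of _ "\<lambda>x. taylor 0 1 p (x - y) y"], intro conjI)
    show "\<forall>x. (ppoly p H cf y has_derivative (\<lambda>e. fst e * taylor 1 0 p (x - y) y + snd e * taylor 0 1 p (x - y) y)) (at x)"
      unfolding pe using taylor_has_derivative by blast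
    show "\<forall>k i. \<bar>cf k i\<bar> \<le> 2 * real (p + 2) * C / r" using cfb by blast
    show "\<forall>x\<in>ball x0 r. \<bar>fst (x - y)\<bar> \<le> H \<and> \<bar>snd (x - y)\<bar> \<le> H"
      using d(2) y(1) comp_le_norm unfolding Y_def H_def by blast
    show "sq_int ?X (\<lambda>x. E 0 0 x - ppoly p H cf y x) \<le> ennreal ((?e * r)\<^sup>2)"
      using E0 unfolding err_def pe by simp
  qed (use E1 E2 tmx in \<open>simp_all add: err_def\<close>)
qed

end

section \<open>Cutoff networks\<close>

lemma abs_comp_le_norm: "\<bar>fst h\<bar> \<le> norm h" "\<bar>snd h\<bar> \<le> norm h" for h :: "real \<times> real"
  using norm_fst_le[of "fst h" "snd h", unfolded prod.collapse] norm_snd_le[of "snd h" "fst h", unfolded prod.collapse]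
  by simp_all

text \<open>The distance to the corners is taken in the sum norm and cut at 1, a function that a
  fixed ReLU network computes exactly, with a size that depends on the corners only. The negative is
  carried along so that D can be recovered from rectified values.\<close>

lemma corner_dist_net:
  assumes "finite Cs"
  shows "\<exists>D L s. L \<ge> 1 \<and> NNs L s [D, \<lambda>x. - D x] \<and> lip 2 D \<and> (\<forall>x. 0 \<le> D x \<and> D x \<le> 1) \<and>
    (\<forall>x. \<forall>c\<in>Cs. D x \<le> \<bar>fst x - fst c\<bar> + \<bar>snd x - snd c\<bar>) \<and>
    (\<forall>x. D x = 1 \<or> (\<exists>c\<in>Cs. D x = \<bar>fst x - fst c\<bar> + \<bar>snd x - snd c\<bar>))"
  using assms
proof (induction Cs)
  case empty
  define gs :: "(real \<times> real \<Rightarrow> real) list" where "gs = [\<lambda>x. 1, \<lambda>x. - 1]"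
  have "NNs 1 (length gs * 3) gs"
  proof (rule NNs_input, intro ballI)
    fix g assume "g \<in> set gs"
    then show "\<exists>a b d. \<forall>x. g x = a * fst x + b * snd x + d"
      by (intro exI[of _ 0] exI[of _ "g 0"]) (auto simp: gs_def)
  qed
  then have "NNs 1 6 [\<lambda>x. 1, \<lambda>x. - 1]" by (simp add: gs_def)
  then show ?case by (intro exI[of _ "\<lambda>x. 1"] exI[of _ 1] exI[of _ 6]) (auto intro: lip_const)
next
  case (insert c Cs)
  then obtain D L s where D: "L \<ge> 1" "NNs L s [D, \<lambda>x. - D x]" "lip 2 D" "\<And>x. 0 \<le> D x \<and> D x \<le> 1"
     "\<And>x c. c \<in> Cs \<Longrightarrow> D x \<le> \<bar>fst x - fst c\<bar> + \<bar>snd x - snd c\<bar>"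
     "\<And>x. D x = 1 \<or> (\<exists>c\<in>Cs. D x = \<bar>fst x - fst c\<bar> + \<bar>snd x - snd c\<bar>)" by blast
  define n where "n x = \<bar>fst x - fst c\<bar> + \<bar>snd x - snd c\<bar>" for x :: "real \<times> real"
  let ?g0 = "[\<lambda>x. fst x - fst c, \<lambda>x. - (fst x - fst c), \<lambda>x. snd x - snd c, \<lambda>x. - (snd x - snd c)]"
  have "NNs 1 (length ?g0 * 3) ?g0"
  proof (rule NNs_input, intro ballI)
    fix g assume "g \<in> set ?g0"
    then consider "g = (\<lambda>x. fst x - fst c)" | "g = (\<lambda>x. - (fst x - fst c))" | "g = (\<lambda>x. snd x - snd c)" | "g = (\<lambda>x. - (snd x - snd c))" by auto
    then show "\<exists>a b d. \<forall>x. g x = a * fst x + b * snd x + d"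
    proof cases
      case 1 then show ?thesis by (intro exI[of _ 1] exI[of _ 0] exI[of _ "- fst c"]) simp
    next
      case 2 then show ?thesis by (intro exI[of _ "-1"] exI[of _ 0] exI[of _ "fst c"]) simp
    next
      case 3 then show ?thesis by (intro exI[of _ 0] exI[of _ 1] exI[of _ "- snd c"]) simp
    next
      case 4 then show ?thesis by (intro exI[of _ 0] exI[of _ "-1"] exI[of _ "snd c"]) simp
    qed
  qed
  then have g0: "NNs 1 12 ?g0" by simp
  have ab: "\<bar>y\<bar> = max 0 y + max 0 (- y)" for y :: real by auto
  have g1: "NNs 2 22 [n, \<lambda>x. - n x]"
    apply (rule NNs_layer[OF g0])
      apply (unfold list.pred_inject, intro conjI)
    subgoal by (rule layer_rowI[of "[1,1,1,1]" _ _ 0]) (simp_all add: n_def ab)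
    subgoal by (rule layer_rowI[of "[-1,-1,-1,-1]" _ _ 0]) (simp_all add: n_def ab)
    by simp_all
  have a: "NNs (L + 2) (s + 6 * 2) [D, \<lambda>x. - D x]" by (rule NNs_deepen[OF D(2)])
  have b: "NNs (L + 2) (22 + 6 * L) [n, \<lambda>x. - n x]" using NNs_deepen[OF g1, of L] by (simp add: add.commute)
  have mf: "f = max 0 f - max 0 (- f)" for f :: real by auto
  have g2: "NNs (L + 3) (s + 6 * 2 + (22 + 6 * L) + 15) [D, \<lambda>x. - D x, \<lambda>x. D x - n x]"
    apply (rule NNs_layer[OF NNs_par[OF a b]])
      apply (unfold list.pred_inject, intro conjI)
    subgoal by (rule layer_rowI[of "[1,-1,0,0]" _ _ 0]) (simp_all add: max_def)
    subgoal by (rule layer_rowI[of "[-1,1,0,0]" _ _ 0]) (simp_all add: max_def)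
    subgoal by (rule layer_rowI[of "[1,-1,-1,1]" _ _ 0]) (simp_all add: max_def)
    by simp_all
  define D' where "D' x = min (D x) (n x)" for x
  \<comment> \<open>The minimum is D minus the positive part of D - n, with D itself recovered from
    its two rectified parts.\<close>
  have m: "D' x = max 0 (D x) - max 0 (- D x) - max 0 (D x - n x)" for x unfolding D'_def by (auto simp: max_def min_def)
  have g3: "NNs (L + 4) (s + 6 * 2 + (22 + 6 * L) + 15 + 8) [D', \<lambda>x. - D' x]"
    apply (rule NNs_layer[OF g2])
      apply (unfold list.pred_inject, intro conjI)
    subgoal by (rule layer_rowI[of "[1,-1,-1]" _ _ 0]) (simp_all add: m)
    subgoal by (rule layer_rowI[of "[-1,1,1]" _ _ 0]) (simp_all add: m)
    by simp_all
  have ln: "lip 2 n"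
    unfolding lip_def
  proof (intro allI)
    fix x y :: "real \<times> real"
    have "\<bar>fst (x - y)\<bar> \<le> norm (x - y)" "\<bar>snd (x - y)\<bar> \<le> norm (x - y)"
      by (rule abs_comp_le_norm)+
    moreover have "\<bar>n x - n y\<bar> \<le> \<bar>fst (x - y)\<bar> + \<bar>snd (x - y)\<bar>" unfolding n_def by (simp add: abs_if split: if_splits)
    ultimately show "\<bar>n x - n y\<bar> \<le> 2 * norm (x - y)" by linarith
  qed
  have n0: "0 \<le> n x" for x unfolding n_def by simp
  show ?case
  proof (rule exI[of _ D'], rule exI[of _ "L + 4"], rule exI[of _ "s + 6 * 2 + (22 + 6 * L) + 15 + 8"], intro conjI)
    show "lip 2 D'" unfolding D'_def by (intro lip_min D ln)
    show "\<forall>x. 0 \<le> D' x \<and> D' x \<le> 1" unfolding D'_def using D(4) n0 by (simp add: min_le_iff_disj)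
    show "\<forall>x. \<forall>c'\<in>insert c Cs. D' x \<le> \<bar>fst x - fst c'\<bar> + \<bar>snd x - snd c'\<bar>"
      unfolding D'_def using D(5) by (auto simp: n_def min_le_iff_disj)
    show "\<forall>x. D' x = 1 \<or> (\<exists>c'\<in>insert c Cs. D' x = \<bar>fst x - fst c'\<bar> + \<bar>snd x - snd c'\<bar>)"
    proof
      fix x
      show "D' x = 1 \<or> (\<exists>c'\<in>insert c Cs. D' x = \<bar>fst x - fst c'\<bar> + \<bar>snd x - snd c'\<bar>)"
        using D(6)[of x] unfolding D'_def n_def min_def by auto
    qed
  qed (use g3 in auto)
qed

lemma coordinate_net:
  "NNs 1 6 [fst, \<lambda>x. - fst x]" "NNs 1 6 [snd, \<lambda>x. - snd x]"
proof -
  have "NNs 1 (length [fst, \<lambda>x::real\<times>real. - fst x] * 3) [fst, \<lambda>x. - fst x]"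
  proof (rule NNs_input, intro ballI)
    fix g :: "real \<times> real \<Rightarrow> real" assume "g \<in> set [fst, \<lambda>x. - fst x]"
    then consider "g = fst" | "g = (\<lambda>x. - fst x)" by auto
    then show "\<exists>a b d. \<forall>x. g x = a * fst x + b * snd x + d"
      by cases (intro exI[of _ 1] exI[of _ 0], simp, intro exI[of _ "-1"] exI[of _ 0], simp)
  qed
  then show "NNs 1 6 [fst, \<lambda>x. - fst x]" by simp
  have "NNs 1 (length [snd, \<lambda>x::real\<times>real. - snd x] * 3) [snd, \<lambda>x. - snd x]"
  proof (rule NNs_input, intro ballI)
    fix g :: "real \<times> real \<Rightarrow> real" assume "g \<in> set [snd, \<lambda>x. - snd x]"
    then consider "g = snd" | "g = (\<lambda>x. - snd x)" by auto
    then show "\<exists>a b d. \<forall>x. g x = a * fst x + b * snd x + d"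
      by cases (rule exI[of _ 0], intro exI[of _ 1] exI[of _ 0], simp, rule exI[of _ 0], intro exI[of _ "-1"] exI[of _ 0], simp)
  qed
  then show "NNs 1 6 [snd, \<lambda>x. - snd x]" by simp
qed

definition hatf :: "real \<Rightarrow> real" where "hatf t = max 0 (t + 1) - 2 * max 0 t + max 0 (t - 1)"
text \<open>A replacement for the coordinate: the identity on [-1, 1] and of modulus at most 1
  everywhere, so that monomials become products of bounded factors on the whole plane.\<close>

definition clipf :: "real \<Rightarrow> real" where "clipf t = max 0 (t + 1) - max 0 (t - 1) - 1"
definition rampf :: "real \<Rightarrow> real" where "rampf t = max 0 (2 - t) - max 0 (1 - t)"

lemma hatf_simps: "0 \<le> hatf t" "hatf t \<le> 1" "\<bar>hatf s - hatf t\<bar> \<le> \<bar>s - t\<bar>" "\<bar>t\<bar> \<ge> 1 \<Longrightarrow> hatf t = 0"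
  "0 \<le> t \<Longrightarrow> t \<le> 1 \<Longrightarrow> hatf t + hatf (t - 1) = 1"
  unfolding hatf_def by (auto simp: max_def)

lemma clipf_simps: "\<bar>clipf t\<bar> \<le> 1" "\<bar>clipf s - clipf t\<bar> \<le> \<bar>s - t\<bar>" "\<bar>t\<bar> \<le> 1 \<Longrightarrow> clipf t = t"
  unfolding clipf_def by (auto simp: max_def abs_le_iff)

lemma rampf_simps: "0 \<le> rampf t" "rampf t \<le> 1" "\<bar>rampf s - rampf t\<bar> \<le> \<bar>s - t\<bar>" "t \<le> 1 \<Longrightarrow> rampf t = 1" "t \<ge> 2 \<Longrightarrow> rampf t = 0"
  "s \<le> t \<Longrightarrow> rampf t \<le> rampf s"
  unfolding rampf_def by (auto simp: max_def)

text \<open>Layer j lives where the distance D to the corners is about 2^-j.\<close>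
definition ramp :: "(real \<times> real \<Rightarrow> real) \<Rightarrow> nat \<Rightarrow> real \<times> real \<Rightarrow> real" where
  "ramp D j x = (if j = 0 then 1 else rampf (2 ^ j * D x))"

text \<open>Differences of consecutive ramps, which telescope to \<open>ramp D 0\<close>, that is to
  1. The last one keeps its full ramp and therefore covers the corners themselves.\<close>

definition ring :: "(real \<times> real \<Rightarrow> real) \<Rightarrow> nat \<Rightarrow> nat \<Rightarrow> real \<times> real \<Rightarrow> real" where
  "ring D p j x = ramp D j x - (if j = p then 0 else ramp D (Suc j) x)"

lemma sum_ring: "(\<Sum>j\<le>p. ring D p j x) = 1"
proof -
  have "(\<Sum>j\<le>p. ring D p j x) = (\<Sum>j<p. ramp D j x - ramp D (Suc j) x) + ramp D p x"
    by (simp add: lessThan_Suc_atMost[symmetric] ring_def)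
  also have "\<dots> = ramp D 0 x" by (subst sum_lessThan_telescope') simp
  finally show ?thesis by (simp add: ramp_def)
qed

lemma ramp_bounds: "0 \<le> ramp D j x" "ramp D j x \<le> 1"
  unfolding ramp_def using rampf_simps by auto

lemma ring_bounds:
  assumes "\<And>x. 0 \<le> D x"
  shows "0 \<le> ring D p j x" "ring D p j x \<le> 1"
proof -
  have "ramp D (Suc j) x \<le> ramp D j x"
  proof (cases "j = 0")
    case True then show ?thesis using ramp_bounds(2)[of D 1 x] by (simp add: ramp_def)
  next
    case False
    have "2 ^ j * D x \<le> 2 ^ Suc j * D x" using assms[of x] by (intro mult_right_mono) auto
    then show ?thesis using False rampf_simps(6)[of "2 ^ j * D x" "2 ^ Suc j * D x"] by (simp add: ramp_def)
  qed
  then show "0 \<le> ring D p j x" using ramp_bounds(1) by (auto simp: ring_def)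
  show "ring D p j x \<le> 1" using ramp_bounds[of D j x] ramp_bounds(1)[of D "Suc j" x] by (auto simp: ring_def)
qed

lemma lip_ramp:
  assumes "lip 2 D" shows "lip (2 * 2 ^ j) (ramp D j)"
proof (cases "j = 0")
  case False
  show ?thesis unfolding lip_def
  proof (intro allI)
    fix x y
    have "\<bar>ramp D j x - ramp D j y\<bar> \<le> \<bar>2 ^ j * D x - 2 ^ j * D y\<bar>" using False rampf_simps(3) by (simp add: ramp_def)
    also have "\<dots> = 2 ^ j * \<bar>D x - D y\<bar>" by (simp add: abs_mult flip: right_diff_distrib)
    also have "\<dots> \<le> 2 ^ j * (2 * norm (x - y))" using lipD[OF assms] by (intro mult_left_mono) auto
    finally show "\<bar>ramp D j x - ramp D j y\<bar> \<le> 2 * 2 ^ j * norm (x - y)" by simp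
  qed
qed (simp add: ramp_def[abs_def] lip_const)

lemma lip_ring:
  assumes "lip 2 D" shows "lip (6 * 2 ^ j) (ring D p j)"
proof (cases "j = p")
  case True
  then show ?thesis using lip_mono[OF lip_ramp[OF assms], of j "6 * 2 ^ j"] by (simp add: ring_def[abs_def])
next
  case False
  have "lip (2 * 2 ^ j + \<bar>-1\<bar> * (2 * 2 ^ Suc j)) (\<lambda>x. ramp D j x + (-1) * ramp D (Suc j) x)"
    by (intro lip_add lip_cmul lip_ramp assms)
  then show ?thesis using False by (simp add: ring_def[abs_def])
qed

lemma ring_support:
  assumes "ring D p j x \<noteq> 0"
  shows "0 < j \<Longrightarrow> D x < 2 / 2 ^ j" "j < p \<Longrightarrow> 1 / 2 ^ Suc j < D x"
proof -
  {
    assume j: "0 < j"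
    show "D x < 2 / 2 ^ j"
    proof (rule ccontr)
      assume "\<not> D x < 2 / 2 ^ j"
      then have D: "2 \<le> 2 ^ j * D x" by (simp add: divide_le_eq mult.commute not_less)
      then have "ramp D j x = 0" "ramp D (Suc j) x = 0" using j rampf_simps(5) by (simp_all add: ramp_def)
      then show False using assms by (simp add: ring_def split: if_splits)
    qed
  }
  {
    assume j: "j < p"
    show "1 / 2 ^ Suc j < D x"
    proof (rule ccontr)
      assume "\<not> 1 / 2 ^ Suc j < D x"
      then have D: "2 ^ Suc j * D x \<le> 1" by (simp add: le_divide_eq mult.commute not_less)
      have "2 ^ j * D x \<le> 1"
      proof (cases "0 \<le> D x")
        case True
        then have "2 ^ j * D x \<le> 2 ^ Suc j * D x" by (intro mult_right_mono) auto
        then show ?thesis using D by linarith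
      next
        case False
        then show ?thesis by (meson less_eq_real_def mult_nonneg_nonpos not_le order_trans zero_le_numeral zero_le_power zero_le_one)
      qed
      then have "ramp D j x = 1" "ramp D (Suc j) x = 1" using D rampf_simps(4) by (simp_all add: ramp_def)
      then show False using assms j by (simp add: ring_def)
    qed
  }
qed

text \<open>The arguments given to \<open>NNs_relu4\<close> spell out hats, clippings and ramp
  differences. With a common depth and size, any selection of these factors, padded by the constant
  1, can form the leaves of one product tree.\<close>

lemma NNs_factors:
  assumes X: "NNs L s [fst, \<lambda>x. - fst x]" and Y: "NNs L s [snd, \<lambda>x. - snd x]" and D: "NNs L s [D, \<lambda>x. - D x]"
  shows "NNs (L + 2) (s + 17) [\<lambda>x. hatf (fst x / h - m)]" "NNs (L + 2) (s + 17) [\<lambda>x. hatf (snd x / h - m)]"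
    "NNs (L + 2) (s + 17) [\<lambda>x. clipf ((fst x - m) / h)]" "NNs (L + 2) (s + 17) [\<lambda>x. clipf ((snd x - m) / h)]"
    "NNs (L + 2) (s + 17) [\<lambda>x. 1]" "NNs (L + 2) (s + 17) [ring D p j]"
proof -
  note R = NNs_relu4
  show "NNs (L + 2) (s + 17) [\<lambda>x. hatf (fst x / h - m)]"
    using R[OF X, of 1 "1/h" "1 - m" "-2" "1/h" "- m" 1 "1/h" "- 1 - m" 0 0 0 0] by (simp add: hatf_def algebra_simps)
  show "NNs (L + 2) (s + 17) [\<lambda>x. hatf (snd x / h - m)]"
    using R[OF Y, of 1 "1/h" "1 - m" "-2" "1/h" "- m" 1 "1/h" "- 1 - m" 0 0 0 0] by (simp add: hatf_def algebra_simps)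
  show "NNs (L + 2) (s + 17) [\<lambda>x. clipf ((fst x - m) / h)]"
    using R[OF X, of 1 "1/h" "1 - m / h" "-1" "1/h" "- 1 - m / h" 0 0 0 0 0 0 "-1"] by (simp add: clipf_def diff_divide_distrib algebra_simps)
  show "NNs (L + 2) (s + 17) [\<lambda>x. clipf ((snd x - m) / h)]"
    using R[OF Y, of 1 "1/h" "1 - m / h" "-1" "1/h" "- 1 - m / h" 0 0 0 0 0 0 "-1"] by (simp add: clipf_def diff_divide_distrib algebra_simps)
  show "NNs (L + 2) (s + 17) [\<lambda>x. 1]"
    using R[OF X, of 0 0 0 0 0 0 0 0 0 0 0 0 1] by simp
  show "NNs (L + 2) (s + 17) [ring D p j]"
  proof -
    consider "j = 0" "j = p" | "j = 0" "j \<noteq> p" | "j \<noteq> 0" "j = p" | "j \<noteq> 0" "j \<noteq> p" by blast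
    then show ?thesis
    proof cases
      case 1
      then have "ring D p j = (\<lambda>x. 1)" by (simp add: ring_def[abs_def] ramp_def)
      then show ?thesis using R[OF X, of 0 0 0 0 0 0 0 0 0 0 0 0 1] by simp
    next
      case 2
      then show ?thesis
        using R[OF D, of "-1" "-2" 2 1 "-2" 1 0 0 0 0 0 0 1] by (simp add: ring_def[abs_def] ramp_def rampf_def algebra_simps)
    next
      case 3
      then show ?thesis
        using R[OF D, of 1 "- (2 ^ j)" 2 "-1" "- (2 ^ j)" 1 0 0 0 0 0 0 0] by (simp add: ring_def[abs_def] ramp_def rampf_def algebra_simps)
    next
      case 4
      then show ?thesis
        using R[OF D, of 1 "- (2 ^ j)" 2 "-1" "- (2 ^ j)" 1 "-1" "- (2 ^ Suc j)" 2 1 "- (2 ^ Suc j)" 1 0]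
        by (simp add: ring_def[abs_def] ramp_def rampf_def algebra_simps)
    qed
  qed
qed

lemma sum_hatf:
  fixes t :: real
  assumes "finite S" "\<lfloor>t\<rfloor> \<in> S" "\<lfloor>t\<rfloor> + 1 \<in> S"
  shows "(\<Sum>m\<in>S. hatf (t - of_int m)) = 1"
proof -
  have "(\<Sum>m\<in>S. hatf (t - of_int m)) = (\<Sum>m\<in>{\<lfloor>t\<rfloor>, \<lfloor>t\<rfloor> + 1}. hatf (t - of_int m))"
  proof (rule sum.mono_neutral_right[OF assms(1)])
    show "\<forall>m\<in>S - {\<lfloor>t\<rfloor>, \<lfloor>t\<rfloor> + 1}. hatf (t - of_int m) = 0"
    proof
      fix m assume "m \<in> S - {\<lfloor>t\<rfloor>, \<lfloor>t\<rfloor> + 1}"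
      then have "m \<le> \<lfloor>t\<rfloor> - 1 \<or> m \<ge> \<lfloor>t\<rfloor> + 2" by auto
      then have "\<bar>t - of_int m\<bar> \<ge> 1" by linarith
      then show "hatf (t - of_int m) = 0" by (rule hatf_simps(4))
    qed
  qed (use assms in auto)
  also have "\<dots> = hatf (t - of_int \<lfloor>t\<rfloor>) + hatf (t - of_int \<lfloor>t\<rfloor> - 1)" by (simp add: algebra_simps)
  also have "\<dots> = 1" by (rule hatf_simps(5)) linarith+
  finally show ?thesis .
qed

section \<open>Gluing\<close>

lemma sum_square_le:
  fixes a :: "'i \<Rightarrow> real"
  shows "(\<Sum>i\<in>I. a i)\<^sup>2 \<le> real (card I) * (\<Sum>i\<in>I. (a i)\<^sup>2)"
  using Cauchy_Schwarz_ineq_sum[of "\<lambda>_. 1" a I] by simp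

text \<open>The overlap of the sets is not counted: Cauchy-Schwarz costs one factor card I, summing
  the local bounds another. With O(p) pieces this is polynomial in p.\<close>

lemma nn_integral_local_sum:
  fixes f :: "real \<times> real \<Rightarrow> real" and c :: "'i \<Rightarrow> real \<times> real \<Rightarrow> real"
  assumes fin: "finite I" and [measurable]: "\<Omega> \<in> sets borel" "\<And>i. i \<in> I \<Longrightarrow> c i \<in> borel_measurable borel" "\<And>i. i \<in> I \<Longrightarrow> B i \<in> sets borel"
    and f: "\<And>x. x \<in> \<Omega> \<Longrightarrow> (f x)\<^sup>2 \<le> real (card I) * (\<Sum>i\<in>I. indicat_real (B i) x * c i x)"
    and c0: "\<And>i x. i \<in> I \<Longrightarrow> 0 \<le> c i x" and v: "\<And>i. i \<in> I \<Longrightarrow> (\<integral>\<^sup>+x\<in>\<Omega> \<inter> B i. ennreal (c i x) \<partial>lborel) \<le> ennreal v" "0 \<le> v"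
  shows "sq_int \<Omega> f \<le> ennreal (real (card I) * (real (card I) * v))"
proof -
  have "sq_int \<Omega> f \<le> (\<integral>\<^sup>+x. ennreal (real (card I)) * (\<Sum>i\<in>I. ennreal (c i x) * indicator (\<Omega> \<inter> B i) x) \<partial>lborel)"
  proof (rule nn_integral_mono)
    fix x
    show "ennreal ((f x)\<^sup>2) * indicator \<Omega> x \<le> ennreal (real (card I)) * (\<Sum>i\<in>I. ennreal (c i x) * indicator (\<Omega> \<inter> B i) x)"
    proof (cases "x \<in> \<Omega>")
      case True
      have "ennreal ((f x)\<^sup>2) \<le> ennreal (real (card I) * (\<Sum>i\<in>I. indicat_real (B i) x * c i x))" by (rule ennreal_leI[OF f[OF True]])
      also have "\<dots> = ennreal (real (card I)) * (\<Sum>i\<in>I. ennreal (indicat_real (B i) x * c i x))"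
      proof -
        have nn: "0 \<le> indicat_real (B i) x * c i x" if "i \<in> I" for i using c0[OF that] by simp
        show ?thesis by (subst ennreal_mult) (use nn in \<open>simp_all add: sum_nonneg sum_ennreal\<close>)
      qed
      also have "(\<Sum>i\<in>I. ennreal (indicat_real (B i) x * c i x)) = (\<Sum>i\<in>I. ennreal (c i x) * indicator (\<Omega> \<inter> B i) x)"
        using True by (intro sum.cong) (auto simp: indicator_def)
      finally show ?thesis using True by simp
    qed simp
  qed
  also have "\<dots> = ennreal (real (card I)) * (\<Sum>i\<in>I. (\<integral>\<^sup>+x\<in>\<Omega> \<inter> B i. ennreal (c i x) \<partial>lborel))"
    by (subst nn_integral_cmult, measurable, subst nn_integral_sum) measurable
  also have "\<dots> \<le> ennreal (real (card I)) * (\<Sum>i\<in>I. ennreal v)" by (intro mult_left_mono sum_mono v) auto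
  also have "(\<Sum>i\<in>I. ennreal v) = ennreal (\<Sum>i\<in>I. v)" by (rule sum_ennreal) (rule v(2))
  also have "(\<Sum>i\<in>I. v) = real (card I) * v" by simp
  also have "ennreal (real (card I)) * \<dots> = ennreal (real (card I) * (real (card I) * v))" using v(2) by (intro ennreal_mult[symmetric]) auto
  finally show ?thesis .
qed

text \<open>Adds an error bounded pointwise to one bounded in L2; the generous constant 2 replaces
  Minkowski's inequality.\<close>

lemma nn_integral_square_add:
  fixes f g :: "real \<times> real \<Rightarrow> real"
  assumes [measurable]: "\<Omega> \<in> sets borel" "f \<in> borel_measurable borel"
    and a: "sq_int \<Omega> f \<le> ennreal (a\<^sup>2)" "0 \<le> a"
    and g: "\<And>x. x \<in> \<Omega> \<Longrightarrow> \<bar>g x\<bar> \<le> \<eta>" "0 \<le> \<eta>" and V: "emeasure lborel \<Omega> \<le> ennreal (v\<^sup>2)" "0 \<le> v"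
  shows "sq_int \<Omega> (\<lambda>x. f x + g x) \<le> ennreal ((2 * (a + \<eta> * v))\<^sup>2)"
proof -
  have p: "ennreal ((f x + g x)\<^sup>2) * indicator \<Omega> x \<le> ennreal 2 * (ennreal ((f x)\<^sup>2) * indicator \<Omega> x) + ennreal (2 * \<eta>\<^sup>2) * indicator \<Omega> x" for x
  proof (cases "x \<in> \<Omega>")
    case True
    have "(f x + g x)\<^sup>2 + (f x - g x)\<^sup>2 = 2 * (f x)\<^sup>2 + 2 * (g x)\<^sup>2" by (simp add: power2_eq_square algebra_simps)
    moreover have "0 \<le> (f x - g x)\<^sup>2" by simp
    moreover have "\<bar>g x\<bar>\<^sup>2 \<le> \<eta>\<^sup>2" using g(1)[OF True] by (intro power_mono) auto
    then have "(g x)\<^sup>2 \<le> \<eta>\<^sup>2" by (simp only: power2_abs)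
    ultimately have "(f x + g x)\<^sup>2 \<le> 2 * (f x)\<^sup>2 + 2 * \<eta>\<^sup>2" by linarith
    then have "ennreal ((f x + g x)\<^sup>2) \<le> ennreal (2 * (f x)\<^sup>2 + 2 * \<eta>\<^sup>2)" by (rule ennreal_leI)
    then show ?thesis using True by (simp add: ennreal_mult)
  qed simp
  have "sq_int \<Omega> (\<lambda>x. f x + g x) \<le> (\<integral>\<^sup>+x. ennreal 2 * (ennreal ((f x)\<^sup>2) * indicator \<Omega> x) + ennreal (2 * \<eta>\<^sup>2) * indicator \<Omega> x \<partial>lborel)"
    by (intro nn_integral_mono p)
  also have "\<dots> = ennreal 2 * (sq_int \<Omega> f) + ennreal (2 * \<eta>\<^sup>2) * emeasure lborel \<Omega>"
    by (subst nn_integral_add) (simp_all add: nn_integral_cmult nn_integral_cmult_indicator)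
  also have "\<dots> \<le> ennreal 2 * ennreal (a\<^sup>2) + ennreal (2 * \<eta>\<^sup>2) * ennreal (v\<^sup>2)"
    by (intro add_mono mult_left_mono a V) auto
  also have "\<dots> = ennreal (2 * a\<^sup>2 + 2 * \<eta>\<^sup>2 * v\<^sup>2)"
    by (simp only: ennreal_mult[symmetric] ennreal_plus[symmetric] zero_le_power2 zero_le_numeral mult_nonneg_nonneg)
  also have "\<dots> \<le> ennreal ((2 * (a + \<eta> * v))\<^sup>2)"
  proof (rule ennreal_leI)
    have "0 \<le> a * (\<eta> * v)" using a g V by simp
    moreover have "(2 * (a + \<eta> * v))\<^sup>2 = (2 * a\<^sup>2 + 2 * \<eta>\<^sup>2 * v\<^sup>2) + (2 * a\<^sup>2 + 2 * (\<eta> * v)\<^sup>2 + 8 * (a * (\<eta> * v)))"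
      by (simp add: power2_eq_square algebra_simps)
    ultimately show "2 * a\<^sup>2 + 2 * \<eta>\<^sup>2 * v\<^sup>2 \<le> (2 * (a + \<eta> * v))\<^sup>2" by simp
  qed
  finally show ?thesis .
qed

text \<open>Gluing local approximations P i of u with a partition of unity chi i: since the chi i sum to one,
  their derivatives sum to zero, so only the differences u - P i enter.\<close>
lemma partition_error:
  fixes ch P Q :: "'i \<Rightarrow> real \<times> real \<Rightarrow> real" and u G :: "real \<times> real \<Rightarrow> real" and e :: real and d :: "real \<times> real"
  assumes op: "open \<Omega>" and fin: "finite I" and um[measurable]: "u \<in> borel_measurable borel" "G \<in> borel_measurable borel" and d: "norm d = 1"
    and g: "\<And>i. i \<in> I \<Longrightarrow> good d (ch i)" and b: "\<And>i x. i \<in> I \<Longrightarrow> 0 \<le> ch i x \<and> ch i x \<le> 1"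
    and l: "\<And>i. i \<in> I \<Longrightarrow> lip (K / r i) (ch i)" "\<And>i. i \<in> I \<Longrightarrow> 0 < r i \<and> r i \<le> 1" "0 \<le> K"
    and S: "\<And>i. i \<in> I \<Longrightarrow> closed (S i) \<and> S i \<subseteq> ball (x0 i) (r i)" "\<And>i x. i \<in> I \<Longrightarrow> x \<notin> S i \<Longrightarrow> ch i x = 0"
    and one: "\<And>x. x \<in> \<Omega> \<Longrightarrow> (\<Sum>i\<in>I. ch i x) = 1"
    and P: "\<And>i x. i \<in> I \<Longrightarrow> dqn d (P i) x \<longlonglongrightarrow> Q i x" "\<And>i x. i \<in> I \<Longrightarrow> isCont (P i) x"
    and Qm: "\<And>i. i \<in> I \<Longrightarrow> Q i \<in> borel_measurable borel"
    and e: "0 \<le> e" "\<And>i. i \<in> I \<Longrightarrow> sq_int (\<Omega> \<inter> ball (x0 i) (r i)) (\<lambda>x. u x - P i x) \<le> ennreal ((e * r i)\<^sup>2)"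
      "\<And>i. i \<in> I \<Longrightarrow> sq_int (\<Omega> \<inter> ball (x0 i) (r i)) (\<lambda>x. G x - Q i x) \<le> ennreal (e\<^sup>2)"
  defines "w \<equiv> \<lambda>x. \<Sum>i\<in>I. ch i x * P i x" and "W \<equiv> \<lambda>x. \<Sum>i\<in>I. (dq d (ch i) x * P i x + ch i x * Q i x)"
  shows "dqn d w x \<longlonglongrightarrow> W x" "W \<in> borel_measurable borel" "w \<in> borel_measurable borel"
    "sq_int \<Omega> (\<lambda>x. u x - w x) \<le> ennreal ((real (card I) * e)\<^sup>2)"
    "sq_int \<Omega> (\<lambda>x. G x - W x) \<le> ennreal ((2 * real (card I) * (1 + K) * e)\<^sup>2)"
proof -
  have Om[measurable]: "\<Omega> \<in> sets borel" using op by simp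
  have Pm[measurable]: "P i \<in> borel_measurable borel" if "i \<in> I" for i
    using P(2)[OF that] by (intro borel_measurable_continuous_onI continuous_at_imp_continuous_on) auto
  have cm[measurable]: "ch i \<in> borel_measurable borel" if "i \<in> I" for i
    using good_continuous[OF g[OF that], of UNIV] by (rule borel_measurable_continuous_onI)
  have dm[measurable]: "dq d (ch i) \<in> borel_measurable borel" if "i \<in> I" for i by (rule dq_measurable[OF g[OF that]])
  note Qm[measurable]
  show "W \<in> borel_measurable borel" "w \<in> borel_measurable borel" unfolding W_def w_def by measurable
  have "dqn d (\<lambda>x. ch i x * P i x) x \<longlonglongrightarrow> dq d (ch i) x * P i x + ch i x * Q i x" if "i \<in> I" for i x
    using that by (intro dqn_mult_lim dq_lim g P) auto
  then have "(\<lambda>n. \<Sum>i\<in>I. dqn d (\<lambda>x. ch i x * P i x) x n) \<longlonglongrightarrow> W x" for x unfolding W_def by (intro tendsto_sum) auto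
  moreover have "(\<lambda>n. \<Sum>i\<in>I. dqn d (\<lambda>x. ch i x * P i x) x n) = dqn d w x" for x
    unfolding w_def dqn_def by (simp add: sum_subtractf sum_distrib_right left_diff_distrib)
  ultimately show "dqn d w x \<longlonglongrightarrow> W x" by simp
  \<comment> \<open>The closed set S i lies inside the ball, so ch i vanishes in a whole
    neighbourhood of every point off the ball, and the limit of its difference quotients is 0 there
    as well.\<close>
  have out: "ch i x = 0" "dq d (ch i) x = 0" if "i \<in> I" "x \<notin> ball (x0 i) (r i)" for i x
  proof -
    have x: "x \<in> - S i" using S(1)[OF that(1)] that(2) by blast
    then show "ch i x = 0" using S(2)[OF that(1)] by blast
    have "dq d (ch i) x = dq d (\<lambda>_. 0) x"
      by (rule dq_local[of "- S i"]) (use S that(1) x in auto)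
    then show "dq d (ch i) x = 0" by (simp add: dq_const)
  qed
  let ?B = "\<lambda>i. ball (x0 i) (r i)"
  have "sq_int \<Omega> (\<lambda>x. u x - w x) \<le> ennreal (real (card I) * (real (card I) * e\<^sup>2))"
  proof (rule nn_integral_local_sum[OF fin, where B="?B" and c="\<lambda>i x. (u x - P i x)\<^sup>2"])
    fix x assume x: "x \<in> \<Omega>"
    have "u x - w x = (\<Sum>i\<in>I. ch i x * (u x - P i x))"
      using one[OF x] unfolding w_def by (simp add: right_diff_distrib sum_subtractf flip: sum_distrib_right)
    then have "(u x - w x)\<^sup>2 \<le> real (card I) * (\<Sum>i\<in>I. (ch i x * (u x - P i x))\<^sup>2)" using sum_square_le by metis
    also have "\<dots> \<le> real (card I) * (\<Sum>i\<in>I. indicat_real (?B i) x * (u x - P i x)\<^sup>2)"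
    proof (intro mult_left_mono sum_mono)
      fix i assume i: "i \<in> I"
      have "(ch i x)\<^sup>2 \<le> indicat_real (?B i) x"
        using b[OF i, of x] out(1)[OF i, of x] by (cases "x \<in> ?B i") (auto simp: power_le_one)
      then show "(ch i x * (u x - P i x))\<^sup>2 \<le> indicat_real (?B i) x * (u x - P i x)\<^sup>2"
        unfolding power_mult_distrib by (rule mult_right_mono) simp
    qed simp
    finally show "(u x - w x)\<^sup>2 \<le> real (card I) * (\<Sum>i\<in>I. indicat_real (?B i) x * (u x - P i x)\<^sup>2)" .
  next
    fix i assume i: "i \<in> I"
    have "(e * r i)\<^sup>2 \<le> e\<^sup>2" using l(2)[OF i] e(1) by (intro power_mono) (auto simp: mult_right_le_one_le)
    then show "sq_int (\<Omega> \<inter> ?B i) (\<lambda>x. u x - P i x) \<le> ennreal (e\<^sup>2)"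
      by (intro order_trans[OF e(2)[OF i]] ennreal_leI)
    show "(\<lambda>x. (u x - P i x)\<^sup>2) \<in> borel_measurable borel" using i by measurable
  qed simp_all
  then show "sq_int \<Omega> (\<lambda>x. u x - w x) \<le> ennreal ((real (card I) * e)\<^sup>2)"
    by (simp only: power2_eq_square mult_ac)
  have db: "\<bar>dq d (ch i) x\<bar> \<le> K / r i" if "i \<in> I" for i x
    using dq_bound[OF g[OF that] l(1)[OF that], of x] d by simp
  have "sq_int \<Omega> (\<lambda>x. G x - W x) \<le> ennreal (real (card I) * (real (card I) * (2 * e\<^sup>2 + 2 * K\<^sup>2 * e\<^sup>2)))"
  proof (rule nn_integral_local_sum[OF fin, where B="?B" and c="\<lambda>i x. 2 * (G x - Q i x)\<^sup>2 + 2 * (K / r i)\<^sup>2 * (u x - P i x)\<^sup>2"])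
    fix x assume x: "x \<in> \<Omega>"
    have s0: "(\<Sum>i\<in>I. dq d (ch i) x) = 0"
    proof -
      have "(\<Sum>i\<in>I. dq d (ch i) x) = dq d (\<lambda>x. \<Sum>i\<in>I. ch i x) x" using g by (intro dq_sum[symmetric])
      also have "\<dots> = dq d (\<lambda>_. 1) x" by (rule dq_local[OF op x]) (rule one)
      finally show ?thesis by (simp add: dq_const)
    qed
    have "G x - W x = (\<Sum>i\<in>I. ch i x * (G x - Q i x) + dq d (ch i) x * (u x - P i x))"
      using one[OF x] s0 unfolding W_def
      by (simp add: right_diff_distrib sum_subtractf sum.distrib flip: sum_distrib_right)
    then have "(G x - W x)\<^sup>2 \<le> real (card I) * (\<Sum>i\<in>I. (ch i x * (G x - Q i x) + dq d (ch i) x * (u x - P i x))\<^sup>2)" using sum_square_le by metis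
    also have "\<dots> \<le> real (card I) * (\<Sum>i\<in>I. indicat_real (?B i) x * (2 * (G x - Q i x)\<^sup>2 + 2 * (K / r i)\<^sup>2 * (u x - P i x)\<^sup>2))"
    proof (intro mult_left_mono sum_mono)
      fix i assume i: "i \<in> I"
      show "(ch i x * (G x - Q i x) + dq d (ch i) x * (u x - P i x))\<^sup>2 \<le> indicat_real (?B i) x * (2 * (G x - Q i x)\<^sup>2 + 2 * (K / r i)\<^sup>2 * (u x - P i x)\<^sup>2)"
      proof (cases "x \<in> ?B i")
        case True
        let ?a = "ch i x * (G x - Q i x)" and ?b = "dq d (ch i) x * (u x - P i x)"
        have "(?a + ?b)\<^sup>2 + (?a - ?b)\<^sup>2 = 2 * ?a\<^sup>2 + 2 * ?b\<^sup>2" by (simp add: power2_eq_square algebra_simps)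
        moreover have "0 \<le> (?a - ?b)\<^sup>2" by simp
        ultimately have 1: "(?a + ?b)\<^sup>2 \<le> 2 * ?a\<^sup>2 + 2 * ?b\<^sup>2" by linarith
        have "(ch i x)\<^sup>2 \<le> 1" using b[OF i, of x] by (simp add: power_le_one)
        then have 2: "?a\<^sup>2 \<le> 1 * (G x - Q i x)\<^sup>2" unfolding power_mult_distrib by (rule mult_right_mono) simp
        have "\<bar>dq d (ch i) x\<bar>\<^sup>2 \<le> (K / r i)\<^sup>2" using db[OF i, of x] by (intro power_mono) auto
        then have "(dq d (ch i) x)\<^sup>2 \<le> (K / r i)\<^sup>2" by (simp only: power2_abs)
        then have 3: "?b\<^sup>2 \<le> (K / r i)\<^sup>2 * (u x - P i x)\<^sup>2" unfolding power_mult_distrib by (rule mult_right_mono) simp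
        have "2 * ?b\<^sup>2 \<le> 2 * (K / r i)\<^sup>2 * (u x - P i x)\<^sup>2" using mult_left_mono[OF 3, of 2] by (simp add: mult.assoc)
        then show ?thesis using True 1 2 by (simp only: indicator_simps mult_1_left)
      qed (use out[OF i] in simp)
    qed simp
    finally show "(G x - W x)\<^sup>2 \<le> real (card I) * (\<Sum>i\<in>I. indicat_real (?B i) x * (2 * (G x - Q i x)\<^sup>2 + 2 * (K / r i)\<^sup>2 * (u x - P i x)\<^sup>2))" .
  next
    fix i assume i: "i \<in> I"
    have [measurable]: "\<Omega> \<inter> ?B i \<in> sets borel" by simp
    have r: "0 < r i" using l(2)[OF i] by simp
    have "(\<integral>\<^sup>+x\<in>\<Omega> \<inter> ?B i. ennreal (2 * (G x - Q i x)\<^sup>2 + 2 * (K / r i)\<^sup>2 * (u x - P i x)\<^sup>2) \<partial>lborel)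
      = (\<integral>\<^sup>+x. ennreal 2 * (ennreal ((G x - Q i x)\<^sup>2) * indicator (\<Omega> \<inter> ?B i) x) + ennreal (2 * (K / r i)\<^sup>2) * (ennreal ((u x - P i x)\<^sup>2) * indicator (\<Omega> \<inter> ?B i) x) \<partial>lborel)"
    proof (intro nn_integral_cong)
      fix x
      have "ennreal (2 * (G x - Q i x)\<^sup>2 + 2 * (K / r i)\<^sup>2 * (u x - P i x)\<^sup>2) = ennreal 2 * ennreal ((G x - Q i x)\<^sup>2) + ennreal (2 * (K / r i)\<^sup>2) * ennreal ((u x - P i x)\<^sup>2)"
        by (simp only: ennreal_mult[symmetric] ennreal_plus[symmetric] zero_le_power2 zero_le_numeral mult_nonneg_nonneg)
      then show "ennreal (2 * (G x - Q i x)\<^sup>2 + 2 * (K / r i)\<^sup>2 * (u x - P i x)\<^sup>2) * indicator (\<Omega> \<inter> ?B i) x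
        = ennreal 2 * (ennreal ((G x - Q i x)\<^sup>2) * indicator (\<Omega> \<inter> ?B i) x) + ennreal (2 * (K / r i)\<^sup>2) * (ennreal ((u x - P i x)\<^sup>2) * indicator (\<Omega> \<inter> ?B i) x)"
        by (simp only: distrib_right mult.assoc)
    qed
    also have "\<dots> = ennreal 2 * (sq_int (\<Omega> \<inter> ?B i) (\<lambda>x. G x - Q i x)) + ennreal (2 * (K / r i)\<^sup>2) * (sq_int (\<Omega> \<inter> ?B i) (\<lambda>x. u x - P i x))"
      using i by (subst nn_integral_add, measurable, subst (1 2) nn_integral_cmult) measurable
    also have "\<dots> \<le> ennreal 2 * ennreal (e\<^sup>2) + ennreal (2 * (K / r i)\<^sup>2) * ennreal ((e * r i)\<^sup>2)"
      by (intro add_mono mult_left_mono e i) auto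
    also have "\<dots> = ennreal (2 * e\<^sup>2 + 2 * (K / r i)\<^sup>2 * (e * r i)\<^sup>2)"
      by (simp only: ennreal_mult[symmetric] ennreal_plus[symmetric] zero_le_power2 zero_le_numeral mult_nonneg_nonneg)
    also have "2 * (K / r i)\<^sup>2 * (e * r i)\<^sup>2 = 2 * K\<^sup>2 * e\<^sup>2" using r by (simp add: power_divide power_mult_distrib)
    finally show "(\<integral>\<^sup>+x\<in>\<Omega> \<inter> ?B i. ennreal (2 * (G x - Q i x)\<^sup>2 + 2 * (K / r i)\<^sup>2 * (u x - P i x)\<^sup>2) \<partial>lborel) \<le> ennreal (2 * e\<^sup>2 + 2 * K\<^sup>2 * e\<^sup>2)" .
    show "(\<lambda>x. 2 * (G x - Q i x)\<^sup>2 + 2 * (K / r i)\<^sup>2 * (u x - P i x)\<^sup>2) \<in> borel_measurable borel" using i by measurable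
  qed simp_all
  also have "\<dots> \<le> ennreal ((2 * real (card I) * (1 + K) * e)\<^sup>2)"
  proof (rule ennreal_leI)
    have k: "2 * e\<^sup>2 + 2 * K\<^sup>2 * e\<^sup>2 \<le> 4 * (1 + K)\<^sup>2 * e\<^sup>2"
    proof -
      have "2 + 2 * K\<^sup>2 \<le> 4 * (1 + K)\<^sup>2" using l(3) by (simp add: power2_eq_square algebra_simps)
      then have "(2 + 2 * K\<^sup>2) * e\<^sup>2 \<le> 4 * (1 + K)\<^sup>2 * e\<^sup>2" by (rule mult_right_mono) simp
      then show ?thesis by (simp add: algebra_simps)
    qed
    have "real (card I) * (real (card I) * (2 * e\<^sup>2 + 2 * K\<^sup>2 * e\<^sup>2)) \<le> real (card I) * (real (card I) * (4 * (1 + K)\<^sup>2 * e\<^sup>2))"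
      by (intro mult_left_mono k) auto
    also have "\<dots> = (2 * real (card I) * (1 + K) * e)\<^sup>2" by (simp add: power_mult_distrib) (simp add: power2_eq_square)
    finally show "real (card I) * (real (card I) * (2 * e\<^sup>2 + 2 * K\<^sup>2 * e\<^sup>2)) \<le> (2 * real (card I) * (1 + K) * e)\<^sup>2" .
  qed
  finally show "sq_int \<Omega> (\<lambda>x. G x - W x) \<le> ennreal ((2 * real (card I) * (1 + K) * e)\<^sup>2)" .
qed

text \<open>Half of the geometric decay is spent on the polynomial factor: x^p splits into two
  powers of sqrt x, and the exponential with rate t = - ln x / 2 that one of them compensates
  dominates all powers.\<close>

lemma poly_geometric_bound:
  assumes "0 < x" "x < (1::real)"
  shows "\<exists>c>0. \<forall>p::nat. (real p + 3) ^ k * x ^ p \<le> c * sqrt x ^ p"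
proof (cases "k = 0")
  case True
  have "x ^ p \<le> sqrt x ^ p" for p
  proof (rule power_mono)
    have "sqrt x * sqrt x \<le> sqrt x * 1" using assms by (intro mult_left_mono) auto
    then show "x \<le> sqrt x" using assms by simp
  qed (use assms in simp)
  then show ?thesis using True by (intro exI[of _ 1]) simp
next
  case False
  define t where "t = - ln x / 2"
  have t: "t > 0" using assms unfolding t_def by simp
  have et: "exp t * sqrt x = 1"
  proof -
    have "exp t * sqrt x = exp (t + ln x / 2)" using assms by (simp add: exp_add ln_sqrt[symmetric])
    then show ?thesis unfolding t_def by simp
  qed
  have pw: "z ^ k \<le> real k ^ k * exp z" if "z \<ge> 0" for z :: real
  proof -
    have "z / real k \<le> exp (z / real k)" using exp_ge_add_one_self[of "z / real k"] by linarith
    then have "(z / real k) ^ k \<le> exp (z / real k) ^ k" using that by (intro power_mono) auto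
    also have "\<dots> = exp z" using False by (simp flip: exp_of_nat_mult)
    finally show ?thesis using False by (simp add: power_divide divide_le_eq mult.commute)
  qed
  have "(real p + 3) ^ k * x ^ p \<le> (real k ^ k * exp (3 * t) / t ^ k) * sqrt x ^ p" for p
  proof -
    have "(t * (real p + 3)) ^ k \<le> real k ^ k * exp (t * (real p + 3))" using t by (intro pw) auto
    then have "(real p + 3) ^ k \<le> real k ^ k * exp (t * (real p + 3)) / t ^ k" using t by (simp add: power_mult_distrib le_divide_eq mult.commute)
    also have "exp (t * (real p + 3)) = exp (3 * t) * exp t ^ p" by (simp add: algebra_simps exp_add flip: exp_of_nat_mult)
    finally have "(real p + 3) ^ k * x ^ p \<le> (real k ^ k * (exp (3 * t) * exp t ^ p) / t ^ k) * x ^ p"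
      using assms by (intro mult_right_mono) auto
    also have "\<dots> = (real k ^ k * (exp (3 * t) * exp t ^ p) / t ^ k) * (sqrt x ^ p * sqrt x ^ p)"
      using assms by (simp flip: power_mult_distrib)
    also have "(real k ^ k * (exp (3 * t) * exp t ^ p) / t ^ k) * (sqrt x ^ p * sqrt x ^ p) = (real k ^ k * exp (3 * t) / t ^ k) * (exp t * sqrt x) ^ p * sqrt x ^ p"
      by (simp add: power_mult_distrib)
    finally show ?thesis unfolding et by simp
  qed
  then show ?thesis using t False by (intro exI[of _ "real k ^ k * exp (3 * t) / t ^ k"]) auto
qed

lemma lip_sum:
  assumes "finite T" "\<And>t. t \<in> T \<Longrightarrow> lip K (f t)"
  shows "lip (real (card T) * K) (\<lambda>x. \<Sum>t\<in>T. f t x)"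
  using assms
proof (induction T)
  case empty then show ?case by (simp add: lip_const)
next
  case (insert t T)
  then show ?case using lip_add[of K "f t" "real (card T) * K" "\<lambda>x. \<Sum>t\<in>T. f t x"] by (simp add: algebra_simps)
qed

lemma power2_ceiling_exists: "1 \<le> n \<Longrightarrow> \<exists>q. n \<le> 2 ^ q \<and> 2 ^ q \<le> 2 * (n::nat)"
proof (induction n rule: dec_induct)
  case base show ?case by (intro exI[of _ 0]) simp
next
  case (step n)
  then obtain q where q: "n \<le> 2 ^ q" "2 ^ q \<le> 2 * n" by blast
  show ?case
  proof (cases "Suc n \<le> 2 ^ q")
    case True then show ?thesis using q by (intro exI[of _ q]) simp
  next
    case False
    then have "2 ^ q = n" using q by simp
    then show ?thesis using step by (intro exI[of _ "Suc q"]) simp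
  qed
qed

lemma card_int_ball: "card {m::int. \<bar>of_int m - t\<bar> \<le> (B::real)} \<le> nat \<lceil>2 * B + 1\<rceil>" "finite {m::int. \<bar>of_int m - t\<bar> \<le> B}"
proof -
  have sub: "{m::int. \<bar>of_int m - t\<bar> \<le> B} \<subseteq> {\<lceil>t - B\<rceil>..\<lfloor>t + B\<rfloor>}" by (auto simp: ceiling_le_iff le_floor_iff abs_le_iff)
  then show "finite {m::int. \<bar>of_int m - t\<bar> \<le> B}" by (rule finite_subset) simp
  have "card {m::int. \<bar>of_int m - t\<bar> \<le> B} \<le> card {\<lceil>t - B\<rceil>..\<lfloor>t + B\<rfloor>}" using sub by (intro card_mono) auto
  also have "\<dots> = nat (\<lfloor>t + B\<rfloor> - \<lceil>t - B\<rceil> + 1)" by simp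
  also have "\<dots> \<le> nat \<lceil>2 * B + 1\<rceil>"
  proof (rule nat_mono)
    have "real_of_int (\<lfloor>t + B\<rfloor> - \<lceil>t - B\<rceil> + 1) \<le> 2 * B + 1" by linarith
    then show "\<lfloor>t + B\<rfloor> - \<lceil>t - B\<rceil> + 1 \<le> \<lceil>2 * B + 1\<rceil>" by (simp add: le_ceiling_iff)
  qed
  finally show "card {m::int. \<bar>of_int m - t\<bar> \<le> B} \<le> nat \<lceil>2 * B + 1\<rceil>" .
qed

text \<open>Two distances to the corners coexist: the Euclidean weight \<delta> in the bounds for u,
  and D, computable by a network, in the cutoffs. \<open>Dd\<close> turns a lower bound for D on a
  ring into one for \<delta>, and \<open>Dc\<close> places points with small D near a
  corner.\<close>

locale net_setup = cone_family +
  fixes D :: "real \<times> real \<Rightarrow> real" and Cs :: "(real \<times> real) set" and L s :: nat and Rb :: real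
  assumes bdd: "\<Omega> \<subseteq> ball 0 Rb" "0 < Rb" and ne: "\<Omega> \<noteq> {}" and finCs: "finite Cs"
    and Dl: "lip 2 D" and D01: "\<And>x. 0 \<le> D x \<and> D x \<le> 1" and Dd: "\<And>x. D x \<le> 2 * \<delta> x"
    and Dc: "\<And>x. D x = 1 \<or> (\<exists>c\<in>Cs. D x = \<bar>fst x - fst c\<bar> + \<bar>snd x - snd c\<bar>)"
    and dlip: "\<And>x y. \<delta> x \<le> \<delta> y + dist x y"
    and nets: "NNs L s [fst, \<lambda>x. - fst x]" "NNs L s [snd, \<lambda>x. - snd x]" "NNs L s [D, \<lambda>x. - D x]"
begin

lemma patch_mono:
  assumes "patch p x0 r e B" "0 \<le> e" "e \<le> e'" "B \<le> B'" "0 \<le> r"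
  shows "patch p x0 r e' B'"
proof -
  obtain y cf Q1 Q2 where P:
     "\<forall>x. (ppoly p ((M + 2) * r) cf y has_derivative (\<lambda>e. fst e * Q1 x + snd e * Q2 x)) (at x)"
     "\<forall>k i. \<bar>cf k i\<bar> \<le> B" "Q1 \<in> borel_measurable borel" "Q2 \<in> borel_measurable borel"
     "\<forall>x\<in>ball x0 r. \<bar>fst (x - y)\<bar> \<le> (M + 2) * r \<and> \<bar>snd (x - y)\<bar> \<le> (M + 2) * r"
     "sq_int (\<Omega> \<inter> ball x0 r) (\<lambda>x. E 0 0 x - ppoly p ((M + 2) * r) cf y x) \<le> ennreal ((e * r)\<^sup>2)"
     "sq_int (\<Omega> \<inter> ball x0 r) (\<lambda>x. E 1 0 x - Q1 x) \<le> ennreal (e\<^sup>2)"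
     "sq_int (\<Omega> \<inter> ball x0 r) (\<lambda>x. E 0 1 x - Q2 x) \<le> ennreal (e\<^sup>2)"
    using assms(1) unfolding patch_def by blast
  have 1: "ennreal ((e * r)\<^sup>2) \<le> ennreal ((e' * r)\<^sup>2)" using assms by (intro ennreal_leI power_mono mult_right_mono) auto
  have 2: "ennreal (e\<^sup>2) \<le> ennreal (e'\<^sup>2)" using assms by (intro ennreal_leI power_mono) auto
  have 3: "\<forall>k i. \<bar>cf k i\<bar> \<le> B'" using P(2) assms(4) order_trans by blast
  show ?thesis unfolding patch_def
    by (rule exI[of _ y], rule exI[of _ cf], rule exI[of _ Q1], rule exI[of _ Q2])
       (intro conjI P(1) 3 P(3-5) order_trans[OF P(6) 1] order_trans[OF P(7) 2] order_trans[OF P(8) 2])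
qed

text \<open>Rings j < p stay away from the corners and are handled by \<open>patch_regular\<close>
  with rate 1/4. The last ring reaches the corners; its patches have radius about 2^-p, and
  \<open>patch_inner\<close> draws its rate from the decay of the gradient. The slower of the two
  rates is \<mu>. The bound 2^p on the coefficients comes from 1 / r.\<close>

lemma patches:
  obtains \<theta> \<mu> c where "0 < \<theta>" "\<theta> \<le> 1/3" "1/4 \<le> \<mu>" "\<mu> < 1" "0 < c"
    "\<And>p j x. 1 \<le> p \<Longrightarrow> j \<le> p \<Longrightarrow> x \<in> \<Omega> \<Longrightarrow> ring D p j x \<noteq> 0 \<Longrightarrow>
       patch p x (3 * (\<theta> / 2 ^ j)) (c * (real p + 3) ^ 3 * \<mu> ^ p) (c * (real p + 3) * 2 ^ p)"
proof -
  obtain Kh \<sigma> r1 where h: "0 < Kh" "0 < \<sigma>" "0 < r1" "\<And>x0 R. x0 \<in> closure \<Omega> \<Longrightarrow> 0 < R \<Longrightarrow> R \<le> r1 \<Longrightarrow>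
     (\<integral>\<^sup>+x\<in>\<Omega> \<inter> ball x0 R. ennreal (sqsum E 1 x) \<partial>lborel) \<le> ennreal (Kh * R powr \<sigma>)"
    using hardy by metis
  \<comment> \<open>For r = 3 \<theta> / 2^j the entries guarantee in turn: r \<le> 1;
    \<open>M * r \<le> \<rho>\<close> for the cone; that the enlarged ball stays within d0 of x; the
    condition \<open>small\<close> of \<open>patch_regular\<close>; a radius admissible for the
    decay estimate.\<close>
  define \<theta> where "\<theta> = Min {1/3, \<rho> / (3 * M), 1 / (24 * (M + 1)), 1 / (192 * (M + 2) * A), r1 / (3 * (M + 1))}"
  have M0: "M > 0" using M4 by simp
  have t: "0 < \<theta>" "\<theta> \<le> 1/3" "3 * M * \<theta> \<le> \<rho>" "24 * (M + 1) * \<theta> \<le> 1" "192 * (M + 2) * A * \<theta> \<le> 1" "3 * (M + 1) * \<theta> \<le> r1"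
  proof -
    let ?S = "{1/3, \<rho> / (3 * M), 1 / (24 * (M + 1)), 1 / (192 * (M + 2) * A), r1 / (3 * (M + 1))}"
    have "\<forall>z\<in>?S. 0 < z" using M0 rho CA h(3) by auto
    then show "0 < \<theta>" unfolding \<theta>_def by (subst Min_gr_iff) auto
    have le: "\<theta> \<le> z" if "z \<in> ?S" for z unfolding \<theta>_def using that by (intro Min_le) auto
    show "\<theta> \<le> 1/3" by (rule le) simp
    have "\<theta> \<le> \<rho> / (3 * M)" by (rule le) simp
    then show "3 * M * \<theta> \<le> \<rho>" using M0 by (simp add: le_divide_eq mult.commute)
    have "\<theta> \<le> 1 / (24 * (M + 1))" by (rule le) simp
    then show "24 * (M + 1) * \<theta> \<le> 1" using M0 by (simp add: le_divide_eq mult.commute)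
    have "\<theta> \<le> 1 / (192 * (M + 2) * A)" by (rule le) simp
    then show "192 * (M + 2) * A * \<theta> \<le> 1" using M0 CA by (simp add: le_divide_eq mult.commute)
    have "\<theta> \<le> r1 / (3 * (M + 1))" by (rule le) simp
    then show "3 * (M + 1) * \<theta> \<le> r1" using M0 by (simp add: le_divide_eq mult.commute)
  qed
  \<comment> \<open>The square root of 2^(- \<sigma>), the factor by which the bound for the squared
    gradient norm shrinks when the radius is halved.\<close>
  define m0 where "m0 = 2 powr (- \<sigma> / 2)"
  have m0: "0 < m0" "m0 < 1" unfolding m0_def using h(2) by (auto simp: powr_less_one)
  define \<mu> where "\<mu> = max (1/4) m0"
  have mu: "1/4 \<le> \<mu>" "\<mu> < 1" "m0 \<le> \<mu>" "0 < \<mu>" unfolding \<mu>_def using m0 by auto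
  define K where "K = 1 / (24 * \<theta>)"
  define g0 where "g0 = sqrt (Kh * (3 * (M + 1) * \<theta>) powr \<sigma>)"
  have g0: "0 < g0" unfolding g0_def using h t M0 by simp
  define c where "c = C * K + 8 * (M + 2) * g0 + 2 * C / (3 * \<theta>)"
  have K0: "0 < K" unfolding K_def using t by simp
  have parts: "0 < C * K" "0 < 8 * (M + 2) * g0" "0 < 2 * C / (3 * \<theta>)" using CA K0 M0 g0 t by auto
  have cp: "C * K \<le> c" "8 * (M + 2) * g0 \<le> c" "2 * C / (3 * \<theta>) \<le> c" "0 < c" unfolding c_def using parts by auto
  show thesis
  proof (rule that[OF t(1,2) mu(1,2) cp(4)])
    fix p j :: nat and x assume p: "1 \<le> p" and j: "j \<le> p" and x: "x \<in> \<Omega>" and rg: "ring D p j x \<noteq> 0"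
    define r where "r = 3 * (\<theta> / 2 ^ j)"
    have r0: "0 < r" unfolding r_def using t by simp
    have j1: "1 \<le> (2::real) ^ j" by simp
    have r3: "r \<le> 3 * \<theta>" unfolding r_def using t j1 by (simp add: divide_le_eq mult_left_le)
    have Mr: "M * r \<le> \<rho>"
    proof -
      have "M * r \<le> M * (3 * \<theta>)" using M0 by (intro mult_left_mono r3) simp
      moreover have "M * (3 * \<theta>) = 3 * M * \<theta>" by simp
      ultimately show ?thesis using t(3) by linarith
    qed
    have xc: "x \<in> closure \<Omega>" using x closure_subset by blast
    have nE: "\<Omega> \<inter> ball x r \<noteq> {}" using x r0 by auto
    have p3: "1 \<le> real p + 3" by simp
    have B1: "2 * real (p + 2) * C / r \<le> c * (real p + 3) * 2 ^ p"
    proof -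
      have "2 * real (p + 2) * C / r = (2 * C / (3 * \<theta>)) * real (p + 2) * 2 ^ j" unfolding r_def by (simp add: field_simps)
      also have "\<dots> \<le> c * (real p + 3) * 2 ^ p" using cp parts j by (intro mult_mono power_increasing) auto
      finally show ?thesis .
    qed
    have "patch p x r (c * (real p + 3) ^ 3 * \<mu> ^ p) (c * (real p + 3) * 2 ^ p)"
    proof (cases "j = p")
      case False
      then have jp: "j < p" using j by simp
      \<comment> \<open>On this ring D exceeds 1 / 2^(j + 1), so \<delta> x is at least 1 / 2^(j +
        2), which is 2 d0. Half of it is given up for the other points of the enlarged ball.\<close>
      define d0 where "d0 = 1 / (8 * 2 ^ j :: real)"
      have "1 \<le> 8 * (2::real) ^ j" using j1 by linarith
      then have d0: "0 < d0" "d0 \<le> 1" unfolding d0_def by (auto simp: divide_le_eq)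
      have dx: "2 * d0 \<le> \<delta> x"
      proof -
        have "1 < D x * (2 * 2 ^ j)" using ring_support(2)[OF rg jp] by (simp add: field_simps)
        also have "\<dots> \<le> (2 * \<delta> x) * (2 * 2 ^ j)" by (rule mult_right_mono[OF Dd]) simp
        finally show ?thesis unfolding d0_def by (simp add: field_simps)
      qed
      have "patch p x r (C * K * real (p + 2) ^ 3 / 4 ^ p) (2 * real (p + 2) * C / r)"
      proof (rule patch_regular[OF xc r0 Mr nE p d0])
        fix z assume z: "z \<in> \<Omega> \<inter> ball x ((M + 1) * r)"
        have "(M + 1) * r \<le> d0"
        proof -
          have "(M + 1) * r = (24 * (M + 1) * \<theta>) * d0" unfolding r_def d0_def by (simp add: field_simps)
          also have "\<dots> \<le> 1 * d0" using t(4) d0 by (intro mult_right_mono) auto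
          finally show ?thesis by simp
        qed
        then show "d0 \<le> \<delta> z" using z dlip[of x z] dx by simp
      next
        have "8 * ((M + 2) * r) * A = (192 * (M + 2) * A * \<theta>) * d0" unfolding r_def d0_def by (simp add: field_simps)
        also have "\<dots> \<le> 1 * d0" using t(5) d0 by (intro mult_right_mono) auto
        finally show "8 * ((M + 2) * r) * A \<le> d0" by simp
        show "d0 \<le> K * r" unfolding K_def r_def d0_def using t by simp
      qed
      then show ?thesis
      proof (rule patch_mono)
        have "C * K * real (p + 2) ^ 3 / 4 ^ p = C * K * real (p + 2) ^ 3 * (1/4) ^ p" by (simp add: power_divide)
        also have "\<dots> \<le> c * (real p + 3) ^ 3 * \<mu> ^ p" using cp parts mu by (intro mult_mono power_mono) auto
        finally show "C * K * real (p + 2) ^ 3 / 4 ^ p \<le> c * (real p + 3) ^ 3 * \<mu> ^ p" .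
      qed (use B1 parts r0 in auto)
    next
      case True
      define G where "G = g0 * m0 ^ p"
      have G0: "0 < G" unfolding G_def using g0 m0 by simp
      have "patch p x r (8 * (M + 2) * G) (2 * C / r)"
      proof (rule patch_inner[OF xc r0 Mr nE G0])
        have R: "0 < (M + 1) * r" "(M + 1) * r \<le> r1"
        proof -
          show "0 < (M + 1) * r" using r0 M0 by simp
          have "(M + 1) * r \<le> (M + 1) * (3 * \<theta>)" using M0 by (intro mult_left_mono r3) simp
          moreover have "(M + 1) * (3 * \<theta>) = 3 * (M + 1) * \<theta>" by simp
          ultimately show "(M + 1) * r \<le> r1" using t(6) by linarith
        qed
        have "Kh * ((M + 1) * r) powr \<sigma> = G\<^sup>2"
        proof -
          have e: "(M + 1) * r = (3 * (M + 1) * \<theta>) / 2 ^ p" unfolding r_def True by simp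
          have "((M + 1) * r) powr \<sigma> = (3 * (M + 1) * \<theta>) powr \<sigma> / (2 ^ p) powr \<sigma>" unfolding e by (rule powr_divide)
          moreover have "(2 ^ p :: real) powr \<sigma> = (2 powr \<sigma>) ^ p"
          proof -
            have "(2 ^ p :: real) powr \<sigma> = (2 powr real p) powr \<sigma>" by (subst powr_realpow) auto
            also have "\<dots> = (2 powr \<sigma>) powr real p" by (simp only: powr_powr mult.commute)
            also have "\<dots> = (2 powr \<sigma>) ^ p" by (rule powr_realpow) simp
            finally show ?thesis .
          qed
          moreover have "(m0 ^ p)\<^sup>2 = 1 / (2 powr \<sigma>) ^ p"
          proof -
            have "m0 * m0 = 1 / 2 powr \<sigma>" unfolding m0_def by (simp add: powr_minus_divide flip: powr_add)
            then show ?thesis by (simp add: power2_eq_square power_divide flip: power_mult_distrib)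
          qed
          moreover have "g0\<^sup>2 = Kh * (3 * (M + 1) * \<theta>) powr \<sigma>" unfolding g0_def using h by simp
          ultimately show ?thesis unfolding G_def power_mult_distrib by simp
        qed
        then show "(\<integral>\<^sup>+x\<in>\<Omega> \<inter> ball x ((M + 1) * r). ennreal (sqsum E 1 x) \<partial>lborel) \<le> ennreal (G\<^sup>2)"
          using h(4)[OF xc R] by simp
      qed
      then show ?thesis
      proof (rule patch_mono)
        have "8 * (M + 2) * G = (8 * (M + 2) * g0) * 1 * m0 ^ p" unfolding G_def by simp
        also have "\<dots> \<le> c * (real p + 3) ^ 3 * \<mu> ^ p" using cp parts mu m0 p3 by (intro mult_mono power_mono one_le_power) auto
        finally show "8 * (M + 2) * G \<le> c * (real p + 3) ^ 3 * \<mu> ^ p" .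
        have "2 * C / r \<le> 2 * real (p + 2) * C / r" using CA r0 by (intro divide_right_mono) auto
        then show "2 * C / r \<le> c * (real p + 3) * 2 ^ p" using B1 by linarith
      qed (use G0 M0 r0 in auto)
    qed
    then show "patch p x (3 * (\<theta> / 2 ^ j)) (c * (real p + 3) ^ 3 * \<mu> ^ p) (c * (real p + 3) * 2 ^ p)" unfolding r_def .
  qed
qed

text \<open>The index (j, m1, m2) names a dyadic level and a grid node; the mesh \<theta> / 2^j is
  proportional to the distance of level j from the corners.\<close>

definition cutoff :: "real \<Rightarrow> nat \<Rightarrow> nat \<times> int \<times> int \<Rightarrow> real \<times> real \<Rightarrow> real" where
  "cutoff \<theta> p i x = ring D p (fst i) x *
     (hatf (fst x / (\<theta> / 2 ^ fst i) - of_int (fst (snd i))) * hatf (snd x / (\<theta> / 2 ^ fst i) - of_int (snd (snd i))))"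

definition cells :: "real \<Rightarrow> nat \<Rightarrow> (nat \<times> int \<times> int) set" where
  "cells \<theta> p = {i. fst i \<le> p \<and> (\<exists>x\<in>\<Omega>. cutoff \<theta> p i x \<noteq> 0)}"

text \<open>For j > 0 a cutoff of level j lives within about 2^-j of a corner and the mesh is
  proportional to 2^-j, so each corner contributes a number of nodes independent of j. The origin is
  inserted as a further centre for level 0, where all of the bounded set \<Omega> has to be
  covered.\<close>

lemma cells_card:
  assumes t: "0 < \<theta>" "\<theta> \<le> 1/3"
  obtains N0 where "\<And>p. finite (cells \<theta> p) \<and> card (cells \<theta> p) \<le> N0 * (p + 1)"
proof -
  define B where "B = 1 + (2 + Rb) / \<theta>"
  define k0 where "k0 = nat \<lceil>2 * B + 1\<rceil>"
  define Z where "Z u = {m::int. \<bar>of_int m - u\<bar> \<le> B}" for u :: real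
  have Z: "finite (Z u)" "card (Z u) \<le> k0" for u unfolding Z_def k0_def using card_int_ball by auto
  define T where "T p = (SIGMA j:{..p}. \<Union>c\<in>insert 0 Cs. Z (fst c / (\<theta> / 2 ^ j)) \<times> Z (snd c / (\<theta> / 2 ^ j)))" for p :: nat
  have fT: "finite (T p)" for p unfolding T_def using finCs Z by auto
  have cT: "card (T p) \<le> (p + 1) * ((card Cs + 1) * (k0 * k0))" for p
  proof -
    have "card (T p) = (\<Sum>j\<in>{..p}. card (\<Union>c\<in>insert 0 Cs. Z (fst c / (\<theta> / 2 ^ j)) \<times> Z (snd c / (\<theta> / 2 ^ j))))"
      unfolding T_def using finCs Z by (intro card_SigmaI) auto
    also have "\<dots> \<le> (\<Sum>j\<in>{..p}. (card Cs + 1) * (k0 * k0))"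
    proof (rule sum_mono)
      fix j
      have "card (\<Union>c\<in>insert 0 Cs. Z (fst c / (\<theta> / 2 ^ j)) \<times> Z (snd c / (\<theta> / 2 ^ j)))
        \<le> (\<Sum>c\<in>insert 0 Cs. card (Z (fst c / (\<theta> / 2 ^ j)) \<times> Z (snd c / (\<theta> / 2 ^ j))))"
        by (rule card_UN_le) (use finCs in simp)
      also have "\<dots> \<le> (\<Sum>c\<in>insert 0 Cs. k0 * k0)"
        unfolding card_cartesian_product by (intro sum_mono mult_le_mono Z)
      also have "\<dots> = card (insert 0 Cs) * (k0 * k0)" by simp
      also have "\<dots> \<le> (card Cs + 1) * (k0 * k0)" using card_insert_le_m1[of "card Cs + 1" Cs 0] finCs
        by (intro mult_le_mono1) (simp add: card_insert_if)
      finally show "card (\<Union>c\<in>insert 0 Cs. Z (fst c / (\<theta> / 2 ^ j)) \<times> Z (snd c / (\<theta> / 2 ^ j))) \<le> (card Cs + 1) * (k0 * k0)" .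
    qed
    finally show ?thesis by simp
  qed
  have sub: "cells \<theta> p \<subseteq> T p" for p
  proof
    fix i assume i: "i \<in> cells \<theta> p"
    obtain j m1 m2 where ji: "i = (j, m1, m2)" by (cases i) auto
    obtain x where jp: "j \<le> p" and x: "x \<in> \<Omega>" "cutoff \<theta> p i x \<noteq> 0" using i unfolding cells_def ji by auto
    define h where "h = \<theta> / 2 ^ j"
    have h0: "h > 0" unfolding h_def using t by simp
    have nz: "ring D p j x \<noteq> 0" "hatf (fst x / h - of_int m1) \<noteq> 0" "hatf (snd x / h - of_int m2) \<noteq> 0"
      using x(2) unfolding cutoff_def ji h_def by auto
    have hm: "\<bar>fst x / h - of_int m1\<bar> < 1" "\<bar>snd x / h - of_int m2\<bar> < 1" using nz(2,3) hatf_simps(4) not_less by blast+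
    have "\<exists>c\<in>insert 0 Cs. \<bar>fst x - fst c\<bar> \<le> (2 + Rb) / 2 ^ j \<and> \<bar>snd x - snd c\<bar> \<le> (2 + Rb) / 2 ^ j"
    proof (cases "j = 0")
      case True
      have "norm x < Rb" using x(1) bdd by auto
      then have "\<bar>fst x - fst 0\<bar> \<le> 2 + Rb" "\<bar>snd x - snd 0\<bar> \<le> 2 + Rb" using abs_comp_le_norm[of x] by auto
      then show ?thesis using True by (intro bexI[of _ 0]) auto
    next
      case False
      have Dx: "D x < 2 / 2 ^ j" using ring_support(1)[OF nz(1)] False by simp
      also have "2 / 2 ^ j \<le> (1::real)" using False by (simp add: divide_le_eq self_le_power)
      finally obtain c where c: "c \<in> Cs" "D x = \<bar>fst x - fst c\<bar> + \<bar>snd x - snd c\<bar>" using Dc[of x] by auto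
      have "2 / 2 ^ j \<le> (2 + Rb) / 2 ^ j" using bdd(2) by (intro divide_right_mono) auto
      then show ?thesis using c Dx by (intro bexI[of _ c]) auto
    qed
    then obtain c where c: "c \<in> insert 0 Cs" "\<bar>fst x - fst c\<bar> \<le> (2 + Rb) / 2 ^ j" "\<bar>snd x - snd c\<bar> \<le> (2 + Rb) / 2 ^ j" by blast
    have inZ: "m \<in> Z (a / h)" if "\<bar>u / h - of_int m\<bar> < 1" "\<bar>u - a\<bar> \<le> (2 + Rb) / 2 ^ j" for m :: int and u a :: real
    proof -
      have "\<bar>u / h - a / h\<bar> = \<bar>u - a\<bar> / h" using h0 by (simp add: abs_divide flip: diff_divide_distrib)
      also have "\<dots> \<le> ((2 + Rb) / 2 ^ j) / h" using that h0 by (intro divide_right_mono) auto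
      also have "\<dots> = (2 + Rb) / \<theta>" unfolding h_def by simp
      finally show ?thesis using that(1) unfolding Z_def B_def by (simp add: abs_le_iff abs_less_iff)
    qed
    show "i \<in> T p" unfolding ji T_def using jp c(1) inZ[OF hm(1) c(2)] inZ[OF hm(2) c(3)] unfolding h_def by auto
  qed
  show thesis
  proof (rule that[of "(card Cs + 1) * (k0 * k0)"])
    fix p
    show "finite (cells \<theta> p) \<and> card (cells \<theta> p) \<le> (card Cs + 1) * (k0 * k0) * (p + 1)"
      using finite_subset[OF sub fT] card_mono[OF fT sub] cT[of p] by (metis le_trans mult.commute)
  qed
qed

lemma cutoff_sum:
  assumes t: "0 < \<theta>" and f: "finite (cells \<theta> p)" and x: "x \<in> \<Omega>"
  shows "(\<Sum>i\<in>cells \<theta> p. cutoff \<theta> p i x) = 1"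
proof -
  define u where "u j = fst x / (\<theta> / 2 ^ j)" for j :: nat
  define v where "v j = snd x / (\<theta> / 2 ^ j)" for j :: nat
  \<comment> \<open>The cells form no product set. Enlarging them, level by level, to products that
    include the grid neighbours of x adds only terms vanishing at x and lets the double sum
    factor.\<close>
  define A' where "A' j = {\<lfloor>u j\<rfloor>, \<lfloor>u j\<rfloor> + 1} \<union> (fst \<circ> snd) ` cells \<theta> p" for j
  define B' where "B' j = {\<lfloor>v j\<rfloor>, \<lfloor>v j\<rfloor> + 1} \<union> (snd \<circ> snd) ` cells \<theta> p" for j
  define T where "T = (SIGMA j:{..p}. A' j \<times> B' j)"
  have fin: "finite (A' j)" "finite (B' j)" for j unfolding A'_def B'_def using f by auto
  have "(\<Sum>i\<in>cells \<theta> p. cutoff \<theta> p i x) = (\<Sum>i\<in>T. cutoff \<theta> p i x)"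
  proof (rule sum.mono_neutral_left)
    show "finite T" unfolding T_def using fin by auto
    show "cells \<theta> p \<subseteq> T"
    proof
      fix i assume i: "i \<in> cells \<theta> p"
      then have "fst i \<le> p" unfolding cells_def by simp
      moreover have "fst (snd i) \<in> A' (fst i)" "snd (snd i) \<in> B' (fst i)" unfolding A'_def B'_def using i by auto
      ultimately show "i \<in> T" unfolding T_def by (cases i) auto
    qed
    show "\<forall>i\<in>T - cells \<theta> p. cutoff \<theta> p i x = 0"
    proof
      fix i assume i: "i \<in> T - cells \<theta> p"
      then have "fst i \<le> p" unfolding T_def by auto
      then show "cutoff \<theta> p i x = 0" using i x unfolding cells_def by auto
    qed
  qed
  also have "\<dots> = (\<Sum>j\<le>p. \<Sum>m\<in>A' j \<times> B' j. cutoff \<theta> p (j, m) x)"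
    unfolding T_def using fin by (subst sum.Sigma) auto
  also have "\<dots> = (\<Sum>j\<le>p. ring D p j x)"
  proof (rule sum.cong[OF refl])
    fix j
    have "(\<Sum>m\<in>A' j \<times> B' j. cutoff \<theta> p (j, m) x) = (\<Sum>m1\<in>A' j. \<Sum>m2\<in>B' j. ring D p j x * (hatf (u j - of_int m1) * hatf (v j - of_int m2)))"
      using fin by (subst sum.cartesian_product) (simp add: cutoff_def u_def v_def case_prod_beta)
    also have "\<dots> = ring D p j x * ((\<Sum>m1\<in>A' j. hatf (u j - of_int m1)) * (\<Sum>m2\<in>B' j. hatf (v j - of_int m2)))"
      unfolding sum_product by (simp only: sum_distrib_left)
    also have "\<dots> = ring D p j x"
    proof -
      have "(\<Sum>m1\<in>A' j. hatf (u j - of_int m1)) = 1" by (rule sum_hatf[OF fin(1)]) (auto simp: A'_def)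
      moreover have "(\<Sum>m2\<in>B' j. hatf (v j - of_int m2)) = 1" by (rule sum_hatf[OF fin(2)]) (auto simp: B'_def)
      ultimately show ?thesis by simp
    qed
    finally show "(\<Sum>m\<in>A' j \<times> B' j. cutoff \<theta> p (j, m) x) = ring D p j x" .
  qed
  also have "\<dots> = 1" by (rule sum_ring)
  finally show ?thesis .
qed

lemma lip_hat:
  assumes "0 < h" shows "lip (1 / h) (\<lambda>x::real\<times>real. hatf (fst x / h - m))" "lip (1 / h) (\<lambda>x::real\<times>real. hatf (snd x / h - m))"
    "lip (1 / h) (\<lambda>x::real\<times>real. clipf ((fst x - m) / h))" "lip (1 / h) (\<lambda>x::real\<times>real. clipf ((snd x - m) / h))"
proof -
  have *: "\<bar>a / h - b / h\<bar> \<le> 1 / h * n" if "\<bar>a - b\<bar> \<le> n" for a b n :: real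
    using that assms by (simp add: divide_right_mono abs_divide flip: diff_divide_distrib)
  have f: "\<bar>fst x - fst y\<bar> \<le> norm (x - y)" "\<bar>snd x - snd y\<bar> \<le> norm (x - y)" for x y :: "real \<times> real"
    using abs_comp_le_norm[of "x - y"] by simp_all
  show "lip (1 / h) (\<lambda>x::real\<times>real. hatf (fst x / h - m))" "lip (1 / h) (\<lambda>x::real\<times>real. hatf (snd x / h - m))"
    unfolding lip_def by (intro allI order_trans[OF hatf_simps(3)]; use *[OF f(1)] *[OF f(2)] in simp)+
  show "lip (1 / h) (\<lambda>x::real\<times>real. clipf ((fst x - m) / h))" "lip (1 / h) (\<lambda>x::real\<times>real. clipf ((snd x - m) / h))"
    unfolding lip_def by (intro allI order_trans[OF clipf_simps(2)]; use *[OF f(1)] *[OF f(2)] in \<open>simp add: diff_divide_distrib\<close>)+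
qed

text \<open>The slopes add up to 6 * 2^j for the ring and 2 * 2^j / \<theta> for the two hats. As
  \<theta> \<le> 1 this is at most 8 * 2^j / \<theta>, which is 24 divided by the patch radius 3
  \<theta> / 2^j.\<close>

lemma cutoff_props:
  assumes t: "0 < \<theta>" "\<theta> \<le> 1/3"
  shows "0 \<le> cutoff \<theta> p i x" "cutoff \<theta> p i x \<le> 1" "lip (24 / (3 * (\<theta> / 2 ^ fst i))) (cutoff \<theta> p i)" "good d (cutoff \<theta> p i)"
proof -
  let ?h = "\<theta> / 2 ^ fst i"
  let ?a = "\<lambda>x::real\<times>real. hatf (fst x / ?h - of_int (fst (snd i)))" and ?b = "\<lambda>x::real\<times>real. hatf (snd x / ?h - of_int (snd (snd i)))"
  have h: "0 < ?h" using t by simp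
  have rb: "0 \<le> ring D p (fst i) x" "ring D p (fst i) x \<le> 1" "\<bar>ring D p (fst i) x\<bar> \<le> 1" for x
    using ring_bounds[of D] D01 by (auto simp: abs_le_iff intro: order_trans[of _ 0])
  have ab: "0 \<le> ?a x * ?b x" "?a x * ?b x \<le> 1" "\<bar>?a x * ?b x\<bar> \<le> 1" "\<bar>?a x\<bar> \<le> 1" "\<bar>?b x\<bar> \<le> 1" for x
    using hatf_simps(1,2) by (auto intro!: mult_le_one mult_nonneg_nonneg simp: abs_mult)
  show "0 \<le> cutoff \<theta> p i x" "cutoff \<theta> p i x \<le> 1" unfolding cutoff_def using rb[of x] ab[of x] by (auto intro: mult_le_one)
  have h': "0 \<le> 1 / ?h" using h by (rule order.strict_implies_order[OF divide_pos_pos[OF zero_less_one]])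
  have h2: "0 \<le> 1 / ?h * 1 + 1 * (1 / ?h)" using h' by linarith
  have l1: "lip (1 / ?h * 1 + 1 * (1 / ?h)) (\<lambda>x. ?a x * ?b x)"
    by (rule lip_mult; (rule lip_hat[OF h] ab h')?; simp?)
  have "lip (6 * 2 ^ fst i * 1 + 1 * (1 / ?h * 1 + 1 * (1 / ?h))) (\<lambda>x. ring D p (fst i) x * (?a x * ?b x))"
    by (rule lip_mult; (rule l1 lip_ring[OF Dl] ab rb h2)?; simp?)
  then show "lip (24 / (3 * ?h)) (cutoff \<theta> p i)" unfolding cutoff_def[abs_def]
    by (rule lip_mono) (use t in \<open>simp add: field_simps\<close>)
  note F = NNs_factors[OF nets]
  have "good d ?a" "good d ?b" "good d (ring D p (fst i))"
    by (rule NNs_good[OF F(1)[where h = ?h and m = "of_int (fst (snd i))"]], simp)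
       (rule NNs_good[OF F(2)[where h = ?h and m = "of_int (snd (snd i))"]], simp,
        rule NNs_good[OF F(6)[where p = p and j = "fst i"]], simp)
  then show "good d (cutoff \<theta> p i)" unfolding cutoff_def[abs_def] using rb ab by (intro good_mult) auto
qed

text \<open>S is a square of side 2 h with h = \<theta> / 2^j, and two of its points have distance
  at most 2 sqrt 2 h < 3 h. So the ball of radius 3 h about any point where the cutoff is nonzero
  contains S; this is the origin of the 3 in the patch radii.\<close>

lemma cutoff_support:
  assumes t: "0 < \<theta>" and x0: "cutoff \<theta> p i x0 \<noteq> 0"
  defines "S \<equiv> {x. \<bar>fst x / (\<theta> / 2 ^ fst i) - of_int (fst (snd i))\<bar> \<le> 1 \<and> \<bar>snd x / (\<theta> / 2 ^ fst i) - of_int (snd (snd i))\<bar> \<le> 1}"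
  shows "closed S" "S \<subseteq> ball x0 (3 * (\<theta> / 2 ^ fst i))" "x \<notin> S \<Longrightarrow> cutoff \<theta> p i x = 0"
proof -
  let ?h = "\<theta> / 2 ^ fst i"
  have h: "0 < ?h" using t by simp
  show "closed S" unfolding S_def by (intro closed_Collect_conj closed_Collect_le continuous_intros) (use t in auto)
  show out: "cutoff \<theta> p i x = 0" if "x \<notin> S" for x
    using that hatf_simps(4)[of "fst x / ?h - of_int (fst (snd i))"] hatf_simps(4)[of "snd x / ?h - of_int (snd (snd i))"]
    unfolding S_def cutoff_def by (auto simp: not_le)
  show "S \<subseteq> ball x0 (3 * ?h)"
  proof
    fix x assume x: "x \<in> S"
    have x0S: "x0 \<in> S" using out x0 by blast
    have d: "\<bar>a - b\<bar> \<le> 2 * ?h" if "\<bar>a / ?h - m\<bar> \<le> 1" "\<bar>b / ?h - m\<bar> \<le> 1" for a b m :: real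
    proof -
      have "\<bar>a / ?h - b / ?h\<bar> \<le> 2" using that by (simp add: abs_le_iff)
      then have "\<bar>a - b\<bar> / ?h \<le> 2" using h by (metis diff_divide_distrib abs_divide abs_of_pos)
      then show ?thesis using pos_divide_le_eq[OF h, of "\<bar>a - b\<bar>" 2] by blast
    qed
    have 1: "\<bar>fst (x0 - x)\<bar> \<le> 2 * ?h" "\<bar>snd (x0 - x)\<bar> \<le> 2 * ?h"
      using d[of "fst x0" "of_int (fst (snd i))" "fst x"] d[of "snd x0" "of_int (snd (snd i))" "snd x"] x x0S unfolding S_def by auto
    have "(norm (x0 - x))\<^sup>2 = \<bar>fst (x0 - x)\<bar>\<^sup>2 + \<bar>snd (x0 - x)\<bar>\<^sup>2" by (simp add: norm_prod_def)
    also have "\<dots> \<le> (2 * ?h)\<^sup>2 + (2 * ?h)\<^sup>2" using 1 by (intro add_mono power_mono) auto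
    also have "\<dots> < (3 * ?h)\<^sup>2"
    proof -
      have "(2 * z)\<^sup>2 + (2 * z)\<^sup>2 < (3 * z)\<^sup>2" if "0 < z" for z :: real using that by (simp add: power_mult_distrib)
      then show ?thesis using h by blast
    qed
    finally have "norm (x0 - x) < 3 * ?h" by (rule power2_less_imp_less) (use h in simp)
    then show "x \<in> ball x0 (3 * ?h)" by (simp add: dist_norm)
  qed
qed

end

section \<open>Assembling the network\<close>

context net_setup
begin

text \<open>Three cutoff factors and at most p clipped coordinates are padded by ones to 2^q leaves.
  Running the tree with m = 4 p gives errors of order 2^p / 16^p up to a power of p, where 2^p is
  the slope of the factors at level p. Multiplied by coefficients of order 2^p this still leaves
  4^-p.\<close>

lemma term_net:
  fixes y1 y2 :: real
  assumes t: "0 < \<theta>" "\<theta> \<le> 1/3" and p: "1 \<le> p" "fst i \<le> p" "k \<le> p" "a \<le> k"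
    and q: "p + 3 \<le> 2 ^ q" "2 ^ q \<le> 2 * (p + 3)" and H: "0 < H" "1 / H \<le> 2 ^ p / \<theta>"
  defines "G \<equiv> \<lambda>x. cutoff \<theta> p i x * (clipf ((fst x - y1) / H) ^ a * clipf ((snd x - y2) / H) ^ (k - a))"
    and "\<eta> \<equiv> 16 * (real p + 3) ^ 4 * (7 + 1 / \<theta>) * (2 ^ p / 16 ^ p)"
  shows "\<exists>N. NNs (L + 2 + q * (4 * p + 3)) (2 ^ q * (s + 68 + 168 * p)) [N] \<and>
    (\<forall>x. \<bar>N x\<bar> \<le> 2) \<and> (\<forall>x. \<bar>G x - N x\<bar> \<le> \<eta>) \<and> lip \<eta> (\<lambda>x. G x - N x)"
proof -
  let ?h = "\<theta> / 2 ^ fst i"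
  let ?r = "ring D p (fst i)"
  let ?hx = "\<lambda>x::real\<times>real. hatf (fst x / ?h - of_int (fst (snd i)))" and ?hy = "\<lambda>x::real\<times>real. hatf (snd x / ?h - of_int (snd (snd i)))"
  let ?cx = "\<lambda>x::real\<times>real. clipf ((fst x - y1) / H)" and ?cy = "\<lambda>x::real\<times>real. clipf ((snd x - y2) / H)"
  define fs where "fs = [?r, ?hx, ?hy] @ replicate a ?cx @ replicate (k - a) ?cy @ replicate (2 ^ q - 3 - k) (\<lambda>x. 1)"
  define \<Lambda> where "\<Lambda> = (6 + 1 / \<theta>) * 2 ^ p"
  have L0: "0 \<le> \<Lambda>" unfolding \<Lambda>_def using t by simp
  have h: "0 < ?h" using t by simp
  have len: "length fs = 2 ^ q" unfolding fs_def using p q by simp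
  have mem: "f \<in> {?r, ?hx, ?hy, ?cx, ?cy, \<lambda>x. 1}" if "f \<in> set fs" for f
    using that unfolding fs_def by (simp only: set_append set_simps in_set_replicate Un_iff insert_iff empty_iff) blast
  have prod: "prod_list (map (\<lambda>f. f x) fs) = G x" for x
    unfolding fs_def G_def cutoff_def by (simp add: mult_ac)
  have rb: "\<bar>?r x\<bar> \<le> 1" for x
    using ring_bounds[of D p "fst i" x] D01 by simp
  have hb: "\<bar>?hx x\<bar> \<le> 1" "\<bar>?hy x\<bar> \<le> 1" for x using hatf_simps(1,2) by (simp_all add: abs_le_iff order_trans[of _ 0])
  have cb: "\<bar>?cx x\<bar> \<le> 1" "\<bar>?cy x\<bar> \<le> 1" for x by (rule clipf_simps(1))+
  have b1: "\<bar>f x\<bar> \<le> 1" if "f \<in> set fs" for f x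
    using mem[OF that] by (elim insertE emptyE) (simp_all only: rb hb cb abs_one order_refl)
  note F = NNs_factors[OF nets]
  have N1: "NNs (L + 2) (s + 17) [f]" if "f \<in> set fs" for f
    using mem[OF that] by (elim insertE emptyE) (simp_all only: F)
  have p2: "(2::real) ^ fst i \<le> 2 ^ p" using p by (intro power_increasing) auto
  have l1: "6 * 2 ^ fst i \<le> \<Lambda>" and l2: "1 / ?h \<le> \<Lambda>" and l3: "1 / H \<le> \<Lambda>"
  proof -
    have e: "\<Lambda> = 6 * 2 ^ p + 2 ^ p / \<theta>" unfolding \<Lambda>_def by (simp add: field_simps)
    have z: "(0::real) \<le> 2 ^ p / \<theta>" "(0::real) \<le> 2 ^ p" using t by auto
    have "1 / ?h = 2 ^ fst i / \<theta>" by simp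
    also have "\<dots> \<le> 2 ^ p / \<theta>" using t by (intro divide_right_mono p2) simp
    finally show "1 / ?h \<le> \<Lambda>" using e z by linarith
    show "6 * 2 ^ fst i \<le> \<Lambda>" "1 / H \<le> \<Lambda>" using e z p2 H by linarith+
  qed
  have lp: "lip \<Lambda> f" if "f \<in> set fs" for f
    using mem[OF that]
    by (elim insertE emptyE)
       (simp_all only: lip_mono[OF lip_ring[OF Dl] l1] lip_mono[OF lip_hat(1)[OF h] l2] lip_mono[OF lip_hat(2)[OF h] l2]
          lip_mono[OF lip_hat(3)[OF H(1)] l3] lip_mono[OF lip_hat(4)[OF H(1)] l3] lip_const[OF L0])
  have q4: "q \<le> 4 * p"
  proof -
    have "p + 3 \<le> 2 ^ (p + 2)" by (induction p) auto
    then have "2 * (p + 3) \<le> 2 * 2 ^ (p + 2)" by (rule mult_le_mono2)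
    also have "\<dots> = 2 ^ (p + 3)" by (simp add: power_add)
    finally have "2 ^ q \<le> (2::nat) ^ (p + 3)" by (rule order_trans[OF q(2)])
    then have "q \<le> p + 3" by (rule power_le_imp_le_exp[rotated]) simp
    then show ?thesis using p by simp
  qed
  have "2 \<le> 4 * p" using p by simp
  then have "\<exists>N. NNs (L + 2 + q * (4 * p + 3)) (2 ^ q * (s + 17 + 51 + 42 * (4 * p))) [N] \<and>
     (\<forall>x. \<bar>N x - prod_list (map (\<lambda>f. f x) fs)\<bar> \<le> 4 ^ q / 4 ^ (4 * p)) \<and>
     lip (16 ^ q * \<Lambda> / 2 ^ (4 * p)) (\<lambda>x. N x - prod_list (map (\<lambda>f. f x) fs))"
    by (rule NNs_prod_tree[OF len q4 _ L0]) (use N1 lp b1 in blast)+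
  then obtain N where N: "NNs (L + 2 + q * (4 * p + 3)) (2 ^ q * (s + 17 + 51 + 42 * (4 * p))) [N]"
     "\<And>x. \<bar>N x - G x\<bar> \<le> 4 ^ q / 4 ^ (4 * p)" "lip (16 ^ q * \<Lambda> / 2 ^ (4 * p)) (\<lambda>x. N x - G x)"
    unfolding prod by blast
  have q16: "(16::real) ^ q \<le> 16 * (real p + 3) ^ 4"
  proof -
    have "(16::real) ^ q = (2 ^ q) ^ 4" by (simp add: power_mult[symmetric] mult.commute[of q] power_mult)
    also have "\<dots> \<le> (2 * (real p + 3)) ^ 4"
    proof (rule power_mono)
      have "real (2 ^ q) \<le> real (2 * (p + 3))" using q(2) by (simp only: of_nat_le_iff)
      then show "2 ^ q \<le> 2 * (real p + 3)" by simp
    qed simp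
    also have "\<dots> = 16 * (real p + 3) ^ 4" by (simp only: power_mult_distrib) simp
    finally show ?thesis .
  qed
  have p16: "(2::real) ^ (4 * p) = 16 ^ p" by (simp add: power_mult)
  have L7: "\<Lambda> + 1 \<le> (7 + 1 / \<theta>) * 2 ^ p" unfolding \<Lambda>_def by (simp add: algebra_simps)
  have e1: "16 ^ q * (\<Lambda> + 1) / 2 ^ (4 * p) \<le> \<eta>"
  proof -
    have "16 ^ q * (\<Lambda> + 1) \<le> 16 * (real p + 3) ^ 4 * ((7 + 1 / \<theta>) * 2 ^ p)"
      using q16 L7 L0 by (intro mult_mono) auto
    then show ?thesis unfolding p16 \<eta>_def by (simp add: divide_right_mono mult.assoc)
  qed
  have e2: "16 ^ q * \<Lambda> / 2 ^ (4 * p) \<le> \<eta>"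
    by (rule order_trans[OF _ e1]) (intro divide_right_mono mult_left_mono; simp)
  have e3: "4 ^ q / 4 ^ (4 * p) \<le> \<eta>"
  proof (rule order_trans[OF _ e1], rule frac_le)
    have "(4::real) ^ q * 1 \<le> 16 ^ q * (\<Lambda> + 1)" using L0 by (intro mult_mono power_mono) auto
    then show "(4::real) ^ q \<le> 16 ^ q * (\<Lambda> + 1)" by simp
    show "(2::real) ^ (4 * p) \<le> 4 ^ (4 * p)" by (rule power_mono) auto
  qed (use L0 in auto)
  have G1: "\<bar>G x\<bar> \<le> 1" for x
  proof -
    have "\<bar>cutoff \<theta> p i x\<bar> \<le> 1" using cutoff_props(1,2)[OF t] by simp
    moreover have "\<bar>?cx x ^ a * ?cy x ^ (k - a)\<bar> \<le> 1"
      unfolding abs_mult power_abs by (intro mult_le_one power_le_one cb zero_le_power abs_ge_zero)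
    ultimately show ?thesis unfolding G_def abs_mult[of "cutoff \<theta> p i x"] by (rule mult_le_one[OF _ abs_ge_zero])
  qed
  have q1: "(4::real) ^ q / 4 ^ (4 * p) \<le> 1" using q4 by (simp add: power_increasing)
  have N2: "\<bar>N x\<bar> \<le> 2" for x using N(2)[of x] G1[of x] q1 unfolding abs_le_iff by linarith
  have "lip (16 ^ q * \<Lambda> / 2 ^ (4 * p)) (\<lambda>x. G x - N x)"
    using N(3) unfolding lip_def by (simp add: abs_le_iff) (smt (verit))
  then have l: "lip \<eta> (\<lambda>x. G x - N x)" by (rule lip_mono[OF _ e2])
  have d: "\<bar>G x - N x\<bar> \<le> \<eta>" for x using N(2)[of x] e3 by (simp add: abs_minus_commute)
  have "2 ^ q * (s + 17 + 51 + 42 * (4 * p)) = 2 ^ q * (s + 68 + 168 * p)" by simp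
  then have n: "NNs (L + 2 + q * (4 * p + 3)) (2 ^ q * (s + 68 + 168 * p)) [N]" using N(1) by (simp only:)
  show ?thesis by (rule exI[of _ N]) (intro conjI allI n N2 d l)
qed

lemma NNs_sum_set:
  assumes "finite T" "T \<noteq> {}" "\<And>t. t \<in> T \<Longrightarrow> NNs L' s' [N t] \<and> (\<forall>x. \<bar>N t x\<bar> \<le> 2)"
  shows "NNs (L' + 1) (card T * (s' + 3)) [\<lambda>x. \<Sum>t\<in>T. c t * N t x]"
proof -
  obtain ts where ts: "set ts = T" "distinct ts" using finite_distinct_list[OF assms(1)] by blast
  have e: "sum_list (map2 (*) (map c us) (map (\<lambda>f. f x) (map N us))) = sum_list (map (\<lambda>t. c t * N t x) us)" for us x
    by (induction us) auto
  have "sum_list (map2 (*) (map c ts) (map (\<lambda>f. f x) (map N ts))) = (\<Sum>t\<in>T. c t * N t x)" for x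
    unfolding e using ts by (simp add: sum_list_distinct_conv_sum_set)
  moreover have "NNs (L' + 1) (length (map N ts) * (s' + 3)) [\<lambda>x. sum_list (map2 (*) (map c ts) (map (\<lambda>f. f x) (map N ts)))]"
    by (rule NNs_sum) (use assms ts in auto)
  ultimately show ?thesis using ts distinct_card[OF ts(2)] by simp
qed

text \<open>The error is split at the glued function w. The first part is the partition estimate.
  The second, w - R, is a sum of product errors and small on the whole plane both in sup norm and in
  Lipschitz constant; the latter controls the limits of its difference quotients.\<close>

lemma net_approx_step:
  assumes t: "0 < \<theta>" "\<theta> \<le> 1/3" and p: "1 \<le> p" and eB: "0 \<le> e" "0 \<le> B"
    and pt: "\<And>j x. j \<le> p \<Longrightarrow> x \<in> \<Omega> \<Longrightarrow> ring D p j x \<noteq> 0 \<Longrightarrow> patch p x (3 * (\<theta> / 2 ^ j)) e B"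
    and fin: "finite (cells \<theta> p)" and n: "card (cells \<theta> p) \<le> n"
  defines "\<eta> \<equiv> real (n * (p + 1)\<^sup>2) * (B * (16 * (real p + 3) ^ 4 * (7 + 1 / \<theta>) * (2 ^ p / 16 ^ p)))"
  defines "err \<equiv> 2 * (50 * real n * e + \<eta> * (2 * Rb))"
  shows "\<exists>R q. 2 ^ q \<le> 2 * (p + 3) \<and>
     NNs (L + 3 + q * (4 * p + 3)) (n * (p + 1)\<^sup>2 * (2 * (p + 3) * (s + 68 + 168 * p) + 3)) [R] \<and>
     sq_int \<Omega> (\<lambda>x. E 0 0 x - R x) \<le> ennreal (err\<^sup>2) \<and>
     sq_int \<Omega> (\<lambda>x. E 1 0 x - dq (1, 0) R x) \<le> ennreal (err\<^sup>2) \<and>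
     sq_int \<Omega> (\<lambda>x. E 0 1 x - dq (0, 1) R x) \<le> ennreal (err\<^sup>2)"
proof -
  define I where "I = cells \<theta> p"
  have finI: "finite I" and cI: "real (card I) \<le> real n" unfolding I_def using fin n by auto
  define r where "r i = 3 * (\<theta> / 2 ^ fst i)" for i :: "nat \<times> int \<times> int"
  define H where "H i = (M + 2) * r i" for i
  have r0: "0 < r i" "r i \<le> 1" for i
  proof -
    show "0 < r i" unfolding r_def using t by simp
    have "3 * \<theta> \<le> 1" "(1::real) \<le> 2 ^ fst i" using t by auto
    then have "3 * \<theta> \<le> 2 ^ fst i" by linarith
    then show "r i \<le> 1" unfolding r_def by (simp add: divide_le_eq)
  qed
  have M0: "0 < M" using M4 by simp
  have H0: "0 < H i" for i unfolding H_def using r0 M0 by simp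
  have "\<forall>i\<in>I. \<exists>x. x \<in> \<Omega> \<and> cutoff \<theta> p i x \<noteq> 0" unfolding I_def cells_def by blast
  then obtain x0 where x0: "\<forall>i\<in>I. x0 i \<in> \<Omega> \<and> cutoff \<theta> p i (x0 i) \<noteq> 0" using bchoice[of I "\<lambda>i x. x \<in> \<Omega> \<and> cutoff \<theta> p i x \<noteq> 0"] by blast
  have Ip: "fst i \<le> p" if "i \<in> I" for i using that unfolding I_def cells_def by simp
  define PP where "PP i y cf Q1 Q2 \<longleftrightarrow>
     (\<forall>x. (ppoly p (H i) cf y has_derivative (\<lambda>e. fst e * Q1 x + snd e * Q2 x)) (at x)) \<and>
     (\<forall>k i. \<bar>cf k i\<bar> \<le> B) \<and> Q1 \<in> borel_measurable borel \<and> Q2 \<in> borel_measurable borel \<and>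
     (\<forall>x\<in>ball (x0 i) (r i). \<bar>fst (x - y)\<bar> \<le> H i \<and> \<bar>snd (x - y)\<bar> \<le> H i) \<and>
     sq_int (\<Omega> \<inter> ball (x0 i) (r i)) (\<lambda>x. E 0 0 x - ppoly p (H i) cf y x) \<le> ennreal ((e * r i)\<^sup>2) \<and>
     sq_int (\<Omega> \<inter> ball (x0 i) (r i)) (\<lambda>x. E 1 0 x - Q1 x) \<le> ennreal (e\<^sup>2) \<and>
     sq_int (\<Omega> \<inter> ball (x0 i) (r i)) (\<lambda>x. E 0 1 x - Q2 x) \<le> ennreal (e\<^sup>2)" for i y cf Q1 Q2
  have "\<forall>i\<in>I. \<exists>z. PP i (fst z) (fst (snd z)) (fst (snd (snd z))) (snd (snd (snd z)))"
  proof
    fix i assume i: "i \<in> I"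
    have "ring D p (fst i) (x0 i) \<noteq> 0" using x0 i unfolding cutoff_def by force
    then have "patch p (x0 i) (r i) e B" unfolding r_def using pt Ip[OF i] x0 i by blast
    then obtain y cf Q1 Q2 where "PP i y cf Q1 Q2" unfolding patch_def PP_def H_def by blast
    then show "\<exists>z. PP i (fst z) (fst (snd z)) (fst (snd (snd z))) (snd (snd (snd z)))"
      by (intro exI[of _ "(y, cf, Q1, Q2)"]) simp
  qed
  then obtain z where z: "\<forall>i\<in>I. PP i (fst (z i)) (fst (snd (z i))) (fst (snd (snd (z i)))) (snd (snd (snd (z i))))"
    using bchoice[of I "\<lambda>i z. PP i (fst z) (fst (snd z)) (fst (snd (snd z))) (snd (snd (snd z)))"] by blast
  define y where "y i = fst (z i)" for i
  define cf where "cf i = fst (snd (z i))" for i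
  define Q1 where "Q1 i = fst (snd (snd (z i)))" for i
  define Q2 where "Q2 i = snd (snd (snd (z i)))" for i
  define P where "P i = ppoly p (H i) (cf i) (y i)" for i
  have PPi: "PP i (y i) (cf i) (Q1 i) (Q2 i)" if "i \<in> I" for i using z that unfolding y_def cf_def Q1_def Q2_def by blast
  have Pd: "(P i has_derivative (\<lambda>e. fst e * Q1 i x + snd e * Q2 i x)) (at x)"
    and cfB: "\<bar>cf i k l\<bar> \<le> B" and Qm: "Q1 i \<in> borel_measurable borel" "Q2 i \<in> borel_measurable borel"
    and yb: "\<forall>x\<in>ball (x0 i) (r i). \<bar>fst (x - y i)\<bar> \<le> H i \<and> \<bar>snd (x - y i)\<bar> \<le> H i"
    and e0: "sq_int (\<Omega> \<inter> ball (x0 i) (r i)) (\<lambda>x. E 0 0 x - P i x) \<le> ennreal ((e * r i)\<^sup>2)"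
    and e1: "sq_int (\<Omega> \<inter> ball (x0 i) (r i)) (\<lambda>x. E 1 0 x - Q1 i x) \<le> ennreal (e\<^sup>2)"
    and e2: "sq_int (\<Omega> \<inter> ball (x0 i) (r i)) (\<lambda>x. E 0 1 x - Q2 i x) \<le> ennreal (e\<^sup>2)"
    if "i \<in> I" for i x k l using PPi[OF that] unfolding PP_def P_def by blast+
  define S where "S i = {x::real\<times>real. \<bar>fst x / (\<theta> / 2 ^ fst i) - of_int (fst (snd i))\<bar> \<le> 1 \<and>
     \<bar>snd x / (\<theta> / 2 ^ fst i) - of_int (snd (snd i))\<bar> \<le> 1}" for i :: "nat \<times> int \<times> int"
  have S: "closed (S i) \<and> S i \<subseteq> ball (x0 i) (r i)" "x \<notin> S i \<Longrightarrow> cutoff \<theta> p i x = 0" if "i \<in> I" for i x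
  proof -
    have c: "cutoff \<theta> p i (x0 i) \<noteq> 0" using x0 that by blast
    show "closed (S i) \<and> S i \<subseteq> ball (x0 i) (r i)" unfolding S_def r_def
      using cutoff_support(1)[OF t(1) c] cutoff_support(2)[OF t(1) c] by blast
    show "x \<notin> S i \<Longrightarrow> cutoff \<theta> p i x = 0" unfolding S_def by (rule cutoff_support(3)[OF t(1) c])
  qed
  have g: "good d (cutoff \<theta> p i)" for d i by (rule cutoff_props(4)[OF t])
  have b: "0 \<le> cutoff \<theta> p i x \<and> cutoff \<theta> p i x \<le> 1" for i x using cutoff_props(1,2)[OF t] by blast
  have l: "lip (24 / r i) (cutoff \<theta> p i)" for i unfolding r_def by (rule cutoff_props(3)[OF t])
  have one: "(\<Sum>i\<in>I. cutoff \<theta> p i x) = 1" if "x \<in> \<Omega>" for x unfolding I_def by (rule cutoff_sum[OF t(1) fin that])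
  have nd: "norm (1::real, 0::real) = 1" "norm (0::real, 1::real) = 1" by (simp_all add: norm_prod_def)
  have P1: "dqn (1, 0) (P i) x \<longlonglongrightarrow> Q1 i x" "dqn (0, 1) (P i) x \<longlonglongrightarrow> Q2 i x" if "i \<in> I" for i x
    using dqn_has_derivative[OF Pd[OF that], of "(1, 0)" x] dqn_has_derivative[OF Pd[OF that], of "(0, 1)" x] by simp_all
  have Pc: "isCont (P i) x" if "i \<in> I" for i x using Pd[OF that] has_derivative_continuous by blast
  have rr: "0 < r i \<and> r i \<le> 1" for i using r0 by blast
  define w where "w = (\<lambda>x. \<Sum>i\<in>I. cutoff \<theta> p i x * P i x)"
  define W1 where "W1 = (\<lambda>x. \<Sum>i\<in>I. (dq (1, 0) (cutoff \<theta> p i) x * P i x + cutoff \<theta> p i x * Q1 i x))"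
  define W2 where "W2 = (\<lambda>x. \<Sum>i\<in>I. (dq (0, 1) (cutoff \<theta> p i) x * P i x + cutoff \<theta> p i x * Q2 i x))"
  note PE1 = partition_error[where S = S and ?x0.0 = x0 and K = 24, OF op finI Em Em nd(1) g b l rr _ S one P1(1) Pc Qm(1) eB(1) e0 e1]
  note PE2 = partition_error[where S = S and ?x0.0 = x0 and K = 24, OF op finI Em Em nd(2) g b l rr _ S one P1(2) Pc Qm(2) eB(1) e0 e2]
  have wlim: "dqn (1, 0) w x \<longlonglongrightarrow> W1 x" "dqn (0, 1) w x \<longlonglongrightarrow> W2 x" for x
    unfolding w_def W1_def W2_def
  proof -
    show "dqn (1, 0) (\<lambda>x. \<Sum>i\<in>I. cutoff \<theta> p i x * P i x) x
      \<longlonglongrightarrow> (\<Sum>i\<in>I. (dq (1, 0) (cutoff \<theta> p i) x * P i x + cutoff \<theta> p i x * Q1 i x))" by (rule PE1(1)) simp_all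
    show "dqn (0, 1) (\<lambda>x. \<Sum>i\<in>I. cutoff \<theta> p i x * P i x) x
      \<longlonglongrightarrow> (\<Sum>i\<in>I. (dq (0, 1) (cutoff \<theta> p i) x * P i x + cutoff \<theta> p i x * Q2 i x))" by (rule PE2(1)) simp_all
  qed
  have wm: "w \<in> borel_measurable borel" "W1 \<in> borel_measurable borel" "W2 \<in> borel_measurable borel"
    
  proof -
    show "w \<in> borel_measurable borel" unfolding w_def by (rule PE1(3)) simp_all
    show "W1 \<in> borel_measurable borel" unfolding W1_def by (rule PE1(2)) simp_all
    show "W2 \<in> borel_measurable borel" unfolding W2_def by (rule PE2(2)) simp_all
  qed
  have werr: "sq_int \<Omega> (\<lambda>x. E 0 0 x - w x) \<le> ennreal ((50 * real n * e)\<^sup>2)"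
    "sq_int \<Omega> (\<lambda>x. E 1 0 x - W1 x) \<le> ennreal ((50 * real n * e)\<^sup>2)"
    "sq_int \<Omega> (\<lambda>x. E 0 1 x - W2 x) \<le> ennreal ((50 * real n * e)\<^sup>2)"
  proof -
    have m: "real (card I) * e \<le> real n * e" "0 \<le> real (card I) * e" using cI eB by (auto intro: mult_right_mono)
    have 1: "ennreal ((real (card I) * e)\<^sup>2) \<le> ennreal ((50 * real n * e)\<^sup>2)"
      using m by (intro ennreal_leI power_mono) auto
    have 2: "ennreal ((2 * real (card I) * (1 + 24) * e)\<^sup>2) \<le> ennreal ((50 * real n * e)\<^sup>2)"
      using m by (intro ennreal_leI power_mono) (auto simp: mult.commute)
    show "sq_int \<Omega> (\<lambda>x. E 0 0 x - w x) \<le> ennreal ((50 * real n * e)\<^sup>2)"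
      unfolding w_def by (rule order_trans[OF PE1(4) 1]) simp_all
    show "sq_int \<Omega> (\<lambda>x. E 1 0 x - W1 x) \<le> ennreal ((50 * real n * e)\<^sup>2)"
      unfolding W1_def by (rule order_trans[OF PE1(5) 2]) simp_all
    show "sq_int \<Omega> (\<lambda>x. E 0 1 x - W2 x) \<le> ennreal ((50 * real n * e)\<^sup>2)"
      unfolding W2_def by (rule order_trans[OF PE2(5) 2]) simp_all
  qed
  obtain q where q: "p + 3 \<le> 2 ^ q" "2 ^ q \<le> 2 * (p + 3)" using power2_ceiling_exists[of "p + 3"] by auto
  \<comment> \<open>One index per cell and monomial, each with its own product network; their number
    is cubic in p.\<close>
  define T where "T = (SIGMA i:I. SIGMA k:{..p}. {..k})"
  have finT: "finite T" unfolding T_def using finI by auto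
  have cT: "card T \<le> n * (p + 1)\<^sup>2"
  proof -
    have "T \<subseteq> I \<times> ({..p} \<times> {..p})" unfolding T_def by auto
    then have "card T \<le> card (I \<times> ({..p} \<times> {..p}))" using finI by (intro card_mono) auto
    also have "\<dots> = card I * ((p + 1) * (p + 1))" by (simp add: card_cartesian_product)
    also have "\<dots> \<le> n * (p + 1)\<^sup>2" using cI unfolding power2_eq_square by (intro mult_le_mono1) simp
    finally show ?thesis .
  qed
  have T0: "T \<noteq> {}"
  proof -
    obtain x where "x \<in> \<Omega>" using ne by blast
    then have "I \<noteq> {}" using one[of x] by force
    then obtain i where "i \<in> I" by blast
    then have "(i, 0, 0) \<in> T" unfolding T_def by simp
    then show ?thesis by blast
  qed
  define G where "G t x = cutoff \<theta> p (fst t) x * (clipf ((fst x - fst (y (fst t))) / H (fst t)) ^ snd (snd t) *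
     clipf ((snd x - snd (y (fst t))) / H (fst t)) ^ (fst (snd t) - snd (snd t)))" for t :: "(nat \<times> int \<times> int) \<times> nat \<times> nat" and x
  define ct where "ct t = cf (fst t) (fst (snd t)) (snd (snd t))" for t :: "(nat \<times> int \<times> int) \<times> nat \<times> nat"
  define \<eta>0 where "\<eta>0 = 16 * (real p + 3) ^ 4 * (7 + 1 / \<theta>) * (2 ^ p / 16 ^ p)"
  have et0: "0 \<le> \<eta>0" unfolding \<eta>0_def using t by simp
  have Tm: "fst t \<in> I" "fst (snd t) \<le> p" "snd (snd t) \<le> fst (snd t)" if "t \<in> T" for t using that unfolding T_def by auto
  have "\<forall>t\<in>T. \<exists>N. NNs (L + 2 + q * (4 * p + 3)) (2 ^ q * (s + 68 + 168 * p)) [N] \<and>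
    (\<forall>x. \<bar>N x\<bar> \<le> 2) \<and> (\<forall>x. \<bar>G t x - N x\<bar> \<le> \<eta>0) \<and> lip \<eta>0 (\<lambda>x. G t x - N x)"
  proof
    fix u assume u: "u \<in> T"
    have "1 / H (fst u) \<le> 2 ^ p / \<theta>"
    proof -
      let ?h = "\<theta> / 2 ^ fst (fst u)"
      have h0: "0 < ?h" using t by simp
      have "?h * 1 \<le> ?h * ((M + 2) * 3)" using h0 M0 by (intro mult_left_mono) auto
      then have "?h \<le> H (fst u)" unfolding H_def r_def by (simp add: mult_ac)
      then have "1 / H (fst u) \<le> 1 / ?h" by (intro divide_left_mono mult_pos_pos H0 h0) auto
      also have "\<dots> = 2 ^ fst (fst u) / \<theta>" by simp
      also have "\<dots> \<le> 2 ^ p / \<theta>" using t Ip[OF Tm(1)[OF u]] by (intro divide_right_mono power_increasing) auto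
      finally show ?thesis .
    qed
    then show "\<exists>N. NNs (L + 2 + q * (4 * p + 3)) (2 ^ q * (s + 68 + 168 * p)) [N] \<and>
    (\<forall>x. \<bar>N x\<bar> \<le> 2) \<and> (\<forall>x. \<bar>G u x - N x\<bar> \<le> \<eta>0) \<and> lip \<eta>0 (\<lambda>x. G u x - N x)"
      unfolding G_def \<eta>0_def by (rule term_net[OF t p Ip[OF Tm(1)[OF u]] Tm(2,3)[OF u] q H0])
  qed
  then obtain N where N: "\<forall>t\<in>T. NNs (L + 2 + q * (4 * p + 3)) (2 ^ q * (s + 68 + 168 * p)) [N t] \<and>
    (\<forall>x. \<bar>N t x\<bar> \<le> 2) \<and> (\<forall>x. \<bar>G t x - N t x\<bar> \<le> \<eta>0) \<and> lip \<eta>0 (\<lambda>x. G t x - N t x)"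
    using bchoice[of T "\<lambda>t N. NNs (L + 2 + q * (4 * p + 3)) (2 ^ q * (s + 68 + 168 * p)) [N] \<and>
    (\<forall>x. \<bar>N x\<bar> \<le> 2) \<and> (\<forall>x. \<bar>G t x - N x\<bar> \<le> \<eta>0) \<and> lip \<eta>0 (\<lambda>x. G t x - N x)"] by blast
  define R where "R = (\<lambda>x. \<Sum>t\<in>T. ct t * N t x)"
  have RN: "NNs (L + 3 + q * (4 * p + 3)) (n * (p + 1)\<^sup>2 * (2 * (p + 3) * (s + 68 + 168 * p) + 3)) [R]"
  proof -
    have a: "NNs (L + 2 + q * (4 * p + 3) + 1) (card T * (2 ^ q * (s + 68 + 168 * p) + 3)) [R]"
      unfolding R_def by (rule NNs_sum_set[OF finT T0]) (use N in blast)
    have b: "card T * (2 ^ q * (s + 68 + 168 * p) + 3) \<le> n * (p + 1)\<^sup>2 * (2 * (p + 3) * (s + 68 + 168 * p) + 3)"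
      by (rule mult_le_mono[OF cT add_le_mono[OF mult_le_mono1[OF q(2)] order_refl]])
    have e: "L + 3 + q * (4 * p + 3) = L + 2 + q * (4 * p + 3) + 1" by simp
    show ?thesis unfolding e by (rule NNs_mono[OF a b])
  qed
  have wG: "w x = (\<Sum>t\<in>T. ct t * G t x)" for x
  proof -
    have "(\<Sum>t\<in>T. ct t * G t x) = (\<Sum>i\<in>I. \<Sum>k\<le>p. \<Sum>a\<le>k. ct (i, k, a) * G (i, k, a) x)"
      unfolding T_def using finI by (simp add: sum.Sigma case_prod_beta)
    also have "\<dots> = (\<Sum>i\<in>I. cutoff \<theta> p i x * P i x)"
    proof (rule sum.cong[OF refl])
      fix i assume i: "i \<in> I"
      \<comment> \<open>Inside S i the scaled coordinates lie in [-1, 1], so clipping changes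
        nothing and the polynomial appears; outside S i the cutoff makes both sides vanish.\<close>
      show "(\<Sum>k\<le>p. \<Sum>a\<le>k. ct (i, k, a) * G (i, k, a) x) = cutoff \<theta> p i x * P i x"
      proof (cases "x \<in> S i")
        case False
        then show ?thesis using S(2)[OF i] by (simp add: G_def)
      next
        case True
        then have "x \<in> ball (x0 i) (r i)" using S(1)[OF i] by blast
        then have "\<bar>fst x - fst (y i)\<bar> \<le> H i" "\<bar>snd x - snd (y i)\<bar> \<le> H i" using yb[OF i] by (simp_all only: fst_diff snd_diff)
        then have "clipf ((fst x - fst (y i)) / H i) = (fst x - fst (y i)) / H i" "clipf ((snd x - snd (y i)) / H i) = (snd x - snd (y i)) / H i"
          using H0[of i] by (auto intro!: clipf_simps(3) simp: abs_divide)
        then show ?thesis unfolding G_def ct_def P_def ppoly_def by (simp add: sum_distrib_left mult_ac)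
      qed
    qed
    finally show ?thesis unfolding w_def by simp
  qed
  have df: "w x - R x = (\<Sum>t\<in>T. ct t * (G t x - N t x))" for x
    unfolding wG R_def by (simp add: sum_subtractf right_diff_distrib)
  have cB: "\<bar>ct t\<bar> \<le> B" if "t \<in> T" for t unfolding ct_def by (rule cfB[OF Tm(1)[OF that]])
  have eta: "real (card T) * (B * \<eta>0) \<le> \<eta>" unfolding \<eta>_def \<eta>0_def[symmetric]
    using cT eB et0 by (intro mult_right_mono) (auto simp only: of_nat_le_iff mult_nonneg_nonneg)
  have "lip (real (card T) * (B * \<eta>0)) (\<lambda>x. \<Sum>t\<in>T. ct t * (G t x - N t x))"
  proof (rule lip_sum[OF finT])
    fix u assume u: "u \<in> T"
    show "lip (B * \<eta>0) (\<lambda>x. ct u * (G u x - N u x))"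
      by (rule lip_mono[OF lip_cmul[of \<eta>0]]) (use N u cB[OF u] et0 in \<open>auto intro: mult_right_mono\<close>)
  qed
  then have lipd: "lip \<eta> (\<lambda>x. w x - R x)" unfolding df[symmetric] by (rule lip_mono[OF _ eta])
  have supd: "\<bar>w x - R x\<bar> \<le> \<eta>" for x
  proof -
    have "\<bar>w x - R x\<bar> \<le> (\<Sum>t\<in>T. \<bar>ct t * (G t x - N t x)\<bar>)" unfolding df by (rule sum_abs)
    also have "\<dots> \<le> real (card T) * (B * \<eta>0)"
    proof (rule sum_bounded_above)
      fix u assume u: "u \<in> T"
      have "\<bar>G u x - N u x\<bar> \<le> \<eta>0" using N u by blast
      then show "\<bar>ct u * (G u x - N u x)\<bar> \<le> B * \<eta>0"
        unfolding abs_mult by (rule mult_mono[OF cB[OF u] _ eB(2) abs_ge_zero])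
    qed
    finally show ?thesis using eta by linarith
  qed
  have gR: "good d R" for d by (rule NNs_good[OF RN]) simp
  \<comment> \<open>The function w is not itself shown to be \<open>good\<close>: convergence of its
    quotients to W and the Lipschitz bound for w - R suffice to compare the limits.\<close>
  have dqd: "\<bar>W x - dq d R x\<bar> \<le> \<eta>" if W: "dqn d w x \<longlonglongrightarrow> W x" and d: "norm d = 1" for W d x
  proof -
    have "dqn d (\<lambda>x. w x - R x) x n = dqn d w x n - dqn d R x n" for n unfolding dqn_def by (simp add: algebra_simps)
    then have e: "dqn d (\<lambda>x. w x - R x) x = (\<lambda>n. dqn d w x n - dqn d R x n)" by (rule ext)
    have t: "dqn d (\<lambda>x. w x - R x) x \<longlonglongrightarrow> W x - dq d R x" unfolding e by (rule tendsto_diff[OF W dq_lim[OF gR]])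
    have b: "\<bar>dqn d (\<lambda>x. w x - R x) x n\<bar> \<le> \<eta>" for n using dqn_lip[OF lipd, of d x n] d by simp
    show ?thesis by (rule tendsto_upperbound[OF tendsto_rabs[OF t]]) (simp_all add: b)
  qed
  have V: "emeasure lborel \<Omega> \<le> ennreal ((2 * Rb)\<^sup>2)"
  proof -
    have "emeasure lborel \<Omega> \<le> emeasure lborel (ball (0::real\<times>real) Rb)" using bdd by (intro emeasure_mono) auto
    also have "\<dots> = ennreal (pi * Rb\<^sup>2)" using bdd by (intro emeasure_ball_plane) simp
    also have "\<dots> \<le> ennreal ((2 * Rb)\<^sup>2)" unfolding power_mult_distrib
      using pi_less_4 by (intro ennreal_leI mult_right_mono) auto
    finally show ?thesis .
  qed
  have eta0: "0 \<le> \<eta>" using order_trans[OF abs_ge_zero supd] .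
  have fin': "sq_int \<Omega> (\<lambda>x. g x - h x) \<le> ennreal (err\<^sup>2)"
    if "g \<in> borel_measurable borel" "W \<in> borel_measurable borel" "sq_int \<Omega> (\<lambda>x. g x - W x) \<le> ennreal ((50 * real n * e)\<^sup>2)"
      "\<And>x. \<bar>W x - h x\<bar> \<le> \<eta>" for g W h :: "real \<times> real \<Rightarrow> real"
  proof -
    have "sq_int \<Omega> (\<lambda>x. (g x - W x) + (W x - h x)) \<le> ennreal ((2 * (50 * real n * e + \<eta> * (2 * Rb)))\<^sup>2)"
      by (rule nn_integral_square_add[OF Om_sets _ that(3) _ that(4) eta0 V]) (use that(1,2) eB bdd in auto)
    then show ?thesis unfolding err_def by simp
  qed
  have "sq_int \<Omega> (\<lambda>x. E 0 0 x - R x) \<le> ennreal (err\<^sup>2)" by (rule fin'[of "E 0 0" w R, OF Em wm(1) werr(1) supd])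
  moreover have "sq_int \<Omega> (\<lambda>x. E 1 0 x - dq (1, 0) R x) \<le> ennreal (err\<^sup>2)"
    by (rule fin'[of "E 1 0" W1 "dq (1, 0) R", OF Em wm(2) werr(2)]) (rule dqd[where W = W1, OF wlim(1) nd(1)])
  moreover have "sq_int \<Omega> (\<lambda>x. E 0 1 x - dq (0, 1) R x) \<le> ennreal (err\<^sup>2)"
    by (rule fin'[of "E 0 1" W2 "dq (0, 1) R", OF Em wm(3) werr(3)]) (rule dqd[where W = W2, OF wlim(2) nd(2)])
  ultimately show ?thesis using q(2) RN by blast
qed

text \<open>Power counting: O(p) cells, quadratically many monomials, a coefficient factor linear in
  p and the fourth power in the product error give at most (p + 3)^8, absorbed by passing from \<mu>
  to its square root. Likewise p^3 terms of size p^2 make up the fifth power in the size.\<close>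

lemma net_approx:
  obtains c' \<nu> b where "0 < c'" "0 < \<nu>" "\<nu> < 1"
    "\<And>p. 1 \<le> p \<Longrightarrow> \<exists>R q. 2 ^ q \<le> 2 * (p + 3) \<and> NNs (L + 3 + q * (4 * p + 3)) (b * (p + 1) ^ 5) [R] \<and>
     sq_int \<Omega> (\<lambda>x. E 0 0 x - R x) \<le> ennreal ((c' * \<nu> ^ p)\<^sup>2) \<and>
     sq_int \<Omega> (\<lambda>x. E 1 0 x - dq (1, 0) R x) \<le> ennreal ((c' * \<nu> ^ p)\<^sup>2) \<and>
     sq_int \<Omega> (\<lambda>x. E 0 1 x - dq (0, 1) R x) \<le> ennreal ((c' * \<nu> ^ p)\<^sup>2)"
proof -
  obtain \<theta> \<mu> c where t: "0 < \<theta>" "\<theta> \<le> 1/3" and mu: "1/4 \<le> \<mu>" "\<mu> < 1" and c: "0 < c"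
    and pt: "\<And>p j x. 1 \<le> p \<Longrightarrow> j \<le> p \<Longrightarrow> x \<in> \<Omega> \<Longrightarrow> ring D p j x \<noteq> 0 \<Longrightarrow>
       patch p x (3 * (\<theta> / 2 ^ j)) (c * (real p + 3) ^ 3 * \<mu> ^ p) (c * (real p + 3) * 2 ^ p)"
    using patches by blast
  obtain N0 where N0: "\<And>p. finite (cells \<theta> p) \<and> card (cells \<theta> p) \<le> N0 * (p + 1)" using cells_card[OF t] by blast
  define K where "K = 2 * (50 * real N0 * c + real N0 * c * 16 * (7 + 1 / \<theta>) * (2 * Rb))"
  have K0: "0 \<le> K" unfolding K_def using c t bdd by auto
  obtain c1 where c1: "0 < c1" "\<And>p. (real p + 3) ^ 8 * \<mu> ^ p \<le> c1 * sqrt \<mu> ^ p"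
    using poly_geometric_bound[of \<mu> 8] mu by force
  define c' where "c' = K * c1 + 1"
  define b where "b = N0 * (6 * (s + 236) + 3)"
  show thesis
  proof (rule that)
    show "0 < c'" unfolding c'_def using K0 c1 by (simp add: add_nonneg_pos)
    show "0 < sqrt \<mu>" "sqrt \<mu> < 1" using mu by auto
    fix p :: nat assume p: "1 \<le> p"
    let ?e = "c * (real p + 3) ^ 3 * \<mu> ^ p" and ?B = "c * (real p + 3) * 2 ^ p" and ?n = "N0 * (p + 1)"
    let ?eta = "real (?n * (p + 1)\<^sup>2) * (?B * (16 * (real p + 3) ^ 4 * (7 + 1 / \<theta>) * (2 ^ p / 16 ^ p)))"
    let ?err = "2 * (50 * real ?n * ?e + ?eta * (2 * Rb))"
    have p3: "1 \<le> real p + 3" "0 \<le> real p + 3" by auto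
    have m0: "0 \<le> \<mu> ^ p" using mu by simp
    have e0: "0 \<le> ?e" and B0: "0 \<le> ?B" using c mu by auto
    obtain R q where R: "2 ^ q \<le> 2 * (p + 3)"
      "NNs (L + 3 + q * (4 * p + 3)) (?n * (p + 1)\<^sup>2 * (2 * (p + 3) * (s + 68 + 168 * p) + 3)) [R]"
      "sq_int \<Omega> (\<lambda>x. E 0 0 x - R x) \<le> ennreal (?err\<^sup>2)"
      "sq_int \<Omega> (\<lambda>x. E 1 0 x - dq (1, 0) R x) \<le> ennreal (?err\<^sup>2)"
      "sq_int \<Omega> (\<lambda>x. E 0 1 x - dq (0, 1) R x) \<le> ennreal (?err\<^sup>2)"
      using net_approx_step[OF t p e0 B0 pt[OF p] conjunct1[OF N0[of p]] conjunct2[OF N0[of p]]] by blast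
    \<comment> \<open>The 2^p of the coefficients times the 2^p / 16^p of the products is 4^-p, and
      \<mu> \<ge> 1/4 was arranged so that this is at most \<mu>^p.\<close>
    have "?eta \<le> real N0 * c * 16 * (7 + 1 / \<theta>) * ((real p + 3) ^ 8 * \<mu> ^ p)"
    proof -
      have 16: "(16::real) ^ p = 4 ^ p * 4 ^ p" "(2::real) ^ p * 2 ^ p = 4 ^ p" by (simp_all flip: power_mult_distrib)
      have "2 ^ p * (2 ^ p / 16 ^ p) = (2 ^ p * 2 ^ p) / (16::real) ^ p" by simp
      also have "\<dots> = (1/4) ^ p" unfolding 16 by (simp add: power_divide)
      finally have h: "2 ^ p * (2 ^ p / 16 ^ p) = (1/4::real) ^ p" .
      have "?eta = real N0 * c * 16 * (7 + 1 / \<theta>) * ((real p + 1) ^ 3 * (real p + 3) ^ 5 * (1/4) ^ p)"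
      proof -
        have "real (?n * (p + 1)\<^sup>2) = real N0 * (real p + 1) ^ 3" by (simp add: power2_eq_square power3_eq_cube algebra_simps)
        then have "?eta = real N0 * (real p + 1) ^ 3 * (c * (real p + 3) * (16 * (real p + 3) ^ 4 * (7 + 1 / \<theta>)) * (2 ^ p * (2 ^ p / 16 ^ p)))"
          by (simp only: mult_ac)
        also have "\<dots> = real N0 * c * 16 * (7 + 1 / \<theta>) * ((real p + 1) ^ 3 * ((real p + 3) * (real p + 3) ^ 4) * (1/4) ^ p)"
          unfolding h by (simp only: mult_ac)
        also have "(real p + 3) * (real p + 3) ^ 4 = (real p + 3) ^ 5" by (simp add: numeral_eq_Suc)
        finally show ?thesis .
      qed
      also have "\<dots> \<le> real N0 * c * 16 * (7 + 1 / \<theta>) * ((real p + 3) ^ 3 * (real p + 3) ^ 5 * \<mu> ^ p)"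
        using c t mu by (intro mult_left_mono mult_mono power_mono) auto
      finally show ?thesis by (simp flip: power_add)
    qed
    then have E1: "?eta * (2 * Rb) \<le> real N0 * c * 16 * (7 + 1 / \<theta>) * ((real p + 3) ^ 8 * \<mu> ^ p) * (2 * Rb)"
      using bdd by (intro mult_right_mono) auto
    have E2: "50 * real ?n * ?e \<le> 50 * real N0 * c * ((real p + 3) ^ 8 * \<mu> ^ p)"
    proof -
      have "(real p + 1) * (real p + 3) ^ 3 \<le> (real p + 3) ^ 5 * (real p + 3) ^ 3"
      proof (rule mult_right_mono)
        have "(real p + 3) ^ 1 \<le> (real p + 3) ^ 5" by (rule power_increasing) auto
        then show "real p + 1 \<le> (real p + 3) ^ 5" by simp
      qed simp
      then have "(real p + 1) * (real p + 3) ^ 3 * \<mu> ^ p \<le> (real p + 3) ^ 8 * \<mu> ^ p"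
        using m0 by (intro mult_right_mono) (auto simp flip: power_add)
      then have "50 * real N0 * c * ((real p + 1) * (real p + 3) ^ 3 * \<mu> ^ p) \<le> 50 * real N0 * c * ((real p + 3) ^ 8 * \<mu> ^ p)"
        using c by (intro mult_left_mono) auto
      moreover have "50 * real ?n * ?e = 50 * real N0 * c * ((real p + 1) * (real p + 3) ^ 3 * \<mu> ^ p)"
      proof -
        have "real ?n = real N0 * (real p + 1)" by (simp add: algebra_simps)
        then show ?thesis by (simp only: mult_ac)
      qed
      ultimately show ?thesis by (simp only:)
    qed
    have "?err \<le> K * ((real p + 3) ^ 8 * \<mu> ^ p)"
    proof -
      have ab: "2 * (Y + X) \<le> 2 * (b' + a' * v') * Z" if "X \<le> a' * Z * v'" "Y \<le> b' * Z" for X Y a' b' v' Z :: real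
        using that by (simp add: algebra_simps)
      show ?thesis unfolding K_def by (rule ab[OF E1 E2])
    qed
    also have "\<dots> \<le> K * (c1 * sqrt \<mu> ^ p)" by (intro mult_left_mono c1 K0)
    also have "\<dots> \<le> c' * sqrt \<mu> ^ p" unfolding c'_def using mu by (simp add: algebra_simps)
    finally have "?err \<le> c' * sqrt \<mu> ^ p" .
    moreover have "0 \<le> ?err" using c t mu bdd by auto
    ultimately have le: "ennreal (?err\<^sup>2) \<le> ennreal ((c' * sqrt \<mu> ^ p)\<^sup>2)" by (intro ennreal_leI power_mono) auto
    have sz: "?n * (p + 1)\<^sup>2 * (2 * (p + 3) * (s + 68 + 168 * p) + 3) \<le> b * (p + 1) ^ 5"
    proof -
      have "2 * (p + 3) * (s + 68 + 168 * p) \<le> 6 * (p + 1) * ((s + 236) * (p + 1))"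
      proof (rule mult_le_mono)
        show "s + 68 + 168 * p \<le> (s + 236) * (p + 1)" by (simp add: add_mult_distrib)
      qed simp
      also have "\<dots> = 6 * (s + 236) * (p + 1)\<^sup>2" by (simp only: power2_eq_square mult_ac)
      finally have "2 * (p + 3) * (s + 68 + 168 * p) + 3 \<le> 6 * (s + 236) * (p + 1)\<^sup>2 + 3 * (p + 1)\<^sup>2" by (simp add: add_mono)
      then have "2 * (p + 3) * (s + 68 + 168 * p) + 3 \<le> (6 * (s + 236) + 3) * (p + 1)\<^sup>2" by (simp add: add_mult_distrib)
      then have "?n * (p + 1)\<^sup>2 * (2 * (p + 3) * (s + 68 + 168 * p) + 3) \<le> ?n * (p + 1)\<^sup>2 * ((6 * (s + 236) + 3) * (p + 1)\<^sup>2)" by (rule mult_le_mono2)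
      also have "\<dots> = b * (p + 1) ^ 5" unfolding b_def by (simp only: numeral_eq_Suc power_Suc power_0 pred_numeral_simps BitM.simps mult_1_right) (simp only: mult_ac)
      finally show ?thesis .
    qed
    show "\<exists>R q. 2 ^ q \<le> 2 * (p + 3) \<and> NNs (L + 3 + q * (4 * p + 3)) (b * (p + 1) ^ 5) [R] \<and>
     sq_int \<Omega> (\<lambda>x. E 0 0 x - R x) \<le> ennreal ((c' * sqrt \<mu> ^ p)\<^sup>2) \<and>
     sq_int \<Omega> (\<lambda>x. E 1 0 x - dq (1, 0) R x) \<le> ennreal ((c' * sqrt \<mu> ^ p)\<^sup>2) \<and>
     sq_int \<Omega> (\<lambda>x. E 0 1 x - dq (0, 1) R x) \<le> ennreal ((c' * sqrt \<mu> ^ p)\<^sup>2)"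
      by (rule exI[of _ R], rule exI[of _ q])
         (intro conjI R(1) NNs_mono[OF R(2) sz] order_trans[OF R(3) le] order_trans[OF R(4) le] order_trans[OF R(5) le])
  qed
qed

end

section \<open>From the weighted class to networks\<close>

text \<open>Local integrability yields measurability on compact subsets only; an exhaustion of the
  open set by compact sets passes it on as a pointwise limit.\<close>

lemma loc_integrable_measurable:
  assumes "open \<Omega>" "loc_integrable \<Omega> g"
  shows "(\<lambda>x. indicat_real \<Omega> x * g x) \<in> borel_measurable borel"
proof -
  obtain K where K: "\<And>n. compact (K n)" "\<And>n. K n \<subseteq> \<Omega>" "\<And>n. K n \<subseteq> interior (K (Suc n))" "\<Union>(range K) = \<Omega>"
    using open_Union_compact_subsets[OF assms(1)] by metis
  have m: "K i \<subseteq> K j" if "i \<le> j" for i j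
    using lift_Suc_mono_le[of K i j] K(3) interior_subset that by (meson order_trans)
  show ?thesis
  proof (rule borel_measurable_LIMSEQ_real)
    fix n
    have "set_integrable lborel (K n) g" using assms(2) K(1,2) unfolding loc_integrable_def by blast
    then have "(\<lambda>x. indicat_real (K n) x *\<^sub>R g x) \<in> borel_measurable lborel"
      unfolding set_integrable_def by (rule borel_measurable_integrable)
    then show "(\<lambda>x. indicat_real (K n) x * g x) \<in> borel_measurable borel" by simp
  next
    fix x :: "real \<times> real"
    show "(\<lambda>n. indicat_real (K n) x * g x) \<longlonglongrightarrow> indicat_real \<Omega> x * g x"
    proof (cases "x \<in> \<Omega>")
      case True
      then obtain N where "x \<in> K N" using K(4) by blast
      then have "\<forall>n\<ge>N. indicat_real (K n) x * g x = indicat_real \<Omega> x * g x" using m True by (auto simp: indicator_def)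
      then show ?thesis by (intro tendsto_eventually) (auto simp: eventually_sequentially)
    next
      case False
      then have "x \<notin> K n" for n using K(2) by blast
      then show ?thesis using False by simp
    qed
  qed
qed

text \<open>\<open>L2norm\<close> is a Bochner integral and would be 0 for a function without
  integrable square. \<open>L2_on\<close> is what makes it the true norm and lets it be exchanged
  for an extended integral.\<close>

lemma nn_integral_L2norm:
  assumes "L2_on X f"
  shows "(\<integral>\<^sup>+x. ennreal (indicat_real X x * (f x)\<^sup>2) \<partial>lborel) = ennreal ((L2norm X f)\<^sup>2)"
    "(\<lambda>x. indicat_real X x * (f x)\<^sup>2) \<in> borel_measurable borel"
proof -
  have i: "integrable lborel (\<lambda>x. indicat_real X x * (f x)\<^sup>2)" using assms unfolding L2_on_def set_integrable_def by simp
  have "0 \<le> (LINT x|lborel. indicat_real X x * (f x)\<^sup>2)" by (intro integral_nonneg_AE always_eventually) auto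
  then have "(L2norm X f)\<^sup>2 = (LINT x|lborel. indicat_real X x * (f x)\<^sup>2)"
    unfolding L2norm_def set_lebesgue_integral_def by simp
  then show "(\<integral>\<^sup>+x. ennreal (indicat_real X x * (f x)\<^sup>2) \<partial>lborel) = ennreal ((L2norm X f)\<^sup>2)"
    using nn_integral_eq_integral[OF i] by simp
  show "(\<lambda>x. indicat_real X x * (f x)\<^sup>2) \<in> borel_measurable borel"
    using borel_measurable_integrable[OF i] by simp
qed

lemma L2norm_nonneg: "0 \<le> L2norm X f"
  unfolding L2norm_def set_lebesgue_integral_def by (intro real_sqrt_ge_zero integral_nonneg_AE always_eventually) auto

lemma nn_integral_sum_L2norm:
  fixes k :: nat and g :: "nat \<Rightarrow> real \<times> real \<Rightarrow> real"
  assumes "\<And>a. a \<le> k \<Longrightarrow> L2_on X (g a)" "(\<Sum>a\<le>k. L2norm X (g a)) \<le> B"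
  shows "(\<integral>\<^sup>+x. ennreal (indicat_real X x * (\<Sum>a\<le>k. (g a x)\<^sup>2)) \<partial>lborel) \<le> ennreal (B\<^sup>2)"
    "(\<lambda>x. indicat_real X x * (\<Sum>a\<le>k. (g a x)\<^sup>2)) \<in> borel_measurable borel"
proof -
  have m: "(\<lambda>x. indicat_real X x * (g a x)\<^sup>2) \<in> borel_measurable borel" if "a \<le> k" for a
    by (rule nn_integral_L2norm(2)[OF assms(1)[OF that]])
  then show "(\<lambda>x. indicat_real X x * (\<Sum>a\<le>k. (g a x)\<^sup>2)) \<in> borel_measurable borel"
    unfolding sum_distrib_left by (intro borel_measurable_sum) auto
  have "(\<integral>\<^sup>+x. ennreal (indicat_real X x * (\<Sum>a\<le>k. (g a x)\<^sup>2)) \<partial>lborel)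
      = (\<integral>\<^sup>+x. (\<Sum>a\<le>k. ennreal (indicat_real X x * (g a x)\<^sup>2)) \<partial>lborel)"
    unfolding sum_distrib_left by (intro nn_integral_cong sum_ennreal[symmetric]) auto
  also have "\<dots> = (\<Sum>a\<le>k. \<integral>\<^sup>+x. ennreal (indicat_real X x * (g a x)\<^sup>2) \<partial>lborel)"
    by (rule nn_integral_sum) (use m in simp)
  also have "\<dots> = (\<Sum>a\<le>k. ennreal ((L2norm X (g a))\<^sup>2))" using nn_integral_L2norm(1)[OF assms(1)] by simp
  also have "\<dots> = ennreal (\<Sum>a\<le>k. (L2norm X (g a))\<^sup>2)" by (rule sum_ennreal) simp
  also have "\<dots> \<le> ennreal (B\<^sup>2)"
  proof (rule ennreal_leI)
    have s: "(\<Sum>a\<in>F. (L2norm X (g a))\<^sup>2) \<le> (\<Sum>a\<in>F. L2norm X (g a))\<^sup>2" if "finite F" for F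
      using that
    proof (induction F)
      case (insert a F)
      have "0 \<le> (\<Sum>a\<in>F. L2norm X (g a))" by (intro sum_nonneg L2norm_nonneg)
      then have "0 \<le> 2 * L2norm X (g a) * (\<Sum>a\<in>F. L2norm X (g a))" using L2norm_nonneg[of X "g a"] by simp
      then show ?case using insert by (simp add: power2_sum)
    qed simp
    have "0 \<le> (\<Sum>a\<le>k. L2norm X (g a))" by (intro sum_nonneg L2norm_nonneg)
    then have b: "(\<Sum>a\<le>k. L2norm X (g a))\<^sup>2 \<le> B\<^sup>2" using assms(2) by (intro power_mono)
    show "(\<Sum>a\<le>k. (L2norm X (g a))\<^sup>2) \<le> B\<^sup>2" by (rule order_trans[OF s[OF finite_atMost] b])
  qed
  finally show "(\<integral>\<^sup>+x. ennreal (indicat_real X x * (\<Sum>a\<le>k. (g a x)\<^sup>2)) \<partial>lborel) \<le> ennreal (B\<^sup>2)" .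
qed

text \<open>The way back from extended integrals to \<open>L2_on\<close> and \<open>L2norm\<close>;
  F is a Borel function that agrees with f on \<Omega>, where f alone need not be measurable on the
  plane.\<close>

lemma L2_on_nn_integral:
  assumes F: "F \<in> borel_measurable borel" "\<forall>x\<in>\<Omega>. F x = f x" and O: "\<Omega> \<in> sets borel"
    and b: "sq_int \<Omega> F \<le> ennreal (B\<^sup>2)"
  shows "L2_on \<Omega> f" "(L2norm \<Omega> f)\<^sup>2 \<le> B\<^sup>2"
proof -
  note [measurable] = F(1) O
  have e1: "(\<lambda>x. indicat_real \<Omega> x *\<^sub>R f x) = (\<lambda>x. indicat_real \<Omega> x * F x)" using F(2) by (auto simp: fun_eq_iff indicator_def)
  have e2: "(\<lambda>x. indicat_real \<Omega> x *\<^sub>R (f x)\<^sup>2) = (\<lambda>x. indicat_real \<Omega> x * (F x)\<^sup>2)" using F(2) by (auto simp: fun_eq_iff indicator_def)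
  have n: "(\<integral>\<^sup>+x. ennreal (indicat_real \<Omega> x * (F x)\<^sup>2) \<partial>lborel) \<le> ennreal (B\<^sup>2)"
  proof (rule order_trans[OF eq_refl b], rule nn_integral_cong)
    show "ennreal (indicat_real \<Omega> x * (F x)\<^sup>2) = ennreal ((F x)\<^sup>2) * indicator \<Omega> x" for x
      by (simp add: indicator_def)
  qed
  have i: "integrable lborel (\<lambda>x. indicat_real \<Omega> x * (F x)\<^sup>2)"
  proof (rule integrableI_bounded)
    have "(\<integral>\<^sup>+x. ennreal (norm (indicat_real \<Omega> x * (F x)\<^sup>2)) \<partial>lborel) = (\<integral>\<^sup>+x. ennreal (indicat_real \<Omega> x * (F x)\<^sup>2) \<partial>lborel)"
      by (intro nn_integral_cong) (simp add: abs_mult)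
    also have "\<dots> < \<infinity>" using n by (rule order.strict_trans1) simp
    finally show "(\<integral>\<^sup>+x. ennreal (norm (indicat_real \<Omega> x * (F x)\<^sup>2)) \<partial>lborel) < \<infinity>" .
  qed simp
  show l: "L2_on \<Omega> f" unfolding L2_on_def set_borel_measurable_def set_integrable_def e1 e2 using i by simp
  have "ennreal ((L2norm \<Omega> f)\<^sup>2) = (\<integral>\<^sup>+x. ennreal (indicat_real \<Omega> x * (f x)\<^sup>2) \<partial>lborel)"
    by (rule nn_integral_L2norm(1)[OF l, symmetric])
  also have "\<dots> = (\<integral>\<^sup>+x. ennreal (indicat_real \<Omega> x * (F x)\<^sup>2) \<partial>lborel)" 
    by (rule arg_cong[where f = "\<lambda>h. \<integral>\<^sup>+x. ennreal (h x) \<partial>lborel", OF e2[unfolded real_scaleR_def]])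
  finally have "ennreal ((L2norm \<Omega> f)\<^sup>2) \<le> ennreal (B\<^sup>2)" using n by (simp only:)
  then show "(L2norm \<Omega> f)\<^sup>2 \<le> B\<^sup>2" by (subst (asm) ennreal_le_iff) simp_all
qed

text \<open>Order 0 takes u itself in place of \<open>D 0 0\<close>, which is tied to u only through
  integrals against test functions. The final estimate is then about u, and no uniqueness of weak
  derivatives has to be proved.\<close>

lemma weak_deriv_family:
  assumes op: "open \<Omega>" and D: "\<And>a b. weak_deriv \<Omega> u a b (D a b)"
  defines "E \<equiv> \<lambda>a b x. indicat_real \<Omega> x * (if a = 0 \<and> b = 0 then u x else D a b x)"
  shows "weak_family \<Omega> E"
proof
  have lu: "loc_integrable \<Omega> u" and lD: "loc_integrable \<Omega> (D a b)" for a b using D unfolding weak_deriv_def by blast+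
  have "loc_integrable \<Omega> (\<lambda>x. if P then u x else D a b x)" for P a b by (cases P) (simp_all add: lu lD)
  then have l: "loc_integrable \<Omega> (\<lambda>x. if a = 0 \<and> b = 0 then u x else D a b x)" for a b .
  show "open \<Omega>" by (rule op)
  show "E a b \<in> borel_measurable borel" for a b unfolding E_def by (rule loc_integrable_measurable[OF op l])
  show "integrable lborel (\<lambda>x. indicat_real K x * E a b x)" if "compact K" "K \<subseteq> \<Omega>" for a b K
  proof -
    have "set_integrable lborel K (\<lambda>x. if a = 0 \<and> b = 0 then u x else D a b x)" using l that unfolding loc_integrable_def by blast
    moreover have "(\<lambda>x. indicat_real K x * E a b x) = (\<lambda>x. indicat_real K x *\<^sub>R (if a = 0 \<and> b = 0 then u x else D a b x))"
      using that(2) by (auto simp: E_def fun_eq_iff indicator_def)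
    ultimately show ?thesis unfolding set_integrable_def by simp
  qed
  show "(\<integral>x. E 0 0 x * pd a b \<phi> x \<partial>lborel) = (-1) ^ (a + b) * (\<integral>x. E a b x * \<phi> x \<partial>lborel)" if "test_fun \<Omega> \<phi>" for a b \<phi>
  proof (cases "a = 0 \<and> b = 0")
    case False
    have e: "E a b = (\<lambda>x. indicat_real \<Omega> x * D a b x)" "E 0 0 = (\<lambda>x. indicat_real \<Omega> x * u x)"
      unfolding E_def if_not_P[OF False] by simp_all
    show ?thesis using D[of a b] that unfolding weak_deriv_def set_lebesgue_integral_def e by (simp add: mult.assoc)
  qed simp
qed

lemma AE_sphere: "AE x in lborel. dist x (c::real\<times>real) \<noteq> r"
proof -
  have s: "sphere c r \<in> sets borel" by simp
  have "emeasure lebesgue (sphere c r) = 0" using negligible_iff_emeasure0[of "sphere c r"] negligible_sphere[of c r] s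
    by (metis sets_completionI_sets sets_lborel)
  then have "sphere c r \<in> null_sets lborel" using s by (simp add: null_sets_def)
  then show ?thesis by (rule AE_I') (auto simp: dist_commute)
qed

text \<open>Removing the closure of the corner neighbourhoods from \<Omega> loses, besides these
  neighbourhoods, only points at distance exactly r from some corner. They form a null set, so the
  bounds on the pieces may be added.\<close>

lemma weighted_cover:
  fixes F :: "real \<times> real \<Rightarrow> real"
  assumes op: "open \<Omega>" and fin: "finite Cs" and F0: "\<And>x. 0 \<le> F x"
    and O0: "(\<integral>\<^sup>+x. ennreal (indicat_real (Omega_0 \<Omega> Cs r) x * F0 x) \<partial>lborel) \<le> ennreal B"
      "(\<lambda>x. indicat_real (Omega_0 \<Omega> Cs r) x * F0 x) \<in> borel_measurable borel" "\<And>x. F x \<le> F0 x"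
    and Oc: "\<And>c. c \<in> Cs \<Longrightarrow> (\<integral>\<^sup>+x. ennreal (indicat_real (Omega_c \<Omega> r c) x * Fc c x) \<partial>lborel) \<le> ennreal B"
      "\<And>c. c \<in> Cs \<Longrightarrow> (\<lambda>x. indicat_real (Omega_c \<Omega> r c) x * Fc c x) \<in> borel_measurable borel"
      "\<And>c x. c \<in> Cs \<Longrightarrow> F x \<le> Fc c x"
    and B: "0 \<le> B"
  shows "(\<integral>\<^sup>+x\<in>\<Omega>. ennreal (F x) \<partial>lborel) \<le> ennreal ((1 + real (card Cs)) * B)"
proof -
  let ?g = "\<lambda>x. ennreal (indicat_real (Omega_0 \<Omega> Cs r) x * F0 x)" and ?h = "\<lambda>c x. ennreal (indicat_real (Omega_c \<Omega> r c) x * Fc c x)"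
  have "AE x in lborel. \<forall>c\<in>Cs. dist x c \<noteq> r"
    using fin by (subst AE_ball_countable) (auto intro: countable_finite AE_sphere)
  then have "(\<integral>\<^sup>+x\<in>\<Omega>. ennreal (F x) \<partial>lborel) \<le> (\<integral>\<^sup>+x. ?g x + (\<Sum>c\<in>Cs. ?h c x) \<partial>lborel)"
  proof (rule nn_integral_mono_AE[OF AE_mp], intro AE_I2 impI)
    fix x assume x: "\<forall>c\<in>Cs. dist x c \<noteq> r"
    consider "x \<notin> \<Omega>" | "x \<in> Omega_0 \<Omega> Cs r" | "x \<in> \<Omega>" "x \<notin> Omega_0 \<Omega> Cs r" by blast
    then show "ennreal (F x) * indicator \<Omega> x \<le> ?g x + (\<Sum>c\<in>Cs. ?h c x)"
    proof cases
      case 1 then show ?thesis by simp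
    next
      case 2
      have "ennreal (F x) \<le> ennreal (F0 x)" by (rule ennreal_leI[OF O0(3)])
      then have "ennreal (F x) * indicator \<Omega> x \<le> ?g x" using 2 by (simp add: Omega_0_def)
      then show ?thesis by (rule order_trans) (simp add: add_increasing2)
    next
      case 3
      have "closure (\<Union>c\<in>Cs. Omega_c \<Omega> r c) \<subseteq> (\<Union>c\<in>Cs. cball c r)"
        using fin by (intro closure_minimal closed_UN) (auto simp: Omega_c_def dist_commute intro: less_imp_le)
      moreover have "x \<in> closure (\<Union>c\<in>Cs. Omega_c \<Omega> r c)" using 3 unfolding Omega_0_def by blast
      ultimately obtain c where c: "c \<in> Cs" "dist x c \<le> r" by (auto simp: dist_commute)
      then have "x \<in> Omega_c \<Omega> r c" using x 3 unfolding Omega_c_def by (simp add: order.strict_iff_order)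
      moreover have "ennreal (F x) \<le> ennreal (Fc c x)" by (rule ennreal_leI[OF Oc(3)[OF c(1)]])
      ultimately have "ennreal (F x) * indicator \<Omega> x \<le> ?h c x" using 3 by simp
      also have "\<dots> \<le> (\<Sum>c\<in>Cs. ?h c x)" using fin c by (intro member_le_sum) auto
      finally show ?thesis by (rule order_trans) (simp add: add_increasing)
    qed
  qed
  also have "\<dots> = (\<integral>\<^sup>+x. ?g x \<partial>lborel) + (\<Sum>c\<in>Cs. \<integral>\<^sup>+x. ?h c x \<partial>lborel)"
    using O0(2) Oc(2) by (subst nn_integral_add) (auto simp: nn_integral_sum)
  also have "\<dots> \<le> ennreal B + (\<Sum>c\<in>Cs. ennreal B)" by (intro add_mono sum_mono O0(1) Oc(1))
  also have "\<dots> = ennreal ((1 + real (card Cs)) * B)"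
    using B by (simp add: ennreal_of_nat_eq_real_of_nat distrib_right ennreal_mult ennreal_plus)
  finally show ?thesis .
qed

section \<open>Choice of the degree and asymptotics as \<epsilon> tends to 0\<close>

lemma degree_choice:
  assumes "0 < c" "0 < \<nu>" "\<nu> < (1::real)"
  obtains pf K where "0 \<le> K" "\<And>\<epsilon>. 0 < \<epsilon> \<Longrightarrow> 1 \<le> pf \<epsilon> \<and> c * \<nu> ^ pf \<epsilon> \<le> \<epsilon>"
    "\<And>\<epsilon>. 0 < \<epsilon> \<Longrightarrow> ln \<epsilon> \<le> - 1 \<Longrightarrow> real (pf \<epsilon>) \<le> K * \<bar>ln \<epsilon>\<bar>"
proof
  define l where "l = - ln \<nu>"
  have l: "0 < l" unfolding l_def using assms by simp
  \<comment> \<open>Solves c \<nu>^p \<le> \<epsilon> for p; the modulus and the summand 1 keep the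
    degree positive for every \<epsilon>.\<close>
  define pf where "pf \<epsilon> = nat \<lceil>\<bar>ln c - ln \<epsilon>\<bar> / l\<rceil> + 1" for \<epsilon>
  show "0 \<le> (\<bar>ln c\<bar> + 1) / l + 2" using l by simp
  fix \<epsilon> :: real assume e: "0 < \<epsilon>"
  have t0: "0 \<le> \<lceil>\<bar>ln c - ln \<epsilon>\<bar> / l\<rceil>"
  proof -
    have "0 \<le> \<bar>ln c - ln \<epsilon>\<bar> / l" using l by simp
    then show ?thesis by linarith
  qed
  have pf: "real (pf \<epsilon>) = of_int \<lceil>\<bar>ln c - ln \<epsilon>\<bar> / l\<rceil> + 1" unfolding pf_def using t0 by simp
  have lo: "\<bar>ln c - ln \<epsilon>\<bar> / l \<le> real (pf \<epsilon>)" and up: "real (pf \<epsilon>) \<le> \<bar>ln c - ln \<epsilon>\<bar> / l + 2" unfolding pf by linarith+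
  have "\<bar>ln c - ln \<epsilon>\<bar> \<le> real (pf \<epsilon>) * l" using lo l by (simp add: pos_divide_le_eq)
  then have "ln c + real (pf \<epsilon>) * ln \<nu> \<le> ln \<epsilon>" unfolding l_def by (simp add: abs_le_iff)
  then have "ln (c * \<nu> ^ pf \<epsilon>) \<le> ln \<epsilon>" using assms by (simp add: ln_mult ln_realpow)
  then have "c * \<nu> ^ pf \<epsilon> \<le> \<epsilon>" using assms e by simp
  then show "1 \<le> pf \<epsilon> \<and> c * \<nu> ^ pf \<epsilon> \<le> \<epsilon>" unfolding pf_def by simp
  assume s: "ln \<epsilon> \<le> - 1"
  have "\<bar>ln c - ln \<epsilon>\<bar> \<le> \<bar>ln c\<bar> * \<bar>ln \<epsilon>\<bar> + \<bar>ln \<epsilon>\<bar>"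
  proof -
    have "\<bar>ln c\<bar> * 1 \<le> \<bar>ln c\<bar> * \<bar>ln \<epsilon>\<bar>" using s by (intro mult_left_mono) auto
    then show ?thesis by linarith
  qed
  then have "\<bar>ln c - ln \<epsilon>\<bar> / l \<le> (\<bar>ln c\<bar> + 1) * \<bar>ln \<epsilon>\<bar> / l" using l by (intro divide_right_mono) (auto simp: algebra_simps)
  then show "real (pf \<epsilon>) \<le> ((\<bar>ln c\<bar> + 1) / l + 2) * \<bar>ln \<epsilon>\<bar>" using up s by (simp add: algebra_simps)
qed

lemma eventually_ln_le: "\<forall>\<^sub>F \<epsilon> in at_right (0::real). 0 < \<epsilon> \<and> ln \<epsilon> \<le> - B \<and> \<epsilon> < 1"
proof (rule eventually_at_rightI[of 0 "min 1 (exp (- B))"])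
  fix \<epsilon> :: real assume "\<epsilon> \<in> {0<..<min 1 (exp (- B))}"
  then have e: "0 < \<epsilon>" "\<epsilon> < 1" "\<epsilon> < exp (- B)" by auto
  then have "ln \<epsilon> < ln (exp (- B))" by (subst ln_less_cancel_iff) auto
  then show "0 < \<epsilon> \<and> ln \<epsilon> \<le> - B \<and> \<epsilon> < 1" using e by simp
qed simp

lemma size_asymptotics:
  assumes "0 \<le> K" "\<And>\<epsilon>. 0 < \<epsilon> \<Longrightarrow> ln \<epsilon> \<le> - 1 \<Longrightarrow> real (pf \<epsilon>) \<le> K * \<bar>ln \<epsilon>\<bar>"
    and "\<And>\<epsilon>. 0 < \<epsilon> \<Longrightarrow> \<epsilon> < 1 \<Longrightarrow> N \<epsilon> \<le> b * (pf \<epsilon> + 1) ^ 5"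
  shows "(\<lambda>\<epsilon>. real (N \<epsilon>)) \<in> O[at_right 0](\<lambda>\<epsilon>. \<bar>ln \<epsilon>\<bar> ^ 5)"
proof (rule bigoI[of _ "real b * (K + 1) ^ 5"])
  show "\<forall>\<^sub>F \<epsilon> in at_right 0. norm (real (N \<epsilon>)) \<le> real b * (K + 1) ^ 5 * norm (\<bar>ln \<epsilon>\<bar> ^ 5)"
    using eventually_ln_le[of 1]
  proof (rule eventually_mono)
    fix \<epsilon> :: real assume e: "0 < \<epsilon> \<and> ln \<epsilon> \<le> - 1 \<and> \<epsilon> < 1"
    have "real (N \<epsilon>) \<le> real (b * (pf \<epsilon> + 1) ^ 5)" using assms(3) e by (simp only: of_nat_le_iff)
    also have "\<dots> = real b * (real (pf \<epsilon>) + 1) ^ 5" by (simp add: add.commute)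
    also have "\<dots> \<le> real b * ((K + 1) * \<bar>ln \<epsilon>\<bar>) ^ 5"
      using assms(2)[of \<epsilon>] e by (intro mult_left_mono power_mono) (auto simp: distrib_right)
    finally show "norm (real (N \<epsilon>)) \<le> real b * (K + 1) ^ 5 * norm (\<bar>ln \<epsilon>\<bar> ^ 5)" by (simp add: power_mult_distrib power_abs)
  qed
qed

text \<open>For \<open>ln \<epsilon> \<le> - exp 1\<close> the iterated logarithm is at least 1, so
  additive constants are absorbed by the product. Since 2^q is at most linear in the degree, q is at
  most a multiple of ln |ln \<epsilon>|.\<close>

lemma depth_asymptotics:
  assumes "0 \<le> K" "\<And>\<epsilon>. 0 < \<epsilon> \<Longrightarrow> ln \<epsilon> \<le> - 1 \<Longrightarrow> real (pf \<epsilon>) \<le> K * \<bar>ln \<epsilon>\<bar>"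
    and "\<And>\<epsilon>. 0 < \<epsilon> \<Longrightarrow> \<epsilon> < 1 \<Longrightarrow> \<exists>q. 2 ^ q \<le> 2 * (pf \<epsilon> + 3) \<and> N \<epsilon> = l + q * (4 * pf \<epsilon> + 3)"
  shows "(\<lambda>\<epsilon>. real (N \<epsilon>)) \<in> O[at_right 0](\<lambda>\<epsilon>. \<bar>ln \<epsilon>\<bar> * ln \<bar>ln \<epsilon>\<bar>)"
proof (rule bigoI)
  define K2 where "K2 = (ln 2 + ln (K + 3) + 1) / ln 2"
  have K2: "0 \<le> K2" unfolding K2_def using assms(1) by (intro divide_nonneg_nonneg add_nonneg_nonneg) auto
  show "\<forall>\<^sub>F \<epsilon> in at_right 0. norm (real (N \<epsilon>)) \<le> (real l + K2 * (4 * K + 3)) * norm (\<bar>ln \<epsilon>\<bar> * ln \<bar>ln \<epsilon>\<bar>)"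
    using eventually_ln_le[of "exp 1"]
  proof (rule eventually_mono)
    fix \<epsilon> :: real assume e: "0 < \<epsilon> \<and> ln \<epsilon> \<le> - exp 1 \<and> \<epsilon> < 1"
    define y where "y = \<bar>ln \<epsilon>\<bar>"
    have e1: "1 \<le> exp (1::real)" by simp
    have y: "exp 1 \<le> y" "1 \<le> y" unfolding y_def using e e1 by linarith+
    have ly: "1 \<le> ln y" using y ln_mono[of "exp 1" y] by simp
    have p: "real (pf \<epsilon>) \<le> K * y" unfolding y_def using assms(2)[of \<epsilon>] e e1 by linarith
    obtain q where q: "2 ^ q \<le> 2 * (pf \<epsilon> + 3)" "N \<epsilon> = l + q * (4 * pf \<epsilon> + 3)" using assms(3) e by blast
    have "real (2 ^ q) \<le> real (2 * (pf \<epsilon> + 3))" using q(1) by (simp only: of_nat_le_iff)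
    then have "2 ^ q \<le> 2 * ((K + 3) * y)" using p y by (simp add: distrib_right)
    then have "ln (2 ^ q) \<le> ln (2 * ((K + 3) * y))" by (rule ln_mono) simp
    then have "real q * ln 2 \<le> ln 2 + ln (K + 3) + ln y" using assms(1) y by (simp add: ln_realpow ln_mult)
    also have "\<dots> \<le> (ln 2 + ln (K + 3)) * ln y + ln y"
      using ly assms(1) mult_left_mono[OF ly, of "ln 2 + ln (K + 3)"] by simp
    finally have "real q \<le> K2 * ln y" unfolding K2_def by (simp add: pos_le_divide_eq algebra_simps)
    moreover have "real (4 * pf \<epsilon> + 3) \<le> (4 * K + 3) * y" using p y by (simp add: distrib_right)
    ultimately have "real q * real (4 * pf \<epsilon> + 3) \<le> (K2 * ln y) * ((4 * K + 3) * y)"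
      using K2 ly by (intro mult_mono) auto
    moreover have "real l * (1 * 1) \<le> real l * (y * ln y)" using y ly by (intro mult_left_mono mult_mono) auto
    moreover have "real (N \<epsilon>) = real l + real q * real (4 * pf \<epsilon> + 3)" unfolding q(2) by simp
    ultimately have "real (N \<epsilon>) \<le> (real l + K2 * (4 * K + 3)) * (y * ln y)" by (simp add: algebra_simps)
    then show "norm (real (N \<epsilon>)) \<le> (real l + K2 * (4 * K + 3)) * norm (\<bar>ln \<epsilon>\<bar> * ln \<bar>ln \<epsilon>\<bar>)"
      unfolding y_def[symmetric] using y ly by (simp add: abs_mult)
  qed
qed

text \<open>As \<delta> \<le> 1, replacing the exponent \<gamma> c by the smaller g, and the
  distance by the smaller \<delta>, only decreases the weight. For order 0 the family uses u itself,
  so that bound is the norm of u, which is why this norm is added to the constant.\<close>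

lemma J_class_weighted:
  assumes op: "open \<Omega>" and fin: "finite Cs" and CA: "0 < C0" "0 < A" and g: "\<And>c. c \<in> Cs \<Longrightarrow> g \<le> \<gamma> c"
    and dl: "\<And>x. 0 \<le> \<delta> x \<and> \<delta> x \<le> 1" "\<And>c x. c \<in> Cs \<Longrightarrow> \<delta> x \<le> dist x c" and u: "L2_on \<Omega> u" and g1: "1 < g"
    and J: "\<forall>k::nat. (\<forall>a\<le>k. L2_on (Omega_0 \<Omega> Cs r) (D a (k - a))) \<and>
            (\<Sum>a\<le>k. L2norm (Omega_0 \<Omega> Cs r) (D a (k - a))) \<le> C0 * A ^ k * fact k \<and>
            (\<forall>c\<in>Cs.
               (\<forall>a\<le>k. L2_on (Omega_c \<Omega> r c)
                   (\<lambda>x. dist x c powr (max 0 (real k - \<gamma> c)) * D a (k - a) x)) \<and>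
               (\<Sum>a\<le>k. L2norm (Omega_c \<Omega> r c)
                   (\<lambda>x. dist x c powr (max 0 (real k - \<gamma> c)) * D a (k - a) x))
                 \<le> C0 * A ^ k * fact k)"
  defines "E \<equiv> \<lambda>a b x. indicat_real \<Omega> x * (if a = 0 \<and> b = 0 then u x else D a b x)"
  shows "\<exists>C>0. \<forall>k. (\<integral>\<^sup>+x\<in>\<Omega>. ennreal (\<delta> x powr (2 * max 0 (real k - g)) * sqsum E k x) \<partial>lborel)
     \<le> ennreal ((C * A ^ k * fact k)\<^sup>2)"
proof (intro exI conjI allI)
  define C where "C = (1 + real (card Cs)) * C0 + L2norm \<Omega> u"
  have u0: "0 \<le> L2norm \<Omega> u" by (rule L2norm_nonneg)
  have c1: "0 < (1 + real (card Cs)) * C0" using CA by simp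
  show C: "0 < C" unfolding C_def using u0 c1 by linarith
  fix k :: nat
  show "(\<integral>\<^sup>+x\<in>\<Omega>. ennreal (\<delta> x powr (2 * max 0 (real k - g)) * sqsum E k x) \<partial>lborel) \<le> ennreal ((C * A ^ k * fact k)\<^sup>2)"
  proof (cases "k = 0")
    case True
    have "(\<integral>\<^sup>+x\<in>\<Omega>. ennreal (\<delta> x powr (2 * max 0 (real k - g)) * sqsum E k x) \<partial>lborel)
       \<le> (\<integral>\<^sup>+x. ennreal (indicat_real \<Omega> x * (u x)\<^sup>2) \<partial>lborel)"
    proof (rule nn_integral_mono)
      fix x
      show "ennreal (\<delta> x powr (2 * max 0 (real k - g)) * sqsum E k x) * indicator \<Omega> x \<le> ennreal (indicat_real \<Omega> x * (u x)\<^sup>2)"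
        using True g1 by (cases "x \<in> \<Omega>") (auto simp: sqsum_def E_def)
    qed
    also have "\<dots> = ennreal ((L2norm \<Omega> u)\<^sup>2)" by (rule nn_integral_L2norm(1)[OF u])
    also have "\<dots> \<le> ennreal ((C * A ^ k * fact k)\<^sup>2)"
      using True u0 c1 unfolding C_def by (intro ennreal_leI power_mono) auto
    finally show ?thesis .
  next
    case False
    let ?m = "max 0 (real k - g)"
    let ?B = "(C0 * A ^ k * fact k)\<^sup>2"
    have "(\<integral>\<^sup>+x\<in>\<Omega>. ennreal (\<delta> x powr (2 * ?m) * sqsum E k x) \<partial>lborel)
       = (\<integral>\<^sup>+x\<in>\<Omega>. ennreal (\<delta> x powr (2 * ?m) * (\<Sum>a\<le>k. (D a (k - a) x)\<^sup>2)) \<partial>lborel)"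
    proof (rule nn_integral_cong)
      fix x
      have "sqsum E k x = (\<Sum>a\<le>k. (D a (k - a) x)\<^sup>2)" if "x \<in> \<Omega>"
        unfolding sqsum_def E_def using that False by (intro sum.cong) auto
      then show "ennreal (\<delta> x powr (2 * ?m) * sqsum E k x) * indicator \<Omega> x
        = ennreal (\<delta> x powr (2 * ?m) * (\<Sum>a\<le>k. (D a (k - a) x)\<^sup>2)) * indicator \<Omega> x" by (cases "x \<in> \<Omega>") auto
    qed
    also have "\<dots> \<le> ennreal ((1 + real (card Cs)) * ?B)"
    proof (rule weighted_cover[where r = r and ?F0.0 = "\<lambda>x. \<Sum>a\<le>k. (D a (k - a) x)\<^sup>2"
          and Fc = "\<lambda>c x. \<Sum>a\<le>k. (dist x c powr (max 0 (real k - \<gamma> c)) * D a (k - a) x)\<^sup>2", OF op fin])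
      have s0: "0 \<le> (\<Sum>a\<le>k. (D a (k - a) x)\<^sup>2)" for x by (intro sum_nonneg) simp
      show "0 \<le> \<delta> x powr (2 * ?m) * (\<Sum>a\<le>k. (D a (k - a) x)\<^sup>2)" for x using s0 by simp
      show "(\<integral>\<^sup>+x. ennreal (indicat_real (Omega_0 \<Omega> Cs r) x * (\<Sum>a\<le>k. (D a (k - a) x)\<^sup>2)) \<partial>lborel) \<le> ennreal ?B"
        by (rule nn_integral_sum_L2norm(1)) (use J in blast)+
      show "(\<lambda>x. indicat_real (Omega_0 \<Omega> Cs r) x * (\<Sum>a\<le>k. (D a (k - a) x)\<^sup>2)) \<in> borel_measurable borel"
        by (rule nn_integral_sum_L2norm(2)[OF _ order_refl]) (use J in blast)
      show "\<delta> x powr (2 * ?m) * (\<Sum>a\<le>k. (D a (k - a) x)\<^sup>2) \<le> (\<Sum>a\<le>k. (D a (k - a) x)\<^sup>2)" for x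
      proof -
        have "\<delta> x powr (2 * ?m) \<le> 1" using dl(1)[of x] by (intro powr_le1) auto
        then show ?thesis using s0 by (intro mult_left_le_one_le) auto
      qed
      fix c assume c: "c \<in> Cs"
      show "(\<integral>\<^sup>+x. ennreal (indicat_real (Omega_c \<Omega> r c) x *
          (\<Sum>a\<le>k. (dist x c powr (max 0 (real k - \<gamma> c)) * D a (k - a) x)\<^sup>2)) \<partial>lborel) \<le> ennreal ?B"
        by (rule nn_integral_sum_L2norm(1)) (use J c in blast)+
      show "(\<lambda>x. indicat_real (Omega_c \<Omega> r c) x *
          (\<Sum>a\<le>k. (dist x c powr (max 0 (real k - \<gamma> c)) * D a (k - a) x)\<^sup>2)) \<in> borel_measurable borel"
        by (rule nn_integral_sum_L2norm(2)[OF _ order_refl]) (use J c in blast)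
      fix x
      let ?w = "dist x c powr (max 0 (real k - \<gamma> c))"
      have "\<delta> x powr ?m \<le> \<delta> x powr (max 0 (real k - \<gamma> c))"
        using dl(1)[of x] g[OF c] by (intro powr_mono') auto
      also have "\<dots> \<le> ?w" using dl(1)[of x] dl(2)[OF c] by (intro powr_mono2) auto
      finally have "(\<delta> x powr ?m)\<^sup>2 \<le> ?w\<^sup>2" by (intro power_mono) auto
      moreover have "\<delta> x powr (2 * ?m) = (\<delta> x powr ?m)\<^sup>2" by (simp only: mult_2 powr_add power2_eq_square)
      ultimately have "\<delta> x powr (2 * ?m) * (\<Sum>a\<le>k. (D a (k - a) x)\<^sup>2) \<le> ?w\<^sup>2 * (\<Sum>a\<le>k. (D a (k - a) x)\<^sup>2)"
        using s0 by (intro mult_right_mono) (simp_all only:)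
      then show "\<delta> x powr (2 * ?m) * (\<Sum>a\<le>k. (D a (k - a) x)\<^sup>2) \<le> (\<Sum>a\<le>k. (?w * D a (k - a) x)\<^sup>2)"
        by (simp only: power_mult_distrib sum_distrib_left)
    qed simp
    also have "\<dots> \<le> ennreal ((C * A ^ k * fact k)\<^sup>2)"
    proof (rule ennreal_leI)
      let ?n = "1 + real (card Cs)"
      have "?n * 1 \<le> ?n * ?n" by (intro mult_left_mono) auto
      then have "?n * ?B \<le> (?n * ?n) * ?B" by (intro mult_right_mono) auto
      also have "\<dots> = (?n * C0 * (A ^ k * fact k))\<^sup>2" by (simp only: power2_eq_square mult_ac)
      also have "\<dots> \<le> (C * (A ^ k * fact k))\<^sup>2"
        using c1 u0 CA unfolding C_def by (intro power_mono mult_right_mono) auto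
      finally show "?n * ?B \<le> (C * A ^ k * fact k)\<^sup>2" by (simp only: mult.assoc)
    qed
    finally show ?thesis .
  qed
qed

section \<open>Putting the pieces together on the polygon\<close>

lemma corner_weight:
  fixes Cs :: "(real \<times> real) set"
  assumes "finite Cs"
  obtains \<delta> where "\<And>x. 0 \<le> \<delta> x \<and> \<delta> x \<le> 1" "\<And>c x. c \<in> Cs \<Longrightarrow> \<delta> x \<le> dist x c"
    "\<And>x. \<delta> x = 1 \<or> (\<exists>c\<in>Cs. \<delta> x = dist x c)" "\<And>x y. \<delta> x \<le> \<delta> y + dist x y" "\<delta> \<in> borel_measurable borel"
proof
  define \<delta> where "\<delta> x = Min (insert 1 ((\<lambda>c. dist x c) ` Cs))" for x
  have fin: "finite (insert 1 ((\<lambda>c. dist x c) ` Cs))" for x using assms by simp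
  have le: "\<delta> x \<le> 1" "c \<in> Cs \<Longrightarrow> \<delta> x \<le> dist x c" for x c unfolding \<delta>_def by (intro Min_le fin; simp)+
  show in': "\<delta> x = 1 \<or> (\<exists>c\<in>Cs. \<delta> x = dist x c)" for x using Min_in[OF fin, of x] unfolding \<delta>_def by blast
  show "0 \<le> \<delta> x \<and> \<delta> x \<le> 1" for x using in'[of x] le(1)[of x] by auto
  show "c \<in> Cs \<Longrightarrow> \<delta> x \<le> dist x c" for c x by (rule le(2))
  show l: "\<delta> x \<le> \<delta> y + dist x y" for x y
    using in'[of y]
  proof
    assume "\<delta> y = 1" then show ?thesis using le(1)[of x] zero_le_dist[of x y] by linarith
  next
    assume "\<exists>c\<in>Cs. \<delta> y = dist y c"
    then obtain c where c: "c \<in> Cs" "\<delta> y = dist y c" by blast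
    then show ?thesis using le(2)[OF c(1), of x] dist_triangle[of x c y] by linarith
  qed
  have "1-lipschitz_on UNIV \<delta>"
  proof (rule lipschitz_onI)
    fix x y
    show "dist (\<delta> x) (\<delta> y) \<le> 1 * dist x y" using l[of x y] l[of y x] by (simp add: dist_real_def abs_le_iff dist_commute)
  qed simp
  then show "\<delta> \<in> borel_measurable borel" by (intro borel_measurable_continuous_onI lipschitz_on_continuous_on)
qed

lemma polygon_net_approx:
  assumes P: "polygon \<Omega>" and fin: "finite (corners \<Omega>)" and gm: "\<forall>c\<in>corners \<Omega>. \<gamma> c > 1"
    and u: "u \<in> J_class \<Omega> (corners \<Omega>) \<gamma> r"
  obtains c l b \<nu> where "0 < c" "0 < \<nu>" "\<nu> < 1"
    "\<And>p. 1 \<le> p \<Longrightarrow> \<exists>R q. 2 ^ q \<le> 2 * (p + 3) \<and> NNs (l + q * (4 * p + 3)) (b * (p + 1) ^ 5) [R] \<and>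
       H1norm_le \<Omega> (\<lambda>x. u x - R x) (c * \<nu> ^ p)"
proof -
  define Cs where "Cs = corners \<Omega>"
  have op: "open \<Omega>" and bd: "bounded \<Omega>" and ne: "\<Omega> \<noteq> {}" and lb: "lipschitz_boundary \<Omega>" using P unfolding polygon_def by auto
  have finCs: "finite Cs" using fin unfolding Cs_def .
  have Cout: "c \<notin> \<Omega>" if "c \<in> Cs" for c using that op unfolding Cs_def corners_def frontier_def by (simp add: interior_open)
  obtain Dw C0 A where Dw: "\<And>a b. weak_deriv \<Omega> u a b (Dw a b)" and CA: "0 < C0" "0 < A" and uL: "L2_on \<Omega> u"
    and J: "\<forall>k::nat. (\<forall>a\<le>k. L2_on (Omega_0 \<Omega> Cs r) (Dw a (k - a))) \<and>
            (\<Sum>a\<le>k. L2norm (Omega_0 \<Omega> Cs r) (Dw a (k - a))) \<le> C0 * A ^ k * fact k \<and>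
            (\<forall>c\<in>Cs.
               (\<forall>a\<le>k. L2_on (Omega_c \<Omega> r c)
                   (\<lambda>x. dist x c powr (max 0 (real k - \<gamma> c)) * Dw a (k - a) x)) \<and>
               (\<Sum>a\<le>k. L2norm (Omega_c \<Omega> r c)
                   (\<lambda>x. dist x c powr (max 0 (real k - \<gamma> c)) * Dw a (k - a) x))
                 \<le> C0 * A ^ k * fact k)"
    using u unfolding J_class_def Cs_def[symmetric] by blast
  obtain \<kappa> \<rho> where cone: "0 < \<kappa>" "\<kappa> \<le> 1" "0 < \<rho>"
    "\<And>x0. x0 \<in> closure \<Omega> \<Longrightarrow> \<exists>d. norm d = 1 \<and> (\<forall>x v t. x \<in> \<Omega> \<longrightarrow> dist x x0 < \<rho> \<longrightarrow> norm (v - d) \<le> \<kappa> \<longrightarrow>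
        0 \<le> t \<longrightarrow> t \<le> \<rho> \<longrightarrow> x + t *\<^sub>R v \<in> \<Omega>)"
    using uniform_cone[OF op bd ne lb] by blast
  obtain \<delta> where d01: "\<And>x. 0 \<le> \<delta> x \<and> \<delta> x \<le> 1" and dc: "\<And>c x. c \<in> Cs \<Longrightarrow> \<delta> x \<le> dist x c"
    and din: "\<And>x. \<delta> x = 1 \<or> (\<exists>c\<in>Cs. \<delta> x = dist x c)" and dl: "\<And>x y. \<delta> x \<le> \<delta> y + dist x y"
    and dm: "\<delta> \<in> borel_measurable borel"
    using corner_weight[OF finCs] by blast
  obtain D L s where L1: "L \<ge> 1" and DN: "NNs L s [D, \<lambda>x. - D x]" and Dl: "lip 2 D" and D01: "\<And>x. 0 \<le> D x \<and> D x \<le> 1"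
    and Dle: "\<And>x c. c \<in> Cs \<Longrightarrow> D x \<le> \<bar>fst x - fst c\<bar> + \<bar>snd x - snd c\<bar>"
    and Din: "\<And>x. D x = 1 \<or> (\<exists>c\<in>Cs. D x = \<bar>fst x - fst c\<bar> + \<bar>snd x - snd c\<bar>)"
    using corner_dist_net[OF finCs] by blast
  \<comment> \<open>The value 3/2 keeps the common exponent below 2 and gives the minimum a meaning
    if there are no corners; lowering the exponents is harmless as long as they stay above
    1.\<close>
  define g where "g = Min (insert (3/2) (\<gamma> ` Cs))"
  have gf: "finite (insert (3/2) (\<gamma> ` Cs))" using finCs by simp
  have g1: "1 < g" unfolding g_def using gm gf Cs_def by (subst Min_gr_iff) auto
  have "g \<le> 3/2" unfolding g_def by (rule Min_le[OF gf]) simp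
  then have g2: "g < 2" by simp
  have gc: "g \<le> \<gamma> c" if "c \<in> Cs" for c unfolding g_def by (rule Min_le[OF gf]) (use that in simp)
  define E where "E = (\<lambda>a b x. indicat_real \<Omega> x * (if a = 0 \<and> b = 0 then u x else Dw a b x))"
  have wf: "weak_family \<Omega> E" unfolding E_def by (rule weak_deriv_family[OF op Dw])
  obtain C where C: "0 < C" "\<And>k. (\<integral>\<^sup>+x\<in>\<Omega>. ennreal (\<delta> x powr (2 * max 0 (real k - g)) * sqsum E k x) \<partial>lborel)
     \<le> ennreal ((C * A ^ k * fact k)\<^sup>2)"
    using J_class_weighted[OF op finCs CA gc d01 dc uL g1 J] unfolding E_def[symmetric] by blast
  obtain Rb where Rb: "0 < Rb" "\<Omega> \<subseteq> ball 0 Rb" using bounded_subset_ballD[OF bd] by blast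
  have d1: "\<delta> x \<le> 1" for x using d01 by blast
  have dball: "t \<le> \<delta> x" if "ball x t \<subseteq> \<Omega>" "0 \<le> t" "t \<le> 1" for x t
    using din[of x]
  proof
    assume "\<exists>c\<in>Cs. \<delta> x = dist x c"
    then obtain c where c: "c \<in> Cs" "\<delta> x = dist x c" by blast
    then have "c \<notin> ball x t" using Cout that by blast
    then show ?thesis using c by simp
  qed (use that in simp)
  have Dd: "D x \<le> 2 * \<delta> x" for x
    using din[of x]
  proof
    assume "\<delta> x = 1" then show ?thesis using D01[of x] by simp
  next
    assume "\<exists>c\<in>Cs. \<delta> x = dist x c"
    then obtain c where c: "c \<in> Cs" "\<delta> x = dist x c" by blast
    have "\<bar>fst x - fst c\<bar> \<le> dist x c" "\<bar>snd x - snd c\<bar> \<le> dist x c"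
      using abs_comp_le_norm[of "x - c"] by (simp_all add: dist_norm)
    then show ?thesis using Dle[OF c(1), of x] c(2) by linarith
  qed
  \<comment> \<open>Coordinates and D must come from networks of equal depth, so the coordinates are
    passed through L - 1 further layers at six entries each.\<close>
  define s' where "s' = s + (6 + 6 * (L - 1))"
  have nets: "NNs L s' [fst, \<lambda>x. - fst x]" "NNs L s' [snd, \<lambda>x. - snd x]" "NNs L s' [D, \<lambda>x. - D x]"
  proof -
    have L: "1 + (L - 1) = L" using L1 by simp
    show "NNs L s' [fst, \<lambda>x. - fst x]" using NNs_mono[OF NNs_deepen[OF coordinate_net(1), of "L - 1", unfolded L]] unfolding s'_def by simp
    show "NNs L s' [snd, \<lambda>x. - snd x]" using NNs_mono[OF NNs_deepen[OF coordinate_net(2), of "L - 1", unfolded L]] unfolding s'_def by simp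
    show "NNs L s' [D, \<lambda>x. - D x]" using NNs_mono[OF DN] unfolding s'_def by simp
  qed
  have NS: "net_setup \<Omega> E \<kappa> \<rho> g C A \<delta> D Cs L s' Rb"
    by (intro net_setup.intro cone_family.intro cone_family_axioms.intro net_setup_axioms.intro)
       (fact wf cone d1 dball g1 g2 C CA dm Rb ne finCs Dl D01 Dd Din dl nets)+
  obtain c' \<nu> b where c': "0 < c'" "0 < \<nu>" "\<nu> < 1"
    "\<And>p. 1 \<le> p \<Longrightarrow> \<exists>R q. 2 ^ q \<le> 2 * (p + 3) \<and> NNs (L + 3 + q * (4 * p + 3)) (b * (p + 1) ^ 5) [R] \<and>
     sq_int \<Omega> (\<lambda>x. E 0 0 x - R x) \<le> ennreal ((c' * \<nu> ^ p)\<^sup>2) \<and>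
     sq_int \<Omega> (\<lambda>x. E 1 0 x - dq (1, 0) R x) \<le> ennreal ((c' * \<nu> ^ p)\<^sup>2) \<and>
     sq_int \<Omega> (\<lambda>x. E 0 1 x - dq (0, 1) R x) \<le> ennreal ((c' * \<nu> ^ p)\<^sup>2)"
    using net_setup.net_approx[OF NS] by blast
  show thesis
  proof (rule that[of "2 * c'" \<nu> "L + 3" b])
    fix p :: nat assume "1 \<le> p"
    then obtain R q where R: "2 ^ q \<le> 2 * (p + 3)" "NNs (L + 3 + q * (4 * p + 3)) (b * (p + 1) ^ 5) [R]"
     and e0: "sq_int \<Omega> (\<lambda>x. E 0 0 x - R x) \<le> ennreal ((c' * \<nu> ^ p)\<^sup>2)"
     and e1: "sq_int \<Omega> (\<lambda>x. E 1 0 x - dq (1, 0) R x) \<le> ennreal ((c' * \<nu> ^ p)\<^sup>2)"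
     and e2: "sq_int \<Omega> (\<lambda>x. E 0 1 x - dq (0, 1) R x) \<le> ennreal ((c' * \<nu> ^ p)\<^sup>2)"
      using c'(4) by blast
    let ?B = "c' * \<nu> ^ p"
    have B0: "0 \<le> ?B" using c' by simp
    have gR: "good d R" for d by (rule NNs_good[OF R(2)]) simp
    note [measurable] = weak_family.Em[OF wf]
    have [measurable]: "R \<in> borel_measurable borel"
      by (rule borel_measurable_continuous_onI[OF good_continuous[OF gR]])
    have [measurable]: "dq d R \<in> borel_measurable borel" for d by (rule dq_measurable[OF gR])
    have Os: "\<Omega> \<in> sets borel" using op by simp
    have m: "(\<lambda>x. E 0 0 x - R x) \<in> borel_measurable borel" "(\<lambda>x. E 1 0 x - dq (1, 0) R x) \<in> borel_measurable borel"
      "(\<lambda>x. E 0 1 x - dq (0, 1) R x) \<in> borel_measurable borel" by measurable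
    have x: "\<forall>x\<in>\<Omega>. E 0 0 x - R x = u x - R x" "\<forall>x\<in>\<Omega>. E 1 0 x - dq (1, 0) R x = Dw 1 0 x - dq (1, 0) R x"
      "\<forall>x\<in>\<Omega>. E 0 1 x - dq (0, 1) R x = Dw 0 1 x - dq (0, 1) R x"
      unfolding E_def by simp_all
    note n0 = L2_on_nn_integral[OF m(1) x(1) Os e0] and n1 = L2_on_nn_integral[OF m(2) x(2) Os e1]
      and n2 = L2_on_nn_integral[OF m(3) x(3) Os e2]
    note W = good_weak_deriv[OF gR gR, of \<Omega>]
    have w1: "weak_deriv \<Omega> (\<lambda>x. u x - R x) 1 0 (\<lambda>x. Dw 1 0 x - dq (1, 0) R x)" by (rule weak_deriv_diff[OF Dw W(1)]) simp
    have w2: "weak_deriv \<Omega> (\<lambda>x. u x - R x) 0 1 (\<lambda>x. Dw 0 1 x - dq (0, 1) R x)" by (rule weak_deriv_diff[OF Dw W(2)]) simp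
    have "sqrt ((L2norm \<Omega> (\<lambda>x. u x - R x))\<^sup>2 + (L2norm \<Omega> (\<lambda>x. Dw 1 0 x - dq (1, 0) R x))\<^sup>2 +
        (L2norm \<Omega> (\<lambda>x. Dw 0 1 x - dq (0, 1) R x))\<^sup>2) \<le> sqrt ((2 * ?B)\<^sup>2)"
    proof (rule real_sqrt_le_mono)
      have "a + b + c \<le> (2 * z)\<^sup>2" if "a \<le> z\<^sup>2" "b \<le> z\<^sup>2" "c \<le> z\<^sup>2" for a b c z :: real
      proof -
        have "(2 * z)\<^sup>2 = 4 * z\<^sup>2" by (simp add: power_mult_distrib)
        then show ?thesis using that zero_le_power2[of z] by linarith
      qed
      from this[OF n0(2) n1(2) n2(2)] show "(L2norm \<Omega> (\<lambda>x. u x - R x))\<^sup>2 + (L2norm \<Omega> (\<lambda>x. Dw 1 0 x - dq (1, 0) R x))\<^sup>2 +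
        (L2norm \<Omega> (\<lambda>x. Dw 0 1 x - dq (0, 1) R x))\<^sup>2 \<le> (2 * ?B)\<^sup>2" .
    qed
    also have "\<dots> = 2 * c' * \<nu> ^ p" unfolding real_sqrt_abs using B0 by simp
    finally have "H1norm_le \<Omega> (\<lambda>x. u x - R x) (2 * c' * \<nu> ^ p)"
      unfolding H1norm_le_def using n0(1) n1(1) n2(1) w1 w2 by blast
    then show "\<exists>R q. 2 ^ q \<le> 2 * (p + 3) \<and> NNs (L + 3 + q * (4 * p + 3)) (b * (p + 1) ^ 5) [R] \<and>
       H1norm_le \<Omega> (\<lambda>x. u x - R x) (2 * c' * \<nu> ^ p)" using R by blast
  qed (use c' in auto)
qed

theorem theorem5p6:
  fixes \<Omega> :: "(real \<times> real) set" and \<gamma> :: "real \<times> real \<Rightarrow> real"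
    and \<epsilon>h :: real and u :: "real \<times> real \<Rightarrow> real"
  assumes "polygon \<Omega>"
    and "finite (corners \<Omega>)"
    and "\<forall>c \<in> corners \<Omega>. \<gamma> c > 1"
    and "\<epsilon>h > 0"
    and "\<forall>c \<in> corners \<Omega>. \<forall>c' \<in> corners \<Omega>. c \<noteq> c' \<longrightarrow>
           Omega_c \<Omega> \<epsilon>h c \<inter> Omega_c \<Omega> \<epsilon>h c' = {}"
    and "u \<in> J_class \<Omega> (corners \<Omega>) \<gamma> \<epsilon>h"
  shows "\<exists>\<Phi> :: real \<Rightarrow> layer list.
           (\<forall>\<epsilon>. 0 < \<epsilon> \<and> \<epsilon> < 1 \<longrightarrow>
              nn_valid (\<Phi> \<epsilon>) \<and> H1norm_le \<Omega> (\<lambda>x. u x - realization (\<Phi> \<epsilon>) x) \<epsilon>) \<and>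
           (\<lambda>\<epsilon>. real (nn_size (\<Phi> \<epsilon>))) \<in> O[at_right 0](\<lambda>\<epsilon>. \<bar>ln \<epsilon>\<bar> ^ 5) \<and>
           (\<lambda>\<epsilon>. real (nn_depth (\<Phi> \<epsilon>))) \<in> O[at_right 0](\<lambda>\<epsilon>. \<bar>ln \<epsilon>\<bar> * ln \<bar>ln \<epsilon>\<bar>)"
proof -
  obtain c l b \<nu> where c: "0 < c" "0 < \<nu>" "\<nu> < 1"
    "\<And>p. 1 \<le> p \<Longrightarrow> \<exists>R q. 2 ^ q \<le> 2 * (p + 3) \<and> NNs (l + q * (4 * p + 3)) (b * (p + 1) ^ 5) [R] \<and>
       H1norm_le \<Omega> (\<lambda>x. u x - R x) (c * \<nu> ^ p)"
    by (rule polygon_net_approx[OF assms(1-3,6)]) (rule that; assumption)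
  obtain pf K where pf: "0 \<le> K" "\<And>\<epsilon>. 0 < \<epsilon> \<Longrightarrow> 1 \<le> pf \<epsilon> \<and> c * \<nu> ^ pf \<epsilon> \<le> \<epsilon>"
    "\<And>\<epsilon>. 0 < \<epsilon> \<Longrightarrow> ln \<epsilon> \<le> - 1 \<Longrightarrow> real (pf \<epsilon>) \<le> K * \<bar>ln \<epsilon>\<bar>"
    by (rule degree_choice[OF c(1-3)]) (rule that; assumption)
  have ex: "\<forall>\<epsilon>. \<exists>\<Phi>. 0 < \<epsilon> \<longrightarrow> nn_valid \<Phi> \<and> H1norm_le \<Omega> (\<lambda>x. u x - realization \<Phi> x) \<epsilon> \<and> nn_size \<Phi> \<le> b * (pf \<epsilon> + 1) ^ 5 \<and>
      (\<exists>q. 2 ^ q \<le> 2 * (pf \<epsilon> + 3) \<and> nn_depth \<Phi> = l + q * (4 * pf \<epsilon> + 3))"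
  proof
    fix \<epsilon> :: real
    show "\<exists>\<Phi>. 0 < \<epsilon> \<longrightarrow> nn_valid \<Phi> \<and> H1norm_le \<Omega> (\<lambda>x. u x - realization \<Phi> x) \<epsilon> \<and> nn_size \<Phi> \<le> b * (pf \<epsilon> + 1) ^ 5 \<and>
      (\<exists>q. 2 ^ q \<le> 2 * (pf \<epsilon> + 3) \<and> nn_depth \<Phi> = l + q * (4 * pf \<epsilon> + 3))"
    proof (cases "0 < \<epsilon>")
      case True
      then obtain R q where R: "2 ^ q \<le> 2 * (pf \<epsilon> + 3)" "NNs (l + q * (4 * pf \<epsilon> + 3)) (b * (pf \<epsilon> + 1) ^ 5) [R]"
         "H1norm_le \<Omega> (\<lambda>x. u x - R x) (c * \<nu> ^ pf \<epsilon>)" using c(4)[of "pf \<epsilon>"] pf(2)[OF True] by blast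
      have H: "H1norm_le \<Omega> (\<lambda>x. u x - R x) \<epsilon>"
        using R(3) order_trans[OF _ conjunct2[OF pf(2)[OF True]]] unfolding H1norm_le_def by blast
      obtain \<Phi> where "nn_valid \<Phi>" "nn_depth \<Phi> = l + q * (4 * pf \<epsilon> + 3)" "nn_size \<Phi> \<le> b * (pf \<epsilon> + 1) ^ 5" "realization \<Phi> = R"
        using NNs_realization[OF R(2)] by blast
      then show ?thesis using R(1) H by (intro exI[of _ \<Phi>]) blast
    qed simp
  qed
  obtain \<Phi> where \<Phi>: "\<forall>\<epsilon>. 0 < \<epsilon> \<longrightarrow> nn_valid (\<Phi> \<epsilon>) \<and> H1norm_le \<Omega> (\<lambda>x. u x - realization (\<Phi> \<epsilon>) x) \<epsilon> \<and>
      nn_size (\<Phi> \<epsilon>) \<le> b * (pf \<epsilon> + 1) ^ 5 \<and> (\<exists>q. 2 ^ q \<le> 2 * (pf \<epsilon> + 3) \<and> nn_depth (\<Phi> \<epsilon>) = l + q * (4 * pf \<epsilon> + 3))"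
    using choice[OF ex] by blast
  have "(\<lambda>\<epsilon>. real (nn_size (\<Phi> \<epsilon>))) \<in> O[at_right 0](\<lambda>\<epsilon>. \<bar>ln \<epsilon>\<bar> ^ 5)"
    by (rule size_asymptotics[OF pf(1,3)]) (use \<Phi> in blast)+
  moreover have "(\<lambda>\<epsilon>. real (nn_depth (\<Phi> \<epsilon>))) \<in> O[at_right 0](\<lambda>\<epsilon>. \<bar>ln \<epsilon>\<bar> * ln \<bar>ln \<epsilon>\<bar>)"
    by (rule depth_asymptotics[OF pf(1,3)]) (use \<Phi> in blast)+
  ultimately show ?thesis using \<Phi> by (intro exI[of _ \<Phi>]) blast
qed

end
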